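(* Let $n\ge1$ be an integer and $0<s<1$. Let $u:\mathbb{R}^n\times\mathbb{R}\to(0,\infty)$ be a positive function with $u\in C^{2s+\epsilon,s+\epsilon}_{x,\,t,\,\rm loc}(\mathbb{R}^n\times\mathbb{R})\cap\mathcal{L}^{2s,s}(\mathbb{R}^n\times\mathbb{R})$ for some $\epsilon>0$, and let $f:\mathbb{R}^n\times\mathbb{R}\times(0,\infty)\to[0,\infty)$ be nonnegative and continuous. Assume that for every $C_1>0$ there exists $C_2>0$ such that $$f(x,t,\zeta)\ge C_2\quad\text{for all }\zeta\ge C_1\text{ and all }(x,t)\in\mathbb{R}^n\times\mathbb{R}.$$ Then the pseudo-differential equation $$(\partial_t-\Delta)^s u(x,t)=f(x,t,u(x,t)),\qquad (x,t)\in\mathbb{R}^n\times\mathbb{R},$$ is equivalent to the integral equation $$u(x,t)=\int_{-\infty}^{+\infty}\int_{\mathbb{R}^n}G(x-y,t-\tau)\,f(y,\tau,u(y,\tau))\,dy\,d\tau,\qquad (x,t)\in\mathbb{R}^n\times\mathbb{R},$$ that is, $u$ satisfies the first equation if and only if it satisfies the second, where $$G(x-y,t-\tau)=A_{n,s}\,\frac{e^{-\frac{|x-y|^2}{4(t-\tau)}}}{(t-\tau)^{\frac n2+1-s}}\,\chi_{\{t>\tau\}},\qquad A_{n,s}=\frac{1}{(4\pi)^{n/2}\Gamma(s)}.$$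
   Context: The fully fractional heat operator is $$(\partial_t-\Delta)^s u(x,t):=C_{n,s}\int_{-\infty}^{t}\int_{\mathbb{R}^n}\frac{u(x,t)-u(y,\tau)}{(t-\tau)^{\frac n2+1+s}}\,e^{-\frac{|x-y|^2}{4(t-\tau)}}\,dy\,d\tau,\qquad C_{n,s}=\frac{1}{(4\pi)^{n/2}|\Gamma(-s)|},$$ where the integral in $y$ is taken in the Cauchy principal value sense. $\chi_{\{t>\tau\}}$ is the indicator function of $\{t>\tau\}$. The slowly increasing function space is $$\mathcal{L}^{2s,s}(\mathbb{R}^n\times\mathbb{R})=\left\{u \in L^1_{\rm loc}(\mathbb{R}^n\times\mathbb{R}) \;\middle|\; \int_{-\infty}^{+\infty}\int_{\mathbb{R}^n}\frac{|u(x,t)|}{1+|x|^{n+2+2s}+|t|^{\frac n2+1+s}}\,dx\,dt<\infty\right\}.$$ Parabolic Hölder spaces $C^{2\alpha,\alpha}_{x,\,t}(\mathbb{R}^n\times\mathbb{R})$: (i) for $0<\alpha\le\frac12$, $u\in C^{2\alpha,\alpha}_{x,t}$ means there is $C>0$ with $|u(x,t)-u(y,\tau)|\le C\left(|x-y|+|t-\tau|^{1/2}\right)^{2\alpha}$ for all $x,y\in\mathbb{R}^n$, $t,\tau\in\mathbb{R}$; (ii) for $\frac12<\alpha\le1$, $u\in C^{2\alpha,\alpha}_{x,t}$ means $u$ is $\alpha$-Hölder continuous in $t$ uniformly in $x$, and $\nabla_x u$ is $(2\alpha-1)$-Hölder continuous in $x$ uniformly in $t$ and $(\alpha-\frac12)$-Hölder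 continuous in $t$ uniformly in $x$; (iii) for $\alpha>1$, $u\in C^{2\alpha,\alpha}_{x,t}$ means $\partial_t u,\,D_x^2u\in C^{2\alpha-2,\alpha-1}_{x,t}$. The local space $C^{2\alpha,\alpha}_{x,\,t,\,\rm loc}(\mathbb{R}^n\times\mathbb{R})$ is defined analogously, with the conditions required on every compact subset of $\mathbb{R}^n\times\mathbb{R}$ (with constants depending on the subset). The condition "$u\in C^{2s+\epsilon,s+\epsilon}_{x,\,t,\,\rm loc}(\mathbb{R}^n\times\mathbb{R})$ for some $\epsilon>0$" (regularity of order $2s+\epsilon$ in $x$ and $s+\epsilon$ in $t$) means $u\in C^{2\alpha,\alpha}_{x,\,t,\,\rm loc}(\mathbb{R}^n\times\mathbb{R})$ for some $\alpha>s$. *)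

theory Defs
  imports "HOL-Analysis.Analysis"
begin

text \<open>
  A function on \<open>\<real>\<^sup>n \<times> \<real>\<close> is a curried function of a space variable in \<^typ>\<open>real ^ 'n\<close>
  and a time variable, and \<open>n = CARD('n)\<close>.
\<close>

text \<open>
  The parabolic Hoelder space \<open>C\<^sup>2\<^sup>\<alpha>\<^sup>,\<^sup>\<alpha>\<close> with the Hoelder estimates required on \<open>K\<close> only; the
  derivatives involved exist everywhere. The case \<open>K = UNIV\<close> is the global space.
  The three rules have disjoint ranges of \<open>\<alpha>\<close>, so exactly one of them applies to a given \<open>\<alpha> > 0\<close>.
  In the last one, \<open>g\<close> is the spatial gradient, \<open>H\<close> the spatial Hessian and \<open>v\<close> the time derivative.
\<close>

inductive parabolic_holder_on ::
    "((real ^ 'n) \<times> real) set \<Rightarrow> real \<Rightarrow> (real ^ 'n \<Rightarrow> real \<Rightarrow> real) \<Rightarrow> bool"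
  for K :: "((real ^ 'n) \<times> real) set"
where
  low: "parabolic_holder_on K \<alpha> u"
    if "0 < \<alpha>" and "\<alpha> \<le> 1 / 2"
      and "\<exists>C>0. \<forall>x t y \<tau>. (x, t) \<in> K \<longrightarrow> (y, \<tau>) \<in> K \<longrightarrow>
             \<bar>u x t - u y \<tau>\<bar> \<le> C * (norm (x - y) + \<bar>t - \<tau>\<bar> powr (1 / 2)) powr (2 * \<alpha>)"
| middle: "parabolic_holder_on K \<alpha> u"
    if "1 / 2 < \<alpha>" and "\<alpha> \<le> 1"
      and "\<And>x t. GDERIV (\<lambda>x. u x t) x :> g x t"
      and "\<exists>C>0. \<forall>x t \<tau>. (x, t) \<in> K \<longrightarrow> (x, \<tau>) \<in> K \<longrightarrow>
             \<bar>u x t - u x \<tau>\<bar> \<le> C * \<bar>t - \<tau>\<bar> powr \<alpha>"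
      and "\<exists>C>0. \<forall>x y t. (x, t) \<in> K \<longrightarrow> (y, t) \<in> K \<longrightarrow>
             norm (g x t - g y t) \<le> C * norm (x - y) powr (2 * \<alpha> - 1)"
      and "\<exists>C>0. \<forall>x t \<tau>. (x, t) \<in> K \<longrightarrow> (x, \<tau>) \<in> K \<longrightarrow>
             norm (g x t - g x \<tau>) \<le> C * \<bar>t - \<tau>\<bar> powr (\<alpha> - 1 / 2)"
| high: "parabolic_holder_on K \<alpha> u"
    if "1 < \<alpha>"
      and "\<And>x t. GDERIV (\<lambda>x. u x t) x :> g x t"
      and "\<And>x t. ((\<lambda>x. g x t) has_derivative (\<lambda>h. H x t *v h)) (at x)"
      and "\<And>x t. ((\<lambda>t. u x t) has_real_derivative v x t) (at t)"
      and "parabolic_holder_on K (\<alpha> - 1) v"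
      and "\<And>i j. parabolic_holder_on K (\<alpha> - 1) (\<lambda>x t. H x t $ i $ j)"

definition parabolic_holder_loc :: "real \<Rightarrow> (real ^ 'n \<Rightarrow> real \<Rightarrow> real) \<Rightarrow> bool" where
  "parabolic_holder_loc \<alpha> u \<longleftrightarrow> (\<forall>K. compact K \<longrightarrow> parabolic_holder_on K \<alpha> u)"

definition slowly_increasing :: "real \<Rightarrow> (real ^ 'n \<Rightarrow> real \<Rightarrow> real) \<Rightarrow> bool" where
  "slowly_increasing s u \<longleftrightarrow>
     (\<forall>K. compact K \<longrightarrow> (\<lambda>(x, t). u x t) absolutely_integrable_on K) \<and>
     integrable lebesgue (\<lambda>(x, t). \<bar>u x t\<bar> /
       (1 + norm x powr (real CARD('n) + 2 + 2 * s) + \<bar>t\<bar> powr (real CARD('n) / 2 + 1 + s)))"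

text \<open>The Cauchy principal value at \<open>x\<close> of the integral of \<open>g\<close> over \<open>\<real>\<^sup>n\<close> exists and is \<open>I\<close>.\<close>

definition has_pv_integral :: "(real ^ 'n \<Rightarrow> real) \<Rightarrow> real ^ 'n \<Rightarrow> real \<Rightarrow> bool" where
  "has_pv_integral g x I \<longleftrightarrow>
     (\<forall>\<epsilon>>0. g absolutely_integrable_on (- ball x \<epsilon>)) \<and>
     ((\<lambda>\<epsilon>. LINT y : - ball x \<epsilon> | lebesgue. g y) \<longlongrightarrow> I) (at_right 0)"

text \<open>
  \<open>has_frac_heat s u x t w\<close> says that the integral defining \<open>(\<partial>\<^sub>t - \<Delta>)\<^sup>s u\<close> at \<open>(x, t)\<close> converges
  and has the value \<open>w\<close>. The inner principal value \<open>h \<tau>\<close> is only required for almost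
  every \<open>\<tau> < t\<close>: membership in the slowly increasing space does not control the spatial tails
  of \<open>u\<close> at each individual time.
\<close>

definition has_frac_heat ::
    "real \<Rightarrow> (real ^ 'n \<Rightarrow> real \<Rightarrow> real) \<Rightarrow> real ^ 'n \<Rightarrow> real \<Rightarrow> real \<Rightarrow> bool" where
  "has_frac_heat s u x t w \<longleftrightarrow>
     (\<exists>h. (AE \<tau> in lebesgue. \<tau> < t \<longrightarrow>
             has_pv_integral
               (\<lambda>y. (u x t - u y \<tau>) / (t - \<tau>) powr (real CARD('n) / 2 + 1 + s)
                    * exp (- (norm (x - y))\<^sup>2 / (4 * (t - \<tau>)))) x (h \<tau>)) \<and>
          h absolutely_integrable_on {..<t} \<and>
          w = 1 / ((4 * pi) powr (real CARD('n) / 2) * \<bar>Gamma (- s)\<bar>)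
                * (LINT \<tau> : {..<t} | lebesgue. h \<tau>))"

definition heat_G :: "real \<Rightarrow> real ^ 'n \<Rightarrow> real \<Rightarrow> real" where
  "heat_G s z r =
     1 / ((4 * pi) powr (real CARD('n) / 2) * Gamma s)
       * (exp (- (norm z)\<^sup>2 / (4 * r)) / r powr (real CARD('n) / 2 + 1 - s))
       * indicator {0<..} r"

end

theory Submission
  imports Defs "HOL-Probability.Distributions"
begin

text \<open>
  All functions are convolved on space-time with kernels \<open>k(r) p\<^sub>r(z)\<close>, where \<open>p\<^sub>r\<close> is the heat kernel; by the
  semigroup law the product of two such kernels is governed by the one-dimensional convolution of the factors \<open>k\<close>.
  Cutting the jumps shorter than \<open>d\<close> off \<open>(\<partial>\<^sub>t - \<Delta>)\<^sup>s\<close> leaves \<open>d\<^sup>-\<^sup>s/s u - b\<^sub>d * u\<close> with \<open>b\<^sub>d = r\<^sup>-\<^sup>1\<^sup>-\<^sup>s\<close>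
  on \<open>r > d\<close>, and this truncation turns the fractional potential \<open>r\<^sup>s\<^sup>-\<^sup>1/\<Gamma>(s)\<close> into an approximate identity of
  mass \<open>\<kappa> = \<bar>\<Gamma>(-s)\<bar>\<close>. Letting \<open>d\<close> tend to 0 shows that potentials solve the equation.

  Conversely, mollify a solution \<open>u\<close>, convolve the truncated equation with the damped potential
  \<open>e\<^sup>-\<^sup>\<lambda>\<^sup>r r\<^sup>s\<^sup>-\<^sup>1/\<Gamma>(s)\<close> and let \<open>d\<close> tend to 0. Up to null sets this yields
  \<open>u = G\<^sub>\<lambda> * g + m\<^sub>\<lambda> * u / \<kappa>\<close> with an explicit positive kernel \<open>m\<^sub>\<lambda>\<close>. As \<open>\<lambda>\<close> tends to 0, the first term increases to
  the potential of \<open>g\<close>, while the differences of \<open>m\<^sub>\<lambda> * u\<close> in \<open>t\<close> and its second differences in \<open>x\<close> vanish; being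
  nonnegative and bounded by \<open>\<kappa> u\<close>, it tends to a constant (a Liouville theorem). A positive constant would bound \<open>u\<close>, hence
  \<open>g = f(\<cdot>, \<cdot>, u)\<close>, from below, and the potential of such a \<open>g\<close> is infinite. So \<open>u\<close> equals the potential almost
  everywhere, and comparing the truncations of both removes the exceptional set.
\<close>

section \<open>Convolution with heat kernels\<close>

text \<open>Nonnegative functions with values in \<open>ennreal\<close> carry the argument: Tonelli
  makes convolution associative without integrability, identities are written as equalities of sums,
  and a subtraction is performed only after finiteness is known. Three obstacles shape the converse
  direction. The undamped potential kernel has infinite mass and is not controlled by the weight of
  the slowly increasing space, so it cannot be convolved with \<open>u\<close>; the damped kernel
  has finite moments. The regularity of \<open>u\<close> is only local, so its truncation errors
  have no bound that survives a convolution over all of space-time; after mollification the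
  truncation falls on the mollifier, whose error decays like the weight. Finally, the remainder
  kernel is of size lam^(1-s) r^(-s) p_r, one power of r short of what the weight dominates. A time
  difference or a second space difference gains the missing 1/r, a first space difference only
  r^(-1/2). This is why second differences appear, and nonnegativity leads back to first
  ones.\<close>

lemma nn_integral_lborel_diff:
  fixes c :: "'a::euclidean_space"
  assumes [measurable]: "f \<in> borel_measurable borel"
  shows "(\<integral>\<^sup>+x. f (c - x) \<partial>lborel) = (\<integral>\<^sup>+x. f x \<partial>lborel)"
proof -
  have "(\<integral>\<^sup>+x. f x \<partial>lborel)
      = (\<integral>\<^sup>+x. f x \<partial>density (distr lborel borel (\<lambda>x. c + (-1) *\<^sub>R x)) (\<lambda>_. \<bar>-1::real\<bar>^DIM('a)))"
    by (subst lborel_affine[of "-1" c]) (simp_all add: ennreal_power[symmetric])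
  then show ?thesis
    by (simp add: nn_integral_density nn_integral_distr)
qed

lemma nn_integral_lborel_shift:
  fixes c :: "'a::euclidean_space"
  assumes [measurable]: "f \<in> borel_measurable borel"
  shows "(\<integral>\<^sup>+x. f (c + x) \<partial>lborel) = (\<integral>\<^sup>+x. f x \<partial>lborel)"
  by (subst lborel_distr_plus[of c, symmetric]) (simp add: nn_integral_distr)

lemma nn_integral_lborel_pair:
  fixes f :: "'a::euclidean_space \<times> 'b::euclidean_space \<Rightarrow> ennreal"
  assumes [measurable]: "f \<in> borel_measurable borel"
  shows "(\<integral>\<^sup>+p. f p \<partial>lborel) = (\<integral>\<^sup>+x. (\<integral>\<^sup>+y. f (x, y) \<partial>lborel) \<partial>lborel)"
    and "(\<integral>\<^sup>+p. f p \<partial>lborel) = (\<integral>\<^sup>+y. (\<integral>\<^sup>+x. f (x, y) \<partial>lborel) \<partial>lborel)"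
proof -
  have m[measurable]: "f \<in> borel_measurable (lborel \<Otimes>\<^sub>M lborel)"
    by (simp add: lborel_prod)
  show "(\<integral>\<^sup>+p. f p \<partial>lborel) = (\<integral>\<^sup>+x. (\<integral>\<^sup>+y. f (x, y) \<partial>lborel) \<partial>lborel)"
    by (simp add: lborel.nn_integral_fst[OF m] lborel_prod)
  show "(\<integral>\<^sup>+p. f p \<partial>lborel) = (\<integral>\<^sup>+y. (\<integral>\<^sup>+x. f (x, y) \<partial>lborel) \<partial>lborel)"
    using lborel_pair.nn_integral_snd[OF m] by (simp add: lborel_prod)
qed

section \<open>Convolution of nonnegative functions\<close>

definition nconv :: "('a::euclidean_space \<Rightarrow> ennreal) \<Rightarrow> ('a \<Rightarrow> ennreal) \<Rightarrow> 'a \<Rightarrow> ennreal" where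
  "nconv N F X = (\<integral>\<^sup>+Y. N Y * F (X - Y) \<partial>lborel)"

lemma nconv_measurable[measurable]:
  fixes N F :: "'a::euclidean_space \<Rightarrow> ennreal"
  assumes [measurable]: "N \<in> borel_measurable borel" "F \<in> borel_measurable borel"
  shows "nconv N F \<in> borel_measurable borel"
  unfolding nconv_def[abs_def] by measurable

lemma nconv_commute:
  fixes N F :: "'a::euclidean_space \<Rightarrow> ennreal"
  assumes [measurable]: "N \<in> borel_measurable borel" "F \<in> borel_measurable borel"
  shows "nconv N F = nconv F N"
proof
  fix X
  show "nconv N F X = nconv F N X"
    unfolding nconv_def
    by (subst nn_integral_lborel_diff[of _ X, symmetric]) (auto simp: mult.commute)
qed

lemma nconv_assoc:
  fixes N K F :: "'a::euclidean_space \<Rightarrow> ennreal"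
  assumes [measurable]: "N \<in> borel_measurable borel" "K \<in> borel_measurable borel"
    "F \<in> borel_measurable borel"
  shows "nconv N (nconv K F) = nconv (nconv N K) F"
proof
  fix X
  have "nconv N (nconv K F) X = (\<integral>\<^sup>+Y. N Y * (\<integral>\<^sup>+Z. K (Z - Y) * F (X - Z) \<partial>lborel) \<partial>lborel)"
    unfolding nconv_def
  proof (rule nn_integral_cong)
    fix Y
    show "N Y * (\<integral>\<^sup>+Z. K Z * F (X - Y - Z) \<partial>lborel) = N Y * (\<integral>\<^sup>+Z. K (Z - Y) * F (X - Z) \<partial>lborel)"
      by (subst nn_integral_lborel_shift[of _ "-Y", symmetric]) (auto simp: algebra_simps)
  qed
  also have "\<dots> = (\<integral>\<^sup>+Y. (\<integral>\<^sup>+Z. N Y * K (Z - Y) * F (X - Z) \<partial>lborel) \<partial>lborel)"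
    by (simp add: nn_integral_cmult[symmetric] mult.assoc)
  also have "\<dots> = (\<integral>\<^sup>+Z. (\<integral>\<^sup>+Y. N Y * K (Z - Y) * F (X - Z) \<partial>lborel) \<partial>lborel)"
    by (rule lborel_pair.Fubini') measurable
  also have "\<dots> = nconv (nconv N K) F X"
    unfolding nconv_def by (simp add: nn_integral_multc)
  finally show "nconv N (nconv K F) X = nconv (nconv N K) F X" .
qed

lemma nconv_mono:
  assumes "\<And>Y. N Y \<le> N' Y" "\<And>Y. F Y \<le> F' Y"
  shows "nconv N F X \<le> nconv N' F' X"
  unfolding nconv_def by (intro nn_integral_mono mult_mono) (auto intro: assms)

lemma nconv_add_left:
  assumes [measurable]: "N \<in> borel_measurable borel" "K \<in> borel_measurable borel"
    "F \<in> borel_measurable borel"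
  shows "nconv (\<lambda>Y. N Y + K Y) F X = nconv N F X + nconv K F X"
  unfolding nconv_def by (simp add: distrib_right nn_integral_add)

lemma nconv_add_right:
  assumes [measurable]: "N \<in> borel_measurable borel" "K \<in> borel_measurable borel"
    "F \<in> borel_measurable borel"
  shows "nconv F (\<lambda>Y. N Y + K Y) X = nconv F N X + nconv F K X"
  unfolding nconv_def by (simp add: distrib_left nn_integral_add)

lemma nconv_cmult_left:
  assumes [measurable]: "N \<in> borel_measurable borel" "F \<in> borel_measurable borel"
  shows "nconv (\<lambda>Y. c * N Y) F X = c * nconv N F X"
  unfolding nconv_def by (simp add: mult.assoc nn_integral_cmult)

lemma nconv_cmult_right:
  assumes [measurable]: "N \<in> borel_measurable borel" "F \<in> borel_measurable borel"
  shows "nconv N (\<lambda>Y. c * F Y) X = c * nconv N F X"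
  unfolding nconv_def by (simp add: mult.left_commute nn_integral_cmult)

section \<open>The Gaussian kernel: product form, mass, semigroup law\<close>

definition heat_kernel :: "real \<Rightarrow> 'a::euclidean_space \<Rightarrow> real" where
  "heat_kernel r z = exp (- (norm z)\<^sup>2 / (4 * r)) / (4 * pi * r) powr (DIM('a) / 2)"

lemma heat_kernel_nonneg[simp]: "0 \<le> heat_kernel r z"
  by (simp add: heat_kernel_def)

lemma heat_kernel_minus[simp]: "heat_kernel r (- z) = heat_kernel r z"
  by (simp add: heat_kernel_def)

lemma heat_kernel_measurable[measurable (raw)]:
  assumes [measurable]: "f \<in> borel_measurable M" "g \<in> borel_measurable M"
  shows "(\<lambda>x. heat_kernel (f x) (g x :: 'a::euclidean_space)) \<in> borel_measurable M"
  unfolding heat_kernel_def by measurable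

text \<open>Each factor is a normal density of variance \<open>2 * r\<close>. The product form
  reduces the total mass and the semigroup law to the one-dimensional facts about
  \<open>normal_density\<close>.\<close>

lemma heat_kernel_eq_prod:
  fixes z :: "'a::euclidean_space"
  assumes "0 < r"
  shows "heat_kernel r z = (\<Prod>b\<in>Basis. normal_density 0 (sqrt (2 * r)) (z \<bullet> b))"
proof -
  have "(\<Prod>b\<in>(Basis::'a set). normal_density 0 (sqrt (2 * r)) (z \<bullet> b))
     = (\<Prod>b\<in>(Basis::'a set). (1 / sqrt (4 * pi * r)) * exp (- (z \<bullet> b)\<^sup>2 / (4 * r)))"
    using assms by (simp add: normal_density_def algebra_simps)
  also have "\<dots> = (1 / sqrt (4 * pi * r)) ^ DIM('a) * exp (\<Sum>b\<in>(Basis::'a set). - (z \<bullet> b)\<^sup>2 / (4 * r))"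
    by (simp add: prod_dividef exp_sum power_divide)
  also have "(\<Sum>b\<in>(Basis::'a set). - (z \<bullet> b)\<^sup>2 / (4 * r)) = - (norm z)\<^sup>2 / (4 * r)"
    by (simp add: norm_eq_sqrt_inner euclidean_inner[of z z] sum_negf sum_divide_distrib
        power2_eq_square sum_nonneg)
  also have "(1 / sqrt (4 * pi * r)) ^ DIM('a) = 1 / (4 * pi * r) powr (DIM('a) / 2)"
    using assms by (simp add: power_divide powr_half_sqrt[symmetric] powr_realpow[symmetric] powr_powr)
  finally show ?thesis
    by (simp add: heat_kernel_def)
qed

lemma nn_integral_heat_kernel:
  assumes "0 < r"
  shows "(\<integral>\<^sup>+z. ennreal (heat_kernel r (z :: 'a::euclidean_space)) \<partial>lborel) = 1"
proof -
  have 1: "(\<integral>\<^sup>+x. ennreal (normal_density 0 (sqrt (2 * r)) x) \<partial>lborel) = 1"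
    using assms by (subst nn_integral_eq_integral) (auto intro!: integrable_normal_density)
  have "(\<integral>\<^sup>+z. ennreal (heat_kernel r (z :: 'a)) \<partial>lborel)
     = (\<integral>\<^sup>+z. (\<Prod>b\<in>(Basis::'a set). ennreal (normal_density 0 (sqrt (2 * r)) (z \<bullet> b))) \<partial>lborel)"
    using assms by (simp add: heat_kernel_eq_prod prod_ennreal)
  also have "\<dots> = 1"
    by (subst nn_integral_lborel_prod) (auto simp: 1)
  finally show ?thesis .
qed

lemma heat_kernel_semigroup:
  fixes x :: "'a::euclidean_space"
  assumes "0 < r" "0 < v"
  shows "(\<integral>\<^sup>+y. ennreal (heat_kernel r y) * ennreal (heat_kernel v (x - y)) \<partial>lborel)
    = ennreal (heat_kernel (r + v) x)"
proof -
  let ?n = "\<lambda>r. normal_density 0 (sqrt (2 * r))"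
  have 1: "(\<integral>\<^sup>+y. ennreal (?n r y) * ennreal (?n v (x - y)) \<partial>lborel) = ennreal (?n (r + v) x)" for x
    using fun_cong[OF conv_normal_density_zero_mean[of "sqrt (2 * v)" "sqrt (2 * r)"], of x] assms
    by (simp add: ennreal_mult'[symmetric] algebra_simps)
  have "(\<integral>\<^sup>+y. ennreal (heat_kernel r y) * ennreal (heat_kernel v (x - y)) \<partial>lborel)
     = (\<integral>\<^sup>+y. (\<Prod>b\<in>(Basis::'a set). ennreal (?n r (y \<bullet> b)) * ennreal (?n v (x \<bullet> b - y \<bullet> b))) \<partial>lborel)"
    using assms by (simp add: heat_kernel_eq_prod prod_ennreal prod.distrib inner_diff_left)
  also have "\<dots> = (\<Prod>b\<in>(Basis::'a set). ennreal (?n (r + v) (x \<bullet> b)))"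
    by (subst nn_integral_lborel_prod[of "\<lambda>b t. ennreal (?n r t) * ennreal (?n v (x \<bullet> b - t))"])
      (auto simp: 1)
  also have "\<dots> = ennreal (heat_kernel (r + v) x)"
    using assms by (simp add: heat_kernel_eq_prod prod_ennreal)
  finally show ?thesis .
qed

text \<open>The time cut-off is left to \<open>k\<close>: all time factors used below vanish for
  \<open>r \<le> 0\<close>, so the value of \<open>heat_kernel\<close> at nonpositive times never
  enters.\<close>

definition stker :: "(real \<Rightarrow> ennreal) \<Rightarrow> 'a::euclidean_space \<times> real \<Rightarrow> ennreal" where
  "stker k Y = k (snd Y) * ennreal (heat_kernel (snd Y) (fst Y))"

lemma stker_measurable[measurable]:
  assumes [measurable]: "k \<in> borel_measurable borel"
  shows "stker k \<in> borel_measurable borel"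
  unfolding stker_def[abs_def] by (simp add: borel_prod[symmetric])

lemma nconv_stker:
  fixes F :: "'a::euclidean_space \<times> real \<Rightarrow> ennreal"
  assumes [measurable]: "k \<in> borel_measurable borel" "F \<in> borel_measurable borel"
  shows "nconv (stker k) F X
    = (\<integral>\<^sup>+r. k r * (\<integral>\<^sup>+z. ennreal (heat_kernel r z) * F (fst X - z, snd X - r) \<partial>lborel) \<partial>lborel)"
proof -
  have [measurable]: "F \<in> borel_measurable (borel \<Otimes>\<^sub>M borel)"
    by (simp add: borel_prod)
  have "nconv (stker k) F X = (\<integral>\<^sup>+r. (\<integral>\<^sup>+z. stker k (z, r) * F (X - (z, r)) \<partial>lborel) \<partial>lborel)"
    unfolding nconv_def by (rule nn_integral_lborel_pair) measurable
  also have "\<dots> = (\<integral>\<^sup>+r. k r * (\<integral>\<^sup>+z. ennreal (heat_kernel r z) * F (fst X - z, snd X - r) \<partial>lborel) \<partial>lborel)"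
  proof (rule nn_integral_cong)
    fix r
    show "(\<integral>\<^sup>+z. stker k (z, r) * F (X - (z, r)) \<partial>lborel)
      = k r * (\<integral>\<^sup>+z. ennreal (heat_kernel r z) * F (fst X - z, snd X - r) \<partial>lborel)"
      by (subst nn_integral_cmult[symmetric]) (auto simp: stker_def mult.assoc minus_prod_def)
  qed
  finally show ?thesis .
qed

text \<open>The two Gaussian times add up to \<open>snd X\<close> whatever the splitting, so after
  the integration over space the Gaussian leaves the integral and only the time factors remain
  convolved.\<close>

lemma nconv_stker_stker:
  assumes [measurable]: "k \<in> borel_measurable borel" "l \<in> borel_measurable borel"
    and "\<And>r. r \<le> 0 \<Longrightarrow> k r = 0" "\<And>r. r \<le> 0 \<Longrightarrow> l r = 0"
  shows "nconv (stker k) (stker l) = (stker (nconv k l) :: 'a::euclidean_space \<times> real \<Rightarrow> ennreal)"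
proof
  fix X :: "'a \<times> real"
  have "nconv (stker k) (stker l) X = (\<integral>\<^sup>+r. k r * l (snd X - r) * ennreal (heat_kernel (snd X) (fst X)) \<partial>lborel)"
  proof (subst nconv_stker, measurable, intro nn_integral_cong)
    fix r
    show "k r * (\<integral>\<^sup>+z. ennreal (heat_kernel r z) * stker l (fst X - z, snd X - r) \<partial>lborel)
      = k r * l (snd X - r) * ennreal (heat_kernel (snd X) (fst X))"
    proof (cases "0 < r \<and> 0 < snd X - r")
      case True
      have "(\<integral>\<^sup>+z. ennreal (heat_kernel r z) * stker l (fst X - z, snd X - r) \<partial>lborel)
        = l (snd X - r) * (\<integral>\<^sup>+z. ennreal (heat_kernel r z) * ennreal (heat_kernel (snd X - r) (fst X - z)) \<partial>lborel)"
        by (subst nn_integral_cmult[symmetric]) (auto simp: stker_def mult_ac)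
      with True heat_kernel_semigroup[of r "snd X - r" "fst X"] show ?thesis
        by (simp add: mult.assoc)
    next
      case False
      then have "k r = 0 \<or> l (snd X - r) = 0" using assms(3,4) by force
      then show ?thesis by (auto simp: stker_def)
    qed
  qed
  also have "\<dots> = stker (nconv k l) X"
    by (simp add: nn_integral_multc stker_def nconv_def)
  finally show "nconv (stker k) (stker l) X = stker (nconv k l) X" .
qed

section \<open>The parabolic weight\<close>

text \<open>For \<open>M = DIM('a) / 2 + 1 + s\<close> this is the denominator in
  \<open>slowly_increasing\<close>. The space exponent is twice the time exponent, as in parabolic
  scaling.\<close>

definition growth :: "real \<Rightarrow> 'a::euclidean_space \<times> real \<Rightarrow> real" where
  "growth M Y = 1 + norm (fst Y) powr (2 * M) + \<bar>snd Y\<bar> powr M"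

lemma growth_ge_1: "1 \<le> growth M Y"
  by (simp add: growth_def)

lemma growth_pos[simp]: "0 < growth M Y" and growth_nonneg[simp]: "0 \<le> growth M Y"
  using growth_ge_1[of M Y] by linarith+

lemma growth_minus[simp]: "growth M (- Y) = growth M Y"
  by (simp add: growth_def)

lemma growth_measurable[measurable]: "growth M \<in> borel_measurable borel"
  unfolding growth_def[abs_def] by (simp add: borel_prod[symmetric])

lemma powr_add_le:
  fixes a b p :: real
  assumes "0 \<le> a" "0 \<le> b" "0 \<le> p"
  shows "(a + b) powr p \<le> 2 powr p * (a powr p + b powr p)"
proof -
  have "(a + b) powr p \<le> (2 * max a b) powr p"
    using assms by (intro powr_mono2) auto
  also have "\<dots> = 2 powr p * max a b powr p"
    using assms by (simp add: powr_mult)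
  also have "\<dots> \<le> 2 powr p * (a powr p + b powr p)"
    by (intro mult_left_mono) (auto simp: max_def)
  finally show ?thesis .
qed

lemma growth_add:
  assumes "0 \<le> M"
  shows "growth M (X + Y) \<le> 2 powr (2 * M) * (growth M X + growth M Y)"
proof -
  let ?c = "2 powr (2 * M) :: real"
  have c: "2 powr M \<le> ?c" "1 \<le> ?c"
    using assms by (auto intro: powr_mono ge_one_powr_ge_zero)
  have "norm (fst (X + Y)) powr (2 * M) \<le> (norm (fst X) + norm (fst Y)) powr (2 * M)"
    using assms by (intro powr_mono2) (auto simp: norm_triangle_ineq)
  also have "\<dots> \<le> ?c * (norm (fst X) powr (2 * M) + norm (fst Y) powr (2 * M))"
    using assms by (intro powr_add_le) auto
  finally have 1: "norm (fst (X + Y)) powr (2 * M) \<le> ?c * (norm (fst X) powr (2 * M) + norm (fst Y) powr (2 * M))" .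
  have "\<bar>snd (X + Y)\<bar> powr M \<le> (\<bar>snd X\<bar> + \<bar>snd Y\<bar>) powr M"
    using assms by (intro powr_mono2) auto
  also have "\<dots> \<le> 2 powr M * (\<bar>snd X\<bar> powr M + \<bar>snd Y\<bar> powr M)"
    using assms by (intro powr_add_le) auto
  also have "\<dots> \<le> ?c * (\<bar>snd X\<bar> powr M + \<bar>snd Y\<bar> powr M)"
    using c by (intro mult_right_mono) auto
  finally have 2: "\<bar>snd (X + Y)\<bar> powr M \<le> ?c * (\<bar>snd X\<bar> powr M + \<bar>snd Y\<bar> powr M)" .
  show ?thesis
    unfolding growth_def using 1 2 c by (simp add: algebra_simps)
qed

text \<open>Both weights are at least 1, so their sum is at most twice their product. In product
  form the inequality can be divided by a weight, which gives the Peetre type bounds for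
  \<open>1 / growth M (X - Y)\<close> below.\<close>

lemma growth_add_mult:
  assumes "0 \<le> M"
  shows "growth M (X + Y) \<le> 2 powr (2 * M + 1) * growth M X * growth M Y"
proof -
  have "growth M X + growth M Y \<le> 2 * (growth M X * growth M Y)"
    using mult_mono[of 1 "growth M X" "growth M Y" "growth M Y"]
      mult_mono[of "growth M X" "growth M X" 1 "growth M Y"] growth_ge_1[of M X] growth_ge_1[of M Y]
    by (smt (verit) growth_nonneg mult_1 mult.right_neutral)
  then have "2 powr (2 * M) * (growth M X + growth M Y) \<le> 2 powr (2 * M) * (2 * (growth M X * growth M Y))"
    by (intro mult_left_mono) auto
  with growth_add[OF assms, of X Y] have "growth M (X + Y) \<le> 2 powr (2 * M) * (2 * (growth M X * growth M Y))"
    by linarith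
  then show ?thesis
    by (simp add: powr_add mult_ac)
qed

lemma weight_diff_le:
  assumes "0 \<le> M"
  shows "1 / growth M (X - Y) \<le> 2 powr (2 * M + 1) * growth M Y / growth M X"
  using growth_add_mult[OF assms, of "X - Y" Y]
  by (simp add: field_simps)

lemma weight_diff_le':
  assumes "0 \<le> M"
  shows "1 / growth M (X - Y) \<le> 2 powr (2 * M + 1) * growth M X / growth M Y"
  using weight_diff_le[OF assms, of Y X] growth_minus[of M "X - Y"] by simp

text \<open>A kernel with a finite \<open>growth\<close> moment reproduces the weight: the decay in
  \<open>X\<close> is kept and the whole cost falls on the kernel.\<close>

lemma nconv_weight_le:
  assumes "0 \<le> M" and [measurable]: "N \<in> borel_measurable borel"
  shows "nconv N (\<lambda>Y. ennreal (1 / growth M Y)) X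
    \<le> ennreal (2 powr (2 * M + 1) / growth M X) * (\<integral>\<^sup>+Y. N Y * ennreal (growth M Y) \<partial>lborel)"
proof -
  have "nconv N (\<lambda>Y. ennreal (1 / growth M Y)) X
      \<le> (\<integral>\<^sup>+Y. ennreal (2 powr (2 * M + 1) / growth M X) * (N Y * ennreal (growth M Y)) \<partial>lborel)"
    unfolding nconv_def
  proof (rule nn_integral_mono)
    fix Y
    have "ennreal (1 / growth M (X - Y)) \<le> ennreal (2 powr (2 * M + 1) / growth M X) * ennreal (growth M Y)"
      using weight_diff_le[OF assms(1), of X Y] by (simp add: ennreal_mult'[symmetric] ennreal_leI)
    then show "N Y * ennreal (1 / growth M (X - Y))
        \<le> ennreal (2 powr (2 * M + 1) / growth M X) * (N Y * ennreal (growth M Y))"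
      by (metis mult.left_commute mult_left_mono zero_le)
  qed
  then show ?thesis
    by (simp add: nn_integral_cmult)
qed

text \<open>The counterpart for an \<open>N\<close> that is only integrable against the weight, such
  as \<open>u\<close>: the cost \<open>growth M X\<close> now depends on the point, and one finite
  integral gives finiteness at every \<open>X\<close>.\<close>

lemma nconv_weight_le':
  assumes "0 \<le> M" and [measurable]: "N \<in> borel_measurable borel"
  shows "nconv N (\<lambda>Y. ennreal (1 / growth M Y)) X
    \<le> ennreal (2 powr (2 * M + 1) * growth M X) * (\<integral>\<^sup>+Y. N Y * ennreal (1 / growth M Y) \<partial>lborel)"
proof -
  have "nconv N (\<lambda>Y. ennreal (1 / growth M Y)) X
      \<le> (\<integral>\<^sup>+Y. ennreal (2 powr (2 * M + 1) * growth M X) * (N Y * ennreal (1 / growth M Y)) \<partial>lborel)"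
    unfolding nconv_def
  proof (rule nn_integral_mono)
    fix Y
    have "ennreal (1 / growth M (X - Y)) \<le> ennreal (2 powr (2 * M + 1) * growth M X) * ennreal (1 / growth M Y)"
      using weight_diff_le'[OF assms(1), of X Y] by (simp add: ennreal_mult'[symmetric] ennreal_leI)
    then show "N Y * ennreal (1 / growth M (X - Y))
        \<le> ennreal (2 powr (2 * M + 1) * growth M X) * (N Y * ennreal (1 / growth M Y))"
      by (metis mult.left_commute mult_left_mono zero_le)
  qed
  then show ?thesis
    by (simp add: nn_integral_cmult)
qed

section \<open>Gaussian bounds for powers and for the weight\<close>

lemma powr_mult_exp_le:
  fixes q w :: real
  assumes "0 < q" "0 \<le> w"
  shows "w powr q * exp (- w / 2) \<le> (2 * q) powr q"
proof -
  \<comment> \<open>\<open>x \<le> exp x\<close> at \<open>x = w / (2 * q)\<close>, raised to the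
    power \<open>q\<close>. Only half of a Gaussian exponent \<open>w\<close> is spent, so that the
    other half remains available.\<close>
  have "w / (2 * q) \<le> exp (w / (2 * q))"
    using exp_ge_add_one_self[of "w / (2 * q)"] by linarith
  then have "(w / (2 * q)) powr q \<le> exp (w / (2 * q)) powr q"
    using assms by (intro powr_mono2) auto
  also have "\<dots> = exp (w / 2)"
    using assms by (simp add: powr_def)
  finally have "w powr q \<le> (2 * q) powr q * exp (w / 2)"
    using assms by (simp add: powr_divide field_simps)
  then have "w powr q * exp (- w / 2) \<le> (2 * q) powr q * exp (w / 2) * exp (- w / 2)"
    by (intro mult_right_mono) auto
  then show ?thesis
    by (simp add: mult.assoc exp_add[symmetric])
qed

lemma powr_double:
  fixes x q :: real
  assumes "0 \<le> x"
  shows "x powr (2 * q) = x\<^sup>2 powr q"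
  using assms powr_powr[of x 2 q] by simp

text \<open>Half of the exponent absorbs the moment; the other half is the Gaussian at time
  \<open>2 * r\<close>, and \<open>2 powr (DIM('a) / 2)\<close> is the quotient of the two
  normalisations.\<close>

lemma norm_powr_heat_kernel_le:
  fixes z :: "'a::euclidean_space"
  assumes "0 < q" "0 < r"
  shows "norm z powr (2 * q) * heat_kernel r z
    \<le> (8 * q) powr q * 2 powr (DIM('a) / 2) * r powr q * heat_kernel (2 * r) z"
proof -
  define w where "w = (norm z)\<^sup>2 / (4 * r)"
  have w: "0 \<le> w" "(norm z)\<^sup>2 = 4 * r * w"
    using assms by (auto simp: w_def)
  have n: "norm z powr (2 * q) = (4 * r) powr q * w powr q"
  proof -
    have "norm z powr (2 * q) = ((norm z)\<^sup>2) powr q"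
      by (simp add: powr_double)
    then show ?thesis
      using w assms by (simp add: powr_mult)
  qed
  have "norm z powr (2 * q) * exp (- w) = (4 * r) powr q * (w powr q * exp (- w / 2)) * exp (- w / 2)"
    by (simp add: n mult.assoc exp_add[symmetric])
  also have "\<dots> \<le> (4 * r) powr q * (2 * q) powr q * exp (- w / 2)"
    using powr_mult_exp_le[OF assms(1) w(1)]
    by (intro mult_right_mono mult_left_mono) auto
  also have "(4 * r) powr q * (2 * q) powr q = (8 * q) powr q * r powr q"
    using assms by (simp add: powr_mult[symmetric] mult_ac)
  finally have "norm z powr (2 * q) * exp (- w) / (4 * pi * r) powr (DIM('a) / 2)
      \<le> (8 * q) powr q * r powr q * exp (- w / 2) / (4 * pi * r) powr (DIM('a) / 2)"
    by (intro divide_right_mono) auto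
  also have "\<dots> = (8 * q) powr q * 2 powr (DIM('a) / 2) * r powr q * heat_kernel (2 * r) z"
  proof -
    have "(4 * pi * (2 * r)) powr (DIM('a) / 2) = 2 powr (DIM('a) / 2) * (4 * pi * r) powr (DIM('a) / 2)"
      using assms by (subst powr_mult[symmetric]) (auto simp: ac_simps)
    then show ?thesis
      by (simp add: heat_kernel_def w_def)
  qed
  finally show ?thesis
    by (simp add: heat_kernel_def w_def)
qed

text \<open>Up to a constant the left side is \<open>r powr (- M)\<close> times a Gaussian factor,
  with the exponent \<open>M\<close> of the weight. The three summands of \<open>growth\<close> are
  multiplied by it and bounded one at a time. Near the origin the kernel is singular, hence the
  condition \<open>1 \<le> r \<or> 1 \<le> norm z\<close>.\<close>

lemma heat_kernel_weight_le:
  fixes z :: "'a::euclidean_space"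
  assumes "0 < s" "0 < r" "1 \<le> r \<or> 1 \<le> norm z" "M = DIM('a) / 2 + 1 + s"
  shows "r powr (- 1 - s) * heat_kernel r z \<le> 2 * (1 + (8 * M) powr M) / growth M (z, r)"
proof -
  define w where "w = (norm z)\<^sup>2 / (4 * r)"
  have M: "1 \<le> M" using assms by simp
  have w: "0 \<le> w" "(norm z)\<^sup>2 = 4 * r * w"
    using assms by (auto simp: w_def)
  have "norm z powr (2 * M) = ((norm z)\<^sup>2) powr M"
    by (simp add: powr_double)
  then have n: "norm z powr (2 * M) * r powr (- M) = 4 powr M * w powr M"
    using w assms(2) by (simp add: powr_mult powr_minus field_simps)
  have a: "norm z powr (2 * M) * r powr (- M) * exp (- w) \<le> (8 * M) powr M"
  proof -
    have "norm z powr (2 * M) * r powr (- M) * exp (- w) = 4 powr M * (w powr M * exp (- w / 2)) * exp (- w / 2)"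
      by (simp add: n mult.assoc exp_add[symmetric])
    also have "\<dots> \<le> 4 powr M * (2 * M) powr M * 1"
      using powr_mult_exp_le[of M w] w M
      by (intro mult_mono) auto
    finally show ?thesis using M by (simp add: powr_mult[symmetric])
  qed
  have b: "r powr M * r powr (- M) * exp (- w) \<le> 1"
    using w assms(2) by (simp add: powr_minus)
  \<comment> \<open>The summand 1 of the weight: if \<open>r < 1\<close>, then
    \<open>1 \<le> norm z\<close> and the moment bound \<open>a\<close> takes over.\<close>
  have c: "1 * r powr (- M) * exp (- w) \<le> 1 + (8 * M) powr M"
  proof (cases "1 \<le> r")
    case True
    then have "r powr (- M) \<le> 1" using M
      by (smt (verit) powr_zero_eq_one powr_mono powr_less_one)
    then have "r powr (- M) * exp (- w) \<le> 1 * 1" using w by (intro mult_mono) auto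
    then show ?thesis using powr_ge_zero[of "8 * M" M] by linarith
  next
    case False
    then have "1 \<le> norm z powr (2 * M)" using assms M by (simp add: ge_one_powr_ge_zero)
    then have "1 * r powr (- M) * exp (- w) \<le> norm z powr (2 * M) * r powr (- M) * exp (- w)"
      by (intro mult_right_mono) auto
    with a show ?thesis by linarith
  qed
  have "r powr (- M) * exp (- w) * growth M (z, r) \<le> 2 * (1 + (8 * M) powr M)"
    using a b c assms by (simp add: growth_def algebra_simps)
  then have d: "r powr (- M) * exp (- w) \<le> 2 * (1 + (8 * M) powr M) / growth M (z, r)"
    by (simp add: field_simps)
  have "r powr (- M) = r powr (- 1 - s) / r powr (DIM('a) / 2)"
    by (simp add: assms powr_diff[symmetric] algebra_simps)
  then have "r powr (- 1 - s) * heat_kernel r z = r powr (- M) * exp (- w) / (4 * pi) powr (DIM('a) / 2)"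
    using assms by (simp add: heat_kernel_def w_def powr_mult)
  also have "\<dots> \<le> r powr (- M) * exp (- w) / 1"
    using pi_gt3 by (intro divide_left_mono) (auto intro!: ge_one_powr_ge_zero)
  finally show ?thesis using d by simp
qed

text \<open>At a distance from the spatial origin the Gaussian beats every negative power of
  \<open>r\<close>. What remains is a Gaussian at time \<open>r + 1\<close>, which stays bounded as
  \<open>r\<close> tends to 0.\<close>

lemma heat_kernel_small_time_le:
  fixes z :: "'a::euclidean_space"
  assumes "0 < d" "d \<le> norm z" "0 < r" "r \<le> 1" "0 \<le> q"
  shows "r powr (- q) * heat_kernel r z
    \<le> 2 powr (DIM('a) / 2) * (8 * (q + DIM('a) / 2) / d\<^sup>2) powr (q + DIM('a) / 2) * heat_kernel (r + 1) z"
proof -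
  let ?n = "DIM('a) / 2"
  define Q where "Q = q + ?n"
  have Q: "0 < Q" using assms by (simp add: Q_def add_nonneg_pos)
  define w where "w = d\<^sup>2 / (4 * r)"
  have w: "0 < w" "r = d\<^sup>2 / (4 * w)" using assms by (auto simp: w_def)
  have "r powr (- Q) = (4 / d\<^sup>2) powr Q * w powr Q"
    using w assms by (simp add: powr_minus powr_divide powr_mult)
  then have "r powr (- Q) * exp (- w / 2) \<le> (4 / d\<^sup>2) powr Q * (2 * Q) powr Q"
    using powr_mult_exp_le[of Q w] Q w by (simp add: mult.assoc mult_left_mono)
  also have "\<dots> = (8 * Q / d\<^sup>2) powr Q"
    using Q assms by (simp add: powr_mult[symmetric])
  finally have 1: "r powr (- Q) * exp (- w / 2) \<le> (8 * Q / d\<^sup>2) powr Q" .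
  have "w / 2 \<le> (norm z)\<^sup>2 / (4 * r * (r + 1))"
  proof -
    have "d\<^sup>2 \<le> (norm z)\<^sup>2" using assms by (intro power_mono) auto
    then have "d\<^sup>2 * (r + 1) \<le> (norm z)\<^sup>2 * 2" using assms by (intro mult_mono) auto
    then have "d\<^sup>2 / (8 * r) \<le> (norm z)\<^sup>2 / (4 * r * (r + 1))"
      using assms by (simp add: frac_le_eq divide_simps) (simp add: algebra_simps)
    then show ?thesis by (simp add: w_def)
  qed
  \<comment> \<open>The exponent splits into that of the Gaussian at time \<open>r + 1\<close> and a
    surplus of at least \<open>d^2 / (8 r)\<close>, which pays for the negative power of
    \<open>r\<close>.\<close>
  also have "\<dots> = (norm z)\<^sup>2 / (4 * r) - (norm z)\<^sup>2 / (4 * (r + 1))"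
    using assms by (simp add: field_simps)
  finally have 2: "exp (- (norm z)\<^sup>2 / (4 * r)) \<le> exp (- w / 2) * exp (- (norm z)\<^sup>2 / (4 * (r + 1)))"
    by (simp add: exp_add[symmetric])
  have 3: "(4 * pi * (r + 1)) powr ?n \<le> 2 powr ?n * (4 * pi) powr ?n"
    using assms by (subst powr_mult[symmetric]) (auto intro!: powr_mono2)
  have "r powr (- Q) = r powr (- q) / r powr ?n"
    by (simp add: Q_def powr_diff[symmetric] algebra_simps)
  then have "r powr (- q) * heat_kernel r z = r powr (- Q) * exp (- (norm z)\<^sup>2 / (4 * r)) / (4 * pi) powr ?n"
    using assms by (simp add: heat_kernel_def powr_mult)
  also have "\<dots> \<le> r powr (- Q) * (exp (- w / 2) * exp (- (norm z)\<^sup>2 / (4 * (r + 1)))) / (4 * pi) powr ?n"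
    using 2 by (intro divide_right_mono mult_left_mono) auto
  also have "\<dots> \<le> (8 * Q / d\<^sup>2) powr Q * exp (- (norm z)\<^sup>2 / (4 * (r + 1))) / (4 * pi) powr ?n"
    using 1 by (simp add: divide_right_mono mult_right_mono mult.assoc[symmetric])
  also have "\<dots> \<le> (8 * Q / d\<^sup>2) powr Q * exp (- (norm z)\<^sup>2 / (4 * (r + 1))) * (2 powr ?n / (4 * pi * (r + 1)) powr ?n)"
  proof -
    have "1 / (4 * pi) powr ?n \<le> 2 powr ?n / (4 * pi * (r + 1)) powr ?n"
      using 3 assms by (simp add: divide_simps)
    then show ?thesis
      by (simp only: divide_inverse mult_1) (intro mult_left_mono, auto)
  qed
  finally show ?thesis
    by (simp add: heat_kernel_def Q_def mult_ac)
qed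

lemma growth_mono: "0 \<le> M \<Longrightarrow> 0 \<le> r \<Longrightarrow> r \<le> r' \<Longrightarrow> growth M (z, r) \<le> growth M (z, r')"
  by (simp add: growth_def powr_mono2)

lemma heat_kernel_shift_weight_le:
  fixes z :: "'a::euclidean_space"
  assumes "0 < s" "0 < r" "r \<le> 1" "M = DIM('a) / 2 + 1 + s"
  shows "heat_kernel (r + 1) z \<le> 2 powr (1 + s) * (2 * (1 + (8 * M) powr M)) / growth M (z, r)"
proof -
  have M: "0 \<le> M" using assms by simp
  \<comment> \<open>As \<open>r + 1 \<le> 2\<close>, the factor
    \<open>(r + 1) powr (- 1 - s)\<close> can be inserted at the cost of a constant, and
    \<open>heat_kernel_weight_le\<close> applies at time \<open>r + 1\<close>.\<close>
  have 1: "1 \<le> 2 powr (1 + s) * (r + 1) powr (- 1 - s)"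
  proof -
    have "(r + 1) powr (1 + s) \<le> 2 powr (1 + s)" using assms by (intro powr_mono2) auto
    moreover have "(r + 1) powr (- 1 - s) = 1 / (r + 1) powr (1 + s)"
      by (simp add: powr_minus[symmetric] divide_inverse)
    ultimately show ?thesis using assms by simp
  qed
  have "heat_kernel (r + 1) z \<le> 2 powr (1 + s) * (r + 1) powr (- 1 - s) * heat_kernel (r + 1) z"
    using mult_right_mono[OF 1, of "heat_kernel (r + 1) z"] by simp
  also have "\<dots> \<le> 2 powr (1 + s) * (2 * (1 + (8 * M) powr M) / growth M (z, r + 1))"
    using heat_kernel_weight_le[of s "r + 1" z M] assms
    by (simp only: mult.assoc) (intro mult_left_mono, auto)
  also have "\<dots> \<le> 2 powr (1 + s) * (2 * (1 + (8 * M) powr M) / growth M (z, r))"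
    using growth_mono[OF M, of r "r + 1" z] assms
    by (intro mult_left_mono divide_left_mono) (auto intro!: add_nonneg_nonneg)
  finally show ?thesis by simp
qed

text \<open>Under the Gaussian, \<open>norm z powr (2 * M)\<close> has mean of order
  \<open>r powr M\<close>, so a space-time moment of \<open>stker k\<close> reduces to a moment of
  \<open>k\<close> alone.\<close>

lemma stker_growth_le:
  assumes [measurable]: "k \<in> borel_measurable borel"
    and k0: "\<And>r. r \<le> 0 \<Longrightarrow> k r = 0" and M: "0 < M"
  shows "(\<integral>\<^sup>+Y. stker k Y * ennreal (growth M (Y :: 'a::euclidean_space \<times> real)) \<partial>lborel)
    \<le> (\<integral>\<^sup>+r. k r * ennreal (1 + (1 + (8 * M) powr M * 2 powr (DIM('a) / 2)) * r powr M) \<partial>lborel)"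
proof -
  let ?C = "(8 * M) powr M * 2 powr (DIM('a) / 2)"
  have "(\<integral>\<^sup>+Y. stker k Y * ennreal (growth M (Y :: 'a \<times> real)) \<partial>lborel)
     = (\<integral>\<^sup>+r. (\<integral>\<^sup>+z. stker k (z, r) * ennreal (growth M (z :: 'a, r)) \<partial>lborel) \<partial>lborel)"
    by (rule nn_integral_lborel_pair) measurable
  also have "\<dots> \<le> (\<integral>\<^sup>+r. k r * ennreal (1 + (1 + ?C) * r powr M) \<partial>lborel)"
  proof (rule nn_integral_mono)
    fix r :: real
    show "(\<integral>\<^sup>+z. stker k (z, r) * ennreal (growth M (z :: 'a, r)) \<partial>lborel)
      \<le> k r * ennreal (1 + (1 + ?C) * r powr M)"
    proof (cases "0 < r")
      case True
      have le: "heat_kernel r z * growth M (z, r)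
          \<le> (1 + r powr M) * heat_kernel r z + ?C * r powr M * heat_kernel (2 * r) z" for z :: 'a
        using norm_powr_heat_kernel_le[OF M True, of z] True
        by (simp add: growth_def algebra_simps)
      have "(\<integral>\<^sup>+z. stker k (z, r) * ennreal (growth M (z :: 'a, r)) \<partial>lborel)
        = k r * (\<integral>\<^sup>+z. ennreal (heat_kernel r z * growth M (z :: 'a, r)) \<partial>lborel)"
        by (subst nn_integral_cmult[symmetric]) (auto simp: stker_def mult.assoc ennreal_mult' borel_prod[symmetric])
      also have "(\<integral>\<^sup>+z. ennreal (heat_kernel r z * growth M (z :: 'a, r)) \<partial>lborel)
        \<le> (\<integral>\<^sup>+z. ennreal (1 + r powr M) * ennreal (heat_kernel r (z :: 'a))
             + ennreal (?C * r powr M) * ennreal (heat_kernel (2 * r) z) \<partial>lborel)"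
        using le by (intro nn_integral_mono)
          (simp add: ennreal_mult'[symmetric] ennreal_plus[symmetric] ennreal_leI add_nonneg_nonneg del: ennreal_plus)
      also have "\<dots> = ennreal (1 + r powr M) + ennreal (?C * r powr M)"
        using True nn_integral_heat_kernel[of r, where 'a='a] nn_integral_heat_kernel[of "2 * r", where 'a='a]
        by (simp add: nn_integral_add nn_integral_cmult)
      also have "\<dots> = ennreal (1 + (1 + ?C) * r powr M)"
        by (subst ennreal_plus[symmetric]) (auto simp: algebra_simps)
      finally show ?thesis by (simp add: mult_left_mono)
    qed (simp add: stker_def k0)
  qed
  finally show ?thesis .
qed

section \<open>One-dimensional kernels\<close>

text \<open>Only the one-sided limits of \<open>F\<close> are used at the ends, so the integrand may
  be singular there.\<close>

lemma nn_integral_FTC_open: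
  fixes f F :: "real \<Rightarrow> real"
  assumes "a < b"
    and F: "\<And>x. a < x \<Longrightarrow> x < b \<Longrightarrow> (F has_real_derivative f x) (at x)"
    and f: "\<And>x. a < x \<Longrightarrow> x < b \<Longrightarrow> isCont f x"
    and nn: "\<And>x. a < x \<Longrightarrow> x < b \<Longrightarrow> 0 \<le> f x"
    and A: "(F \<longlongrightarrow> A) (at_right a)" and B: "(F \<longlongrightarrow> B) (at_left b)"
  shows "(\<integral>\<^sup>+x. indicator {a<..<b} x * ennreal (f x) \<partial>lborel) = ennreal (B - A)"
proof -
  have 1: "((F \<circ> real_of_ereal) \<longlongrightarrow> A) (at_right (ereal a))"
    using A by (simp add: ereal_tendsto_simps)
  have 2: "((F \<circ> real_of_ereal) \<longlongrightarrow> B) (at_left (ereal b))"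
    using B by (simp add: ereal_tendsto_simps)
  have si: "set_integrable lborel {a<..<b} f" and eq: "(LBINT x=ereal a..ereal b. f x) = B - A"
    using interval_integral_FTC_nonneg[OF _ _ _ _ 1 2, of f] assms by (auto simp: einterval_eq_Icc)
  have "(\<integral>\<^sup>+x. indicator {a<..<b} x * ennreal (f x) \<partial>lborel)
      = (\<integral>\<^sup>+x. ennreal (indicator {a<..<b} x *\<^sub>R f x) \<partial>lborel)"
    by (intro nn_integral_cong) (auto simp: indicator_def)
  also have "\<dots> = ennreal (\<integral>x. indicator {a<..<b} x *\<^sub>R f x \<partial>lborel)"
    using si by (intro nn_integral_eq_integral) (auto simp: set_integrable_def indicator_def nn)
  also have "(\<integral>x. indicator {a<..<b} x *\<^sub>R f x \<partial>lborel) = B - A"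
    using eq assms(1) by (simp add: interval_lebesgue_integral_def set_lebesgue_integral_def einterval_eq_Icc)
  finally show ?thesis .
qed

lemma nn_integral_powr_tail:
  fixes d p :: real
  assumes "0 < d" "0 < p"
  shows "(\<integral>\<^sup>+r. indicator {d<..} r * ennreal (r powr (- 1 - p)) \<partial>lborel) = ennreal (d powr (- p) / p)"
proof -
  have "(\<integral>\<^sup>+r. ennreal (r powr (- 1 - p)) * indicator {d..} r \<partial>lborel) = ennreal (0 - - (d powr (- p) / p))"
  proof (rule nn_integral_FTC_atLeast[where F = "\<lambda>r. - (r powr (- p) / p)"])
    fix x assume "d \<le> x"
    with assms show "((\<lambda>r. - (r powr (- p) / p)) has_real_derivative x powr (- 1 - p)) (at x)"
      by (auto intro!: derivative_eq_intros simp: powr_diff powr_minus divide_simps)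
  next
    show "((\<lambda>r. - (r powr (- p) / p)) \<longlongrightarrow> 0) at_top"
      using tendsto_minus[OF tendsto_divide[OF tendsto_neg_powr[OF _ filterlim_ident, of "- p"] tendsto_const[of p]]] assms
      by simp
  qed auto
  also have "(\<integral>\<^sup>+r. ennreal (r powr (- 1 - p)) * indicator {d..} r \<partial>lborel)
      = (\<integral>\<^sup>+r. indicator {d<..} r * ennreal (r powr (- 1 - p)) \<partial>lborel)"
  proof (rule nn_integral_cong_AE)
    show "AE r in lborel. ennreal (r powr (- 1 - p)) * indicator {d..} r = indicator {d<..} r * ennreal (r powr (- 1 - p))"
      using AE_lborel_singleton[of d] by eventually_elim (auto simp: indicator_def)
  qed
  finally show ?thesis by simp
qed

lemma nn_integral_Gamma_scaled:
  fixes p y :: real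
  assumes "0 < p" "0 < y"
  shows "(\<integral>\<^sup>+t. indicator {0<..} t * ennreal (t powr (p - 1) * exp (- y * t)) \<partial>lborel)
    = ennreal (Gamma p * y powr (- p))"
proof -
  have "ennreal (Gamma p) = (\<integral>\<^sup>+t. ennreal (indicator {0..} t * t powr (p - 1) / exp t) \<partial>lborel)"
    by (rule Gamma_conv_nn_integral_real[OF assms(1)])
  also have "\<dots> = ennreal y * (\<integral>\<^sup>+t. ennreal (indicator {0..} (y * t) * (y * t) powr (p - 1) / exp (y * t)) \<partial>lborel)"
    using nn_integral_real_affine[of "\<lambda>t. ennreal (indicator {0..} t * t powr (p - 1) / exp t)" y 0] assms
    by simp
  also have "(\<integral>\<^sup>+t. ennreal (indicator {0..} (y * t) * (y * t) powr (p - 1) / exp (y * t)) \<partial>lborel)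
      = (\<integral>\<^sup>+t. ennreal (y powr (p - 1)) * (indicator {0<..} t * ennreal (t powr (p - 1) * exp (- y * t))) \<partial>lborel)"
    using assms by (intro nn_integral_cong)
      (auto simp: indicator_def zero_le_mult_iff powr_mult exp_minus ennreal_mult'[symmetric] field_simps)
  also have "\<dots> = ennreal (y powr (p - 1)) * (\<integral>\<^sup>+t. indicator {0<..} t * ennreal (t powr (p - 1) * exp (- y * t)) \<partial>lborel)"
    by (rule nn_integral_cmult) measurable
  finally have *: "ennreal (Gamma p) = ennreal (y powr p) * (\<integral>\<^sup>+t. indicator {0<..} t * ennreal (t powr (p - 1) * exp (- y * t)) \<partial>lborel)"
    using assms by (simp add: mult.assoc[symmetric] ennreal_mult'[symmetric] powr_diff)
  have "ennreal (y powr (- p)) * ennreal (Gamma p)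
      = (\<integral>\<^sup>+t. indicator {0<..} t * ennreal (t powr (p - 1) * exp (- y * t)) \<partial>lborel)"
    unfolding * using assms by (simp add: mult.assoc[symmetric] ennreal_mult'[symmetric] powr_minus)
  then show ?thesis
    by (simp add: ennreal_mult'' mult.commute)
qed

text \<open>\<open>1 - exp (- d * y)\<close> is the integral of \<open>d * exp (- d * v)\<close>
  over \<open>0 < v < y\<close>. After the order of integration is exchanged, the inner integral is
  a power tail and the outer one a Gamma integral with exponent \<open>1 - s\<close>.\<close>

lemma nn_integral_powr_one_minus_exp:
  fixes s d :: real
  assumes "0 < s" "s < 1" "0 < d"
  shows "(\<integral>\<^sup>+y. indicator {0<..} y * ennreal (y powr (- 1 - s) * (1 - exp (- d * y))) \<partial>lborel)
    = ennreal (Gamma (1 - s) / s * d powr s)"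
proof -
  have ex: "ennreal (1 - exp (- d * y)) = (\<integral>\<^sup>+v. indicator {0<..<y} v * ennreal (d * exp (- d * v)) \<partial>lborel)"
    if "0 < y" for y
  proof -
    have lim: "((\<lambda>v. - exp (- d * v)) \<longlongrightarrow> - exp (- d * c)) (at c within A)" for c A
      by (intro tendsto_intros)
    have "(\<integral>\<^sup>+v. indicator {0<..<y} v * ennreal (d * exp (- d * v)) \<partial>lborel)
      = ennreal (- exp (- d * y) - - exp (- d * 0))"
      using assms that lim[of 0] lim[of y]
      by (intro nn_integral_FTC_open[where F = "\<lambda>v. - exp (- d * v)"])
        (auto intro!: derivative_eq_intros tendsto_intros)
    then show ?thesis by simp
  qed
  have "(\<integral>\<^sup>+y. indicator {0<..} y * ennreal (y powr (- 1 - s) * (1 - exp (- d * y))) \<partial>lborel)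
    = (\<integral>\<^sup>+y. (\<integral>\<^sup>+v. (indicator {0<..} v * ennreal (d * exp (- d * v))) * (indicator {v<..} y * ennreal (y powr (- 1 - s))) \<partial>lborel) \<partial>lborel)"
  proof (rule nn_integral_cong)
    fix y :: real
    show "indicator {0<..} y * ennreal (y powr (- 1 - s) * (1 - exp (- d * y)))
      = (\<integral>\<^sup>+v. (indicator {0<..} v * ennreal (d * exp (- d * v))) * (indicator {v<..} y * ennreal (y powr (- 1 - s))) \<partial>lborel)"
    proof (cases "0 < y")
      case True
      have "(\<integral>\<^sup>+v. (indicator {0<..} v * ennreal (d * exp (- d * v))) * (indicator {v<..} y * ennreal (y powr (- 1 - s))) \<partial>lborel)
         = (\<integral>\<^sup>+v. ennreal (y powr (- 1 - s)) * (indicator {0<..<y} v * ennreal (d * exp (- d * v))) \<partial>lborel)"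
        by (intro nn_integral_cong) (auto simp: indicator_def mult.commute)
      also have "\<dots> = ennreal (y powr (- 1 - s)) * ennreal (1 - exp (- d * y))"
        unfolding ex[OF True] by (rule nn_integral_cmult) measurable
      finally show ?thesis using True by (simp add: ennreal_mult')
    next
      case False
      then have "(\<integral>\<^sup>+v. (indicator {0<..} v * ennreal (d * exp (- d * v))) * (indicator {v<..} y * ennreal (y powr (- 1 - s))) \<partial>lborel)
         = (\<integral>\<^sup>+(v::real). 0 \<partial>lborel)"
        by (intro nn_integral_cong) (auto simp: indicator_def)
      with False show ?thesis by simp
    qed
  qed
  also have "\<dots> = (\<integral>\<^sup>+v. (\<integral>\<^sup>+y. (indicator {0<..} v * ennreal (d * exp (- d * v))) * (indicator {v<..} y * ennreal (y powr (- 1 - s))) \<partial>lborel) \<partial>lborel)"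
  proof (rule lborel_pair.Fubini')
    have "(\<lambda>x::real \<times> real. indicator {fst x<..} (snd x) :: ennreal) = (\<lambda>x. if fst x < snd x then 1 else 0)"
      by (auto simp: indicator_def)
    then have [measurable]: "(\<lambda>x::real \<times> real. indicator {fst x<..} (snd x) :: ennreal) \<in> borel_measurable (lborel \<Otimes>\<^sub>M lborel)"
      by simp
    show "(\<lambda>(v, y). (indicator {0<..} v * ennreal (d * exp (- d * v))) * (indicator {v<..} y * ennreal (y powr (- 1 - s)))) \<in> borel_measurable (lborel \<Otimes>\<^sub>M lborel)"
      unfolding split_beta by measurable
  qed
  also have "\<dots> = (\<integral>\<^sup>+v. ennreal (d / s) * (indicator {0<..} v * ennreal (v powr ((1 - s) - 1) * exp (- d * v))) \<partial>lborel)"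
  proof (rule nn_integral_cong)
    fix v :: real
    have "(\<integral>\<^sup>+y. (indicator {0<..} v * ennreal (d * exp (- d * v))) * (indicator {v<..} y * ennreal (y powr (- 1 - s))) \<partial>lborel)
      = (indicator {0<..} v * ennreal (d * exp (- d * v))) * (\<integral>\<^sup>+y. indicator {v<..} y * ennreal (y powr (- 1 - s)) \<partial>lborel)"
      by (rule nn_integral_cmult) measurable
    also have "\<dots> = indicator {0<..} v * (ennreal (d * exp (- d * v)) * ennreal (v powr (- s) / s))"
      using assms by (cases "0 < v") (simp_all add: nn_integral_powr_tail)
    also have "\<dots> = ennreal (d / s) * (indicator {0<..} v * ennreal (v powr ((1 - s) - 1) * exp (- d * v)))"
      using assms by (cases "0 < v") (simp_all add: ennreal_mult'[symmetric] mult_ac)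
    finally show "(\<integral>\<^sup>+y. (indicator {0<..} v * ennreal (d * exp (- d * v))) * (indicator {v<..} y * ennreal (y powr (- 1 - s))) \<partial>lborel)
      = ennreal (d / s) * (indicator {0<..} v * ennreal (v powr ((1 - s) - 1) * exp (- d * v)))" .
  qed
  also have "\<dots> = ennreal (d / s) * ennreal (Gamma (1 - s) * d powr (- (1 - s)))"
    by (subst nn_integral_cmult) (use nn_integral_Gamma_scaled[of "1 - s" d] assms in auto)
  also have "\<dots> = ennreal (Gamma (1 - s) / s * d powr s)"
    using assms by (simp add: ennreal_mult'[symmetric] powr_diff)
  finally show ?thesis .
qed

text \<open>An incomplete beta integral. It is elementary because the exponents \<open>s - 1\<close>
  and \<open>- 1 - s\<close> add up to -2: the variable \<open>v / (r - v)\<close> turns it into the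
  integral of a power.\<close>

lemma nn_integral_beta_kernel:
  fixes m r s :: real
  assumes "0 < s" "0 < m" "m < r"
  shows "(\<integral>\<^sup>+v. indicator {0<..<m} v * ennreal (v powr (s - 1) * (r - v) powr (- 1 - s)) \<partial>lborel)
    = ennreal ((m / (r - m)) powr s / (s * r))"
proof -
  have "(\<integral>\<^sup>+v. indicator {0<..<m} v * ennreal (v powr (s - 1) * (r - v) powr (- 1 - s)) \<partial>lborel)
    = ennreal ((m / (r - m)) powr s / (s * r) - 0)"
  proof (rule nn_integral_FTC_open[where F = "\<lambda>v. (v / (r - v)) powr s / (s * r)"])
    fix v assume v: "0 < v" "v < m"
    have "((\<lambda>v. (v / (r - v)) powr s / (s * r)) has_real_derivative
        (s * (v / (r - v)) powr (s - 1) * (r / (r - v)\<^sup>2)) / (s * r)) (at v)"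
      using v assms by (auto intro!: derivative_eq_intros simp: divide_simps power2_eq_square)
    also have "(s * (v / (r - v)) powr (s - 1) * (r / (r - v)\<^sup>2)) / (s * r) = v powr (s - 1) * (r - v) powr (- 1 - s)"
    proof -
      have "(r - v) powr (- 1 - s) = 1 / ((r - v) powr (s - 1) * (r - v) powr 2)"
        by (simp add: powr_add[symmetric] powr_minus_divide[symmetric])
      then show ?thesis
        using v assms by (simp add: powr_divide)
    qed
    finally show "((\<lambda>v. (v / (r - v)) powr s / (s * r)) has_real_derivative v powr (s - 1) * (r - v) powr (- 1 - s)) (at v)" .
    show "isCont (\<lambda>v. v powr (s - 1) * (r - v) powr (- 1 - s)) v"
      using v assms by (auto intro!: continuous_intros)
  next
    have "((\<lambda>v. (v / (r - v)) powr s / (s * r)) \<longlongrightarrow> (0 / (r - 0)) powr s / (s * r)) (at_right 0)"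
      using assms by (intro tendsto_intros tendsto_powr') (auto intro!: eventually_at_right_less[THEN eventually_mono] simp: eventually_at_right_field intro: exI[of _ m])
    then show "((\<lambda>v. (v / (r - v)) powr s / (s * r)) \<longlongrightarrow> 0) (at_right 0)" by simp
    show "((\<lambda>v. (v / (r - v)) powr s / (s * r)) \<longlongrightarrow> (m / (r - m)) powr s / (s * r)) (at_left m)"
      using assms by (intro tendsto_intros) auto
  qed (use assms in auto)
  then show ?thesis by simp
qed


section \<open>The time factors and their convolution identity\<close>

definition fpot :: "real \<Rightarrow> real \<Rightarrow> real \<Rightarrow> ennreal" where
  "fpot s lam r = ennreal (if 0 < r then exp (- lam * r) * r powr (s - 1) / Gamma s else 0)"

definition fjump :: "real \<Rightarrow> real \<Rightarrow> real \<Rightarrow> ennreal" where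
  "fjump s d r = ennreal (if d < r then r powr (- 1 - s) else 0)"

text \<open>\<open>mar\<close> is what the truncation leaves of the potential with \<open>lam = 0\<close>, and \<open>mrem\<close> is the error caused by the
  damping factor; see \<open>fpot_jump_identity\<close>.\<close>

definition mar :: "real \<Rightarrow> real \<Rightarrow> real \<Rightarrow> ennreal" where
  "mar s d r = ennreal (if 0 < r then (r powr s - max 0 (r - d) powr s) / (s * Gamma s * r * d powr s) else 0)"

definition mrem :: "real \<Rightarrow> real \<Rightarrow> real \<Rightarrow> real \<Rightarrow> ennreal" where
  "mrem s lam d r = (\<integral>\<^sup>+v. ennreal (if 0 < v \<and> v < r - d
     then v powr (s - 1) * (r - v) powr (- 1 - s) * (exp (- lam * v) - exp (- lam * r)) / Gamma s else 0) \<partial>lborel)"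

lemma fpot_measurable[measurable]: "fpot s lam \<in> borel_measurable borel"
  and fjump_measurable[measurable]: "fjump s d \<in> borel_measurable borel"
  and mar_measurable[measurable]: "mar s d \<in> borel_measurable borel"
  and mrem_measurable[measurable]: "mrem s lam d \<in> borel_measurable borel"
  unfolding fpot_def[abs_def] fjump_def[abs_def] mar_def[abs_def] mrem_def[abs_def] by measurable

lemma fpot_nonpos: "r \<le> 0 \<Longrightarrow> fpot s lam r = 0"
  and fjump_nonpos: "0 \<le> d \<Longrightarrow> r \<le> 0 \<Longrightarrow> fjump s d r = 0"
  and mar_nonpos: "r \<le> 0 \<Longrightarrow> mar s d r = 0"
  by (simp_all add: fpot_def fjump_def mar_def)

lemma mrem_nonpos: "0 \<le> d \<Longrightarrow> r \<le> d \<Longrightarrow> mrem s lam d r = 0"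
  unfolding mrem_def by (subst nn_integral_cong[where v = "\<lambda>_. 0"]) auto

lemma mar_bounds:
  fixes s d r :: real
  assumes "0 < s" "s < 1" "0 < d" "0 < r"
  shows "0 \<le> r powr s - max 0 (r - d) powr s"
    and "(r powr s - max 0 (r - d) powr s) / r \<le> d * r powr (s - 2)"
proof -
  have "max 0 (r - d) powr s \<le> r powr s"
    using assms by (intro powr_mono2) auto
  then show "0 \<le> r powr s - max 0 (r - d) powr s"
    by simp
  have *: "r powr s - max 0 (r - d) powr s \<le> d * r powr (s - 1)"
  proof (cases "r \<le> d")
    case True
    have "r powr s = r * r powr (s - 1)" using assms by (simp add: powr_diff)
    also have "\<dots> \<le> d * r powr (s - 1)" using True by (intro mult_right_mono) auto
    finally show ?thesis using True assms by simp
  next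
    case False
    then have r: "0 < r - d" by simp
    \<comment> \<open>For \<open>w \<le> 1\<close> and \<open>s < 1\<close> the power
      \<open>w powr s\<close> is at least \<open>w\<close>, so the relative loss
      \<open>1 - w powr s\<close> is at most \<open>1 - w = d / r\<close>, a full power of
      \<open>d / r\<close>.\<close>
    define w where "w = (r - d) / r"
    have w: "0 < w" "w \<le> 1" using r assms by (auto simp: w_def)
    have "w powr 1 \<le> w powr s" using w assms by (intro powr_mono') auto
    then have "w \<le> w powr s" using w by simp
    moreover have "(r - d) powr s = w powr s * r powr s"
      using r assms by (simp add: w_def powr_divide)
    ultimately have "w * r powr s \<le> (r - d) powr s"
      using mult_right_mono[of w "w powr s" "r powr s"] by simp
    then have "r powr s - (r - d) powr s \<le> (1 - w) * r powr s" by (simp add: algebra_simps)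
    also have "\<dots> = d * r powr (s - 1)"
      using assms by (simp add: w_def powr_diff field_simps)
    finally show ?thesis using r by simp
  qed
  have "(r powr s - max 0 (r - d) powr s) / r \<le> d * r powr (s - 1) / r"
    using * assms by (intro divide_right_mono) auto
  also have "\<dots> = d * r powr (s - 2)"
    using assms by (simp add: powr_diff power2_eq_square)
  finally show "(r powr s - max 0 (r - d) powr s) / r \<le> d * r powr (s - 2)" .
qed

text \<open>For fixed \<open>r > 0\<close> the factor \<open>d powr (1 - s)\<close> tends to 0,
  while \<open>r powr (s - 2)\<close> is integrable at infinity: the fixed mass of
  \<open>mar\<close> concentrates at time 0.\<close>

lemma mar_le:
  assumes "0 < s" "s < 1" "0 < d" "0 < r"
  shows "mar s d r \<le> ennreal (d powr (1 - s) * r powr (s - 2) / (s * Gamma s))"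
proof -
  have G: "0 < s * Gamma s" using assms by (simp add: Gamma_real_pos)
  have "(r powr s - max 0 (r - d) powr s) / (s * Gamma s * r * d powr s)
      = (r powr s - max 0 (r - d) powr s) / r * (1 / (s * Gamma s * d powr s))"
    by (simp add: field_simps)
  also have "\<dots> \<le> d * r powr (s - 2) * (1 / (s * Gamma s * d powr s))"
    using G assms by (intro mult_right_mono mar_bounds) auto
  also have "\<dots> = d powr (1 - s) * r powr (s - 2) / (s * Gamma s)"
    using assms by (simp add: powr_diff)
  finally show ?thesis
    using assms by (simp add: mar_def ennreal_leI)
qed

text \<open>Writing \<open>1 / r\<close> as the integral of \<open>exp (- r * y)\<close> over
  \<open>y > 0\<close> leaves the Laplace transform of
  \<open>r powr s - max 0 (r - d) powr s\<close>. The shift by \<open>d\<close> multiplies the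
  transform of \<open>r powr s\<close> by \<open>exp (- d * y)\<close>, and
  \<open>nn_integral_powr_one_minus_exp\<close> finishes. The powers of \<open>d\<close> cancel, so
  the mass does not depend on the truncation.\<close>

lemma nn_integral_mar:
  assumes "0 < s" "s < 1" "0 < d"
  shows "(\<integral>\<^sup>+r. mar s d r \<partial>lborel) = ennreal (Gamma (1 - s) / s)"
proof -
  have G: "0 < Gamma s" "0 < Gamma (1 - s)" using assms by (auto simp: Gamma_real_pos)
  define L where "L r = r powr s - max 0 (r - d) powr s" for r
  have L: "0 \<le> L r" if "0 < r" for r using mar_bounds(1)[of s d r] that assms by (simp add: L_def)
  have [measurable]: "L \<in> borel_measurable borel" unfolding L_def[abs_def] by measurable
  have inv: "ennreal (1 / r) = (\<integral>\<^sup>+y. indicator {0<..} y * ennreal (exp (- r * y)) \<partial>lborel)" if "0 < r" for r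
  proof -
    have "(\<integral>\<^sup>+y. indicator {0<..} y * ennreal (exp (- r * y)) \<partial>lborel)
      = (\<integral>\<^sup>+y. indicator {0<..} y * ennreal (y powr (1 - 1) * exp (- r * y)) \<partial>lborel)"
      by (intro nn_integral_cong) (auto simp: indicator_def)
    then show ?thesis
      using nn_integral_Gamma_scaled[of 1 r] that by (simp add: powr_minus divide_inverse)
  qed
  have lap: "(\<integral>\<^sup>+r. indicator {0<..} r * ennreal (L r * exp (- y * r)) \<partial>lborel)
      = ennreal (Gamma (1 + s) * (y powr (- 1 - s) * (1 - exp (- d * y))))" if y: "0 < y" for y
  proof -
    have a: "(\<integral>\<^sup>+t. indicator {0<..} t * ennreal (t powr s * exp (- y * t)) \<partial>lborel)
        = ennreal (Gamma (1 + s) * y powr (- 1 - s))"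
      using nn_integral_Gamma_scaled[of "1 + s" y] y assms by simp
    have "(\<integral>\<^sup>+r. indicator {0<..} r * ennreal (max 0 (r - d) powr s * exp (- y * r)) \<partial>lborel)
      = (\<integral>\<^sup>+r. ennreal (exp (- d * y)) * (indicator {0<..} (-d + r) * ennreal ((-d + r) powr s * exp (- y * (-d + r)))) \<partial>lborel)"
      using assms by (intro nn_integral_cong)
        (auto simp: indicator_def max_def ennreal_mult'[symmetric] exp_add[symmetric] algebra_simps)
    also have "\<dots> = ennreal (exp (- d * y)) * (\<integral>\<^sup>+r. indicator {0<..} (-d + r) * ennreal ((-d + r) powr s * exp (- y * (-d + r))) \<partial>lborel)"
      by (rule nn_integral_cmult) measurable
    also have "(\<integral>\<^sup>+r. indicator {0<..} (-d + r) * ennreal ((-d + r) powr s * exp (- y * (-d + r))) \<partial>lborel)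
       = ennreal (Gamma (1 + s) * y powr (- 1 - s))"
      by (subst nn_integral_lborel_shift[of "\<lambda>t. indicator {0<..} t * ennreal (t powr s * exp (- y * t))"]) (measurable, rule a)
    finally have b: "(\<integral>\<^sup>+r. indicator {0<..} r * ennreal (max 0 (r - d) powr s * exp (- y * r)) \<partial>lborel)
      = ennreal (exp (- d * y) * (Gamma (1 + s) * y powr (- 1 - s)))"
      by (simp add: ennreal_mult'[symmetric])
    have "(\<integral>\<^sup>+t. indicator {0<..} t * ennreal (t powr s * exp (- y * t)) \<partial>lborel)
      = (\<integral>\<^sup>+r. indicator {0<..} r * ennreal (L r * exp (- y * r)) + indicator {0<..} r * ennreal (max 0 (r - d) powr s * exp (- y * r)) \<partial>lborel)"
      using L by (intro nn_integral_cong)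
        (auto simp: indicator_def ennreal_plus[symmetric] L_def algebra_simps simp del: ennreal_plus)
    also have "\<dots> = (\<integral>\<^sup>+r. indicator {0<..} r * ennreal (L r * exp (- y * r)) \<partial>lborel)
        + ennreal (exp (- d * y) * (Gamma (1 + s) * y powr (- 1 - s)))"
      unfolding b[symmetric] by (rule nn_integral_add) measurable
    finally have "(\<integral>\<^sup>+r. indicator {0<..} r * ennreal (L r * exp (- y * r)) \<partial>lborel)
       = ennreal (Gamma (1 + s) * y powr (- 1 - s)) - ennreal (exp (- d * y) * (Gamma (1 + s) * y powr (- 1 - s)))"
      unfolding a by (simp add: ennreal_add_diff_cancel_right)
    also have "\<dots> = ennreal (Gamma (1 + s) * (y powr (- 1 - s) * (1 - exp (- d * y))))"
      using assms by (subst ennreal_minus) (auto simp: algebra_simps Gamma_real_pos intro!: mult_nonneg_nonneg less_imp_le)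
    finally show ?thesis .
  qed
  have "(\<integral>\<^sup>+r. indicator {0<..} r * ennreal (L r / r) \<partial>lborel)
     = (\<integral>\<^sup>+r. (\<integral>\<^sup>+y. indicator {0<..} y * (indicator {0<..} r * ennreal (L r * exp (- y * r))) \<partial>lborel) \<partial>lborel)"
  proof (rule nn_integral_cong)
    fix r :: real
    show "indicator {0<..} r * ennreal (L r / r) = (\<integral>\<^sup>+y. indicator {0<..} y * (indicator {0<..} r * ennreal (L r * exp (- y * r))) \<partial>lborel)"
    proof (cases "0 < r")
      case True
      have "(\<integral>\<^sup>+y. indicator {0<..} y * (indicator {0<..} r * ennreal (L r * exp (- y * r))) \<partial>lborel)
        = (\<integral>\<^sup>+y. ennreal (L r) * (indicator {0<..} y * ennreal (exp (- r * y))) \<partial>lborel)"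
        using True L by (intro nn_integral_cong) (auto simp: indicator_def ennreal_mult' mult.commute)
      also have "\<dots> = ennreal (L r) * ennreal (1 / r)"
        unfolding inv[OF True] by (rule nn_integral_cmult) measurable
      finally show ?thesis using True L by (simp add: ennreal_mult'[symmetric])
    qed simp
  qed
  also have "\<dots> = (\<integral>\<^sup>+y. (\<integral>\<^sup>+r. indicator {0<..} y * (indicator {0<..} r * ennreal (L r * exp (- y * r))) \<partial>lborel) \<partial>lborel)"
    by (rule lborel_pair.Fubini') measurable
  also have "\<dots> = (\<integral>\<^sup>+y. ennreal (Gamma (1 + s)) * (indicator {0<..} y * ennreal (y powr (- 1 - s) * (1 - exp (- d * y)))) \<partial>lborel)"
  proof (rule nn_integral_cong)
    fix y :: real
    have "(\<integral>\<^sup>+r. indicator {0<..} y * (indicator {0<..} r * ennreal (L r * exp (- y * r))) \<partial>lborel)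
      = indicator {0<..} y * (\<integral>\<^sup>+r. indicator {0<..} r * ennreal (L r * exp (- y * r)) \<partial>lborel)"
      by (rule nn_integral_cmult) measurable
    also have "\<dots> = ennreal (Gamma (1 + s)) * (indicator {0<..} y * ennreal (y powr (- 1 - s) * (1 - exp (- d * y))))"
    proof (cases "0 < y")
      case True
      then show ?thesis
        using assms by (simp only: lap) (simp add: ennreal_mult' Gamma_real_pos less_imp_le)
    qed simp
    finally show "(\<integral>\<^sup>+r. indicator {0<..} y * (indicator {0<..} r * ennreal (L r * exp (- y * r))) \<partial>lborel)
      = ennreal (Gamma (1 + s)) * (indicator {0<..} y * ennreal (y powr (- 1 - s) * (1 - exp (- d * y))))" .
  qed
  also have "\<dots> = ennreal (Gamma (1 + s)) * ennreal (Gamma (1 - s) / s * d powr s)"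
    unfolding nn_integral_powr_one_minus_exp[OF assms, symmetric] by (rule nn_integral_cmult) measurable
  also have "\<dots> = ennreal (Gamma (1 + s) * (Gamma (1 - s) / s * d powr s))"
    by (rule ennreal_mult'[symmetric]) (use assms Gamma_real_pos[of "1 + s"] in simp)
  also have "Gamma (1 + s) = s * Gamma s"
    using Gamma_plus1[of s] nonpos_Ints_nonpos[of s] assms by (force simp: add.commute)
  finally have main: "(\<integral>\<^sup>+r. indicator {0<..} r * ennreal (L r / r) \<partial>lborel) = ennreal (s * Gamma s * (Gamma (1 - s) / s * d powr s))" .
  have "(\<integral>\<^sup>+r. mar s d r \<partial>lborel) = (\<integral>\<^sup>+r. ennreal (1 / (s * Gamma s * d powr s)) * (indicator {0<..} r * ennreal (L r / r)) \<partial>lborel)"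
    using G assms by (intro nn_integral_cong)
      (auto simp: mar_def L_def indicator_def ennreal_mult'[symmetric] field_simps)
  also have "\<dots> = ennreal (1 / (s * Gamma s * d powr s)) * ennreal (s * Gamma s * (Gamma (1 - s) / s * d powr s))"
    unfolding main[symmetric] by (rule nn_integral_cmult) measurable
  also have "\<dots> = ennreal (Gamma (1 - s) / s)"
    using less_imp_neq[OF G(1)] assms by (simp add: ennreal_mult'[symmetric])
  finally show ?thesis .
qed

text \<open>For \<open>d < r\<close> the convolution runs over \<open>0 < v < r - d\<close>. Writing
  \<open>exp (- lam * v)\<close> as \<open>exp (- lam * r)\<close> plus a nonnegative difference,
  the difference gives \<open>mrem\<close> and the constant part the elementary integral
  \<open>nn_integral_beta_kernel\<close> with \<open>m = r - d\<close>. For \<open>r \<le> d\<close>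
  both the convolution and \<open>mrem\<close> vanish. As an equality of sums the identity avoids
  subtraction in \<open>ennreal\<close>.\<close>

lemma fpot_jump_identity:
  assumes "0 < s" "s < 1" "0 < d" "0 \<le> lam"
  shows "ennreal (d powr (- s) / s) * fpot s lam r + mrem s lam d r
    = ennreal (exp (- lam * r)) * mar s d r + nconv (fpot s lam) (fjump s d) r"
proof (cases "d < r")
  case True
  have G: "0 < Gamma s" using assms by (auto simp: Gamma_real_pos)
  have r: "0 < r" "0 < r - d" using True assms by auto
  have "nconv (fpot s lam) (fjump s d) r
    = (\<integral>\<^sup>+v. ennreal (if 0 < v \<and> v < r - d then v powr (s - 1) * (r - v) powr (- 1 - s) * (exp (- lam * v) - exp (- lam * r)) / Gamma s else 0)
        + ennreal (exp (- lam * r) / Gamma s) * (indicator {0<..<r - d} v * ennreal (v powr (s - 1) * (r - v) powr (- 1 - s))) \<partial>lborel)"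
    unfolding nconv_def
  proof (rule nn_integral_cong)
    fix v
    show "fpot s lam v * fjump s d (r - v)
      = ennreal (if 0 < v \<and> v < r - d then v powr (s - 1) * (r - v) powr (- 1 - s) * (exp (- lam * v) - exp (- lam * r)) / Gamma s else 0)
        + ennreal (exp (- lam * r) / Gamma s) * (indicator {0<..<r - d} v * ennreal (v powr (s - 1) * (r - v) powr (- 1 - s)))"
    proof (cases "0 < v \<and> v < r - d")
      case True
      define a where "a = v powr (s - 1) * (r - v) powr (- 1 - s)"
      have "0 \<le> exp (- lam * v) - exp (- lam * r)"
        using True assms by (simp add: mult_left_mono)
      then have nn: "0 \<le> a * (exp (- lam * v) - exp (- lam * r)) / Gamma s" "0 \<le> exp (- lam * r) / Gamma s * a"
        using G by (auto simp: a_def)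
      have "exp (- lam * v) * v powr (s - 1) / Gamma s * (r - v) powr (- 1 - s)
        = a * (exp (- lam * v) - exp (- lam * r)) / Gamma s + exp (- lam * r) / Gamma s * a"
        using G by (simp add: a_def field_simps)
      with nn True G show ?thesis
        by (simp add: fpot_def fjump_def ennreal_mult'[symmetric] ennreal_plus[symmetric] a_def[symmetric]
            del: ennreal_plus)
    qed (auto simp: fpot_def fjump_def)
  qed
  also have "\<dots> = mrem s lam d r + ennreal (exp (- lam * r) / Gamma s) * (\<integral>\<^sup>+v. indicator {0<..<r - d} v * ennreal (v powr (s - 1) * (r - v) powr (- 1 - s)) \<partial>lborel)"
    unfolding mrem_def by (subst nn_integral_add) (auto simp: nn_integral_cmult)
  also have "(\<integral>\<^sup>+v. indicator {0<..<r - d} v * ennreal (v powr (s - 1) * (r - v) powr (- 1 - s)) \<partial>lborel)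
     = ennreal (((r - d) / d) powr s / (s * r))"
    using nn_integral_beta_kernel[of s "r - d" r] r assms by simp
  finally have eq: "nconv (fpot s lam) (fjump s d) r
     = mrem s lam d r + ennreal (exp (- lam * r) / Gamma s * (((r - d) / d) powr s / (s * r)))"
    using G by (simp add: ennreal_mult'[symmetric])
  have "ennreal (d powr (- s) / s) * fpot s lam r
      = ennreal (exp (- lam * r)) * mar s d r + ennreal (exp (- lam * r) / Gamma s * (((r - d) / d) powr s / (s * r)))"
  proof -
    \<comment> \<open>The origin of \<open>mar\<close>:
      \<open>d powr (- s) / s * r powr (s - 1)\<close> exceeds the beta integral by
      \<open>(r powr s - (r - d) powr s) / (s * r * d powr s)\<close>.\<close>
    have "d powr (- s) / s * (exp (- lam * r) * r powr (s - 1) / Gamma s)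
      = exp (- lam * r) * ((r powr s - max 0 (r - d) powr s) / (s * Gamma s * r * d powr s))
        + exp (- lam * r) / Gamma s * (((r - d) / d) powr s / (s * r))"
      using r assms G by (simp add: powr_divide powr_diff powr_minus max_def divide_simps) (simp add: algebra_simps)
    moreover have "0 \<le> exp (- lam * r) * ((r powr s - max 0 (r - d) powr s) / (s * Gamma s * r * d powr s))"
      using mar_bounds(1)[of s d r] r assms G by (intro mult_nonneg_nonneg divide_nonneg_nonneg) auto
    moreover have "0 \<le> exp (- lam * r) / Gamma s * (((r - d) / d) powr s / (s * r))"
      using r assms G by simp
    ultimately have "ennreal (d powr (- s) / s * (exp (- lam * r) * r powr (s - 1) / Gamma s))
      = ennreal (exp (- lam * r) * ((r powr s - max 0 (r - d) powr s) / (s * Gamma s * r * d powr s)))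
        + ennreal (exp (- lam * r) / Gamma s * (((r - d) / d) powr s / (s * r)))"
      by (simp only:) (rule ennreal_plus, auto)
    moreover have "ennreal (d powr (- s) / s) * fpot s lam r = ennreal (d powr (- s) / s * (exp (- lam * r) * r powr (s - 1) / Gamma s))"
      unfolding fpot_def if_P[OF r(1)] by (rule ennreal_mult'[symmetric]) (use assms in simp)
    moreover have "ennreal (exp (- lam * r)) * mar s d r
        = ennreal (exp (- lam * r) * ((r powr s - max 0 (r - d) powr s) / (s * Gamma s * r * d powr s)))"
      unfolding mar_def if_P[OF r(1)] by (rule ennreal_mult'[symmetric]) simp
    ultimately show ?thesis
      by simp
  qed
  then show ?thesis
    unfolding eq by (simp add: ac_simps)
next
  case False
  have 0: "nconv (fpot s lam) (fjump s d) r = 0"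
    unfolding nconv_def using False by (subst nn_integral_cong[where v = "\<lambda>_. 0"]) (auto simp: fpot_def fjump_def)
  show ?thesis
  proof (cases "0 < r")
    case True
    have "d powr (- s) / s * (exp (- lam * r) * r powr (s - 1) / Gamma s)
      = exp (- lam * r) * ((r powr s - max 0 (r - d) powr s) / (s * Gamma s * r * d powr s))"
      using False True assms by (simp add: powr_diff powr_minus divide_simps)
    then show ?thesis
      using False True assms 0
      by (simp add: mrem_nonpos fpot_def mar_def ennreal_mult'[symmetric])
  qed (use assms False 0 in \<open>simp add: fpot_def mar_def mrem_nonpos\<close>)
qed

section \<open>The damping error: limits and bounds\<close>

lemma mrem_antimono_d:
  assumes "0 < s" "0 \<le> d'" "d' \<le> d" "0 \<le> lam"
  shows "mrem s lam d r \<le> mrem s lam d' r"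
  unfolding mrem_def
proof (rule nn_integral_mono)
  fix v
  have "0 \<le> exp (- lam * v) - exp (- lam * r)" if "v < r"
    using that assms by (simp add: mult_left_mono)
  then show "ennreal (if 0 < v \<and> v < r - d then v powr (s - 1) * (r - v) powr (- 1 - s) * (exp (- lam * v) - exp (- lam * r)) / Gamma s else 0)
    \<le> ennreal (if 0 < v \<and> v < r - d' then v powr (s - 1) * (r - v) powr (- 1 - s) * (exp (- lam * v) - exp (- lam * r)) / Gamma s else 0)"
    using assms by (auto simp: not_less)
qed

lemma mrem_incseq:
  assumes "0 < s" "0 \<le> lam"
  shows "incseq (\<lambda>j. mrem s lam (inverse (real (Suc j))))"
  using assms by (intro incseq_SucI le_funI mrem_antimono_d) (auto simp: field_simps)

lemma mrem_LIMSEQ: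
  assumes "0 < s" "0 \<le> lam"
  shows "(\<lambda>j. mrem s lam (inverse (real (Suc j))) r) \<longlonglongrightarrow> mrem s lam 0 r"
  unfolding mrem_def
proof (rule nn_integral_LIMSEQ)
  show "incseq (\<lambda>j v. ennreal (if 0 < v \<and> v < r - inverse (real (Suc j)) then v powr (s - 1) * (r - v) powr (- 1 - s) * (exp (- lam * v) - exp (- lam * r)) / Gamma s else 0))"
  proof (intro incseq_SucI le_funI)
    fix j v
    have i: "inverse (real (Suc (Suc j))) \<le> inverse (real (Suc j))" by (simp add: field_simps)
    have "0 \<le> exp (- lam * v) - exp (- lam * r)" if "v < r"
      using that assms by (simp add: mult_left_mono)
    moreover have "v < r" if "v < r - inverse (real (Suc j))"
      using that positive_imp_inverse_positive[of "real (Suc j)"] by linarith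
    note calculation = calculation this
    show "ennreal (if 0 < v \<and> v < r - inverse (real (Suc j)) then v powr (s - 1) * (r - v) powr (- 1 - s) * (exp (- lam * v) - exp (- lam * r)) / Gamma s else 0)
      \<le> ennreal (if 0 < v \<and> v < r - inverse (real (Suc (Suc j))) then v powr (s - 1) * (r - v) powr (- 1 - s) * (exp (- lam * v) - exp (- lam * r)) / Gamma s else 0)"
    proof -
      have "v < r - inverse (real (Suc (Suc j)))" if "v < r - inverse (real (Suc j))"
        using that i by linarith
      then show ?thesis
        using calculation assms by (auto simp del: of_nat_Suc)
    qed
  qed
  show "(\<lambda>v. ennreal (if 0 < v \<and> v < r - inverse (real (Suc j)) then v powr (s - 1) * (r - v) powr (- 1 - s) * (exp (- lam * v) - exp (- lam * r)) / Gamma s else 0)) \<in> borel_measurable lborel" for j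
    by measurable
  fix v
  show "(\<lambda>j. ennreal (if 0 < v \<and> v < r - inverse (real (Suc j)) then v powr (s - 1) * (r - v) powr (- 1 - s) * (exp (- lam * v) - exp (- lam * r)) / Gamma s else 0))
    \<longlonglongrightarrow> ennreal (if 0 < v \<and> v < r - 0 then v powr (s - 1) * (r - v) powr (- 1 - s) * (exp (- lam * v) - exp (- lam * r)) / Gamma s else 0)"
  proof (cases "v < r")
    case True
    then have "\<forall>\<^sub>F j in sequentially. inverse (real (Suc j)) < r - v"
      using order_tendstoD(2)[OF LIMSEQ_inverse_real_of_nat, of "r - v"] by simp
    then have "\<forall>\<^sub>F j in sequentially. v < r - inverse (real (Suc j)) \<longleftrightarrow> v < r - 0"
      by (rule eventually_mono) (use True in auto)
    then show ?thesis
      by (intro tendsto_eventually, elim eventually_mono) (simp only:)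
  next
    case False
    have "\<not> v < r - inverse (real (Suc j))" for j
      using False positive_imp_inverse_positive[of "real (Suc j)"] by linarith
    then show ?thesis using False by simp
  qed
qed

text \<open>Writing the difference of exponentials as the integral of
  \<open>lam * exp (- lam * p)\<close> over \<open>v < p < r\<close> and exchanging the order makes
  the integral over \<open>v\<close> elementary; \<open>p = r * q\<close> then scales to the unit
  interval. Now \<open>lam\<close> and \<open>r\<close> occur only in
  \<open>lam * exp (- lam * r * q)\<close>, and the bounds below are bounds for this factor.\<close>

lemma mrem_eq:
  assumes "0 < s" "0 < r" "0 < lam"
  shows "mrem s lam 0 r = (\<integral>\<^sup>+q. ennreal (if 0 < q \<and> q < 1
    then lam * exp (- lam * r * q) * (q / (1 - q)) powr s / (s * Gamma s) else 0) \<partial>lborel)"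
proof -
  have G: "0 < Gamma s" using assms by (auto simp: Gamma_real_pos)
  define h where "h v p = ennreal (if 0 < v \<and> v < p \<and> p < r
    then v powr (s - 1) * (r - v) powr (- 1 - s) / Gamma s * (lam * exp (- lam * p)) else 0)" for v p
  have "mrem s lam 0 r = (\<integral>\<^sup>+v. (\<integral>\<^sup>+p. h v p \<partial>lborel) \<partial>lborel)"
    unfolding mrem_def
  proof (rule nn_integral_cong)
    fix v
    show "ennreal (if 0 < v \<and> v < r - 0 then v powr (s - 1) * (r - v) powr (- 1 - s) * (exp (- lam * v) - exp (- lam * r)) / Gamma s else 0)
      = (\<integral>\<^sup>+p. h v p \<partial>lborel)"
    proof (cases "0 < v \<and> v < r")
      case True
      have lim: "((\<lambda>p. - exp (- lam * p)) \<longlongrightarrow> - exp (- lam * c)) (at c within A)" for c A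
        by (intro tendsto_intros)
      have "(\<integral>\<^sup>+p. h v p \<partial>lborel) = (\<integral>\<^sup>+p. ennreal (v powr (s - 1) * (r - v) powr (- 1 - s) / Gamma s) * (indicator {v<..<r} p * ennreal (lam * exp (- lam * p))) \<partial>lborel)"
        using True G by (intro nn_integral_cong) (auto simp: h_def indicator_def ennreal_mult'[symmetric])
      also have "\<dots> = ennreal (v powr (s - 1) * (r - v) powr (- 1 - s) / Gamma s) * (\<integral>\<^sup>+p. indicator {v<..<r} p * ennreal (lam * exp (- lam * p)) \<partial>lborel)"
        by (rule nn_integral_cmult) measurable
      also have "(\<integral>\<^sup>+p. indicator {v<..<r} p * ennreal (lam * exp (- lam * p)) \<partial>lborel) = ennreal (- exp (- lam * r) - - exp (- lam * v))"
        using True assms lim[of v] lim[of r]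
        by (intro nn_integral_FTC_open[where F = "\<lambda>p. - exp (- lam * p)"]) (auto intro!: derivative_eq_intros)
      finally show ?thesis
        using True G by (simp add: ennreal_mult'[symmetric])
    next
      case False
      then have "(\<integral>\<^sup>+p. h v p \<partial>lborel) = (\<integral>\<^sup>+(p::real). 0 \<partial>lborel)"
        by (intro nn_integral_cong) (auto simp: h_def)
      with False show ?thesis by auto
    qed
  qed
  also have "\<dots> = (\<integral>\<^sup>+p. (\<integral>\<^sup>+v. h v p \<partial>lborel) \<partial>lborel)"
    by (rule lborel_pair.Fubini') (simp add: h_def split_beta)
  also have "\<dots> = (\<integral>\<^sup>+p. ennreal (if 0 < p \<and> p < r then lam * exp (- lam * p) * ((p / (r - p)) powr s / (s * Gamma s * r)) else 0) \<partial>lborel)"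
  proof (rule nn_integral_cong)
    fix p
    show "(\<integral>\<^sup>+v. h v p \<partial>lborel) = ennreal (if 0 < p \<and> p < r then lam * exp (- lam * p) * ((p / (r - p)) powr s / (s * Gamma s * r)) else 0)"
    proof (cases "0 < p \<and> p < r")
      case True
      have "(\<integral>\<^sup>+v. h v p \<partial>lborel) = (\<integral>\<^sup>+v. ennreal (lam * exp (- lam * p) / Gamma s) * (indicator {0<..<p} v * ennreal (v powr (s - 1) * (r - v) powr (- 1 - s))) \<partial>lborel)"
        using True G assms by (intro nn_integral_cong) (auto simp: h_def indicator_def ennreal_mult'[symmetric] mult_ac)
      also have "\<dots> = ennreal (lam * exp (- lam * p) / Gamma s) * (\<integral>\<^sup>+v. indicator {0<..<p} v * ennreal (v powr (s - 1) * (r - v) powr (- 1 - s)) \<partial>lborel)"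
        by (rule nn_integral_cmult) measurable
      also have "\<dots> = ennreal (lam * exp (- lam * p) / Gamma s) * ennreal ((p / (r - p)) powr s / (s * r))"
        using nn_integral_beta_kernel[of s p r] True assms by simp
      finally show ?thesis
        using True G assms by (simp add: ennreal_mult'[symmetric] mult_ac)
    next
      case False
      then have "(\<integral>\<^sup>+v. h v p \<partial>lborel) = (\<integral>\<^sup>+(v::real). 0 \<partial>lborel)"
        by (intro nn_integral_cong) (auto simp: h_def)
      with False show ?thesis by auto
    qed
  qed
  also have "\<dots> = ennreal \<bar>r\<bar> * (\<integral>\<^sup>+q. ennreal (if 0 < 0 + r * q \<and> 0 + r * q < r then lam * exp (- lam * (0 + r * q)) * (((0 + r * q) / (r - (0 + r * q))) powr s / (s * Gamma s * r)) else 0) \<partial>lborel)"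
    using assms by (intro nn_integral_real_affine) auto
  also have "\<dots> = (\<integral>\<^sup>+q. ennreal r * ennreal (if 0 < 0 + r * q \<and> 0 + r * q < r then lam * exp (- lam * (0 + r * q)) * (((0 + r * q) / (r - (0 + r * q))) powr s / (s * Gamma s * r)) else 0) \<partial>lborel)"
    using assms by (subst nn_integral_cmult) auto
  also have "\<dots> = (\<integral>\<^sup>+q. ennreal (if 0 < q \<and> q < 1 then lam * exp (- lam * r * q) * (q / (1 - q)) powr s / (s * Gamma s) else 0) \<partial>lborel)"
  proof (rule nn_integral_cong)
    fix q
    have "r * q < r \<longleftrightarrow> q < 1" "0 < r * q \<longleftrightarrow> 0 < q"
      using assms by (auto simp: zero_less_mult_iff)
    moreover have "(r * q) / (r - r * q) = q / (1 - q)"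
      using assms by (simp add: right_diff_distrib[of r 1, simplified, symmetric])
    ultimately show "ennreal r * ennreal (if 0 < 0 + r * q \<and> 0 + r * q < r then lam * exp (- lam * (0 + r * q)) * (((0 + r * q) / (r - (0 + r * q))) powr s / (s * Gamma s * r)) else 0)
      = ennreal (if 0 < q \<and> q < 1 then lam * exp (- lam * r * q) * (q / (1 - q)) powr s / (s * Gamma s) else 0)"
      using assms by (auto simp: ennreal_mult'[symmetric] mult_ac)
  qed
  finally show ?thesis .
qed

lemma nn_integral_one_minus_powr:
  fixes s :: real
  assumes "s < 1"
  shows "(\<integral>\<^sup>+q. indicator {0<..<1} q * ennreal ((1 - q) powr (- s)) \<partial>lborel) = ennreal (1 / (1 - s))"
proof -
  have "(\<integral>\<^sup>+q. indicator {0<..<1} q * ennreal ((1 - q) powr (- s)) \<partial>lborel)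
    = ennreal (0 - - (1 / (1 - s)))"
  proof (rule nn_integral_FTC_open[where F = "\<lambda>q. - ((1 - q) powr (1 - s) / (1 - s))"])
    show "((\<lambda>q. - ((1 - q) powr (1 - s) / (1 - s))) has_real_derivative (1 - q) powr (- s)) (at q)"
      if "0 < q" "q < 1" for q
    proof -
      have "((\<lambda>q. (1 - q) powr (1 - s)) has_real_derivative (1 - s) * (1 - q) powr (1 - s - of_nat 1) * (- 1)) (at q)"
        using that by (intro DERIV_fun_powr) (auto intro!: derivative_eq_intros)
      from DERIV_minus[OF DERIV_cdivide[OF this, of "1 - s"]] show ?thesis
        using assms by simp
    qed
    show "isCont (\<lambda>q. (1 - q) powr (- s)) q" if "0 < q" "q < 1" for q
      using that by (auto intro!: continuous_intros)
    have "((\<lambda>q. - ((1 - q) powr (1 - s) / (1 - s))) \<longlongrightarrow> - ((1 - 0) powr (1 - s) / (1 - s))) (at_right 0)"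
      using assms by (intro tendsto_intros) auto
    then show "((\<lambda>q. - ((1 - q) powr (1 - s) / (1 - s))) \<longlongrightarrow> - (1 / (1 - s))) (at_right 0)" by simp
    have "((\<lambda>q. - ((1 - q) powr (1 - s) / (1 - s))) \<longlongrightarrow> - ((1 - 1) powr (1 - s) / (1 - s))) (at_left 1)"
      using assms by (intro tendsto_intros tendsto_powr') (auto simp: eventually_at_left_field intro: exI[of _ 0])
    then show "((\<lambda>q. - ((1 - q) powr (1 - s) / (1 - s))) \<longlongrightarrow> 0) (at_left 1)" by simp
  qed (use assms in auto)
  then show ?thesis by simp
qed

text \<open>The power \<open>q powr s\<close> is charged to \<open>g\<close>; the other factor
  \<open>(1 - q) powr (- s)\<close> has integral \<open>1 / (1 - s)\<close>.\<close>

lemma mrem_le_aux: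
  assumes "0 < s" "s < 1" "0 \<le> A"
    and "\<And>q. 0 < q \<Longrightarrow> q < 1 \<Longrightarrow> g q * q powr s \<le> A"
  shows "(\<integral>\<^sup>+q. ennreal (if 0 < q \<and> q < 1 then g q * (q / (1 - q)) powr s / (s * Gamma s) else 0) \<partial>lborel)
    \<le> ennreal (A / (s * Gamma s * (1 - s)))"
proof -
  have G: "0 < Gamma s" using assms by (auto simp: Gamma_real_pos)
  have "(\<integral>\<^sup>+q. ennreal (if 0 < q \<and> q < 1 then g q * (q / (1 - q)) powr s / (s * Gamma s) else 0) \<partial>lborel)
    \<le> (\<integral>\<^sup>+q. ennreal (A / (s * Gamma s)) * (indicator {0<..<1} q * ennreal ((1 - q) powr (- s))) \<partial>lborel)"
  proof (rule nn_integral_mono)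
    fix q :: real
    show "ennreal (if 0 < q \<and> q < 1 then g q * (q / (1 - q)) powr s / (s * Gamma s) else 0)
      \<le> ennreal (A / (s * Gamma s)) * (indicator {0<..<1} q * ennreal ((1 - q) powr (- s)))"
    proof (cases "0 < q \<and> q < 1")
      case True
      have "g q * (q / (1 - q)) powr s / (s * Gamma s) = (g q * q powr s) * ((1 - q) powr (- s) / (s * Gamma s))"
        using True by (simp add: powr_divide powr_minus field_simps)
      also have "\<dots> \<le> A * ((1 - q) powr (- s) / (s * Gamma s))"
        using True G assms by (intro mult_right_mono) auto
      finally show ?thesis
        using True G assms by (simp add: ennreal_mult'[symmetric] ennreal_leI)
    qed auto
  qed
  also have "\<dots> = ennreal (A / (s * Gamma s)) * ennreal (1 / (1 - s))"
    unfolding nn_integral_one_minus_powr[OF assms(2), symmetric] by (rule nn_integral_cmult) measurable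
  also have "\<dots> = ennreal (A / (s * Gamma s) * (1 / (1 - s)))"
    by (rule ennreal_mult'[symmetric]) (use assms G in auto)
  finally show ?thesis by simp
qed

lemma exp_le_powr:
  fixes q x :: real
  assumes "0 < q" "0 < x"
  shows "exp (- x) \<le> (2 * q) powr q * x powr (- q)"
proof -
  have "exp (- x) * x powr q \<le> exp (- x / 2) * x powr q"
    using assms by (intro mult_right_mono) auto
  also have "\<dots> \<le> (2 * q) powr q"
    using powr_mult_exp_le[of q x] assms by (simp add: mult.commute)
  finally show ?thesis
    using assms by (simp add: powr_minus field_simps)
qed

text \<open>For use at bounded times, where smallness in \<open>lam\<close> is enough and decay in
  \<open>r\<close> is irrelevant.\<close>

lemma mrem_le_const:
  assumes "0 < s" "s < 1" "0 < lam"
  shows "mrem s lam 0 r \<le> ennreal (lam / (s * Gamma s * (1 - s)))"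
proof (cases "0 < r")
  case True
  have "lam * exp (- lam * r * q) * q powr s \<le> lam" if "0 < q" "q < 1" for q
  proof -
    have "exp (- lam * r * q) * q powr s \<le> 1 * 1"
      using that assms True by (intro mult_mono powr_le1) auto
    then show ?thesis using assms by (simp add: mult.assoc)
  qed
  then show ?thesis
    unfolding mrem_eq[OF assms(1) True assms(3)] using assms by (intro mrem_le_aux) auto
qed (simp add: mrem_nonpos)

text \<open>\<open>exp_le_powr\<close> with exponent \<open>s\<close> at \<open>lam * r * q\<close>
  cancels \<open>q powr s\<close>. The decay \<open>r powr (- s)\<close> is one power short of what
  the weight can dominate; the missing \<open>1 / r\<close> comes from differences in space or
  time.\<close>

lemma mrem_le_powr:
  assumes "0 < s" "s < 1" "0 < lam" "0 < r"
  shows "mrem s lam 0 r \<le> ennreal ((2 * s) powr s * lam powr (1 - s) * r powr (- s) / (s * Gamma s * (1 - s)))"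
proof -
  have "lam * exp (- lam * r * q) * q powr s \<le> (2 * s) powr s * lam powr (1 - s) * r powr (- s)" if "0 < q" "q < 1" for q
  proof -
    have "exp (- lam * r * q) \<le> (2 * s) powr s * (lam * r * q) powr (- s)"
      using exp_le_powr[of s "lam * r * q"] that assms by simp
    then have "lam * exp (- lam * r * q) * q powr s \<le> lam * ((2 * s) powr s * (lam * r * q) powr (- s)) * q powr s"
      using assms by (intro mult_right_mono mult_left_mono) auto
    also have "\<dots> = (2 * s) powr s * lam powr (1 - s) * r powr (- s)"
      using that assms by (simp add: powr_mult powr_diff powr_minus field_simps)
    finally show ?thesis .
  qed
  then show ?thesis
    unfolding mrem_eq[OF assms(1,4,3)] using assms by (intro mrem_le_aux) auto
qed

lemma mrem_antimono:
  assumes "0 < s" "0 < lam" "0 < r" "r \<le> r'"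
  shows "mrem s lam 0 r' \<le> mrem s lam 0 r"
proof -
  have G: "0 < Gamma s" using assms by (auto simp: Gamma_real_pos)
  have "0 < r'" using assms by simp
  then show ?thesis
    unfolding mrem_eq[OF assms(1,3,2)] mrem_eq[OF assms(1) \<open>0 < r'\<close> assms(2)]
    using assms G by (intro nn_integral_mono)
      (auto intro!: ennreal_leI divide_right_mono mult_right_mono mult_left_mono)
qed

text \<open>The difference of the exponentials contributes \<open>lam * h * q\<close>; the rest is
  bounded as before, now with exponent \<open>1 + s\<close>. The result keeps
  \<open>lam powr (1 - s)\<close> and gains the factor \<open>1 / r\<close>.\<close>

lemma mrem_diff_le:
  assumes "0 < s" "s < 1" "0 < lam" "0 < r" "0 \<le> h"
  shows "mrem s lam 0 r \<le> mrem s lam 0 (r + h)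
    + ennreal ((2 * (1 + s)) powr (1 + s) * h * lam powr (1 - s) * r powr (- 1 - s) / (s * Gamma s * (1 - s)))"
proof -
  have G: "0 < Gamma s" using assms by (auto simp: Gamma_real_pos)
  have rh: "0 < r + h" using assms by simp
  let ?A = "(2 * (1 + s)) powr (1 + s) * h * lam powr (1 - s) * r powr (- 1 - s)"
  let ?g = "\<lambda>q. lam * (exp (- lam * r * q) - exp (- lam * (r + h) * q))"
  have le: "?g q * q powr s \<le> ?A" and nn: "0 \<le> ?g q" if q: "0 < q" "q < 1" for q
  proof -
    have e: "exp (- lam * r * q) - exp (- lam * (r + h) * q) = exp (- (lam * r * q)) * (1 - exp (- (lam * h * q)))"
      by (simp add: exp_add[symmetric] algebra_simps)
    have "1 - exp (- (lam * h * q)) \<le> lam * h * q"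
      using exp_ge_add_one_self[of "- (lam * h * q)"] by linarith
    moreover have "exp (- (lam * r * q)) \<le> (2 * (1 + s)) powr (1 + s) * (lam * r * q) powr (- (1 + s))"
      using assms q by (intro exp_le_powr) auto
    moreover have nn1: "0 \<le> 1 - exp (- (lam * h * q))" using assms q by simp
    ultimately have "exp (- (lam * r * q)) * (1 - exp (- (lam * h * q)))
        \<le> (2 * (1 + s)) powr (1 + s) * (lam * r * q) powr (- (1 + s)) * (lam * h * q)"
      by (intro mult_mono) auto
    then have "?g q * q powr s \<le> lam * ((2 * (1 + s)) powr (1 + s) * (lam * r * q) powr (- (1 + s)) * (lam * h * q)) * q powr s"
      unfolding e using assms by (intro mult_right_mono mult_left_mono) auto
    also have "\<dots> = ?A"
      using q assms by (simp add: powr_mult powr_diff powr_minus powr_add divide_simps power2_eq_square)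
    finally show "?g q * q powr s \<le> ?A" .
    show "0 \<le> ?g q" unfolding e using nn1 assms by simp
  qed
  have "mrem s lam 0 r = (\<integral>\<^sup>+q. ennreal (if 0 < q \<and> q < 1 then lam * exp (- lam * (r + h) * q) * (q / (1 - q)) powr s / (s * Gamma s) else 0)
     + ennreal (if 0 < q \<and> q < 1 then ?g q * (q / (1 - q)) powr s / (s * Gamma s) else 0) \<partial>lborel)"
    unfolding mrem_eq[OF assms(1,4,3)]
  proof (rule nn_integral_cong)
    fix q
    show "ennreal (if 0 < q \<and> q < 1 then lam * exp (- lam * r * q) * (q / (1 - q)) powr s / (s * Gamma s) else 0)
      = ennreal (if 0 < q \<and> q < 1 then lam * exp (- lam * (r + h) * q) * (q / (1 - q)) powr s / (s * Gamma s) else 0)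
     + ennreal (if 0 < q \<and> q < 1 then ?g q * (q / (1 - q)) powr s / (s * Gamma s) else 0)"
    proof (cases "0 < q \<and> q < 1")
      case True
      let ?w = "(q / (1 - q)) powr s / (s * Gamma s)"
      have "lam * exp (- lam * r * q) * ?w = lam * exp (- lam * (r + h) * q) * ?w + ?g q * ?w"
        by (simp add: algebra_simps)
      moreover have "0 \<le> lam * exp (- lam * (r + h) * q) * ?w" "0 \<le> ?g q * ?w"
        using True nn[of q] assms G by (auto intro!: mult_nonneg_nonneg)
      ultimately have "ennreal (lam * exp (- lam * r * q) * ?w) = ennreal (lam * exp (- lam * (r + h) * q) * ?w) + ennreal (?g q * ?w)"
        by (simp only:) (rule ennreal_plus, auto)
      with True show ?thesis by simp
    qed auto
  qed
  also have "\<dots> = mrem s lam 0 (r + h) + (\<integral>\<^sup>+q. ennreal (if 0 < q \<and> q < 1 then ?g q * (q / (1 - q)) powr s / (s * Gamma s) else 0) \<partial>lborel)"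
    unfolding mrem_eq[OF assms(1) rh assms(3)] by (rule nn_integral_add) measurable
  also have "\<dots> \<le> mrem s lam 0 (r + h) + ennreal (?A / (s * Gamma s * (1 - s)))"
    using assms le by (intro add_left_mono mrem_le_aux) auto
  finally show ?thesis .
qed

section \<open>Approximate identities\<close>

text \<open>\<open>F\<close> is neither bounded nor integrable, so concentration of the mass alone
  is not enough: outside each ball, \<open>Q j\<close> must be dominated by a vanishing multiple of
  one kernel \<open>V\<close> that has finite mass and a finite convolution with \<open>F\<close> at
  \<open>X\<close>. Continuity is used at \<open>X\<close> only.\<close>

lemma approx_identity:
  fixes Q :: "nat \<Rightarrow> 'b::euclidean_space \<Rightarrow> ennreal" and F :: "'b \<Rightarrow> real"
  assumes Q[measurable]: "\<And>j. Q j \<in> borel_measurable borel"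
    and F[measurable]: "F \<in> borel_measurable borel" and F0: "\<And>Y. 0 \<le> F Y" and cont: "isCont F X"
    and k0: "0 \<le> k" and mass: "(\<lambda>j. \<integral>\<^sup>+Y. Q j Y \<partial>lborel) \<longlonglongrightarrow> ennreal k"
    and off: "\<And>d. 0 < d \<Longrightarrow> \<exists>V e. V \<in> borel_measurable borel \<and> (\<integral>\<^sup>+Y. V Y \<partial>lborel) < \<infinity>
      \<and> nconv V (\<lambda>Y. ennreal (F Y)) X < \<infinity> \<and> (\<forall>j. 0 \<le> e j) \<and> e \<longlonglongrightarrow> (0::real)
      \<and> (\<forall>j Y. d \<le> norm Y \<longrightarrow> Q j Y \<le> ennreal (e j) * V Y)"
  shows "(\<lambda>j. nconv (Q j) (\<lambda>Y. ennreal (F Y)) X) \<longlonglongrightarrow> ennreal (k * F X)"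
proof -
  define I where "I j = (\<integral>\<^sup>+Y. Q j Y \<partial>lborel)" for j
  define N where "N j = nconv (Q j) (\<lambda>Y. ennreal (F Y)) X" for j
  \<comment> \<open>Both inequalities stay in additive form because \<open>N j\<close> and
    \<open>I j\<close> can be infinite for small \<open>j\<close>.\<close>
  have key: "\<exists>e c. (\<forall>j. 0 \<le> e j) \<and> e \<longlonglongrightarrow> 0 \<and> 0 \<le> c
      \<and> (\<forall>j. N j \<le> ennreal (F X + \<epsilon>) * I j + ennreal (e j * c))
      \<and> (\<forall>j. ennreal (F X) * I j \<le> N j + (ennreal \<epsilon> * I j + ennreal (e j * c)))" if "0 < \<epsilon>" for \<epsilon>
  proof -
    obtain d where d: "0 < d" "\<And>Y. norm (Y - X) < d \<Longrightarrow> norm (F Y - F X) < \<epsilon>"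
      using cont \<open>0 < \<epsilon>\<close> unfolding isCont_def LIM_eq by (metis diff_self norm_zero)
    obtain V e where [measurable]: "V \<in> borel_measurable borel" and V: "(\<integral>\<^sup>+Y. V Y \<partial>lborel) < \<infinity>"
      "nconv V (\<lambda>Y. ennreal (F Y)) X < \<infinity>" and e: "\<And>j. 0 \<le> e j" "e \<longlonglongrightarrow> 0"
      and QV: "\<And>j Y. d \<le> norm Y \<Longrightarrow> Q j Y \<le> ennreal (e j) * V Y"
      using off[OF d(1)] by metis
    define c where "c = enn2real (nconv V (\<lambda>Y. ennreal (F Y)) X) + F X * enn2real (\<integral>\<^sup>+Y. V Y \<partial>lborel)"
    have near: "F (X - Y) \<le> F X + \<epsilon>" "F X \<le> F (X - Y) + \<epsilon>" if "norm Y < d" for Y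
      using d(2)[of "X - Y"] that by (auto simp: abs_less_iff)
    have "N j \<le> ennreal (F X + \<epsilon>) * I j + ennreal (e j * c)" for j
    proof -
      have "N j \<le> (\<integral>\<^sup>+Y. ennreal (F X + \<epsilon>) * Q j Y + ennreal (e j) * (V Y * ennreal (F (X - Y))) \<partial>lborel)"
        unfolding N_def nconv_def
      proof (rule nn_integral_mono)
        fix Y
        show "Q j Y * ennreal (F (X - Y)) \<le> ennreal (F X + \<epsilon>) * Q j Y + ennreal (e j) * (V Y * ennreal (F (X - Y)))"
        proof (cases "norm Y < d")
          case True
          then have "Q j Y * ennreal (F (X - Y)) \<le> Q j Y * ennreal (F X + \<epsilon>)"
            by (intro mult_left_mono ennreal_leI near) auto
          then show ?thesis by (simp add: mult.commute add_increasing2)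
        next
          case False
          then have "Q j Y * ennreal (F (X - Y)) \<le> ennreal (e j) * V Y * ennreal (F (X - Y))"
            by (intro mult_right_mono QV) auto
          then show ?thesis by (simp add: mult.assoc add_increasing)
        qed
      qed
      also have "\<dots> = ennreal (F X + \<epsilon>) * I j + ennreal (e j) * nconv V (\<lambda>Y. ennreal (F Y)) X"
        by (simp add: nn_integral_add nn_integral_cmult I_def nconv_def)
      also have "ennreal (e j) * nconv V (\<lambda>Y. ennreal (F Y)) X = ennreal (e j * enn2real (nconv V (\<lambda>Y. ennreal (F Y)) X))"
        using V(2) e(1) by (simp add: ennreal_mult')
      also have "\<dots> \<le> ennreal (e j * c)"
        using e(1) F0 by (intro ennreal_leI mult_left_mono) (auto simp: c_def)
      finally show ?thesis by (simp add: add_left_mono)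
    qed
    moreover have "ennreal (F X) * I j \<le> N j + (ennreal \<epsilon> * I j + ennreal (e j * c))" for j
    proof -
      have "ennreal (F X) * I j = (\<integral>\<^sup>+Y. ennreal (F X) * Q j Y \<partial>lborel)"
        by (simp add: I_def nn_integral_cmult)
      also have "\<dots> \<le> (\<integral>\<^sup>+Y. Q j Y * ennreal (F (X - Y)) + (ennreal \<epsilon> * Q j Y + ennreal (e j * F X) * V Y) \<partial>lborel)"
      proof (rule nn_integral_mono)
        fix Y
        show "ennreal (F X) * Q j Y \<le> Q j Y * ennreal (F (X - Y)) + (ennreal \<epsilon> * Q j Y + ennreal (e j * F X) * V Y)"
        proof (cases "norm Y < d")
          case True
          then have "ennreal (F X) * Q j Y \<le> ennreal (F (X - Y) + \<epsilon>) * Q j Y"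
            by (intro mult_right_mono ennreal_leI near) auto
          also have "\<dots> = Q j Y * ennreal (F (X - Y)) + ennreal \<epsilon> * Q j Y"
            using F0 that by (simp add: ennreal_plus distrib_right distrib_left mult.commute)
          finally show ?thesis by (simp add: add.assoc[symmetric] add_increasing2)
        next
          case False
          then have "ennreal (F X) * Q j Y \<le> ennreal (F X) * (ennreal (e j) * V Y)"
            by (intro mult_left_mono QV) auto
          also have "\<dots> = ennreal (e j * F X) * V Y"
            using F0 e(1) by (simp add: ennreal_mult mult_ac)
          finally show ?thesis by (simp add: add.assoc[symmetric] add_increasing)
        qed
      qed
      also have "\<dots> = N j + (ennreal \<epsilon> * I j + ennreal (e j * F X) * (\<integral>\<^sup>+Y. V Y \<partial>lborel))"
        by (simp add: nn_integral_add nn_integral_cmult I_def N_def nconv_def)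
      also have "ennreal (e j * F X) * (\<integral>\<^sup>+Y. V Y \<partial>lborel) = ennreal (e j * (F X * enn2real (\<integral>\<^sup>+Y. V Y \<partial>lborel)))"
        using V(1) e(1) F0 by (simp add: ennreal_mult' mult.assoc[symmetric])
      also have "\<dots> \<le> ennreal (e j * c)"
        using e(1) F0 by (intro ennreal_leI mult_left_mono) (auto simp: c_def)
      finally show ?thesis by (simp add: add_left_mono)
    qed
    moreover have "0 \<le> c" using F0 by (simp add: c_def)
    ultimately show ?thesis using e by blast
  qed
  have Ik: "(\<lambda>j. I j) \<longlonglongrightarrow> ennreal k" using mass by (simp add: I_def)
  have evI: "\<forall>\<^sub>F j in sequentially. I j < ennreal (k + 1)"
    using k0 by (intro order_tendstoD(2)[OF Ik]) (simp add: ennreal_less_iff)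
  have ik: "(\<lambda>j. enn2real (I j)) \<longlonglongrightarrow> k"
    using k0 tendsto_enn2real[OF Ik] by simp
  have evN: "\<forall>\<^sub>F j in sequentially. N j < \<infinity>"
  proof -
    obtain e c where "\<And>j. N j \<le> ennreal (F X + 1) * I j + ennreal (e j * c)"
      using key[of 1] by auto
    then show ?thesis
      using evI
    proof (elim eventually_mono)
      fix j assume a: "I j < ennreal (k + 1)" and b: "\<And>j. N j \<le> ennreal (F X + 1) * I j + ennreal (e j * c)"
      have "I j < \<infinity>" using a by (rule order_less_trans) simp
      then have "ennreal (F X + 1) * I j + ennreal (e j * c) < \<infinity>"
        by (simp add: ennreal_mult_less_top)
      then show "N j < \<infinity>" using b[of j] by (rule order_le_less_trans[rotated])
    qed
  qed
  have lim: "(\<lambda>j. enn2real (N j) - F X * enn2real (I j)) \<longlonglongrightarrow> 0"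
  proof (rule LIMSEQ_I)
    fix \<eta> :: real assume \<eta>: "0 < \<eta>"
    define \<epsilon> where "\<epsilon> = \<eta> / (2 * (k + 1))"
    have \<epsilon>: "0 < \<epsilon>" "\<epsilon> * (k + 1) = \<eta> / 2" using \<eta> k0 by (simp_all add: \<epsilon>_def nonzero_divide_eq_eq)
    obtain e c where e: "\<And>j. 0 \<le> e j" "e \<longlonglongrightarrow> 0" "0 \<le> c"
      and N1: "\<And>j. N j \<le> ennreal (F X + \<epsilon>) * I j + ennreal (e j * c)"
      and N2: "\<And>j. ennreal (F X) * I j \<le> N j + (ennreal \<epsilon> * I j + ennreal (e j * c))"
      using key[OF \<epsilon>(1)] by blast
    have "(\<lambda>j. e j * c) \<longlonglongrightarrow> 0 * c" by (intro tendsto_mult e tendsto_const)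
    from order_tendstoD(2)[OF this, of "\<eta> / 2"] have "\<forall>\<^sub>F j in sequentially. e j * c < \<eta> / 2"
      using \<eta> by simp
    with evI evN have "\<forall>\<^sub>F j in sequentially. norm (enn2real (N j) - F X * enn2real (I j) - 0) < \<eta>"
    proof eventually_elim
      case (elim j)
      have fin: "I j < \<infinity>" using elim(1) by (rule order_less_trans) simp
      obtain i where i: "I j = ennreal i" "0 \<le> i" using fin by (cases "I j") auto
      obtain n where n: "N j = ennreal n" "0 \<le> n" using elim(2) by (cases "N j") auto
      have ik1: "i < k + 1" using elim(1) i k0 by (simp add: ennreal_less_iff del: ennreal_plus)
      have "ennreal n \<le> ennreal ((F X + \<epsilon>) * i + e j * c)"
        using N1[of j] i n e F0 \<epsilon> by (simp add: ennreal_mult[symmetric] ennreal_plus[symmetric] add_nonneg_nonneg del: ennreal_plus)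
      then have 1: "n \<le> (F X + \<epsilon>) * i + e j * c"
        using i e F0[of X] \<epsilon> by (subst (asm) ennreal_le_iff) (auto intro!: add_nonneg_nonneg mult_nonneg_nonneg)
      have "ennreal (F X * i) \<le> ennreal (n + (\<epsilon> * i + e j * c))"
        using N2[of j] i n e F0 \<epsilon> by (simp add: ennreal_mult[symmetric] ennreal_plus[symmetric] add_nonneg_nonneg del: ennreal_plus)
      then have 2: "F X * i \<le> n + (\<epsilon> * i + e j * c)"
        using i n e \<epsilon> by (subst (asm) ennreal_le_iff) (auto intro!: add_nonneg_nonneg mult_nonneg_nonneg)
      have "\<epsilon> * i \<le> \<eta> / 2" using ik1 \<epsilon> by (metis less_imp_le mult_left_mono)
      then show ?case using 1 2 elim(3) i n by (auto simp: abs_less_iff distrib_right)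
    qed
    then show "\<exists>no. \<forall>j\<ge>no. norm (enn2real (N j) - F X * enn2real (I j) - 0) < \<eta>"
      by (simp add: eventually_sequentially)
  qed
  have "(\<lambda>j. (enn2real (N j) - F X * enn2real (I j)) + F X * enn2real (I j)) \<longlonglongrightarrow> 0 + F X * k"
    by (intro tendsto_intros lim ik)
  then have "(\<lambda>j. ennreal (enn2real (N j))) \<longlonglongrightarrow> ennreal (k * F X)"
    by (intro tendsto_ennrealI) (simp add: mult.commute)
  moreover have "\<forall>\<^sub>F j in sequentially. ennreal (enn2real (N j)) = N j"
    using evN by eventually_elim (simp add: less_top)
  ultimately show ?thesis
    unfolding N_def by (rule Lim_transform_eventually)
qed

text \<open>The majorant that \<open>heat_kernel_small_time_le\<close> provides for singular kernels
  at small times and away from the spatial origin.\<close>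

definition hshift :: "'a::euclidean_space \<times> real \<Rightarrow> ennreal" where
  "hshift Y = ennreal (if 0 < snd Y \<and> snd Y < 1 then heat_kernel (snd Y + 1) (fst Y) else 0)"

lemma hshift_measurable[measurable]: "hshift \<in> borel_measurable borel"
  unfolding hshift_def[abs_def] by (simp add: borel_prod[symmetric])

lemma nn_integral_stker:
  assumes [measurable]: "k \<in> borel_measurable borel" and k0: "\<And>r. r \<le> 0 \<Longrightarrow> k r = 0"
  shows "(\<integral>\<^sup>+Y. stker k (Y :: 'a::euclidean_space \<times> real) \<partial>lborel) = (\<integral>\<^sup>+r. k r \<partial>lborel)"
proof -
  have "(\<integral>\<^sup>+Y. stker k (Y :: 'a \<times> real) \<partial>lborel) = (\<integral>\<^sup>+r. (\<integral>\<^sup>+z. stker k (z :: 'a, r) \<partial>lborel) \<partial>lborel)"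
    by (rule nn_integral_lborel_pair) measurable
  also have "\<dots> = (\<integral>\<^sup>+r. k r \<partial>lborel)"
  proof (rule nn_integral_cong)
    fix r
    show "(\<integral>\<^sup>+z. stker k (z :: 'a, r) \<partial>lborel) = k r"
    proof (cases "0 < r")
      case True
      then show ?thesis
        using nn_integral_heat_kernel[OF True, where 'a='a] by (simp add: stker_def nn_integral_cmult)
    qed (simp add: stker_def k0)
  qed
  finally show ?thesis .
qed

lemma nn_integral_hshift: "(\<integral>\<^sup>+Y. hshift (Y :: 'a::euclidean_space \<times> real) \<partial>lborel) \<le> 1"
proof -
  have "(\<integral>\<^sup>+Y. hshift (Y :: 'a \<times> real) \<partial>lborel) = (\<integral>\<^sup>+r. (\<integral>\<^sup>+z. hshift (z :: 'a, r) \<partial>lborel) \<partial>lborel)"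
    by (rule nn_integral_lborel_pair) measurable
  also have "\<dots> \<le> (\<integral>\<^sup>+r. indicator {0..1::real} r \<partial>lborel)"
  proof (rule nn_integral_mono)
    fix r :: real
    show "(\<integral>\<^sup>+z. hshift (z :: 'a, r) \<partial>lborel) \<le> indicator {0..1} r"
      using nn_integral_heat_kernel[of "r + 1", where 'a='a] by (cases "0 < r \<and> r < 1") (auto simp: hshift_def)
  qed
  also have "\<dots> = 1" by simp
  finally show ?thesis .
qed

lemma inverse_Suc_powr_tendsto_0:
  assumes "0 < p"
  shows "(\<lambda>j. inverse (real (Suc j)) powr p) \<longlonglongrightarrow> 0"
  using tendsto_powr'[OF LIMSEQ_inverse_real_of_nat tendsto_const, of p] assms by simp

text \<open>A point away from the space-time origin has a large time or a large space component.
  \<open>fin1\<close> controls the first region, where the damped \<open>r powr (s - 2)\<close> is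
  at most a multiple of the potential kernel, and \<open>fin2\<close> the second, where
  \<open>hshift\<close> is the majorant.\<close>

lemma approx_mar:
  fixes F :: "'a::euclidean_space \<times> real \<Rightarrow> real"
  assumes s: "0 < s" "s < 1" and lam: "0 \<le> lam"
    and F[measurable]: "F \<in> borel_measurable borel" and F0: "\<And>Y. 0 \<le> F Y" and cont: "isCont F X"
    and fin1: "nconv (stker (fpot s lam)) (\<lambda>Y. ennreal (F Y)) X < \<infinity>"
    and fin2: "nconv hshift (\<lambda>Y. ennreal (F Y)) X < \<infinity>"
  shows "(\<lambda>j. nconv (stker (\<lambda>r. ennreal (exp (- lam * r)) * mar s (inverse (real (Suc j))) r)) (\<lambda>Y. ennreal (F Y)) X)
    \<longlonglongrightarrow> ennreal (Gamma (1 - s) / s * F X)"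
proof (rule approx_identity)
  have G: "0 < Gamma s" "0 < Gamma (1 - s)" using s by (auto simp: Gamma_real_pos)
  let ?k = "\<lambda>j r. ennreal (exp (- lam * r)) * mar s (inverse (real (Suc j))) r"
  have mass: "(\<integral>\<^sup>+Y. stker (?k j) (Y :: 'a \<times> real) \<partial>lborel) = (\<integral>\<^sup>+r. ?k j r \<partial>lborel)" for j
    by (rule nn_integral_stker) (auto simp: mar_nonpos)
  show "stker (?k j) \<in> borel_measurable borel" for j by measurable
  show "0 \<le> Gamma (1 - s) / s" using G s by simp
  have dpos: "0 < inverse (real (Suc j))" for j by simp
  show "(\<lambda>j. \<integral>\<^sup>+Y. stker (?k j) (Y :: 'a \<times> real) \<partial>lborel) \<longlonglongrightarrow> ennreal (Gamma (1 - s) / s)"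
  proof (cases "lam = 0")
    case True
    then show ?thesis unfolding mass using nn_integral_mar[OF s dpos] by simp
  next
    case False
    then have l: "0 < lam" using lam by simp
    define c where "c = 1 / (s * Gamma s) * (Gamma s / (1 - s) * lam powr (1 - s))"
    have up: "(\<integral>\<^sup>+r. ?k j r \<partial>lborel) \<le> ennreal (Gamma (1 - s) / s)" for j
      unfolding nn_integral_mar[OF s dpos[of j], symmetric]
    proof (rule nn_integral_mono)
      fix r
      show "?k j r \<le> mar s (inverse (real (Suc j))) r"
      proof (cases "0 < r")
        case True
        then have "ennreal (exp (- lam * r)) \<le> 1" using l by simp
        then show ?thesis using mult_right_mono[of _ 1 "mar s (inverse (real (Suc j))) r"] by simp
      qed (simp add: mar_nonpos)
    qed
    \<comment> \<open>The mass lost through the damping is the integral of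
      \<open>1 - exp (- lam * r)\<close> against \<open>mar\<close>; by \<open>mar_le\<close> it is
      at most a constant times a positive power of the truncation length.\<close>
    have low: "ennreal (Gamma (1 - s) / s) \<le> (\<integral>\<^sup>+r. ?k j r \<partial>lborel) + ennreal (inverse (real (Suc j)) powr (1 - s) * c)" for j
    proof -
      let ?d = "inverse (real (Suc j))"
      have "ennreal (Gamma (1 - s) / s) = (\<integral>\<^sup>+r. mar s ?d r \<partial>lborel)"
        by (rule nn_integral_mar[OF s dpos, symmetric])
      also have "\<dots> \<le> (\<integral>\<^sup>+r. ?k j r + ennreal (?d powr (1 - s) / (s * Gamma s))
           * (indicator {0<..} r * ennreal (r powr (- 1 - (1 - s)) * (1 - exp (- lam * r)))) \<partial>lborel)"
      proof (rule nn_integral_mono)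
        fix r
        show "mar s ?d r \<le> ?k j r + ennreal (?d powr (1 - s) / (s * Gamma s))
           * (indicator {0<..} r * ennreal (r powr (- 1 - (1 - s)) * (1 - exp (- lam * r))))"
        proof (cases "0 < r")
          case True
          have nn: "0 \<le> 1 - exp (- lam * r)" using True l by simp
          have "mar s ?d r = ?k j r + ennreal (1 - exp (- lam * r)) * mar s ?d r"
            using nn by (simp add: distrib_right[symmetric] ennreal_plus[symmetric] del: ennreal_plus)
          also have "\<dots> \<le> ?k j r + ennreal (1 - exp (- lam * r)) * ennreal (?d powr (1 - s) * r powr (s - 2) / (s * Gamma s))"
            by (intro add_left_mono mult_left_mono mar_le[OF s dpos True]) simp
          also have "ennreal (1 - exp (- lam * r)) * ennreal (?d powr (1 - s) * r powr (s - 2) / (s * Gamma s))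
             = ennreal (?d powr (1 - s) / (s * Gamma s)) * ennreal (r powr (- 1 - (1 - s)) * (1 - exp (- lam * r)))"
            using nn s G by (simp add: ennreal_mult'[symmetric] mult_ac)
          finally show ?thesis using True by simp
        qed (simp add: mar_nonpos)
      qed
      also have "\<dots> = (\<integral>\<^sup>+r. ?k j r \<partial>lborel) + ennreal (?d powr (1 - s) / (s * Gamma s))
           * (\<integral>\<^sup>+r. indicator {0<..} r * ennreal (r powr (- 1 - (1 - s)) * (1 - exp (- lam * r))) \<partial>lborel)"
        by (subst nn_integral_add) (measurable, subst nn_integral_cmult, auto)
      also have "\<dots> = (\<integral>\<^sup>+r. ?k j r \<partial>lborel) + ennreal (?d powr (1 - s) * c)"
        using nn_integral_powr_one_minus_exp[of "1 - s" lam] s l G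
        by (simp add: c_def ennreal_mult'[symmetric])
      finally show ?thesis .
    qed
    have c0: "0 \<le> c" using s G by (simp add: c_def)
    have "(\<lambda>j. ennreal (Gamma (1 - s) / s) - ennreal (inverse (real (Suc j)) powr (1 - s) * c)) \<longlonglongrightarrow> ennreal (Gamma (1 - s) / s) - ennreal (0 * c)"
      using s by (intro tendsto_diff_ennreal tendsto_ennrealI tendsto_mult inverse_Suc_powr_tendsto_0 tendsto_const) auto
    then have lim: "(\<lambda>j. ennreal (Gamma (1 - s) / s) - ennreal (inverse (real (Suc j)) powr (1 - s) * c)) \<longlonglongrightarrow> ennreal (Gamma (1 - s) / s)"
      by simp
    have "ennreal (Gamma (1 - s) / s) - ennreal (inverse (real (Suc j)) powr (1 - s) * c) \<le> (\<integral>\<^sup>+r. ?k j r \<partial>lborel)" for j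
      using low[of j] by (simp add: ennreal_minus_le_iff add.commute)
    then show ?thesis
      unfolding mass using up
      by (intro tendsto_sandwich[OF _ _ lim tendsto_const] always_eventually allI)
  qed
  fix d :: real assume "0 < d"
  \<comment> \<open>As \<open>2 * d' \<le> d\<close>, either \<open>r > d'\<close> or
    \<open>norm z \<ge> d'\<close>, and \<open>d' < 1\<close> puts the remaining small times into
    the range of \<open>hshift\<close>.\<close>
  define d' where "d' = min (d / 2) (1 / 2)"
  have d': "0 < d'" "d' < 1" "2 * d' \<le> d" using \<open>0 < d\<close> by (auto simp: d'_def)
  define K where "K = 2 powr (DIM('a) / 2) * (8 * (2 - s + DIM('a) / 2) / d'\<^sup>2) powr (2 - s + DIM('a) / 2)"
  have K: "0 \<le> K" by (simp add: K_def)
  define V where "V Y = stker (\<lambda>r. ennreal (if d' < r then exp (- lam * r) * r powr (s - 2) else 0)) Y + hshift Y" for Y :: "'a \<times> real"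
  define e where "e j = inverse (real (Suc j)) powr (1 - s) / (s * Gamma s) * (1 + K)" for j
  have [measurable]: "V \<in> borel_measurable borel" unfolding V_def[abs_def] by measurable
  have "(\<integral>\<^sup>+Y. V Y \<partial>lborel) < \<infinity>"
  proof -
    have "(\<integral>\<^sup>+Y. V Y \<partial>lborel) = (\<integral>\<^sup>+r. ennreal (if d' < r then exp (- lam * r) * r powr (s - 2) else 0) \<partial>lborel) + (\<integral>\<^sup>+Y. hshift (Y :: 'a \<times> real) \<partial>lborel)"
      unfolding V_def using d' by (subst nn_integral_add) (auto simp: nn_integral_stker)
    also have "(\<integral>\<^sup>+r. ennreal (if d' < r then exp (- lam * r) * r powr (s - 2) else 0) \<partial>lborel)
        \<le> (\<integral>\<^sup>+r. indicator {d'<..} r * ennreal (r powr (- 1 - (1 - s))) \<partial>lborel)"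
    proof (intro nn_integral_mono)
      fix r
      have "exp (- lam * r) * r powr (s - 2) \<le> 1 * r powr (s - 2)" if "d' < r"
        using that d' lam by (intro mult_right_mono) auto
      then show "ennreal (if d' < r then exp (- lam * r) * r powr (s - 2) else 0) \<le> indicator {d'<..} r * ennreal (r powr (- 1 - (1 - s)))"
        by (auto intro!: ennreal_leI)
    qed
    also have "\<dots> = ennreal (d' powr (- (1 - s)) / (1 - s))"
      using d' s by (intro nn_integral_powr_tail) auto
    finally have "(\<integral>\<^sup>+Y. V Y \<partial>lborel) \<le> ennreal (d' powr (- (1 - s)) / (1 - s)) + 1"
      using nn_integral_hshift[where 'a='a] by (simp add: add_mono order_trans)
    then show ?thesis
      by (rule order_le_less_trans) simp
  qed
  moreover have "nconv V (\<lambda>Y. ennreal (F Y)) X < \<infinity>"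
  proof -
    have "nconv V (\<lambda>Y. ennreal (F Y)) X
        \<le> nconv (\<lambda>Y. ennreal (Gamma s / d') * stker (fpot s lam) Y + hshift Y) (\<lambda>Y. ennreal (F Y)) X"
    proof (rule nconv_mono)
      fix Y :: "'a \<times> real"
      have "ennreal (if d' < r then exp (- lam * r) * r powr (s - 2) else 0) \<le> ennreal (Gamma s / d') * fpot s lam r" for r
      proof (cases "d' < r")
        case True
        have "r powr (s - 2) = r powr (s - 1) / r" using True d' by (simp add: powr_diff power2_eq_square)
        also have "\<dots> \<le> r powr (s - 1) / d'" using True d' by (intro divide_left_mono) auto
        finally have "exp (- lam * r) * r powr (s - 2) \<le> exp (- lam * r) * (r powr (s - 1) / d')"
          by (intro mult_left_mono) auto
        also have "\<dots> = Gamma s / d' * (exp (- lam * r) * r powr (s - 1) / Gamma s)"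
          using G less_imp_neq[OF G(1)] by simp
        finally show ?thesis
          using True d' G by (simp add: fpot_def ennreal_mult'[symmetric] ennreal_leI)
      qed simp
      then show "V Y \<le> ennreal (Gamma s / d') * stker (fpot s lam) Y + hshift Y"
        unfolding V_def stker_def by (intro add_right_mono) (simp add: mult.assoc[symmetric] mult_right_mono)
    qed simp
    also have "\<dots> = ennreal (Gamma s / d') * nconv (stker (fpot s lam)) (\<lambda>Y. ennreal (F Y)) X + nconv hshift (\<lambda>Y. ennreal (F Y)) X"
      by (simp add: nconv_add_left nconv_cmult_left)
    also have "\<dots> < \<infinity>"
      using fin1 fin2 by (simp add: ennreal_mult_less_top)
    finally show ?thesis .
  qed
  moreover have "\<forall>j. 0 \<le> e j" using s G K by (simp add: e_def)
  moreover have "e \<longlonglongrightarrow> 0"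
  proof -
    have "e \<longlonglongrightarrow> 0 / (s * Gamma s) * (1 + K)"
      unfolding e_def[abs_def] using s less_imp_neq[OF G(1)] by (intro tendsto_intros inverse_Suc_powr_tendsto_0) auto
    then show ?thesis by simp
  qed
  moreover have "\<forall>j Y. d \<le> norm Y \<longrightarrow> stker (?k j) Y \<le> ennreal (e j) * V Y"
  proof (intro allI impI)
    fix j and Y :: "'a \<times> real" assume Y: "d \<le> norm Y"
    obtain z r where Yzr: "Y = (z, r)" by (cases Y)
    let ?c = "inverse (real (Suc j)) powr (1 - s) / (s * Gamma s)"
    have c0: "0 \<le> ?c" using s G by simp
    show "stker (?k j) Y \<le> ennreal (e j) * V Y"
    proof (cases "0 < r")
      case True
      have m: "mar s (inverse (real (Suc j))) r \<le> ennreal (?c * r powr (s - 2))"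
        using mar_le[OF s dpos True, of j] by simp
      show ?thesis
      proof (cases "d' < r")
        case True
        have "stker (?k j) Y \<le> ennreal (exp (- lam * r)) * ennreal (?c * r powr (s - 2)) * ennreal (heat_kernel r z)"
          unfolding stker_def Yzr using m by (simp add: mult_left_mono mult_right_mono)
        also have "\<dots> = ennreal ?c * (ennreal (exp (- lam * r) * r powr (s - 2)) * ennreal (heat_kernel r z))"
          using c0 by (simp only: ennreal_mult'[symmetric] ennreal_mult''[symmetric] heat_kernel_nonneg powr_ge_zero exp_ge_zero) (simp add: ac_simps)
        also have "\<dots> \<le> ennreal (e j) * V Y"
        proof (rule mult_mono)
          show "ennreal ?c \<le> ennreal (e j)"
            unfolding e_def using mult_left_mono[of 1 "1 + K" ?c] c0 K by (intro ennreal_leI) simp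
          show "ennreal (exp (- lam * r) * r powr (s - 2)) * ennreal (heat_kernel r z) \<le> V Y"
            using True by (simp add: V_def Yzr stker_def)
        qed auto
        finally show ?thesis .
      next
        case False
        have "norm Y \<le> norm z + \<bar>r\<bar>"
          unfolding Yzr using norm_Pair_le[of z r] by simp
        then have z: "d' \<le> norm z" using Y False d' \<open>0 < r\<close> by simp
        have "r powr (- (2 - s)) * heat_kernel r z \<le> K * heat_kernel (r + 1) z"
          unfolding K_def using heat_kernel_small_time_le[OF d'(1) z \<open>0 < r\<close>, of "2 - s"] False d' s by simp
        then have h: "r powr (s - 2) * heat_kernel r z \<le> K * heat_kernel (r + 1) z" by simp
        have "stker (?k j) Y \<le> 1 * ennreal (?c * r powr (s - 2)) * ennreal (heat_kernel r z)"
          unfolding stker_def Yzr fst_conv snd_conv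
          using m lam \<open>0 < r\<close> by (intro mult_mono) auto
        also have "\<dots> = ennreal ?c * ennreal (r powr (s - 2) * heat_kernel r z)"
          using c0 by (simp only: mult_1 ennreal_mult'[symmetric] ennreal_mult''[symmetric] heat_kernel_nonneg powr_ge_zero) (simp add: ac_simps)
        also have "\<dots> \<le> ennreal ?c * ennreal (K * heat_kernel (r + 1) z)"
          using h by (intro mult_left_mono ennreal_leI) auto
        also have "\<dots> = ennreal (?c * K) * ennreal (heat_kernel (r + 1) z)"
          using c0 K by (simp only: ennreal_mult'[symmetric] ennreal_mult''[symmetric] heat_kernel_nonneg) (simp add: ac_simps)
        also have "\<dots> \<le> ennreal (e j) * V Y"
        proof (rule mult_mono)
          show "ennreal (?c * K) \<le> ennreal (e j)"
            unfolding e_def using mult_left_mono[of K "1 + K" ?c] c0 K by (intro ennreal_leI) simp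
          show "ennreal (heat_kernel (r + 1) z) \<le> V Y"
            using False d' \<open>0 < r\<close> by (auto simp: V_def hshift_def Yzr)
        qed auto
        finally show ?thesis .
      qed
    qed (simp add: stker_def Yzr mar_nonpos)
  qed
  ultimately show "\<exists>V e. V \<in> borel_measurable borel \<and> (\<integral>\<^sup>+Y. V Y \<partial>lborel) < \<infinity>
      \<and> nconv V (\<lambda>Y. ennreal (F Y)) X < \<infinity> \<and> (\<forall>j. 0 \<le> e j) \<and> e \<longlonglongrightarrow> 0
      \<and> (\<forall>j Y. d \<le> norm Y \<longrightarrow> stker (?k j) Y \<le> ennreal (e j) * V Y)"
    by (intro exI[of _ V] exI[of _ e]) simp
qed (use F F0 cont in auto)

section \<open>Heat averages of parabolic Hoelder functions\<close>

text \<open>The heat flow for a time \<open>r\<close>, started from the values of \<open>F\<close>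
  at time \<open>snd X - r\<close> and read off at \<open>X\<close>.\<close>

definition heat_avg :: "real \<Rightarrow> ('a::euclidean_space \<times> real \<Rightarrow> ennreal) \<Rightarrow> 'a \<times> real \<Rightarrow> ennreal" where
  "heat_avg r F X = (\<integral>\<^sup>+z. ennreal (heat_kernel r z) * F (fst X - z, snd X - r) \<partial>lborel)"

lemma heat_avg_measurable[measurable]:
  fixes F :: "'a::euclidean_space \<times> real \<Rightarrow> ennreal"
  assumes [measurable]: "F \<in> borel_measurable borel"
  shows "(\<lambda>r. heat_avg r F X) \<in> borel_measurable borel"
proof -
  have [measurable]: "F \<in> borel_measurable (borel \<Otimes>\<^sub>M borel)"
    by (simp add: borel_prod)
  show ?thesis unfolding heat_avg_def by measurable
qed

text \<open>The absolute value is taken after the space integration, which keeps the cancellation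
  between \<open>z\<close> and \<open>- z\<close>. Finiteness is what makes the time integral in
  \<open>has_frac_heat\<close> converge. An infinite average counts as 0 through
  \<open>enn2real\<close>; by \<open>AE_heat_avg_finite\<close> this concerns only a null set of
  \<open>r\<close> in the applications.\<close>

definition frac_gap :: "real \<Rightarrow> ('a::euclidean_space \<times> real \<Rightarrow> real) \<Rightarrow> 'a \<times> real \<Rightarrow> ennreal" where
  "frac_gap s F X = (\<integral>\<^sup>+r. indicator {0<..} r
     * ennreal (r powr (- 1 - s) * \<bar>F X - enn2real (heat_avg r (\<lambda>Y. ennreal (F Y)) X)\<bar>) \<partial>lborel)"

text \<open>By the symmetry of the Gaussian, twice the average over the unit ball is an average of
  \<open>F (x + z) + F (x - z)\<close>. So only second differences enter, and their size
  \<open>norm z powr (2 * b)\<close> has Gaussian mean of order \<open>r powr b\<close>. The part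
  outside the unit ball is kept as an integral, since no growth bound on \<open>F\<close> is
  available there.\<close>

lemma heat_avg_local_estimate:
  fixes F :: "'a::euclidean_space \<times> real \<Rightarrow> real"
  assumes b: "0 < b" and r: "0 < r" "r < 1" and c: "0 \<le> c"
    and F[measurable]: "F \<in> borel_measurable borel" and F0: "\<And>Y. 0 \<le> F Y"
    and i: "\<bar>F X - F (fst X, snd X - r)\<bar> \<le> c * r powr b"
    and ii: "\<And>z. norm z < 1 \<Longrightarrow> \<bar>F (fst X + z, snd X - r) + F (fst X - z, snd X - r) - 2 * F (fst X, snd X - r)\<bar>
       \<le> c * norm z powr (2 * b)"
  shows "ennreal \<bar>F X - enn2real (heat_avg r (\<lambda>Y. ennreal (F Y)) X)\<bar>
    \<le> ennreal (2 * (1 + (8 * b) powr b * 2 powr (DIM('a) / 2)) * (c + F X) * r powr b)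
      + (\<integral>\<^sup>+z. ennreal (heat_kernel r z) * (indicator {z. 1 \<le> norm z} z * ennreal (F (fst X - z, snd X - r))) \<partial>lborel)"
proof -
  define K where "K = (8 * b) powr b * 2 powr (DIM('a) / 2)"
  have K: "0 \<le> K" by (simp add: K_def)
  define G where "G z = F (fst X - z, snd X - r)" for z
  have [measurable]: "F \<in> borel_measurable (borel \<Otimes>\<^sub>M borel)"
    by (simp add: borel_prod)
  have [measurable]: "G \<in> borel_measurable borel"
    unfolding G_def[abs_def] by measurable
  define p where "p z = ennreal (heat_kernel r z)" for z :: 'a
  have [measurable]: "p \<in> borel_measurable borel"
    unfolding p_def[abs_def] by measurable
  have G0: "0 \<le> G z" for z by (simp add: G_def F0)
  have p1: "(\<integral>\<^sup>+z. p z \<partial>lborel) = 1"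
    unfolding p_def by (rule nn_integral_heat_kernel[OF r(1)])
  define S where "S = {z::'a. 1 \<le> norm z}"
  have [measurable]: "S \<in> sets borel" unfolding S_def by measurable
  define far where "far = (\<integral>\<^sup>+z. p z * (indicator S z * ennreal (G z)) \<partial>lborel)"
  define near where "near = (\<integral>\<^sup>+z. p z * (indicator (- S) z * ennreal (G z)) \<partial>lborel)"
  define T where "T = heat_avg r (\<lambda>Y. ennreal (F Y)) X"
  define m where "m = (\<integral>\<^sup>+z. p z * ennreal (norm z powr (2 * b)) \<partial>lborel)"
  let ?g = "G 0"
  have split: "T = near + far"
    unfolding T_def heat_avg_def near_def far_def
    by (subst nn_integral_add[symmetric])
      (auto intro!: nn_integral_cong simp: p_def G_def indicator_def)
  have m: "m \<le> ennreal (K * r powr b)"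
  proof -
    have "m \<le> (\<integral>\<^sup>+z. ennreal (K * r powr b) * ennreal (heat_kernel (2 * r) (z :: 'a)) \<partial>lborel)"
      unfolding m_def p_def
    proof (rule nn_integral_mono)
      fix z :: 'a
      show "ennreal (heat_kernel r z) * ennreal (norm z powr (2 * b)) \<le> ennreal (K * r powr b) * ennreal (heat_kernel (2 * r) z)"
        using norm_powr_heat_kernel_le[OF b r(1), of z]
        by (simp add: ennreal_mult''[symmetric] K_def mult.commute ennreal_leI)
    qed
    also have "\<dots> = ennreal (K * r powr b)"
      using nn_integral_heat_kernel[of "2 * r", where 'a='a] r by (simp add: nn_integral_cmult)
    finally show ?thesis .
  qed
  \<comment> \<open>Chebyshev: outside the unit ball \<open>norm z powr (2 * b)\<close> is at least
    1, so the mass missing there is bounded by the same moment.\<close>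
  have tail: "(\<integral>\<^sup>+z. p z * indicator S z \<partial>lborel) \<le> m"
    unfolding m_def
  proof (intro nn_integral_mono mult_left_mono)
    fix z :: 'a
    have "1 \<le> norm z powr (2 * b)" if "1 \<le> norm z"
      using that b by (intro ge_one_powr_ge_zero) auto
    then show "indicator S z \<le> ennreal (norm z powr (2 * b))"
      by (auto simp: S_def indicator_def)
  qed simp
  have reflect: "(\<integral>\<^sup>+z. p z * (indicator (- S) z * ennreal (G (- z))) \<partial>lborel) = near"
    using nn_integral_lborel_diff[of "\<lambda>z. p z * (indicator (- S) z * ennreal (G z))" 0]
    by (simp add: near_def p_def S_def indicator_def)
  have near2: "near + near = (\<integral>\<^sup>+z. p z * (indicator (- S) z * ennreal (G z + G (- z))) \<partial>lborel)"
    apply (subst (2) reflect[symmetric])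
    unfolding near_def
    by (subst nn_integral_add[symmetric])
      (auto intro!: nn_integral_cong simp: G0 ennreal_plus distrib_left)
  have up: "near + near \<le> ennreal (2 * ?g) + ennreal (c * (K * r powr b))"
  proof -
    have "near + near \<le> (\<integral>\<^sup>+z. ennreal (2 * ?g) * p z + ennreal c * (p z * ennreal (norm z powr (2 * b))) \<partial>lborel)"
      unfolding near2
    proof (rule nn_integral_mono)
      fix z
      show "p z * (indicator (- S) z * ennreal (G z + G (- z))) \<le> ennreal (2 * ?g) * p z + ennreal c * (p z * ennreal (norm z powr (2 * b)))"
      proof (cases "norm z < 1")
        case True
        have "G z + G (- z) \<le> 2 * ?g + c * norm z powr (2 * b)"
          using ii[OF True] by (simp add: G_def abs_le_iff)
        then have "p z * ennreal (G z + G (- z)) \<le> p z * ennreal (2 * ?g + c * norm z powr (2 * b))"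
          by (intro mult_left_mono ennreal_leI) auto
        also have "\<dots> = ennreal (2 * ?g) * p z + ennreal c * (p z * ennreal (norm z powr (2 * b)))"
          using G0[of 0] c by (simp add: ennreal_plus ennreal_mult distrib_left mult_ac)
        finally show ?thesis using True by (simp add: S_def)
      qed (simp add: S_def)
    qed
    also have "\<dots> = ennreal (2 * ?g) + ennreal c * m"
      by (simp add: nn_integral_add nn_integral_cmult p1 m_def)
    also have "\<dots> \<le> ennreal (2 * ?g) + ennreal c * ennreal (K * r powr b)"
      using m by (intro add_left_mono mult_left_mono) auto
    finally show ?thesis using c by (simp add: ennreal_mult')
  qed
  have low: "ennreal (2 * ?g) \<le> near + near + ennreal ((c + 2 * ?g) * (K * r powr b))"
  proof -
    have "ennreal (2 * ?g) = (\<integral>\<^sup>+z. ennreal (2 * ?g) * p z \<partial>lborel)"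
      by (simp add: nn_integral_cmult p1)
    also have "\<dots> \<le> (\<integral>\<^sup>+z. p z * (indicator (- S) z * ennreal (G z + G (- z)))
       + (ennreal c * (p z * ennreal (norm z powr (2 * b))) + ennreal (2 * ?g) * (p z * indicator S z)) \<partial>lborel)"
    proof (rule nn_integral_mono)
      fix z
      show "ennreal (2 * ?g) * p z \<le> p z * (indicator (- S) z * ennreal (G z + G (- z)))
       + (ennreal c * (p z * ennreal (norm z powr (2 * b))) + ennreal (2 * ?g) * (p z * indicator S z))"
      proof (cases "norm z < 1")
        case True
        have "2 * ?g \<le> (G z + G (- z)) + c * norm z powr (2 * b)"
          using ii[OF True] by (simp add: G_def abs_le_iff)
        then have "p z * ennreal (2 * ?g) \<le> p z * ennreal ((G z + G (- z)) + c * norm z powr (2 * b))"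
          by (intro mult_left_mono ennreal_leI) auto
        also have "\<dots> = p z * ennreal (G z + G (- z)) + ennreal c * (p z * ennreal (norm z powr (2 * b)))"
          using G0[of z] G0[of "- z"] c
          by (subst ennreal_plus) (auto simp: ennreal_mult distrib_left mult_ac)
        finally show ?thesis using True by (simp add: S_def mult.commute)
      next
        case False
        then show ?thesis by (simp add: S_def mult.commute add_increasing)
      qed
    qed
    also have "\<dots> = near + near + (ennreal c * m + ennreal (2 * ?g) * (\<integral>\<^sup>+z. p z * indicator S z \<partial>lborel))"
      by (simp add: nn_integral_add nn_integral_cmult near2 m_def)
    also have "\<dots> \<le> near + near + (ennreal c * ennreal (K * r powr b) + ennreal (2 * ?g) * ennreal (K * r powr b))"
      using m order_trans[OF tail m] by (intro add_mono mult_left_mono) auto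
    also have "\<dots> = near + near + ennreal ((c + 2 * ?g) * (K * r powr b))"
      using c G0[of 0] K by (simp add: ennreal_mult'[symmetric] ennreal_plus[symmetric] distrib_right del: ennreal_plus)
    finally show ?thesis .
  qed
  have nearfin: "near < \<infinity>"
  proof -
    have "near \<le> near + near" by simp
    also note up
    finally show ?thesis by (rule order_le_less_trans) simp
  qed
  show ?thesis
  proof (cases "far = \<infinity>")
    case True
    then show ?thesis
      by (simp add: far_def p_def S_def G_def)
  next
    case False
    obtain n f where n: "near = ennreal n" "0 \<le> n" and f: "far = ennreal f" "0 \<le> f"
      using nearfin False by (cases near; cases far) auto
    have rb: "0 \<le> r powr b" "r powr b \<le> 1" using r b by (auto intro: powr_le1)
    have "ennreal (2 * n) \<le> ennreal (2 * ?g + c * (K * r powr b))"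
      using up n c K G0[of 0] by (simp add: ennreal_plus[symmetric] del: ennreal_plus)
    then have 1: "2 * n \<le> 2 * ?g + c * (K * r powr b)"
      using c K G0[of 0] by (subst (asm) ennreal_le_iff) auto
    have "ennreal (2 * ?g) \<le> ennreal (2 * n + (c + 2 * ?g) * (K * r powr b))"
      using low n c K G0[of 0] by (simp add: ennreal_plus[symmetric] del: ennreal_plus)
    then have 2: "2 * ?g \<le> 2 * n + (c + 2 * ?g) * (K * r powr b)"
      using c K n G0[of 0] by (subst (asm) ennreal_le_iff) auto
    have gX: "\<bar>F X - ?g\<bar> \<le> c * r powr b" using i by (simp add: G_def)
    \<comment> \<open>The final constant is to involve \<open>F X\<close> and not the value at the
      earlier time; for \<open>r < 1\<close> the two differ by at most \<open>c\<close>.\<close>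
    have "c * r powr b \<le> c" using c rb by (simp add: mult_left_le)
    then have "?g \<le> F X + c" using gX by linarith
    then have 3: "(c + 2 * ?g) * (K * r powr b) \<le> (c + 2 * (F X + c)) * (K * r powr b)"
      using K by (intro mult_right_mono) auto
    have 4: "c * (K * r powr b) \<ge> 0" "F X * (K * r powr b) \<ge> 0" "F X * r powr b \<ge> 0" "c * r powr b \<ge> 0"
      using c K F0 by auto
    have "T = ennreal (n + f)" using split n f by (simp add: ennreal_plus)
    then have "enn2real T = n + f" using n f by (simp del: ennreal_plus)
    moreover have "\<bar>F X - (n + f)\<bar> \<le> 2 * (1 + K) * (c + F X) * r powr b + f"
      using 1 2 3 4 gX f unfolding abs_le_iff by (auto simp: algebra_simps)
    ultimately have "ennreal \<bar>F X - enn2real T\<bar> \<le> ennreal (2 * (1 + K) * (c + F X) * r powr b + f)"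
      by (intro ennreal_leI) simp
    also have "\<dots> = ennreal (2 * (1 + K) * (c + F X) * r powr b) + far"
      using f c K F0[of X] by (simp add: ennreal_plus)
    finally show ?thesis
      by (simp add: far_def p_def S_def G_def T_def K_def)
  qed
qed

lemma nn_integral_powr_unit:
  fixes p :: real
  assumes "0 < p"
  shows "(\<integral>\<^sup>+r. indicator {0<..<1} r * ennreal (r powr (p - 1)) \<partial>lborel) = ennreal (1 / p)"
proof -
  have "(\<integral>\<^sup>+r. indicator {0<..<1} r * ennreal (r powr (p - 1)) \<partial>lborel) = ennreal (1 / p - 0)"
  proof (rule nn_integral_FTC_open[where F = "\<lambda>r. r powr p / p"])
    show "((\<lambda>r. r powr p / p) has_real_derivative r powr (p - 1)) (at r)" if "0 < r" for r
      using DERIV_cdivide[OF has_real_derivative_powr[OF that, of p], of p] assms by simp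
    show "isCont (\<lambda>r. r powr (p - 1)) r" if "0 < r" for r
      using that by (auto intro!: continuous_intros)
    have "((\<lambda>r. r powr p / p) \<longlongrightarrow> 0 powr p / p) (at_right 0)"
      using assms by (intro tendsto_intros tendsto_powr') (auto simp: eventually_at_right_field intro: exI[of _ 1])
    then show "((\<lambda>r. r powr p / p) \<longlongrightarrow> 0) (at_right 0)" by simp
    have "((\<lambda>r. r powr p / p) \<longlongrightarrow> 1 powr p / p) (at_left 1)"
      using assms by (intro tendsto_intros) auto
    then show "((\<lambda>r. r powr p / p) \<longlongrightarrow> 1 / p) (at_left 1)" by simp
  qed auto
  then show ?thesis by simp
qed

text \<open>For \<open>r < 1\<close> the local estimate leaves \<open>r powr (b - s - 1)\<close>,
  integrable at 0 because \<open>s < b\<close>: here the excess regularity pays. The region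
  \<open>1 \<le> r\<close> or \<open>1 \<le> norm z\<close> is dominated by the weight. The constant
  is chosen before \<open>F\<close>, \<open>X\<close> and \<open>c\<close>, so that \<open>c\<close>
  may depend on the point.\<close>

lemma frac_gap_le:
  assumes s: "0 < s" "s < b" "b \<le> 1" and M: "M = DIM('a::euclidean_space) / 2 + 1 + s"
  obtains C where "0 \<le> C"
    and "\<And>(F :: 'a \<times> real \<Rightarrow> real) X c. F \<in> borel_measurable borel \<Longrightarrow> (\<And>Y. 0 \<le> F Y) \<Longrightarrow> 0 \<le> c
      \<Longrightarrow> (\<And>r. 0 < r \<Longrightarrow> r < 1 \<Longrightarrow> \<bar>F X - F (fst X, snd X - r)\<bar> \<le> c * r powr b)
      \<Longrightarrow> (\<And>r z. 0 < r \<Longrightarrow> r < 1 \<Longrightarrow> norm z < 1 \<Longrightarrow>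
            \<bar>F (fst X + z, snd X - r) + F (fst X - z, snd X - r) - 2 * F (fst X, snd X - r)\<bar> \<le> c * norm z powr (2 * b))
      \<Longrightarrow> frac_gap s F X \<le> ennreal (C * (c + F X)) + ennreal C * nconv (\<lambda>Y. ennreal (1 / growth M Y)) (\<lambda>Y. ennreal (F Y)) X"
proof -
  define K where "K = 2 * (1 + (8 * b) powr b * 2 powr (DIM('a) / 2))"
  have K: "0 \<le> K" by (simp add: K_def)
  define C1 where "C1 = 2 * (1 + (8 * M) powr M)"
  have C1: "0 \<le> C1" by (simp add: C1_def)
  define C where "C = K / (b - s) + 1 / s + C1"
  have C: "0 \<le> C" "C1 \<le> C" using K C1 s by (auto simp: C_def)
  show ?thesis
  proof (rule that[OF C(1)])
    fix F :: "'a \<times> real \<Rightarrow> real" and X and c :: real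
    assume F[measurable]: "F \<in> borel_measurable borel" and F0: "\<And>Y. 0 \<le> F Y" and c: "0 \<le> c"
      and i: "\<And>r. 0 < r \<Longrightarrow> r < 1 \<Longrightarrow> \<bar>F X - F (fst X, snd X - r)\<bar> \<le> c * r powr b"
      and ii: "\<And>r z. 0 < r \<Longrightarrow> r < 1 \<Longrightarrow> norm z < 1 \<Longrightarrow>
            \<bar>F (fst X + z, snd X - r) + F (fst X - z, snd X - r) - 2 * F (fst X, snd X - r)\<bar> \<le> c * norm z powr (2 * b)"
    have [measurable]: "F \<in> borel_measurable (borel \<Otimes>\<^sub>M borel)"
      by (simp add: borel_prod)
    define W where "W = nconv (\<lambda>Y. ennreal (1 / growth M Y)) (\<lambda>Y. ennreal (F Y)) X"
    define far where "far r = (\<integral>\<^sup>+z. ennreal (heat_kernel r z) * ((if 1 \<le> norm z \<or> 1 \<le> r then 1 else 0) * ennreal (F (fst X - z, snd X - r))) \<partial>lborel)" for r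
    have [measurable]: "far \<in> borel_measurable borel"
      unfolding far_def[abs_def] by measurable
    have pt: "indicator {0<..} r * ennreal (r powr (- 1 - s) * \<bar>F X - enn2real (heat_avg r (\<lambda>Y. ennreal (F Y)) X)\<bar>)
      \<le> ennreal (K * (c + F X)) * (indicator {0<..<1} r * ennreal (r powr ((b - s) - 1)))
        + (ennreal (F X) * (indicator {1..} r * ennreal (r powr (- 1 - s))) + indicator {0<..} r * ennreal (r powr (- 1 - s)) * far r)" for r
    proof (cases "0 < r")
      case r: True
      show ?thesis
      proof (cases "r < 1")
        case True
        have "far r = (\<integral>\<^sup>+z. ennreal (heat_kernel r z) * (indicator {z. 1 \<le> norm z} z * ennreal (F (fst X - z, snd X - r))) \<partial>lborel)"
          unfolding far_def using True by (intro nn_integral_cong) (auto simp: indicator_def)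
        then have "ennreal \<bar>F X - enn2real (heat_avg r (\<lambda>Y. ennreal (F Y)) X)\<bar> \<le> ennreal (K * (c + F X) * r powr b) + far r"
          using heat_avg_local_estimate[of b r c F X] s r True c F F0 i ii by (simp add: K_def)
        then have "ennreal (r powr (- 1 - s)) * ennreal \<bar>F X - enn2real (heat_avg r (\<lambda>Y. ennreal (F Y)) X)\<bar>
          \<le> ennreal (r powr (- 1 - s)) * (ennreal (K * (c + F X) * r powr b) + far r)"
          by (intro mult_left_mono) auto
        also have "\<dots> = ennreal (K * (c + F X)) * ennreal (r powr ((b - s) - 1)) + ennreal (r powr (- 1 - s)) * far r"
        proof -
          have "r powr (- 1 - s) * (K * (c + F X) * r powr b) = K * (c + F X) * r powr ((b - s) - 1)"
            using r by (simp add: powr_add[symmetric] algebra_simps)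
          then have "ennreal (r powr (- 1 - s)) * ennreal (K * (c + F X) * r powr b) = ennreal (K * (c + F X)) * ennreal (r powr ((b - s) - 1))"
            by (simp only: ennreal_mult'[symmetric] ennreal_mult''[symmetric] powr_ge_zero)
          then show ?thesis
            by (simp only: distrib_left)
        qed
        finally show ?thesis
          using True r by (simp add: ennreal_mult')
      next
        case False
        have fT: "far r = heat_avg r (\<lambda>Y. ennreal (F Y)) X"
          unfolding far_def heat_avg_def using False by simp
        have "ennreal \<bar>F X - enn2real (heat_avg r (\<lambda>Y. ennreal (F Y)) X)\<bar> \<le> ennreal (F X + enn2real (heat_avg r (\<lambda>Y. ennreal (F Y)) X))"
          using F0[of X] by (intro ennreal_leI) (simp add: abs_le_iff)
        also have "\<dots> \<le> ennreal (F X) + far r"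
          using F0[of X] by (cases "far r") (auto simp: fT[symmetric] ennreal_plus)
        finally have "ennreal (r powr (- 1 - s)) * ennreal \<bar>F X - enn2real (heat_avg r (\<lambda>Y. ennreal (F Y)) X)\<bar>
          \<le> ennreal (r powr (- 1 - s)) * (ennreal (F X) + far r)"
          by (intro mult_left_mono) auto
        then show ?thesis
          using False r by (simp add: ennreal_mult' distrib_left distrib_right mult_ac)
      qed
    qed simp
    have "frac_gap s F X \<le> (\<integral>\<^sup>+r. ennreal (K * (c + F X)) * (indicator {0<..<1} r * ennreal (r powr ((b - s) - 1)))
        + (ennreal (F X) * (indicator {1..} r * ennreal (r powr (- 1 - s))) + indicator {0<..} r * ennreal (r powr (- 1 - s)) * far r) \<partial>lborel)"
      unfolding frac_gap_def by (intro nn_integral_mono pt)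
    also have "\<dots> = ennreal (K * (c + F X)) * (\<integral>\<^sup>+r. indicator {0<..<1} r * ennreal (r powr ((b - s) - 1)) \<partial>lborel)
        + (ennreal (F X) * (\<integral>\<^sup>+r. indicator {1..} r * ennreal (r powr (- 1 - s)) \<partial>lborel) + (\<integral>\<^sup>+r. indicator {0<..} r * ennreal (r powr (- 1 - s)) * far r \<partial>lborel))"
      by (subst nn_integral_add, measurable)+ (simp add: nn_integral_cmult)
    also have "(\<integral>\<^sup>+r. indicator {0<..<1} r * ennreal (r powr ((b - s) - 1)) \<partial>lborel) = ennreal (1 / (b - s))"
      using s by (intro nn_integral_powr_unit) auto
    also have "(\<integral>\<^sup>+r. indicator {1..} r * ennreal (r powr (- 1 - s)) \<partial>lborel) = ennreal (1 / s)"
    proof -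
      have "(\<integral>\<^sup>+r. indicator {1..} r * ennreal (r powr (- 1 - s)) \<partial>lborel) = (\<integral>\<^sup>+r. indicator {1<..} r * ennreal (r powr (- 1 - s)) \<partial>lborel)"
      proof (rule nn_integral_cong_AE)
        show "AE r in lborel. indicator {1..} r * ennreal (r powr (- 1 - s)) = indicator {1<..} r * ennreal (r powr (- 1 - s))"
          using AE_lborel_singleton[of 1] by eventually_elim (auto simp: indicator_def)
      qed
      then show ?thesis using nn_integral_powr_tail[of 1 s] s by simp
    qed
    also have "(\<integral>\<^sup>+r. indicator {0<..} r * ennreal (r powr (- 1 - s)) * far r \<partial>lborel) \<le> ennreal C1 * W"
    proof -
      have "(\<integral>\<^sup>+r. indicator {0<..} r * ennreal (r powr (- 1 - s)) * far r \<partial>lborel)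
        \<le> (\<integral>\<^sup>+r. (\<integral>\<^sup>+z. ennreal C1 * (ennreal (1 / growth M (z, r)) * ennreal (F (X - (z, r)))) \<partial>lborel) \<partial>lborel)"
      proof (rule nn_integral_mono)
        fix r :: real
        show "indicator {0<..} r * ennreal (r powr (- 1 - s)) * far r
          \<le> (\<integral>\<^sup>+z. ennreal C1 * (ennreal (1 / growth M (z, r)) * ennreal (F (X - (z, r)))) \<partial>lborel)"
        proof (cases "0 < r")
          case True
          have "ennreal (r powr (- 1 - s)) * far r
            = (\<integral>\<^sup>+z. ennreal (r powr (- 1 - s)) * (ennreal (heat_kernel r z) * ((if 1 \<le> norm z \<or> 1 \<le> r then 1 else 0) * ennreal (F (fst X - z, snd X - r)))) \<partial>lborel)"
            unfolding far_def by (rule nn_integral_cmult[symmetric]) measurable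
          also have "\<dots> \<le> (\<integral>\<^sup>+z. ennreal C1 * (ennreal (1 / growth M (z, r)) * ennreal (F (X - (z, r)))) \<partial>lborel)"
          proof (rule nn_integral_mono)
            fix z :: 'a
            show "ennreal (r powr (- 1 - s)) * (ennreal (heat_kernel r z) * ((if 1 \<le> norm z \<or> 1 \<le> r then 1 else 0) * ennreal (F (fst X - z, snd X - r))))
              \<le> ennreal C1 * (ennreal (1 / growth M (z, r)) * ennreal (F (X - (z, r))))"
            proof (cases "1 \<le> norm z \<or> 1 \<le> r")
              case True
              then have "r powr (- 1 - s) * heat_kernel r z \<le> C1 / growth M (z, r)"
                unfolding C1_def using heat_kernel_weight_le[OF s(1) \<open>0 < r\<close> _ M, of z] by auto
              then have "ennreal (r powr (- 1 - s) * heat_kernel r z) * ennreal (F (X - (z, r))) \<le> ennreal (C1 * (1 / growth M (z, r))) * ennreal (F (X - (z, r)))"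
                by (intro mult_right_mono ennreal_leI) auto
              with True C1 show ?thesis
                by (simp only: if_True mult_1 ennreal_mult' powr_ge_zero mult.assoc) (cases X, simp)
            qed simp
          qed
          finally show ?thesis using True by simp
        qed simp
      qed
      also have "\<dots> = (\<integral>\<^sup>+Y. ennreal C1 * (ennreal (1 / growth M Y) * ennreal (F (X - Y))) \<partial>lborel)"
        by (rule nn_integral_lborel_pair(2)[symmetric]) measurable
      also have "\<dots> = ennreal C1 * W"
        unfolding W_def nconv_def by (rule nn_integral_cmult) measurable
      finally show ?thesis .
    qed
    also have "ennreal (K * (c + F X)) * ennreal (1 / (b - s)) + (ennreal (F X) * ennreal (1 / s) + ennreal C1 * W)
      \<le> ennreal (C * (c + F X)) + ennreal C * W"
    proof -
      have "K * (c + F X) * (1 / (b - s)) + F X * (1 / s) \<le> (K / (b - s) + 1 / s) * (c + F X)"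
        using c s by (simp add: algebra_simps add_divide_distrib)
      also have "\<dots> \<le> C * (c + F X)"
        using c F0[of X] C1 by (intro mult_right_mono) (auto simp: C_def)
      finally have "ennreal (K * (c + F X) * (1 / (b - s)) + F X * (1 / s)) \<le> ennreal (C * (c + F X))"
        by (rule ennreal_leI)
      then have "ennreal (K * (c + F X)) * ennreal (1 / (b - s)) + ennreal (F X) * ennreal (1 / s) \<le> ennreal (C * (c + F X))"
        using K c F0[of X] s by (simp add: ennreal_mult'[symmetric] ennreal_plus[symmetric] del: ennreal_plus)
      moreover have "ennreal C1 * W \<le> ennreal C * W"
        using C by (intro mult_right_mono ennreal_leI) auto
      ultimately show ?thesis by (simp add: add.assoc[symmetric] add_mono)
    qed
    finally show "frac_gap s F X \<le> ennreal (C * (c + F X)) + ennreal C * nconv (\<lambda>Y. ennreal (1 / growth M Y)) (\<lambda>Y. ennreal (F Y)) X"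
      by (simp add: W_def add_left_mono)
  qed
qed

section \<open>Differences of functions in the parabolic Hoelder classes\<close>

lemma gderiv_isCont: "GDERIV f x :> D \<Longrightarrow> isCont f x"
  unfolding gderiv_def by (rule has_derivative_continuous)

text \<open>Supplies bounds for the time derivative and the Hessian in rule \<open>high\<close>,
  which are only known to belong to a class of lower order. Induction on the rules is used because
  that order may itself exceed 1.\<close>

lemma parabolic_holder_on_bounded:
  fixes u :: "real ^ 'n \<Rightarrow> real \<Rightarrow> real"
  assumes "parabolic_holder_on (cball 0 R \<times> cball 0 R) a u" "0 \<le> R"
  shows "\<exists>B. \<forall>x t. norm x \<le> R \<longrightarrow> \<bar>t\<bar> \<le> R \<longrightarrow> \<bar>u x t\<bar> \<le> B"
  using assms(1)
proof induction
  case (low a u)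
  then obtain C where C: "0 < C" "\<And>x t y \<tau>. norm x \<le> R \<Longrightarrow> \<bar>t\<bar> \<le> R \<Longrightarrow> norm y \<le> R \<Longrightarrow> \<bar>\<tau>\<bar> \<le> R \<Longrightarrow>
      \<bar>u x t - u y \<tau>\<bar> \<le> C * (norm (x - y) + \<bar>t - \<tau>\<bar> powr (1 / 2)) powr (2 * a)"
    by (auto simp: dist_norm)
  have "\<bar>u x t\<bar> \<le> \<bar>u 0 0\<bar> + C * (R + R powr (1 / 2)) powr (2 * a)" if "norm x \<le> R" "\<bar>t\<bar> \<le> R" for x t
  proof -
    have "C * (norm (x - 0) + \<bar>t - 0\<bar> powr (1 / 2)) powr (2 * a) \<le> C * (R + R powr (1 / 2)) powr (2 * a)"
      using that low.hyps C(1) by (intro mult_left_mono powr_mono2 add_mono) auto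
    then show ?thesis using C(2)[of x t 0 0] that assms(2) by simp
  qed
  then show ?case by blast
next
  case (middle a u g)
  then obtain C where C: "0 < C" "\<And>x t \<tau>. norm x \<le> R \<Longrightarrow> \<bar>t\<bar> \<le> R \<Longrightarrow> \<bar>\<tau>\<bar> \<le> R \<Longrightarrow>
      \<bar>u x t - u x \<tau>\<bar> \<le> C * \<bar>t - \<tau>\<bar> powr a"
    by (auto simp: dist_norm)
  have "continuous_on (cball 0 R) (\<lambda>x. u x 0)"
    using middle.hyps(3) by (intro continuous_at_imp_continuous_on ballI gderiv_isCont)
  then have "bounded ((\<lambda>x. u x 0) ` cball 0 R)"
    by (intro compact_imp_bounded compact_continuous_image) auto
  then obtain B where "\<forall>x\<in>cball 0 R. norm (u x 0) \<le> B"
    by (auto simp: bounded_iff)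
  then have B: "\<bar>u x 0\<bar> \<le> B" if "norm x \<le> R" for x
    using that by auto
  have "\<bar>u x t\<bar> \<le> B + C * R powr a" if "norm x \<le> R" "\<bar>t\<bar> \<le> R" for x t
  proof -
    have "C * \<bar>t - 0\<bar> powr a \<le> C * R powr a"
      using that middle.hyps C(1) by (intro mult_left_mono powr_mono2) auto
    then show ?thesis using C(2)[of x t 0] B[of x] that assms(2) by simp
  qed
  then show ?case by blast
next
  case (high a u g H v)
  then obtain V where V: "\<And>x t. norm x \<le> R \<Longrightarrow> \<bar>t\<bar> \<le> R \<Longrightarrow> \<bar>v x t\<bar> \<le> V" by blast
  have "continuous_on (cball 0 R) (\<lambda>x. u x 0)"
    using high.hyps(2) by (intro continuous_at_imp_continuous_on ballI gderiv_isCont)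
  then have "bounded ((\<lambda>x. u x 0) ` cball 0 R)"
    by (intro compact_imp_bounded compact_continuous_image) auto
  then obtain B where "\<forall>x\<in>cball 0 R. norm (u x 0) \<le> B"
    by (auto simp: bounded_iff)
  then have B: "\<bar>u x 0\<bar> \<le> B" if "norm x \<le> R" for x
    using that by auto
  have "\<bar>u x t\<bar> \<le> B + V * R" if "norm x \<le> R" "\<bar>t\<bar> \<le> R" for x t
  proof -
    have "norm (u x t - u x 0) \<le> V * norm (t - 0)"
    proof (rule field_differentiable_bound[where S = "cball 0 R" and f' = "v x"])
      fix \<tau> :: real assume "\<tau> \<in> cball 0 R"
      then show "(u x has_field_derivative v x \<tau>) (at \<tau> within cball 0 R)" "norm (v x \<tau>) \<le> V"
        using high.hyps(4) V[of x \<tau>] that by (auto intro: has_field_derivative_at_within)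
    qed (use that assms(2) in auto)
    moreover have "V * \<bar>t\<bar> \<le> V * R"
      using that V[of 0 0] assms(2) by (intro mult_left_mono) auto
    ultimately show ?thesis using B[of x] that by simp
  qed
  then show ?case by blast
qed

text \<open>Mean value theorem for \<open>f (x + q z) + f (x - q z)\<close> in \<open>q\<close>: its
  derivative is the inner product of \<open>z\<close> with a difference of gradients at two points
  at most \<open>2 * norm z\<close> apart, which yields the exponent \<open>p + 1\<close>.\<close>

lemma second_difference_le:
  fixes f :: "'a::real_inner \<Rightarrow> real"
  assumes g: "\<And>y. GDERIV f y :> g y" and p: "0 \<le> p" and C: "0 \<le> C"
    and xz: "norm (x + z) \<le> R" "norm (x - z) \<le> R"
    and H: "\<And>y y'. norm y \<le> R \<Longrightarrow> norm y' \<le> R \<Longrightarrow> norm (g y - g y') \<le> C * norm (y - y') powr p"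
  shows "\<bar>f (x + z) + f (x - z) - 2 * f x\<bar> \<le> C * 2 powr p * norm z powr (p + 1)"
proof -
  define h where "h q = f (x + q *\<^sub>R z) + f (x - q *\<^sub>R z)" for q
  have d: "(h has_real_derivative (z \<bullet> (g (x + q *\<^sub>R z) - g (x - q *\<^sub>R z)))) (at q)" for q
  proof -
    have f: "(f has_derivative (\<lambda>h. h \<bullet> g y)) (at y within S)" for y S
      using g[of y] by (simp add: gderiv_def has_derivative_at_withinI)
    have 1: "((\<lambda>q. f (x + q *\<^sub>R z)) has_derivative (\<lambda>w. (w *\<^sub>R z) \<bullet> g (x + q *\<^sub>R z))) (at q)"
      by (rule has_derivative_compose[OF _ f]) (auto intro!: derivative_eq_intros)
    have 2: "((\<lambda>q. f (x - q *\<^sub>R z)) has_derivative (\<lambda>w. (- (w *\<^sub>R z)) \<bullet> g (x - q *\<^sub>R z))) (at q)"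
      by (rule has_derivative_compose[OF _ f]) (auto intro!: derivative_eq_intros)
    show ?thesis
      unfolding has_field_derivative_def h_def
      by (rule has_derivative_eq_rhs[OF has_derivative_add[OF 1 2]]) (auto simp: fun_eq_iff algebra_simps)
  qed
  obtain q where q: "0 < q" "q < 1" "h 1 - h 0 = (1 - 0) * (z \<bullet> (g (x + q *\<^sub>R z) - g (x - q *\<^sub>R z)))"
    using MVT2[of 0 1 h "\<lambda>q. z \<bullet> (g (x + q *\<^sub>R z) - g (x - q *\<^sub>R z))"] d by auto
  \<comment> \<open>Only the end points \<open>x + z\<close> and \<open>x - z\<close> are assumed to
    lie in the ball; the intermediate points are convex combinations of them.\<close>
  have in1: "norm (x + q *\<^sub>R z) \<le> R"
  proof -
    define m where "m = (1 + q) / 2"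
    define k where "k = (1 - q) / 2"
    have mk: "m + k = 1" "m - k = q" "0 \<le> m" "0 \<le> k"
      using q by (auto simp: m_def k_def field_simps)
    have "m *\<^sub>R (x + z) + k *\<^sub>R (x - z) = (m + k) *\<^sub>R x + (m - k) *\<^sub>R z"
      by (simp add: scaleR_add_right scaleR_diff_right scaleR_add_left scaleR_diff_left)
    then have "m *\<^sub>R (x + z) + k *\<^sub>R (x - z) = x + q *\<^sub>R z"
      by (simp add: mk)
    then show ?thesis
      using convexD[OF convex_cball, of "x + z" 0 R "x - z" m k] mk xz by simp
  qed
  have in2: "norm (x - q *\<^sub>R z) \<le> R"
  proof -
    define m where "m = (1 - q) / 2"
    define k where "k = (1 + q) / 2"
    have mk: "m + k = 1" "m - k = - q" "0 \<le> m" "0 \<le> k"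
      using q by (auto simp: m_def k_def field_simps)
    have "m *\<^sub>R (x + z) + k *\<^sub>R (x - z) = (m + k) *\<^sub>R x + (m - k) *\<^sub>R z"
      by (simp add: scaleR_add_right scaleR_diff_right scaleR_add_left scaleR_diff_left)
    then have "m *\<^sub>R (x + z) + k *\<^sub>R (x - z) = x - q *\<^sub>R z"
      by (simp add: mk)
    then show ?thesis
      using convexD[OF convex_cball, of "x + z" 0 R "x - z" m k] mk xz by simp
  qed
  have "f (x + z) + f (x - z) - 2 * f x = z \<bullet> (g (x + q *\<^sub>R z) - g (x - q *\<^sub>R z))"
    using q(3) by (simp add: h_def)
  also have "\<bar>\<dots>\<bar> \<le> norm z * norm (g (x + q *\<^sub>R z) - g (x - q *\<^sub>R z))"
    by (rule Cauchy_Schwarz_ineq2)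
  also have "\<dots> \<le> norm z * (C * norm (2 *\<^sub>R z) powr p)"
  proof (intro mult_left_mono)
    have "norm (g (x + q *\<^sub>R z) - g (x - q *\<^sub>R z)) \<le> C * norm ((x + q *\<^sub>R z) - (x - q *\<^sub>R z)) powr p"
      by (rule H[OF in1 in2])
    also have "(x + q *\<^sub>R z) - (x - q *\<^sub>R z) = (2 * q) *\<^sub>R z"
      by (simp add: scaleR_add_left[symmetric])
    also have "C * norm ((2 * q) *\<^sub>R z) powr p \<le> C * norm (2 *\<^sub>R z) powr p"
      using q p C by (intro mult_left_mono powr_mono2) (auto simp: mult_right_mono)
    finally show "norm (g (x + q *\<^sub>R z) - g (x - q *\<^sub>R z)) \<le> C * norm (2 *\<^sub>R z) powr p" .
  qed auto
  also have "\<dots> = C * 2 powr p * norm z powr (p + 1)"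
    by (simp add: powr_mult powr_add)
  finally show ?thesis .
qed

text \<open>The three rules are reduced to what the operator sees: order \<open>min a 1\<close> in
  time and, through second differences, \<open>2 * min a 1\<close> in space. Cutting the order off
  at 1 is harmless because only an order above \<open>s < 1\<close> is wanted later.\<close>

lemma parabolic_holder_on_estimates:
  fixes u :: "real ^ 'n \<Rightarrow> real \<Rightarrow> real"
  assumes "parabolic_holder_on (cball 0 R \<times> cball 0 R) a u" "0 \<le> R"
  shows "\<exists>c\<ge>0. (\<forall>x t \<tau>. norm x \<le> R \<longrightarrow> \<bar>t\<bar> \<le> R \<longrightarrow> \<bar>\<tau>\<bar> \<le> R \<longrightarrow> \<bar>u x t - u x \<tau>\<bar> \<le> c * \<bar>t - \<tau>\<bar> powr (min a 1))
     \<and> (\<forall>x z t. norm (x + z) \<le> R \<longrightarrow> norm (x - z) \<le> R \<longrightarrow> \<bar>t\<bar> \<le> R \<longrightarrow>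
          \<bar>u (x + z) t + u (x - z) t - 2 * u x t\<bar> \<le> c * norm z powr (2 * min a 1))
     \<and> (\<forall>t. \<bar>t\<bar> \<le> R \<longrightarrow> continuous_on (cball 0 R) (\<lambda>x. u x t))"
  using assms(1)
proof cases
  case low
  then obtain C where C: "0 < C" "\<And>x t y \<tau>. norm x \<le> R \<Longrightarrow> \<bar>t\<bar> \<le> R \<Longrightarrow> norm y \<le> R \<Longrightarrow> \<bar>\<tau>\<bar> \<le> R \<Longrightarrow>
      \<bar>u x t - u y \<tau>\<bar> \<le> C * (norm (x - y) + \<bar>t - \<tau>\<bar> powr (1 / 2)) powr (2 * a)"
    by (auto simp: dist_norm)
  have a: "min a 1 = a" "0 < a" using low by auto
  have sp: "\<bar>u x t - u y t\<bar> \<le> C * norm (x - y) powr (2 * a)" if "norm x \<le> R" "norm y \<le> R" "\<bar>t\<bar> \<le> R" for x y t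
    using C(2)[of x t y t] that by simp
  show ?thesis
  proof (intro exI[of _ "2 * C"] conjI allI impI)
    fix x :: "real ^ 'n" and t \<tau> assume "norm x \<le> R" "\<bar>t\<bar> \<le> R" "\<bar>\<tau>\<bar> \<le> R"
    then have "\<bar>u x t - u x \<tau>\<bar> \<le> C * \<bar>t - \<tau>\<bar> powr a"
      using C(2)[of x t x \<tau>] by (simp add: powr_powr)
    also have "\<dots> \<le> 2 * C * \<bar>t - \<tau>\<bar> powr a" using C(1) by (intro mult_right_mono) auto
    finally show "\<bar>u x t - u x \<tau>\<bar> \<le> 2 * C * \<bar>t - \<tau>\<bar> powr (min a 1)" using a by simp
  next
    fix x z :: "real ^ 'n" and t assume xz: "norm (x + z) \<le> R" "norm (x - z) \<le> R" "\<bar>t\<bar> \<le> R"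
    have "norm (2 *\<^sub>R x) \<le> norm (x + z) + norm (x - z)"
      using norm_triangle_ineq[of "x + z" "x - z"] by (simp add: scaleR_2)
    then have "norm x \<le> R" using xz by simp
    then show "\<bar>u (x + z) t + u (x - z) t - 2 * u x t\<bar> \<le> 2 * C * norm z powr (2 * min a 1)"
      using sp[of "x + z" x t] sp[of "x - z" x t] xz a by simp
  next
    fix t :: real assume t: "\<bar>t\<bar> \<le> R"
    show "continuous_on (cball 0 R) (\<lambda>x. u x t)"
      unfolding continuous_on_def
    proof
      fix y :: "real ^ 'n" assume y: "y \<in> cball 0 R"
      have "((\<lambda>x. C * norm (x - y) powr (2 * a)) \<longlongrightarrow> C * norm (y - y) powr (2 * a)) (at y within cball 0 R)"
        using a by (intro tendsto_intros tendsto_powr') auto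
      then have "((\<lambda>x. C * norm (x - y) powr (2 * a)) \<longlongrightarrow> 0) (at y within cball 0 R)" by simp
      then have "((\<lambda>x. u x t - u y t) \<longlongrightarrow> 0) (at y within cball 0 R)"
      proof (rule Lim_null_comparison[rotated])
        show "\<forall>\<^sub>F x in at y within cball 0 R. norm (u x t - u y t) \<le> C * norm (x - y) powr (2 * a)"
          unfolding eventually_at_filter using sp t y by (intro always_eventually) auto
      qed
      then show "((\<lambda>x. u x t) \<longlongrightarrow> u y t) (at y within cball 0 R)"
        by (simp add: LIM_zero_iff)
    qed
  qed (use C in auto)
next
  case (middle g)
  then obtain C where C: "0 < C" "\<And>x t \<tau>. norm x \<le> R \<Longrightarrow> \<bar>t\<bar> \<le> R \<Longrightarrow> \<bar>\<tau>\<bar> \<le> R \<Longrightarrow>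
      \<bar>u x t - u x \<tau>\<bar> \<le> C * \<bar>t - \<tau>\<bar> powr a"
    by (auto simp: dist_norm)
  obtain D where D: "0 < D" "\<And>x y t. norm x \<le> R \<Longrightarrow> norm y \<le> R \<Longrightarrow> \<bar>t\<bar> \<le> R \<Longrightarrow>
      norm (g x t - g y t) \<le> D * norm (x - y) powr (2 * a - 1)"
    using middle(5) by (auto simp: dist_norm)
  have a: "min a 1 = a" using middle by auto
  define c where "c = max C (D * 2 powr (2 * a - 1))"
  show ?thesis
  proof (intro exI[of _ c] conjI allI impI)
    show "0 \<le> c" using C by (simp add: c_def)
    fix x :: "real ^ 'n" and t \<tau> assume "norm x \<le> R" "\<bar>t\<bar> \<le> R" "\<bar>\<tau>\<bar> \<le> R"
    then have "\<bar>u x t - u x \<tau>\<bar> \<le> C * \<bar>t - \<tau>\<bar> powr a" by (rule C(2))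
    also have "\<dots> \<le> c * \<bar>t - \<tau>\<bar> powr a" by (intro mult_right_mono) (auto simp: c_def)
    finally show "\<bar>u x t - u x \<tau>\<bar> \<le> c * \<bar>t - \<tau>\<bar> powr (min a 1)" using a by simp
  next
    fix x z :: "real ^ 'n" and t assume xz: "norm (x + z) \<le> R" "norm (x - z) \<le> R" "\<bar>t\<bar> \<le> R"
    have "\<bar>u (x + z) t + u (x - z) t - 2 * u x t\<bar> \<le> D * 2 powr (2 * a - 1) * norm z powr ((2 * a - 1) + 1)"
      using D middle(1) xz by (intro second_difference_le[where g = "\<lambda>x. g x t" and R = R] middle(3)) auto
    also have "\<dots> \<le> c * norm z powr ((2 * a - 1) + 1)" by (intro mult_right_mono) (auto simp: c_def)
    finally show "\<bar>u (x + z) t + u (x - z) t - 2 * u x t\<bar> \<le> c * norm z powr (2 * min a 1)" using a by simp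
  next
    fix t :: real
    show "continuous_on (cball 0 R) (\<lambda>x. u x t)"
      using middle(3) by (intro continuous_at_imp_continuous_on ballI gderiv_isCont)
  qed
next
  case (high g H v)
  have a: "min a 1 = 1" using high by auto
  obtain V where V: "\<And>x t. norm x \<le> R \<Longrightarrow> \<bar>t\<bar> \<le> R \<Longrightarrow> \<bar>v x t\<bar> \<le> V"
    using parabolic_holder_on_bounded[OF high(5) assms(2)] by blast
  have "\<forall>ij. \<exists>B. \<forall>x t. norm x \<le> R \<longrightarrow> \<bar>t\<bar> \<le> R \<longrightarrow> \<bar>H x t $ fst ij $ snd ij\<bar> \<le> B"
    using parabolic_holder_on_bounded[OF high(6) assms(2)] by blast
  then obtain B' where B': "\<And>ij x t. norm x \<le> R \<Longrightarrow> \<bar>t\<bar> \<le> R \<Longrightarrow> \<bar>H x t $ fst ij $ snd ij\<bar> \<le> B' ij"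
    by metis
  define B where "B = Max (range B')"
  have B: "\<bar>H x t $ i $ j\<bar> \<le> B" if "norm x \<le> R" "\<bar>t\<bar> \<le> R" for x t i j
  proof -
    have "B' (i, j) \<le> B" unfolding B_def by (intro Max_ge) auto
    with B'[OF that, of "(i, j)"] show ?thesis by simp
  qed
  define L where "L = real CARD('n) * real CARD('n) * B"
  have "0 \<le> B" using order_trans[OF abs_ge_zero B[of 0 0 undefined undefined]] assms(2) by simp
  then have L0: "0 \<le> L" by (simp add: L_def)
  have L: "norm (g x t - g y t) \<le> L * norm (x - y) powr 1" if "norm x \<le> R" "norm y \<le> R" "\<bar>t\<bar> \<le> R" for x y t
  proof -
    have "norm (g x t - g y t) \<le> L * norm (x - y)"
    proof (rule differentiable_bound[where S = "cball 0 R" and f' = "\<lambda>x. (*v) (H x t)"])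
      fix w :: "real ^ 'n" assume w: "w \<in> cball 0 R"
      show "((\<lambda>x. g x t) has_derivative (*v) (H w t)) (at w within cball 0 R)"
        by (rule has_derivative_at_withinI[OF high(3)])
      show "onorm ((*v) (H w t)) \<le> L"
        unfolding L_def using B w that by (intro onorm_le_matrix_component) auto
    qed (use that in auto)
    then show ?thesis by simp
  qed
  define c where "c = max V (L * 2)"
  have c0: "0 \<le> c" using L0 by (simp add: c_def)
  show ?thesis
  proof (intro exI[of _ c] conjI allI impI)
    fix x :: "real ^ 'n" and t \<tau> assume "norm x \<le> R" "\<bar>t\<bar> \<le> R" "\<bar>\<tau>\<bar> \<le> R"
    then have "norm (u x t - u x \<tau>) \<le> c * norm (t - \<tau>)"
    proof (intro field_differentiable_bound[where S = "cball 0 R" and f' = "v x"])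
      fix \<sigma> :: real assume "\<sigma> \<in> cball 0 R"
      then show "(u x has_field_derivative v x \<sigma>) (at \<sigma> within cball 0 R)" "norm (v x \<sigma>) \<le> c"
        using high(4) V[of x \<sigma>] \<open>norm x \<le> R\<close> by (auto intro: has_field_derivative_at_within simp: c_def max.coboundedI1)
    qed auto
    then show "\<bar>u x t - u x \<tau>\<bar> \<le> c * \<bar>t - \<tau>\<bar> powr (min a 1)" using a by simp
  next
    fix x z :: "real ^ 'n" and t assume xz: "norm (x + z) \<le> R" "norm (x - z) \<le> R" "\<bar>t\<bar> \<le> R"
    have "\<bar>u (x + z) t + u (x - z) t - 2 * u x t\<bar> \<le> L * 2 powr 1 * norm z powr (1 + 1)"
      using L L0 xz by (intro second_difference_le[where g = "\<lambda>x. g x t" and R = R] high(2)) auto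
    also have "\<dots> \<le> c * norm z powr (1 + 1)" by (intro mult_right_mono) (auto simp: c_def)
    finally show "\<bar>u (x + z) t + u (x - z) t - 2 * u x t\<bar> \<le> c * norm z powr (2 * min a 1)" using a by simp
  next
    fix t :: real
    show "continuous_on (cball 0 R) (\<lambda>x. u x t)"
      using high(2) by (intro continuous_at_imp_continuous_on ballI gderiv_isCont)
  qed (rule c0)
qed

lemma parabolic_holder_loc_estimates:
  fixes u :: "real ^ 'n \<Rightarrow> real \<Rightarrow> real"
  assumes "parabolic_holder_loc a u" "0 \<le> R"
  shows "\<exists>c\<ge>0. (\<forall>x t \<tau>. norm x \<le> R \<longrightarrow> \<bar>t\<bar> \<le> R \<longrightarrow> \<bar>\<tau>\<bar> \<le> R \<longrightarrow> \<bar>u x t - u x \<tau>\<bar> \<le> c * \<bar>t - \<tau>\<bar> powr (min a 1))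
     \<and> (\<forall>x z t. norm (x + z) \<le> R \<longrightarrow> norm (x - z) \<le> R \<longrightarrow> \<bar>t\<bar> \<le> R \<longrightarrow>
          \<bar>u (x + z) t + u (x - z) t - 2 * u x t\<bar> \<le> c * norm z powr (2 * min a 1))
     \<and> (\<forall>t. \<bar>t\<bar> \<le> R \<longrightarrow> continuous_on (cball 0 R) (\<lambda>x. u x t))"
  using assms by (intro parabolic_holder_on_estimates) (auto simp: parabolic_holder_loc_def compact_Times)

text \<open>The time modulus is uniform on compact sets, so continuity in \<open>x\<close> at the
  fixed time \<open>snd X\<close> extends to joint continuity.\<close>

lemma parabolic_holder_loc_continuous:
  fixes u :: "real ^ 'n \<Rightarrow> real \<Rightarrow> real"
  assumes "parabolic_holder_loc a u" "0 < a"
  shows "continuous_on UNIV (\<lambda>X. u (fst X) (snd X))"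
proof (rule continuous_at_imp_continuous_on, rule ballI)
  fix X :: "(real ^ 'n) \<times> real"
  define R where "R = norm (fst X) + \<bar>snd X\<bar> + 1"
  have R: "norm (fst X) < R" "\<bar>snd X\<bar> < R" "0 \<le> R"
    using norm_ge_zero[of "fst X"] abs_ge_zero[of "snd X"] unfolding R_def by linarith+
  obtain c where c: "\<And>x t \<tau>. norm x \<le> R \<Longrightarrow> \<bar>t\<bar> \<le> R \<Longrightarrow> \<bar>\<tau>\<bar> \<le> R \<Longrightarrow> \<bar>u x t - u x \<tau>\<bar> \<le> c * \<bar>t - \<tau>\<bar> powr (min a 1)"
    and cont: "\<And>t. \<bar>t\<bar> \<le> R \<Longrightarrow> continuous_on (cball 0 R) (\<lambda>x. u x t)"
    using parabolic_holder_loc_estimates[OF assms(1) R(3)] by blast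
  have "isCont (\<lambda>x. u x (snd X)) (fst X)"
    using cont[of "snd X"] R by (intro continuous_on_interior[of "cball 0 R"]) auto
  then have 1: "((\<lambda>Y. u (fst Y) (snd X)) \<longlongrightarrow> u (fst X) (snd X)) (at X)"
    by (intro isCont_tendsto_compose[of _ "\<lambda>x. u x (snd X)"] tendsto_fst tendsto_ident_at)
  have "((\<lambda>Y. c * \<bar>snd Y - snd X\<bar> powr (min a 1)) \<longlongrightarrow> c * \<bar>snd X - snd X\<bar> powr (min a 1)) (at X)"
    using assms(2) by (intro tendsto_intros tendsto_powr') auto
  then have 2: "((\<lambda>Y. c * \<bar>snd Y - snd X\<bar> powr (min a 1)) \<longlongrightarrow> 0) (at X)" by simp
  have ev: "\<forall>\<^sub>F Y in at X. norm (u (fst Y) (snd Y) - u (fst Y) (snd X)) \<le> c * \<bar>snd Y - snd X\<bar> powr (min a 1)"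
  proof -
    have "((\<lambda>Y. norm (fst Y)) \<longlongrightarrow> norm (fst X)) (at X)" "((\<lambda>Y. \<bar>snd Y\<bar>) \<longlongrightarrow> \<bar>snd X\<bar>) (at X)"
      by (intro tendsto_intros)+
    from order_tendstoD(2)[OF this(1) R(1)] order_tendstoD(2)[OF this(2) R(2)] show ?thesis
      by eventually_elim (use c R in auto)
  qed
  have 3: "((\<lambda>Y. u (fst Y) (snd Y) - u (fst Y) (snd X)) \<longlongrightarrow> 0) (at X)"
    by (rule Lim_null_comparison[OF ev 2])
  from tendsto_add[OF 3 1] show "isCont (\<lambda>X. u (fst X) (snd X)) X"
    by (simp add: isCont_def)
qed

section \<open>Truncated fractional heat operators\<close>

lemma nn_integral_lincomb:
  fixes f g :: "'a::euclidean_space \<Rightarrow> ennreal"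
  assumes "f \<in> borel_measurable borel" "g \<in> borel_measurable borel"
  shows "(\<integral>\<^sup>+x. a * f x + b * g x \<partial>lborel) = a * (\<integral>\<^sup>+x. f x \<partial>lborel) + b * (\<integral>\<^sup>+x. g x \<partial>lborel)"
  using assms by (simp add: nn_integral_add nn_integral_cmult)

lemma stker_linear: "stker (\<lambda>r. c * k r) Y = c * stker k Y"
  "stker (\<lambda>r. k r + l r) Y = stker k Y + stker l Y"
  by (simp_all add: stker_def distrib_right mult.assoc)

text \<open>Within \<open>norm z < 1\<close> and \<open>r < 1\<close> the cut-off
  \<open>d < r\<close> bounds the kernel and the weight is at most 3; elsewhere
  \<open>heat_kernel_weight_le\<close> applies.\<close>

lemma fjump_weight_le:
  fixes M :: real
  assumes "0 < s" "0 < d" and M: "M = DIM('a::euclidean_space) / 2 + 1 + s"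
  obtains C where "0 \<le> C"
    "\<And>Y :: 'a \<times> real. stker (fjump s d) Y \<le> ennreal C * ennreal (1 / growth M Y)"
proof
  define C1 where "C1 = 2 * (1 + (8 * M) powr M)"
  define C2 where "C2 = 3 * (d powr (- 1 - s) / (4 * pi * d) powr (DIM('a) / 2))"
  have C: "0 \<le> C1" "0 \<le> C2" by (auto simp: C1_def C2_def)
  then show "0 \<le> C1 + C2" by simp
  fix Y :: "'a \<times> real"
  obtain z r where Y: "Y = (z, r)" by (cases Y)
  show "stker (fjump s d) Y \<le> ennreal (C1 + C2) * ennreal (1 / growth M Y)"
  proof (cases "d < r")
    case True
    have r: "0 < r" using True assms by simp
    have "r powr (- 1 - s) * heat_kernel r z \<le> (C1 + C2) * (1 / growth M (z, r))"
    proof (cases "1 \<le> r \<or> 1 \<le> norm z")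
      case True
      then have "r powr (- 1 - s) * heat_kernel r z \<le> C1 / growth M (z, r)"
        unfolding C1_def by (intro heat_kernel_weight_le[OF assms(1) r _ M])
      also have "\<dots> \<le> (C1 + C2) / growth M (z, r)"
        using C by (intro divide_right_mono) auto
      finally show ?thesis by simp
    next
      case False
      have g: "growth M (z, r) \<le> 3"
        using False r M assms(1) powr_le1[of "2 * M" "norm z"] powr_le1[of M r]
        by (simp add: growth_def)
      have "exp (- (norm z)\<^sup>2 / (4 * r)) / (4 * pi * r) powr (DIM('a) / 2) \<le> 1 / (4 * pi * d) powr (DIM('a) / 2)"
        using True r assms by (intro frac_le powr_mono2) auto
      moreover have "r powr (- 1 - s) \<le> d powr (- 1 - s)"
        using True assms by (intro powr_mono2') auto
      ultimately have "r powr (- 1 - s) * heat_kernel r z \<le> d powr (- 1 - s) * (1 / (4 * pi * d) powr (DIM('a) / 2))"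
        unfolding heat_kernel_def by (intro mult_mono) auto
      also have "\<dots> = C2 / 3" by (simp add: C2_def)
      also have "\<dots> \<le> C2 / growth M (z, r)"
        using g C by (intro divide_left_mono) auto
      also have "\<dots> \<le> (C1 + C2) / growth M (z, r)"
        using C by (intro divide_right_mono) auto
      finally show ?thesis by simp
    qed
    then show ?thesis
      using True C by (simp add: stker_def Y fjump_def ennreal_mult'[symmetric] ennreal_leI del: ennreal_plus)
  qed (simp add: stker_def Y fjump_def)
qed

lemma nconv_fjump_finite:
  fixes F :: "'a::euclidean_space \<times> real \<Rightarrow> ennreal"
  assumes "0 < s" "0 < d" and M: "M = DIM('a) / 2 + 1 + s" and [measurable]: "F \<in> borel_measurable borel"
    and W: "nconv (\<lambda>Y. ennreal (1 / growth M Y)) F X < \<infinity>"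
  shows "nconv (stker (fjump s d)) F X < \<infinity>"
proof -
  obtain C where C: "0 \<le> C" "\<And>Y :: 'a \<times> real. stker (fjump s d) Y \<le> ennreal C * ennreal (1 / growth M Y)"
    using fjump_weight_le[OF assms(1,2) M] by blast
  have "nconv (stker (fjump s d)) F X \<le> nconv (\<lambda>Y. ennreal C * ennreal (1 / growth M Y)) F X"
    by (intro nconv_mono C) auto
  also have "\<dots> = ennreal C * nconv (\<lambda>Y. ennreal (1 / growth M Y)) F X"
    by (rule nconv_cmult_left) measurable
  also have "\<dots> < \<infinity>" using W by (simp add: ennreal_mult_less_top)
  finally show ?thesis .
qed

lemma hshift_weight_le:
  assumes "0 < s" and M: "M = DIM('a::euclidean_space) / 2 + 1 + s"
  shows "hshift (Y :: 'a \<times> real) \<le> ennreal (2 powr (1 + s) * (2 * (1 + (8 * M) powr M))) * ennreal (1 / growth M Y)"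
proof (cases "0 < snd Y \<and> snd Y < 1")
  case True
  then have "heat_kernel (snd Y + 1) (fst Y) \<le> 2 powr (1 + s) * (2 * (1 + (8 * M) powr M)) / growth M (fst Y, snd Y)"
    using assms by (intro heat_kernel_shift_weight_le) auto
  then show ?thesis
    using True by (simp add: hshift_def ennreal_mult'[symmetric] ennreal_leI)
qed (auto simp: hshift_def)

text \<open>The damping makes the moment of order \<open>M\<close> of the time factor finite, as a
  sum of two Gamma integrals, and \<open>nconv_weight_le\<close> then reproduces the weight. At
  \<open>lam = 0\<close> even the mass would be infinite.\<close>

lemma fpot_weight_le:
  fixes M :: real
  assumes "0 < s" "0 < lam" and M: "M = DIM('a::euclidean_space) / 2 + 1 + s"
  obtains C where "0 \<le> C"
    "\<And>Y :: 'a \<times> real. nconv (stker (fpot s lam)) (\<lambda>Y. ennreal (1 / growth M Y)) Y \<le> ennreal C * ennreal (1 / growth M Y)"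
proof -
  have G: "0 < Gamma s" using assms by (auto simp: Gamma_real_pos)
  have M0: "0 < M" using M assms by simp
  define K where "K = 1 + (8 * M) powr M * 2 powr (DIM('a) / 2)"
  have K: "0 \<le> K" by (simp add: K_def)
  define c where "c = 1 / Gamma s * (Gamma s * lam powr (- s)) + K / Gamma s * (Gamma (s + M) * lam powr (- (s + M)))"
  have "(\<integral>\<^sup>+r. fpot s lam r * ennreal (1 + K * r powr M) \<partial>lborel)
    = (\<integral>\<^sup>+r. ennreal (1 / Gamma s) * (indicator {0<..} r * ennreal (r powr (s - 1) * exp (- lam * r)))
        + ennreal (K / Gamma s) * (indicator {0<..} r * ennreal (r powr ((s + M) - 1) * exp (- lam * r))) \<partial>lborel)"
  proof (rule nn_integral_cong)
    fix r
    show "fpot s lam r * ennreal (1 + K * r powr M) = ennreal (1 / Gamma s) * (indicator {0<..} r * ennreal (r powr (s - 1) * exp (- lam * r)))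
        + ennreal (K / Gamma s) * (indicator {0<..} r * ennreal (r powr ((s + M) - 1) * exp (- lam * r)))"
    proof (cases "0 < r")
      case True
      have "exp (- lam * r) * r powr (s - 1) / Gamma s * (1 + K * r powr M)
        = 1 / Gamma s * (r powr (s - 1) * exp (- lam * r)) + K / Gamma s * (r powr ((s + M) - 1) * exp (- lam * r))"
        using True by (simp add: powr_add powr_diff field_simps) (simp add: add_divide_distrib)
      moreover have "0 \<le> 1 / Gamma s * (r powr (s - 1) * exp (- lam * r))" "0 \<le> K / Gamma s * (r powr ((s + M) - 1) * exp (- lam * r))"
        using K G by auto
      ultimately have "ennreal (exp (- lam * r) * r powr (s - 1) / Gamma s * (1 + K * r powr M))
        = ennreal (1 / Gamma s * (r powr (s - 1) * exp (- lam * r))) + ennreal (K / Gamma s * (r powr ((s + M) - 1) * exp (- lam * r)))"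
        by (simp only:) (rule ennreal_plus, auto)
      then show ?thesis
        using True K G by (simp add: fpot_def ennreal_mult'[symmetric] del: ennreal_plus)
    qed (simp add: fpot_def)
  qed
  also have "\<dots> = ennreal (1 / Gamma s) * (\<integral>\<^sup>+r. indicator {0<..} r * ennreal (r powr (s - 1) * exp (- lam * r)) \<partial>lborel)
     + ennreal (K / Gamma s) * (\<integral>\<^sup>+r. indicator {0<..} r * ennreal (r powr ((s + M) - 1) * exp (- lam * r)) \<partial>lborel)"
    by (rule nn_integral_lincomb) measurable
  also have "\<dots> = ennreal (1 / Gamma s) * ennreal (Gamma s * lam powr (- s)) + ennreal (K / Gamma s) * ennreal (Gamma (s + M) * lam powr (- (s + M)))"
    using nn_integral_Gamma_scaled[of s lam] nn_integral_Gamma_scaled[of "s + M" lam] assms(1,2) M0 by simp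
  also have "\<dots> < \<infinity>" by (simp add: ennreal_mult_less_top)
  finally have fin: "(\<integral>\<^sup>+r. fpot s lam r * ennreal (1 + K * r powr M) \<partial>lborel) < \<infinity>" .
  define J where "J = (\<integral>\<^sup>+Y. stker (fpot s lam) Y * ennreal (growth M (Y :: 'a \<times> real)) \<partial>lborel)"
  have "J \<le> (\<integral>\<^sup>+r. fpot s lam r * ennreal (1 + K * r powr M) \<partial>lborel)"
    unfolding J_def K_def using M0 by (intro stker_growth_le) (auto simp: fpot_nonpos)
  then have J: "J < \<infinity>" using fin by (rule order_le_less_trans)
  show ?thesis
  proof
    show "0 \<le> 2 powr (2 * M + 1) * enn2real J" by simp
    fix Y :: "'a \<times> real"
    have "nconv (stker (fpot s lam)) (\<lambda>Y. ennreal (1 / growth M Y)) Y \<le> ennreal (2 powr (2 * M + 1) / growth M Y) * J"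
      unfolding J_def using M0 by (intro nconv_weight_le) auto
    also have "\<dots> = ennreal (2 powr (2 * M + 1) * enn2real J) * ennreal (1 / growth M Y)"
      using J by (cases J) (auto simp: ennreal_mult'[symmetric] mult_ac)
    finally show "nconv (stker (fpot s lam)) (\<lambda>Y. ennreal (1 / growth M Y)) Y \<le> ennreal (2 powr (2 * M + 1) * enn2real J) * ennreal (1 / growth M Y)" .
  qed
qed

text \<open>The truncated convolution is finite, so the average is finite for almost every
  \<open>r\<close> above the truncation length; countably many truncations exhaust
  \<open>r > 0\<close>.\<close>

lemma AE_heat_avg_finite:
  fixes F :: "'a::euclidean_space \<times> real \<Rightarrow> ennreal"
  assumes s: "0 < s" and M: "M = DIM('a) / 2 + 1 + s" and [measurable]: "F \<in> borel_measurable borel"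
    and W: "nconv (\<lambda>Y. ennreal (1 / growth M Y)) F X < \<infinity>"
  shows "AE r in lborel. 0 < r \<longrightarrow> heat_avg r F X < \<infinity>"
proof -
  have "AE r in lborel. fjump s (inverse (real (Suc j))) r * heat_avg r F X \<noteq> \<infinity>" for j
  proof (rule nn_integral_noteq_infinite)
    show "(\<integral>\<^sup>+r. fjump s (inverse (real (Suc j))) r * heat_avg r F X \<partial>lborel) \<noteq> \<infinity>"
      using nconv_fjump_finite[OF s _ M _ W, of "inverse (real (Suc j))"]
      by (simp add: nconv_stker heat_avg_def)
  qed measurable
  then have "AE r in lborel. \<forall>j. fjump s (inverse (real (Suc j))) r * heat_avg r F X \<noteq> \<infinity>"
    by (simp add: AE_all_countable)
  then show ?thesis
  proof eventually_elim
    case (elim r)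
    show ?case
    proof
      assume "0 < r"
      then obtain j where "inverse (real (Suc j)) < r" using reals_Archimedean by blast
      then show "heat_avg r F X < \<infinity>"
        using elim[rule_format, of j] \<open>0 < r\<close> by (auto simp: fjump_def ennreal_mult_eq_top_iff less_top)
    qed
  qed
qed

text \<open>The two terms of the truncated operator may each grow like \<open>d powr (- s)\<close>,
  while their difference is bounded uniformly in \<open>d\<close>. This is the majorant for the
  passages to the limit under a convolution.\<close>

lemma truncation_le:
  fixes F :: "'a::euclidean_space \<times> real \<Rightarrow> real"
  assumes s: "0 < s" and d: "0 < d" and M: "M = DIM('a) / 2 + 1 + s" and [measurable]: "F \<in> borel_measurable borel"
    and F0: "\<And>Y. 0 \<le> F Y" and W: "nconv (\<lambda>Y. ennreal (1 / growth M Y)) (\<lambda>Y. ennreal (F Y)) X < \<infinity>"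
  shows "ennreal (d powr (- s) / s * F X) \<le> nconv (stker (fjump s d)) (\<lambda>Y. ennreal (F Y)) X + frac_gap s F X"
    and "nconv (stker (fjump s d)) (\<lambda>Y. ennreal (F Y)) X \<le> ennreal (d powr (- s) / s * F X) + frac_gap s F X"
proof -
  let ?T = "\<lambda>r. heat_avg r (\<lambda>Y. ennreal (F Y)) X"
  let ?g = "\<lambda>r. indicator {0<..} r * ennreal (r powr (- 1 - s) * \<bar>F X - enn2real (?T r)\<bar>)"
  have A: "ennreal (d powr (- s) / s * F X) = (\<integral>\<^sup>+r. fjump s d r * ennreal (F X) \<partial>lborel)"
  proof -
    have "(\<integral>\<^sup>+r. fjump s d r \<partial>lborel) = (\<integral>\<^sup>+r. indicator {d<..} r * ennreal (r powr (- 1 - s)) \<partial>lborel)"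
      by (intro nn_integral_cong) (auto simp: fjump_def)
    then have "(\<integral>\<^sup>+r. fjump s d r * ennreal (F X) \<partial>lborel) = ennreal (d powr (- s) / s) * ennreal (F X)"
      using nn_integral_powr_tail[OF d s] by (simp add: nn_integral_multc)
    then show ?thesis
      using F0[of X] by (simp only: ennreal_mult'')
  qed
  have B: "nconv (stker (fjump s d)) (\<lambda>Y. ennreal (F Y)) X = (\<integral>\<^sup>+r. fjump s d r * ?T r \<partial>lborel)"
    by (simp add: nconv_stker heat_avg_def)
  have 1: "fjump s d r * ennreal (F X) \<le> fjump s d r * ?T r + ?g r" if "0 < r \<longrightarrow> ?T r < \<infinity>" for r
  proof (cases "d < r")
    case True
    have "F X \<le> enn2real (?T r) + \<bar>F X - enn2real (?T r)\<bar>" by simp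
    then have "ennreal (F X) \<le> ennreal (enn2real (?T r) + \<bar>F X - enn2real (?T r)\<bar>)" by (rule ennreal_leI)
    also have "\<dots> = ?T r + ennreal \<bar>F X - enn2real (?T r)\<bar>"
      using that True d by (simp add: ennreal_plus less_top)
    finally have "ennreal (r powr (- 1 - s)) * ennreal (F X) \<le> ennreal (r powr (- 1 - s)) * (?T r + ennreal \<bar>F X - enn2real (?T r)\<bar>)"
      by (intro mult_left_mono) auto
    then show ?thesis using True d by (simp add: fjump_def distrib_left ennreal_mult')
  qed (simp add: fjump_def)
  have 2: "fjump s d r * ?T r \<le> fjump s d r * ennreal (F X) + ?g r" if "0 < r \<longrightarrow> ?T r < \<infinity>" for r
  proof (cases "d < r")
    case True
    have "?T r = ennreal (enn2real (?T r))" using that True d by (simp add: less_top)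
    also have "\<dots> \<le> ennreal (F X + \<bar>F X - enn2real (?T r)\<bar>)" by (rule ennreal_leI) simp
    also have "\<dots> = ennreal (F X) + ennreal \<bar>F X - enn2real (?T r)\<bar>"
      using F0 by (simp add: ennreal_plus)
    finally have "ennreal (r powr (- 1 - s)) * ?T r \<le> ennreal (r powr (- 1 - s)) * (ennreal (F X) + ennreal \<bar>F X - enn2real (?T r)\<bar>)"
      by (intro mult_left_mono) auto
    then show ?thesis using True d by (simp add: fjump_def distrib_left ennreal_mult')
  qed (simp add: fjump_def)
  have ae: "AE r in lborel. 0 < r \<longrightarrow> ?T r < \<infinity>"
    by (rule AE_heat_avg_finite[OF s M _ W]) measurable
  have "(\<integral>\<^sup>+r. fjump s d r * ennreal (F X) \<partial>lborel) \<le> (\<integral>\<^sup>+r. fjump s d r * ?T r + ?g r \<partial>lborel)"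
    by (rule nn_integral_mono_AE, rule AE_mp[OF ae], intro AE_I2 impI) (use 1 in blast)
  then show "ennreal (d powr (- s) / s * F X) \<le> nconv (stker (fjump s d)) (\<lambda>Y. ennreal (F Y)) X + frac_gap s F X"
    unfolding A B frac_gap_def by (subst (asm) nn_integral_add) auto
  have "(\<integral>\<^sup>+r. fjump s d r * ?T r \<partial>lborel) \<le> (\<integral>\<^sup>+r. fjump s d r * ennreal (F X) + ?g r \<partial>lborel)"
    by (rule nn_integral_mono_AE, rule AE_mp[OF ae], intro AE_I2 impI) (use 2 in blast)
  then show "nconv (stker (fjump s d)) (\<lambda>Y. ennreal (F Y)) X \<le> ennreal (d powr (- s) / s * F X) + frac_gap s F X"
    unfolding A B frac_gap_def by (subst (asm) nn_integral_add) auto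
qed

lemma truncation_limit:
  fixes F :: "'a::euclidean_space \<times> real \<Rightarrow> real"
  assumes s: "0 < s" and M: "M = DIM('a) / 2 + 1 + s" and F[measurable]: "F \<in> borel_measurable borel"
    and F0: "\<And>Y. 0 \<le> F Y" and W: "nconv (\<lambda>Y. ennreal (1 / growth M Y)) (\<lambda>Y. ennreal (F Y)) X < \<infinity>"
    and gap: "frac_gap s F X < \<infinity>"
  defines "h \<equiv> \<lambda>r. r powr (- 1 - s) * (F X - enn2real (heat_avg r (\<lambda>Y. ennreal (F Y)) X))"
  shows "set_integrable lborel {0<..} h"
    and "(\<lambda>j. inverse (real (Suc j)) powr (- s) / s * F X - enn2real (nconv (stker (fjump s (inverse (real (Suc j))))) (\<lambda>Y. ennreal (F Y)) X))
      \<longlonglongrightarrow> (LINT r:{0<..}|lborel. h r)"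
proof -
  let ?T = "\<lambda>r. heat_avg r (\<lambda>Y. ennreal (F Y)) X"
  let ?d = "\<lambda>j. inverse (real (Suc j))"
  have [measurable]: "h \<in> borel_measurable borel" unfolding h_def by measurable
  show int: "set_integrable lborel {0<..} h"
    unfolding set_integrable_def
  proof (rule integrableI_bounded)
    have "(\<integral>\<^sup>+r. ennreal (norm (indicator {0<..} r *\<^sub>R h r)) \<partial>lborel) = frac_gap s F X"
      unfolding frac_gap_def by (intro nn_integral_cong) (auto simp: h_def indicator_def abs_mult)
    then show "(\<integral>\<^sup>+r. ennreal (norm (indicator {0<..} r *\<^sub>R h r)) \<partial>lborel) < \<infinity>" using gap by simp
  qed measurable
  have ae: "AE r in lborel. 0 < r \<longrightarrow> ?T r < \<infinity>"
    by (rule AE_heat_avg_finite[OF s M _ W]) measurable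
  \<comment> \<open>The jump kernel has mass \<open>?d j powr (- s) / s\<close>, so the truncated
    expression is the integral of \<open>h\<close> over \<open>r > ?d j\<close>.\<close>
  have eq: "?d j powr (- s) / s * F X - enn2real (nconv (stker (fjump s (?d j))) (\<lambda>Y. ennreal (F Y)) X)
     = (\<integral>r. indicator {?d j<..} r * h r \<partial>lborel)" for j
  proof -
    have dj: "0 < ?d j" by simp
    have B: "nconv (stker (fjump s (?d j))) (\<lambda>Y. ennreal (F Y)) X = (\<integral>\<^sup>+r. fjump s (?d j) r * ?T r \<partial>lborel)"
      by (simp add: nconv_stker heat_avg_def)
    also have "\<dots> = (\<integral>\<^sup>+r. ennreal (indicator {?d j<..} r * (r powr (- 1 - s) * enn2real (?T r))) \<partial>lborel)"
    proof (rule nn_integral_cong_AE)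
      show "AE r in lborel. fjump s (?d j) r * ?T r = ennreal (indicator {?d j<..} r * (r powr (- 1 - s) * enn2real (?T r)))"
        using ae
      proof eventually_elim
        case (elim r)
        show ?case
        proof (cases "?d j < r")
          case True
          then have "0 < r" using dj by (rule order_less_trans[rotated])
          with True elim show ?thesis by (simp add: fjump_def ennreal_mult less_top)
        qed (simp add: fjump_def)
      qed
    qed
    finally have B': "nconv (stker (fjump s (?d j))) (\<lambda>Y. ennreal (F Y)) X
      = (\<integral>\<^sup>+r. ennreal (indicator {?d j<..} r * (r powr (- 1 - s) * enn2real (?T r))) \<partial>lborel)" .
    have fin: "nconv (stker (fjump s (?d j))) (\<lambda>Y. ennreal (F Y)) X < \<infinity>"
      by (rule nconv_fjump_finite[OF s dj M _ W]) measurable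
    have i1: "integrable lborel (\<lambda>r. indicator {?d j<..} r * (r powr (- 1 - s) * enn2real (?T r)))"
      using fin unfolding B' by (intro integrableI_nonneg) auto
    have e1: "enn2real (nconv (stker (fjump s (?d j))) (\<lambda>Y. ennreal (F Y)) X) = (\<integral>r. indicator {?d j<..} r * (r powr (- 1 - s) * enn2real (?T r)) \<partial>lborel)"
      unfolding B' by (rule integral_eq_nn_integral[symmetric]) auto
    have tail: "(\<integral>\<^sup>+r. ennreal (indicator {?d j<..} r * r powr (- 1 - s)) \<partial>lborel) = ennreal (?d j powr (- s) / s)"
      unfolding nn_integral_powr_tail[OF dj s, symmetric] by (intro nn_integral_cong) (auto simp: indicator_def)
    have i2: "integrable lborel (\<lambda>r. indicator {?d j<..} r * r powr (- 1 - s))"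
      using tail by (intro integrableI_nonneg) auto
    have e2: "(\<integral>r. indicator {?d j<..} r * r powr (- 1 - s) \<partial>lborel) = ?d j powr (- s) / s"
      using tail s by (subst integral_eq_nn_integral) auto
    have "(\<integral>r. indicator {?d j<..} r * h r \<partial>lborel)
      = (\<integral>r. indicator {?d j<..} r * r powr (- 1 - s) * F X - indicator {?d j<..} r * (r powr (- 1 - s) * enn2real (?T r)) \<partial>lborel)"
      by (intro Bochner_Integration.integral_cong) (auto simp: h_def algebra_simps)
    also have "\<dots> = (\<integral>r. indicator {?d j<..} r * r powr (- 1 - s) * F X \<partial>lborel) - (\<integral>r. indicator {?d j<..} r * (r powr (- 1 - s) * enn2real (?T r)) \<partial>lborel)"
      by (intro Bochner_Integration.integral_diff integrable_mult_left i1 i2)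
    finally show ?thesis unfolding e1 by (simp only: integral_mult_left_zero e2)
  qed
  show "(\<lambda>j. ?d j powr (- s) / s * F X - enn2real (nconv (stker (fjump s (?d j))) (\<lambda>Y. ennreal (F Y)) X))
      \<longlonglongrightarrow> (LINT r:{0<..}|lborel. h r)"
    unfolding eq set_lebesgue_integral_def
  proof (rule integral_dominated_convergence[where w = "\<lambda>r. norm (indicator {0<..} r *\<^sub>R h r)"])
    show "integrable lborel (\<lambda>r. norm (indicator {0<..} r *\<^sub>R h r))"
      using int unfolding set_integrable_def by (rule integrable_norm)
    show "AE r in lborel. (\<lambda>j. indicator {?d j<..} r * h r) \<longlonglongrightarrow> indicator {0<..} r *\<^sub>R h r"
    proof (rule AE_I2)
      fix r :: real
      show "(\<lambda>j. indicator {?d j<..} r * h r) \<longlonglongrightarrow> indicator {0<..} r *\<^sub>R h r"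
      proof (cases "0 < r")
        case True
        have "\<forall>\<^sub>F j in sequentially. ?d j < r"
          using order_tendstoD(2)[OF LIMSEQ_inverse_real_of_nat True] .
        then have "\<forall>\<^sub>F j in sequentially. indicator {?d j<..} r * h r = indicator {0<..} r *\<^sub>R h r"
          by (rule eventually_mono) (use True in auto)
        then show ?thesis by (rule tendsto_eventually)
      next
        case False
        have "\<not> ?d j < r" for j
          using False positive_imp_inverse_positive[of "real (Suc j)"] by linarith
        then show ?thesis using False by simp
      qed
    qed
    show "AE r in lborel. norm (indicator {?d j<..} r * h r) \<le> norm (indicator {0<..} r *\<^sub>R h r)" for j
    proof (rule AE_I2)
      fix r :: real
      have "0 < r" if "?d j < r"
        using that positive_imp_inverse_positive[of "real (Suc j)"] by linarith
      then show "norm (indicator {?d j<..} r * h r) \<le> norm (indicator {0<..} r *\<^sub>R h r)"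
        by (auto simp: indicator_def simp del: of_nat_Suc)
    qed
  qed measurable
qed

section \<open>Truncations of potentials\<close>

lemma nconv_fpot_identity:
  fixes F :: "'a::euclidean_space \<times> real \<Rightarrow> ennreal"
  assumes "0 < s" "s < 1" "0 < d" "0 \<le> lam" and [measurable]: "F \<in> borel_measurable borel"
  shows "ennreal (d powr (- s) / s) * nconv (stker (fpot s lam)) F X + nconv (stker (mrem s lam d)) F X
    = nconv (stker (\<lambda>r. ennreal (exp (- lam * r)) * mar s d r)) F X + nconv (stker (fpot s lam)) (nconv (stker (fjump s d)) F) X"
proof -
  have "nconv (stker (fpot s lam)) (nconv (stker (fjump s d)) F) X = nconv (nconv (stker (fpot s lam)) (stker (fjump s d))) F X"
    by (subst nconv_assoc) auto
  also have "nconv (stker (fpot s lam)) (stker (fjump s d)) = (stker (nconv (fpot s lam) (fjump s d)) :: 'a \<times> real \<Rightarrow> ennreal)"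
    using assms by (intro nconv_stker_stker) (auto simp: fpot_nonpos fjump_nonpos)
  finally have 1: "nconv (stker (\<lambda>r. ennreal (exp (- lam * r)) * mar s d r)) F X + nconv (stker (fpot s lam)) (nconv (stker (fjump s d)) F) X
    = nconv (\<lambda>Y. stker (\<lambda>r. ennreal (exp (- lam * r)) * mar s d r) Y + stker (nconv (fpot s lam) (fjump s d)) Y) F X"
    by (simp add: nconv_add_left)
  have 2: "ennreal (d powr (- s) / s) * nconv (stker (fpot s lam)) F X + nconv (stker (mrem s lam d)) F X
    = nconv (\<lambda>Y. ennreal (d powr (- s) / s) * stker (fpot s lam) Y + stker (mrem s lam d) Y) F X"
    by (simp add: nconv_add_left nconv_cmult_left)
  show ?thesis
    unfolding 1 2 stker_linear[symmetric] using fpot_jump_identity[OF assms(1-4)] by simp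
qed

text \<open>At \<open>lam = 0\<close> the damping error vanishes and the truncation of
  \<open>U\<close> is exactly the convolution of \<open>g\<close> with \<open>mar\<close>. The
  approximate identity asks for a finite convolution of \<open>hshift\<close> with \<open>g\<close>;
  \<open>hshift\<close> is dominated by the potential kernel one unit of time later, whence the
  finiteness assumption at \<open>X + (0, 1)\<close>.\<close>

lemma potential_truncation_limit:
  fixes g :: "'a::euclidean_space \<times> real \<Rightarrow> real"
  assumes s: "0 < s" "s < 1" and g[measurable]: "g \<in> borel_measurable borel"
    and g0: "\<And>Y. 0 \<le> g Y" and cont: "isCont g X"
  defines "U \<equiv> nconv (stker (fpot s 0)) (\<lambda>Y. ennreal (g Y))"
  assumes fin: "U X < \<infinity>" "U (X + (0, 1)) < \<infinity>"
  shows "(\<lambda>j. ennreal (inverse (real (Suc j)) powr (- s) / s) * U X - nconv (stker (fjump s (inverse (real (Suc j))))) U X)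
    \<longlonglongrightarrow> ennreal (Gamma (1 - s) / s * g X)"
    and "nconv (stker (fjump s (inverse (real (Suc j))))) U X \<le> ennreal (inverse (real (Suc j)) powr (- s) / s) * U X"
proof -
  let ?d = "\<lambda>j. inverse (real (Suc j))"
  let ?g = "\<lambda>Y. ennreal (g Y)"
  have G: "0 < Gamma s" using s by (auto simp: Gamma_real_pos)
  have [measurable]: "g \<in> borel_measurable (borel \<Otimes>\<^sub>M borel)"
    by (simp add: borel_prod)
  have [measurable]: "U \<in> borel_measurable borel" unfolding U_def by measurable
  have mrem0: "mrem s 0 d = (\<lambda>_. 0)" for d
    by (simp add: mrem_def fun_eq_iff cong: if_cong)
  have id: "ennreal (?d j powr (- s) / s) * U X = nconv (stker (mar s (?d j))) ?g X + nconv (stker (fjump s (?d j))) U X" for j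
  proof -
    have "nconv (stker (fpot s 0)) (nconv (stker (fjump s (?d j))) ?g) = nconv (stker (fjump s (?d j))) U"
    proof -
      have "nconv (stker (fpot s 0)) (nconv (stker (fjump s (?d j))) ?g) = nconv (nconv (stker (fpot s 0)) (stker (fjump s (?d j)))) ?g"
        by (rule nconv_assoc) measurable
      also have "nconv (stker (fpot s 0)) (stker (fjump s (?d j))) = (nconv (stker (fjump s (?d j))) (stker (fpot s 0)) :: 'a \<times> real \<Rightarrow> ennreal)"
        by (rule nconv_commute) measurable
      also have "nconv (nconv (stker (fjump s (?d j))) (stker (fpot s 0))) ?g = nconv (stker (fjump s (?d j))) U"
        unfolding U_def by (rule nconv_assoc[symmetric]) measurable
      finally show ?thesis .
    qed
    then show ?thesis
      using nconv_fpot_identity[OF s, of "?d j" 0 ?g X]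
      by (simp add: mrem0 U_def stker_def nconv_def)
  qed
  show "nconv (stker (fjump s (?d j))) U X \<le> ennreal (?d j powr (- s) / s) * U X"
    unfolding id by simp
  have "nconv (stker (fjump s (?d j))) U X < \<infinity>" for j
  proof -
    have "nconv (stker (fjump s (?d j))) U X \<le> ennreal (?d j powr (- s) / s) * U X"
      unfolding id by simp
    also have "\<dots> < \<infinity>" using fin(1) by (simp add: ennreal_mult_less_top)
    finally show ?thesis .
  qed
  then have "ennreal (?d j powr (- s) / s) * U X - nconv (stker (fjump s (?d j))) U X = nconv (stker (mar s (?d j))) ?g X" for j
    unfolding id by (simp add: less_top)
  moreover have "(\<lambda>j. nconv (stker (\<lambda>r. ennreal (exp (- 0 * r)) * mar s (?d j) r)) ?g X) \<longlonglongrightarrow> ennreal (Gamma (1 - s) / s * g X)"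
  proof (rule approx_mar[OF s _ g g0 cont])
    show "nconv (stker (fpot s 0)) ?g X < \<infinity>" using fin(1) by (simp add: U_def)
    \<comment> \<open>On \<open>0 < r < 1\<close> the factor \<open>(r + 1) powr (s - 1)\<close> is
      at least 1/2, so \<open>hshift\<close> is at most \<open>2 * Gamma s\<close> times the
      potential kernel at time \<open>r + 1\<close>.\<close>
    have "nconv hshift ?g X \<le> (\<integral>\<^sup>+Y. ennreal (Gamma s * 2) * (stker (fpot s 0) (Y + (0, 1)) * ?g (X - Y)) \<partial>lborel)"
      unfolding nconv_def
    proof (rule nn_integral_mono)
      fix Y :: "'a \<times> real"
      have "hshift Y \<le> ennreal (Gamma s * 2) * stker (fpot s 0) (Y + (0, 1))"
      proof (cases "0 < snd Y \<and> snd Y < 1")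
        case True
        have "2 powr (s - 1) \<le> (snd Y + 1) powr (s - 1)"
          using True s by (intro powr_mono2') auto
        moreover have "2 powr (- 1) \<le> (2::real) powr (s - 1)"
          using s by (intro powr_mono) auto
        ultimately have "1 \<le> 2 * (snd Y + 1) powr (s - 1)" by (simp add: powr_minus)
        then have "1 * heat_kernel (snd Y + 1) (fst Y) \<le> 2 * (snd Y + 1) powr (s - 1) * heat_kernel (snd Y + 1) (fst Y)"
          by (intro mult_right_mono) auto
        also have "\<dots> = Gamma s * 2 * ((snd Y + 1) powr (s - 1) / Gamma s * heat_kernel (snd Y + 1) (fst Y))"
          using less_imp_neq[OF G] by simp
        finally have "ennreal (heat_kernel (snd Y + 1) (fst Y)) \<le> ennreal (Gamma s * 2 * ((snd Y + 1) powr (s - 1) / Gamma s * heat_kernel (snd Y + 1) (fst Y)))"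
          by (intro ennreal_leI) simp
        also have "\<dots> = ennreal (Gamma s * 2) * stker (fpot s 0) (Y + (0, 1))"
          using True G by (simp add: stker_def fpot_def ennreal_mult''[symmetric])
        finally show ?thesis using True by (simp add: hshift_def)
      qed (auto simp: hshift_def)
      then show "hshift Y * ?g (X - Y) \<le> ennreal (Gamma s * 2) * (stker (fpot s 0) (Y + (0, 1)) * ?g (X - Y))"
        by (simp add: mult.assoc[symmetric] mult_right_mono)
    qed
    also have "\<dots> = ennreal (Gamma s * 2) * (\<integral>\<^sup>+Y. stker (fpot s 0) (Y + (0, 1)) * ?g (X - Y) \<partial>lborel)"
      by (rule nn_integral_cmult) measurable
    also have "(\<integral>\<^sup>+Y. stker (fpot s 0) (Y + (0, 1)) * ?g (X - Y) \<partial>lborel) = U (X + (0, 1))"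
      unfolding U_def nconv_def
      by (subst nn_integral_lborel_shift[of "\<lambda>Y. stker (fpot s 0) Y * ?g (X + (0, 1) - Y)" "(0, 1)", symmetric])
        (auto simp: algebra_simps)
    also have "ennreal (Gamma s * 2) * U (X + (0, 1)) < \<infinity>"
      using fin(2) by (simp add: ennreal_mult_less_top)
    finally show "nconv hshift ?g X < \<infinity>" .
  qed simp
  ultimately show "(\<lambda>j. ennreal (?d j powr (- s) / s) * U X - nconv (stker (fjump s (?d j))) U X) \<longlonglongrightarrow> ennreal (Gamma (1 - s) / s * g X)"
    by simp
qed

section \<open>Mollified solutions\<close>

lemma enn2real_nn_integral:
  assumes [measurable]: "f \<in> borel_measurable M" and fin: "(\<integral>\<^sup>+x. f x \<partial>M) < \<infinity>"
  shows "integrable M (\<lambda>x. enn2real (f x))" and "(\<integral>x. enn2real (f x) \<partial>M) = enn2real (\<integral>\<^sup>+x. f x \<partial>M)"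
proof -
  have "AE x in M. f x \<noteq> \<infinity>"
    using fin by (intro nn_integral_noteq_infinite) auto
  then have ae: "AE x in M. ennreal (enn2real (f x)) = f x"
    by (rule AE_mp) (auto simp: less_top)
  then have eq: "(\<integral>\<^sup>+x. ennreal (enn2real (f x)) \<partial>M) = (\<integral>\<^sup>+x. f x \<partial>M)"
    by (rule nn_integral_cong_AE)
  show "integrable M (\<lambda>x. enn2real (f x))"
    using fin eq by (intro integrableI_nonneg) auto
  show "(\<integral>x. enn2real (f x) \<partial>M) = enn2real (\<integral>\<^sup>+x. f x \<partial>M)"
    by (subst integral_eq_nn_integral) (auto simp: eq)
qed

text \<open>Dominated convergence for differences of two \<open>ennreal\<close> sequences that may
  separately diverge; only the difference has the majorant \<open>D\<close>. The pointwise
  hypotheses are restricted to \<open>n Y \<noteq> 0\<close>, so that for a compactly supported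
  \<open>n\<close> local bounds suffice.\<close>

lemma nconv_dominated_diff:
  fixes n :: "'b::euclidean_space \<Rightarrow> real" and p q :: "nat \<Rightarrow> 'b \<Rightarrow> ennreal" and l :: "'b \<Rightarrow> real"
  assumes n[measurable]: "n \<in> borel_measurable borel" and n0: "\<And>Y. 0 \<le> n Y"
    and p[measurable]: "\<And>j. p j \<in> borel_measurable borel" and q[measurable]: "\<And>j. q j \<in> borel_measurable borel"
    and D[measurable]: "D \<in> borel_measurable borel" and l[measurable]: "l \<in> borel_measurable borel" and l0: "\<And>Y. 0 \<le> l Y"
    and le1: "\<And>j Y. n Y \<noteq> 0 \<Longrightarrow> p j (X - Y) \<le> q j (X - Y) + D (X - Y)"
    and le2: "\<And>j Y. n Y \<noteq> 0 \<Longrightarrow> q j (X - Y) \<le> p j (X - Y) + D (X - Y)"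
    and lim: "\<And>Y. n Y \<noteq> 0 \<Longrightarrow> (\<lambda>j. enn2real (p j (X - Y)) - enn2real (q j (X - Y))) \<longlonglongrightarrow> l (X - Y)"
    and finD: "nconv (\<lambda>Y. ennreal (n Y)) D X < \<infinity>"
    and finp: "\<And>j. nconv (\<lambda>Y. ennreal (n Y)) (p j) X < \<infinity>"
  shows "(\<lambda>j. enn2real (nconv (\<lambda>Y. ennreal (n Y)) (p j) X) - enn2real (nconv (\<lambda>Y. ennreal (n Y)) (q j) X))
      \<longlonglongrightarrow> enn2real (nconv (\<lambda>Y. ennreal (n Y)) (\<lambda>Y. ennreal (l Y)) X)
    \<and> nconv (\<lambda>Y. ennreal (n Y)) (\<lambda>Y. ennreal (l Y)) X < \<infinity>"
proof -
  let ?n = "\<lambda>Y. ennreal (n Y)"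
  define P where "P j Y = ?n Y * p j (X - Y)" for j Y
  define Q where "Q j Y = ?n Y * q j (X - Y)" for j Y
  define E where "E Y = ?n Y * D (X - Y)" for Y
  have [measurable]: "P j \<in> borel_measurable borel" "Q j \<in> borel_measurable borel" "E \<in> borel_measurable borel" for j
    unfolding P_def[abs_def] Q_def[abs_def] E_def[abs_def] by measurable
  have PQ: "P j Y \<le> Q j Y + E Y" "Q j Y \<le> P j Y + E Y" for j Y
    unfolding P_def Q_def E_def distrib_left[symmetric]
    using le1[of Y j] le2[of Y j] by (cases "n Y = 0"; simp add: mult_left_mono)+
  have finP: "(\<integral>\<^sup>+Y. P j Y \<partial>lborel) < \<infinity>" for j using finp[of j] by (simp add: P_def nconv_def)
  have finE: "(\<integral>\<^sup>+Y. E Y \<partial>lborel) < \<infinity>" using finD by (simp add: E_def nconv_def)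
  have finQ: "(\<integral>\<^sup>+Y. Q j Y \<partial>lborel) < \<infinity>" for j
  proof -
    have "(\<integral>\<^sup>+Y. Q j Y \<partial>lborel) \<le> (\<integral>\<^sup>+Y. P j Y + E Y \<partial>lborel)"
      by (intro nn_integral_mono PQ)
    also have "\<dots> < \<infinity>" using finP[of j] finE by (simp add: nn_integral_add)
    finally show ?thesis .
  qed
  have ae: "AE Y in lborel. E Y \<noteq> \<infinity> \<and> (\<forall>j. P j Y \<noteq> \<infinity> \<and> Q j Y \<noteq> \<infinity>)"
  proof -
    have "AE Y in lborel. E Y \<noteq> \<infinity>"
      using finE by (intro nn_integral_noteq_infinite) auto
    moreover have "AE Y in lborel. P j Y \<noteq> \<infinity>" "AE Y in lborel. Q j Y \<noteq> \<infinity>" for j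
      using finP[of j] finQ[of j] by (intro nn_integral_noteq_infinite; simp)+
    ultimately show ?thesis
      by (simp add: AE_all_countable)
  qed
  have bd: "\<bar>enn2real (P j Y) - enn2real (Q j Y)\<bar> \<le> enn2real (E Y)"
    if fin: "E Y \<noteq> \<infinity> \<and> (\<forall>j. P j Y \<noteq> \<infinity> \<and> Q j Y \<noteq> \<infinity>)" for j Y
  proof -
    obtain a b c where abc: "P j Y = ennreal a" "0 \<le> a" "Q j Y = ennreal b" "0 \<le> b" "E Y = ennreal c" "0 \<le> c"
      using fin[THEN conjunct1] fin[THEN conjunct2, rule_format, of j]
      by (cases "P j Y"; cases "Q j Y"; cases "E Y") auto
    have "ennreal a \<le> ennreal (b + c)" "ennreal b \<le> ennreal (a + c)"
      using PQ[of j Y] abc by (simp_all add: ennreal_plus)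
    then show ?thesis
      using abc by (simp add: ennreal_le_iff abs_le_iff del: ennreal_plus)
  qed
  have ptlim: "(\<lambda>j. enn2real (P j Y) - enn2real (Q j Y)) \<longlonglongrightarrow> n Y * l (X - Y)" for Y
  proof (cases "n Y = 0")
    case False
    have "(\<lambda>j. n Y * (enn2real (p j (X - Y)) - enn2real (q j (X - Y)))) \<longlonglongrightarrow> n Y * l (X - Y)"
      by (intro tendsto_intros lim False)
    then show ?thesis by (simp add: P_def Q_def enn2real_mult n0 right_diff_distrib)
  qed (simp add: P_def Q_def)
  have "(\<lambda>j. \<integral>Y. enn2real (P j Y) - enn2real (Q j Y) \<partial>lborel) \<longlonglongrightarrow> (\<integral>Y. n Y * l (X - Y) \<partial>lborel)"
    and int: "integrable lborel (\<lambda>Y. n Y * l (X - Y))"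
  proof -
    have w: "integrable lborel (\<lambda>Y. enn2real (E Y))"
      using finE by (intro enn2real_nn_integral) auto
    have b: "AE Y in lborel. norm (enn2real (P j Y) - enn2real (Q j Y)) \<le> enn2real (E Y)" for j
      using ae by (rule AE_mp) (intro AE_I2 impI, simp only: real_norm_def, erule bd)
    show "(\<lambda>j. \<integral>Y. enn2real (P j Y) - enn2real (Q j Y) \<partial>lborel) \<longlonglongrightarrow> (\<integral>Y. n Y * l (X - Y) \<partial>lborel)"
      by (rule integral_dominated_convergence[OF _ _ w _ b]) (auto simp: ptlim)
    show "integrable lborel (\<lambda>Y. n Y * l (X - Y))"
      by (rule integrable_dominated_convergence[where s = "\<lambda>j Y. enn2real (P j Y) - enn2real (Q j Y)", OF _ _ w _ b]) (auto simp: ptlim)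
  qed
  moreover have "(\<integral>Y. enn2real (P j Y) - enn2real (Q j Y) \<partial>lborel) = enn2real (nconv ?n (p j) X) - enn2real (nconv ?n (q j) X)" for j
    using enn2real_nn_integral[OF _ finP[of j]] enn2real_nn_integral[OF _ finQ[of j]]
    by (simp add: P_def Q_def nconv_def)
  moreover have nl: "nconv ?n (\<lambda>Y. ennreal (l Y)) X = ennreal (\<integral>Y. n Y * l (X - Y) \<partial>lborel)"
  proof -
    have "nconv ?n (\<lambda>Y. ennreal (l Y)) X = (\<integral>\<^sup>+Y. ennreal (n Y * l (X - Y)) \<partial>lborel)"
      unfolding nconv_def by (intro nn_integral_cong) (simp add: ennreal_mult n0 l0)
    also have "\<dots> = ennreal (\<integral>Y. n Y * l (X - Y) \<partial>lborel)"
      using int by (intro nn_integral_eq_integral) (auto simp: n0 l0)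
    finally show ?thesis .
  qed
  moreover have "0 \<le> (\<integral>Y. n Y * l (X - Y) \<partial>lborel)"
    by (intro Bochner_Integration.integral_nonneg mult_nonneg_nonneg n0 l0)
  ultimately show ?thesis
    by simp
qed

text \<open>A squared truncated paraboloid, for \<open>k > 0\<close> supported in the ball of radius
  \<open>1 / k\<close>. Its gradient is Lipschitz, which gives quadratic second differences with
  explicit constants. The mass is left unnormalised, since convolutions with it are only compared
  with each other.\<close>

definition bump :: "real \<Rightarrow> 'b::real_normed_vector \<Rightarrow> real" where
  "bump k Y = (max 0 (1 - (k * norm Y)\<^sup>2))\<^sup>2"

lemma bump_nonneg[simp]: "0 \<le> bump k Y"
  by (simp add: bump_def)

lemma bump_le_1: "bump k Y \<le> 1"
  by (simp add: bump_def max_def power_le_one)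

lemma bump_continuous: "continuous_on UNIV (bump k)"
  unfolding bump_def[abs_def] by (intro continuous_intros)

lemma bump_measurable[measurable]: "bump k \<in> borel_measurable borel"
  by (intro borel_measurable_continuous_onI bump_continuous)

lemma bump_eq_0: "0 < k \<Longrightarrow> 1 \<le> k * norm Y \<Longrightarrow> bump k Y = 0"
  using one_le_power[of "k * norm Y" 2] by (simp add: bump_def)

lemma bump_pos: "0 \<le> k \<Longrightarrow> k * norm Y < 1 \<Longrightarrow> 0 < bump k Y"
  using abs_square_less_1[of "k * norm Y"] by (simp add: bump_def)

lemma max_sq_lipschitz:
  fixes a b :: real
  assumes "a \<le> 1" "b \<le> 1"
  shows "\<bar>(max 0 a)\<^sup>2 - (max 0 b)\<^sup>2\<bar> \<le> 2 * \<bar>a - b\<bar>"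
proof -
  have "\<bar>(max 0 a)\<^sup>2 - (max 0 b)\<^sup>2\<bar> = \<bar>max 0 a + max 0 b\<bar> * \<bar>max 0 a - max 0 b\<bar>"
    unfolding abs_mult[symmetric] by (rule arg_cong[where f = abs]) (simp add: power2_eq_square algebra_simps)
  also have "\<dots> \<le> 2 * \<bar>a - b\<bar>"
    using assms by (intro mult_mono) auto
  finally show ?thesis .
qed

text \<open>The square of the positive part has the derivative \<open>2 * max 0 v\<close>, which is
  Lipschitz with constant 2; the cases below make the resulting bound explicit.\<close>

lemma max_sq_second_difference:
  fixes v h :: real
  shows "\<bar>(max 0 (v + h))\<^sup>2 + (max 0 (v - h))\<^sup>2 - 2 * (max 0 v)\<^sup>2\<bar> \<le> 2 * h\<^sup>2"
proof -
  have *: "\<bar>(max 0 (v + h))\<^sup>2 + (max 0 (v - h))\<^sup>2 - 2 * (max 0 v)\<^sup>2\<bar> \<le> 2 * h\<^sup>2" if "0 \<le> h" for h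
  proof (cases "v \<le> 0")
    case True
    have "(max 0 (v + h))\<^sup>2 \<le> h\<^sup>2" using True that by (intro power_mono) auto
    moreover have "max 0 (v - h) = 0" "max 0 v = 0" using True that by auto
    ultimately have "\<bar>(max 0 (v + h))\<^sup>2 + (max 0 (v - h))\<^sup>2 - 2 * (max 0 v)\<^sup>2\<bar> \<le> h\<^sup>2" by simp
    also have "h\<^sup>2 \<le> 2 * h\<^sup>2" by simp
    finally show ?thesis .
  next
    case False
    show ?thesis
    proof (cases "h \<le> v")
      case True
      then show ?thesis using False that by (simp add: max_def power2_eq_square algebra_simps)
    next
      case nh: False
      have e: "(max 0 (v + h))\<^sup>2 + (max 0 (v - h))\<^sup>2 - 2 * (max 0 v)\<^sup>2 = h\<^sup>2 + 2 * v * h - v\<^sup>2"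
        using nh False that by (simp add: max_def power2_eq_square algebra_simps)
      have "0 \<le> (h - v) * (h - v)" by simp
      then have a1: "2 * (v * h) \<le> h * h + v * v" by (simp add: algebra_simps)
      have a2: "v * v \<le> v * h" "0 \<le> v * h" "0 \<le> h * h" using nh False that by (auto intro: mult_left_mono)
      have "h * h + 2 * (v * h) - v * v \<le> 2 * (h * h)" "- (h * h + 2 * (v * h) - v * v) \<le> 2 * (h * h)"
        using a1 a2 by linarith+
      then show ?thesis
        unfolding e by (simp add: abs_le_iff power2_eq_square mult.assoc)
    qed
  qed
  show ?thesis
    using *[of h] *[of "- h"] by (cases "0 \<le> h") (auto simp: add.commute)
qed

lemma bump_time_lipschitz:
  fixes Y :: "'a::euclidean_space \<times> real"
  assumes "norm Y \<le> 4" "0 < r" "r < 1"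
  shows "\<bar>bump k Y - bump k (fst Y, snd Y - r)\<bar> \<le> 18 * k\<^sup>2 * r"
proof -
  have n: "(norm Y)\<^sup>2 = (norm (fst Y))\<^sup>2 + (snd Y)\<^sup>2" for Y :: "'a \<times> real"
    by (simp add: norm_prod_def)
  have t: "\<bar>snd Y\<bar> \<le> 4" using norm_snd_le[of "snd Y" "fst Y"] assms(1) by simp
  have "\<bar>bump k Y - bump k (fst Y, snd Y - r)\<bar> \<le> 2 * \<bar>(1 - (k * norm Y)\<^sup>2) - (1 - (k * norm (fst Y, snd Y - r))\<^sup>2)\<bar>"
    unfolding bump_def by (rule max_sq_lipschitz) auto
  also have "(1 - (k * norm Y)\<^sup>2) - (1 - (k * norm (fst Y, snd Y - r))\<^sup>2) = k\<^sup>2 * (r * (r - 2 * snd Y))"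
    by (simp only: power_mult_distrib n fst_conv snd_conv) (simp add: power2_eq_square algebra_simps)
  \<comment> \<open>\<open>\<bar>r - 2 * snd Y\<bar>\<close> is at most 1 + 8.\<close>
  also have "\<bar>\<dots>\<bar> \<le> k\<^sup>2 * (r * 9)"
    using assms t by (simp add: abs_mult) (intro mult_left_mono, auto)
  finally show ?thesis by (simp add: mult_ac)
qed

lemma bump_space_second_difference:
  fixes Y :: "'a::euclidean_space \<times> real" and t :: real
  assumes "norm Y \<le> 4"
  shows "\<bar>bump k (fst Y + z, t) + bump k (fst Y - z, t) - 2 * bump k (fst Y, t)\<bar> \<le> (128 * k ^ 4 + 4 * k\<^sup>2) * (norm z)\<^sup>2"
proof -
  define x where "x = fst Y"
  have n: "(norm Y)\<^sup>2 = (norm (fst Y))\<^sup>2 + (snd Y)\<^sup>2" for Y :: "'a \<times> real"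
    by (simp add: norm_prod_def)
  have x: "norm x \<le> 4" using norm_fst_le[of "fst Y" "snd Y"] assms by (simp add: x_def)
  \<comment> \<open>Expanding the squared norms gives \<open>v - h\<close> and \<open>v + h\<close>:
    the even part \<open>k^2 * (norm z)^2\<close> moves the centre from \<open>A\<close> to
    \<open>v\<close>, the odd part \<open>h\<close> enters as a second difference. From
    \<open>norm x \<le> 4\<close> comes
    \<open>2 * h^2 \<le> 8 * 16 * k^4 * (norm z)^2\<close>.\<close>
  define A where "A = 1 - (k * norm (x, t))\<^sup>2"
  define v where "v = A - k\<^sup>2 * (norm z)\<^sup>2"
  define h where "h = 2 * k\<^sup>2 * (x \<bullet> z)"
  have e: "1 - (k * norm (x + z, t))\<^sup>2 = v - h" "1 - (k * norm (x - z, t))\<^sup>2 = v + h"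
    by (simp_all only: v_def A_def h_def power_mult_distrib n fst_conv snd_conv)
      (simp_all add: power2_norm_eq_inner inner_add_left inner_add_right
        inner_diff_left inner_diff_right inner_commute algebra_simps)
  have gen: "\<bar>a + b - 2 * d\<bar> \<le> \<bar>b + a - 2 * c\<bar> + 2 * \<bar>c - d\<bar>" for a b c d :: real
  proof -
    have "a + b - 2 * d = (b + a - 2 * c) + 2 * (c - d)" by simp
    then show ?thesis
      using abs_triangle_ineq[of "b + a - 2 * c" "2 * (c - d)"] by (simp only: abs_mult abs_numeral)
  qed
  have "\<bar>(max 0 (v - h))\<^sup>2 + (max 0 (v + h))\<^sup>2 - 2 * (max 0 A)\<^sup>2\<bar>
     \<le> \<bar>(max 0 (v + h))\<^sup>2 + (max 0 (v - h))\<^sup>2 - 2 * (max 0 v)\<^sup>2\<bar> + 2 * \<bar>(max 0 v)\<^sup>2 - (max 0 A)\<^sup>2\<bar>"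
    by (rule gen)
  also have "\<dots> \<le> 2 * h\<^sup>2 + 2 * (2 * \<bar>v - A\<bar>)"
    by (intro add_mono max_sq_second_difference mult_left_mono max_sq_lipschitz) (auto simp: v_def A_def intro: order_trans[of _ 0])
  also have "\<bar>v - A\<bar> = k\<^sup>2 * (norm z)\<^sup>2" by (simp add: v_def)
  also have "2 * h\<^sup>2 \<le> 128 * k ^ 4 * (norm z)\<^sup>2"
  proof -
    have "\<bar>x \<bullet> z\<bar> \<le> 4 * norm z"
      using Cauchy_Schwarz_ineq2[of x z] mult_right_mono[OF x, of "norm z"] by simp
    then have "(x \<bullet> z)\<^sup>2 \<le> (4 * norm z)\<^sup>2" by (subst power2_abs[symmetric], intro power_mono) auto
    then have "8 * k ^ 4 * (x \<bullet> z)\<^sup>2 \<le> 8 * k ^ 4 * (4 * norm z)\<^sup>2" by (intro mult_left_mono) auto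
    then show ?thesis by (simp add: h_def power_mult_distrib power2_eq_square power4_eq_xxxx mult_ac)
  qed
  finally show ?thesis
    unfolding bump_def x_def[symmetric] e A_def[symmetric] by (simp add: algebra_simps)
qed

lemma growth_le_ball: "0 \<le> M \<Longrightarrow> norm Y \<le> R \<Longrightarrow> growth M Y \<le> 1 + R powr (2 * M) + R powr M"
  using norm_fst_le[of "fst Y" "snd Y"] norm_snd_le[of "snd Y" "fst Y"] unfolding growth_def
  by (intro add_mono powr_mono2 order_refl) auto

lemma bump_growth_finite:
  fixes k :: real
  assumes "0 \<le> M" "1 \<le> k"
  shows "(\<integral>\<^sup>+Y. ennreal (bump k Y) * ennreal (growth M (Y :: 'a::euclidean_space \<times> real)) \<partial>lborel) < \<infinity>"
proof -
  have "(\<integral>\<^sup>+Y. ennreal (bump k Y) * ennreal (growth M (Y :: 'a \<times> real)) \<partial>lborel)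
    \<le> (\<integral>\<^sup>+Y. ennreal 3 * indicator (cball 0 1 :: ('a \<times> real) set) Y \<partial>lborel)"
  proof (rule nn_integral_mono)
    fix Y :: "'a \<times> real"
    show "ennreal (bump k Y) * ennreal (growth M Y) \<le> ennreal 3 * indicator (cball 0 1) Y"
    proof (cases "norm Y \<le> 1")
      case True
      have "bump k Y * growth M Y \<le> 1 * 3"
        using growth_le_ball[OF assms(1) True] bump_le_1[of k Y] by (intro mult_mono) auto
      then have "ennreal (bump k Y * growth M Y) \<le> ennreal 3" by (intro ennreal_leI) simp
      then show ?thesis using True by (simp add: ennreal_mult)
    next
      case False
      then have "1 \<le> k * norm Y" using assms(2) mult_mono[of 1 k 1 "norm Y"] by simp
      then show ?thesis using assms(2) bump_eq_0[of k Y] by simp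
    qed
  qed
  also have "\<dots> = ennreal 3 * emeasure lborel (cball 0 1 :: ('a \<times> real) set)"
    by (rule nn_integral_cmult_indicator) simp
  also have "\<dots> < \<infinity>"
    using emeasure_compact_finite[of "cball 0 1 :: ('a \<times> real) set"] by (simp add: ennreal_mult_less_top less_top)
  finally show ?thesis .
qed

text \<open>\<open>frac_gap_le\<close> with \<open>b = 1\<close>. The decay in \<open>Y\<close> is
  the point: far from the support the local constant is 0 and only the convolution of the weight
  with the bump remains, which \<open>nconv_weight_le\<close> bounds by the weight.\<close>

lemma bump_frac_gap_le:
  fixes k :: real
  assumes s: "0 < s" "s < 1" and M: "M = DIM('a::euclidean_space) / 2 + 1 + s" and k: "1 \<le> k"
  obtains C where "0 \<le> C"
    "\<And>Y :: 'a \<times> real. frac_gap s (bump k) Y \<le> ennreal C * ennreal (1 / growth M Y)"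
    "\<And>Y :: 'a \<times> real. ennreal (bump k Y) \<le> ennreal C * ennreal (1 / growth M Y)"
proof -
  have M0: "0 \<le> M" using M s by simp
  have z0: "bump k Y = 0" if "1 \<le> norm Y" for Y :: "'a \<times> real"
    using that k mult_mono[of 1 k 1 "norm Y"] by (intro bump_eq_0) auto
  obtain C0 where C0: "0 \<le> C0" and gap: "\<And>(F :: 'a \<times> real \<Rightarrow> real) X c. F \<in> borel_measurable borel \<Longrightarrow> (\<And>Y. 0 \<le> F Y) \<Longrightarrow> 0 \<le> c
      \<Longrightarrow> (\<And>r. 0 < r \<Longrightarrow> r < 1 \<Longrightarrow> \<bar>F X - F (fst X, snd X - r)\<bar> \<le> c * r powr 1)
      \<Longrightarrow> (\<And>r z. 0 < r \<Longrightarrow> r < 1 \<Longrightarrow> norm z < 1 \<Longrightarrow>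
            \<bar>F (fst X + z, snd X - r) + F (fst X - z, snd X - r) - 2 * F (fst X, snd X - r)\<bar> \<le> c * norm z powr (2 * 1))
      \<Longrightarrow> frac_gap s F X \<le> ennreal (C0 * (c + F X)) + ennreal C0 * nconv (\<lambda>Y. ennreal (1 / growth M Y)) (\<lambda>Y. ennreal (F Y)) X"
    using frac_gap_le[OF s(1) s(2) order_refl M] by metis
  define J where "J = enn2real (\<integral>\<^sup>+Y. ennreal (bump k Y) * ennreal (growth M (Y :: 'a \<times> real)) \<partial>lborel)"
  have J: "(\<integral>\<^sup>+Y. ennreal (bump k Y) * ennreal (growth M (Y :: 'a \<times> real)) \<partial>lborel) = ennreal J"
    using bump_growth_finite[OF M0 k, where 'a='a] by (simp add: J_def)
  have J0: "0 \<le> J" by (simp add: J_def)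
  define g where "g = 1 + 4 powr (2 * M) + 4 powr M"
  have g: "1 \<le> g" by (simp add: g_def)
  define c where "c = 18 * k\<^sup>2 + (128 * k ^ 4 + 4 * k\<^sup>2)"
  have c: "0 \<le> c" "18 * k\<^sup>2 \<le> c" "128 * k ^ 4 + 4 * k\<^sup>2 \<le> c" by (auto simp: c_def)
  define C where "C = C0 * ((c + 1) * g) + C0 * (2 powr (2 * M + 1) * J) + g"
  have C: "0 \<le> C" "g \<le> C" using C0 c g J0 by (auto simp: C_def)
  have conv: "nconv (\<lambda>Y. ennreal (1 / growth M Y)) (\<lambda>Y. ennreal (bump k Y)) X \<le> ennreal (2 powr (2 * M + 1) * J / growth M X)" for X :: "'a \<times> real"
  proof -
    have "nconv (\<lambda>Y. ennreal (1 / growth M Y)) (\<lambda>Y. ennreal (bump k Y)) X = nconv (\<lambda>Y. ennreal (bump k Y)) (\<lambda>Y. ennreal (1 / growth M Y)) X"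
      by (subst nconv_commute) auto
    also have "\<dots> \<le> ennreal (2 powr (2 * M + 1) / growth M X) * ennreal J"
      unfolding J[symmetric] by (intro nconv_weight_le M0) measurable
    finally show ?thesis using J0 by (simp add: ennreal_mult''[symmetric] mult_ac)
  qed
  show ?thesis
  proof (rule that[OF C(1)])
    fix Y :: "'a \<times> real"
    have le_g: "a \<le> a * g / growth M Y" if "norm Y \<le> 4" "0 \<le> a" for a
    proof -
      have "1 \<le> g / growth M Y" using growth_le_ball[OF M0 that(1)] by (simp add: g_def)
      then show ?thesis using mult_left_mono[of 1 "g / growth M Y" a] that by simp
    qed
    \<comment> \<open>The differences at \<open>Y\<close> reach points at distance at most 2 from
      \<open>Y\<close>, so for \<open>norm Y > 4\<close> all of them lie outside the
      support.\<close>
    define c' where "c' = (if norm Y \<le> 4 then c else 0)"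
    have b: "c' + bump k Y \<le> (c + 1) * g / growth M Y"
    proof (cases "norm Y \<le> 4")
      case True
      have "c' + bump k Y \<le> c + 1" using True bump_le_1[of k Y] by (simp add: c'_def)
      also have "\<dots> \<le> (c + 1) * g / growth M Y" using True c by (intro le_g) auto
      finally show ?thesis .
    next
      case False
      then show ?thesis using z0[of Y] c g by (simp add: c'_def)
    qed
    show "ennreal (bump k Y) \<le> ennreal C * ennreal (1 / growth M Y)"
    proof (cases "norm Y \<le> 4")
      case True
      have "bump k Y \<le> 1 * g / growth M Y" using le_g[OF True, of 1] bump_le_1[of k Y] by linarith
      also have "\<dots> \<le> C / growth M Y" using C by (intro divide_right_mono) auto
      finally show ?thesis using C by (simp add: ennreal_mult'[symmetric] ennreal_leI)
    qed (use z0[of Y] in simp)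
    have "frac_gap s (bump k) Y \<le> ennreal (C0 * (c' + bump k Y)) + ennreal C0 * nconv (\<lambda>Y. ennreal (1 / growth M Y)) (\<lambda>Y. ennreal (bump k Y)) Y"
    proof (rule gap)
      show "0 \<le> c'" using c by (simp add: c'_def)
      fix r :: real assume r: "0 < r" "r < 1"
      show "\<bar>bump k Y - bump k (fst Y, snd Y - r)\<bar> \<le> c' * r powr 1"
      proof (cases "norm Y \<le> 4")
        case True
        have "18 * k\<^sup>2 * r \<le> c * r" using c r by (intro mult_right_mono) auto
        from order_trans[OF bump_time_lipschitz[OF True r, of k] this] show ?thesis
          using True r by (simp add: c'_def)
      next
        case False
        have "norm Y - norm (0 :: 'a, r) \<le> norm (Y - (0, r))" by (rule norm_triangle_ineq2)
        then have "1 \<le> norm (fst Y, snd Y - r)" using False r by (cases Y) simp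
        then show ?thesis using z0[of Y] z0[of "(fst Y, snd Y - r)"] False c by (simp add: c'_def)
      qed
      fix z :: 'a assume z: "norm z < 1"
      show "\<bar>bump k (fst Y + z, snd Y - r) + bump k (fst Y - z, snd Y - r) - 2 * bump k (fst Y, snd Y - r)\<bar> \<le> c' * norm z powr (2 * 1)"
      proof (cases "norm Y \<le> 4")
        case True
        have "(128 * k ^ 4 + 4 * k\<^sup>2) * (norm z)\<^sup>2 \<le> c * (norm z)\<^sup>2" using c by (intro mult_right_mono) auto
        from order_trans[OF bump_space_second_difference[OF True, of k z "snd Y - r"] this] show ?thesis
          using True by (simp add: c'_def)
      next
        case False
        have far: "1 \<le> norm (fst Y + w, snd Y - r)" if "norm w < 1" for w
        proof -
          have "norm Y - norm (- w, r) \<le> norm (Y - (- w, r))" by (rule norm_triangle_ineq2)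
          moreover have "norm (- w, r) \<le> 2" using norm_Pair_le[of "- w" r] that r by simp
          ultimately show ?thesis using False by (cases Y) simp
        qed
        show ?thesis
          using z0[OF far[OF z]] z0[OF far[of "- z"]] z0[OF far[of 0]] z False c by (simp add: c'_def)
      qed
    qed auto
    also have "\<dots> \<le> ennreal (C0 * ((c + 1) * g / growth M Y)) + ennreal C0 * ennreal (2 powr (2 * M + 1) * J / growth M Y)"
      using b C0 conv by (intro add_mono mult_left_mono ennreal_leI) auto
    also have "\<dots> = ennreal (C0 * ((c + 1) * g / growth M Y) + C0 * (2 powr (2 * M + 1) * J / growth M Y))"
      using C0 c g J0 by (simp add: ennreal_mult'[symmetric] ennreal_plus[symmetric] del: ennreal_plus)
    also have "\<dots> \<le> ennreal (C * (1 / growth M Y))"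
    proof (rule ennreal_leI)
      have "C * (1 / growth M Y) = C0 * ((c + 1) * g / growth M Y) + C0 * (2 powr (2 * M + 1) * J / growth M Y) + g / growth M Y"
        by (simp only: C_def mult_1_right times_divide_eq_right add_divide_distrib)
      moreover have "0 \<le> g / growth M Y" using g by simp
      ultimately show "C0 * ((c + 1) * g / growth M Y) + C0 * (2 powr (2 * M + 1) * J / growth M Y) \<le> C * (1 / growth M Y)"
        by linarith
    qed
    also have "\<dots> = ennreal C * ennreal (1 / growth M Y)"
      by (rule ennreal_mult'[OF C(1)])
    finally show "frac_gap s (bump k) Y \<le> ennreal C * ennreal (1 / growth M Y)" .
  qed
qed

text \<open>The assumption \<open>lim\<close> is the equation \<open>(\<partial>\<^sub>t - \<Delta>)\<^sup>s u = g\<close>, multiplied by \<open>\<kappa> = \<bar>\<Gamma>(-s)\<bar>\<close> and expressed by the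
  truncations at \<open>d = 1 / (j + 1)\<close>.\<close>

locale frac_solution =
  fixes s M \<kappa> :: real and u g :: "'a::euclidean_space \<times> real \<Rightarrow> real"
  assumes s: "0 < s" "s < 1" and M: "M = DIM('a) / 2 + 1 + s"
    and \<kappa>: "\<kappa> = Gamma (1 - s) / s"
    and u_cont: "continuous_on UNIV u" and u0: "\<And>Y. 0 \<le> u Y"
    and g_cont: "continuous_on UNIV g" and g0: "\<And>Y. 0 \<le> g Y"
    and slow: "(\<integral>\<^sup>+Y. ennreal (u Y) * ennreal (1 / growth M Y) \<partial>lborel) < \<infinity>"
    and gap: "\<And>R. \<exists>C. \<forall>X. norm X \<le> R \<longrightarrow> frac_gap s u X \<le> ennreal C"
    and lim: "\<And>X. (\<lambda>j. inverse (real (Suc j)) powr (- s) / s * u X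
        - enn2real (nconv (stker (fjump s (inverse (real (Suc j))))) (\<lambda>Y. ennreal (u Y)) X)) \<longlonglongrightarrow> \<kappa> * g X"
begin

abbreviation eu :: "'a \<times> real \<Rightarrow> ennreal" where "eu \<equiv> \<lambda>Y. ennreal (u Y)"
abbreviation eg :: "'a \<times> real \<Rightarrow> ennreal" where "eg \<equiv> \<lambda>Y. ennreal (g Y)"
abbreviation wt :: "'a \<times> real \<Rightarrow> ennreal" where "wt \<equiv> \<lambda>Y. ennreal (1 / growth M Y)"
abbreviation bm :: "real \<Rightarrow> 'a \<times> real \<Rightarrow> ennreal" where "bm k \<equiv> \<lambda>Y. ennreal (bump k Y)"
abbreviation dl :: "nat \<Rightarrow> real" where "dl j \<equiv> inverse (real (Suc j))"
abbreviation jk :: "nat \<Rightarrow> 'a \<times> real \<Rightarrow> ennreal" where "jk j \<equiv> stker (fjump s (dl j))"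

section \<open>Mollification of a solution\<close>

lemma M0: "0 \<le> M" using M s by simp

lemma dl_pos: "0 < dl j" by simp

lemma kappa_pos: "0 < \<kappa>" using s by (simp add: \<kappa> Gamma_real_pos)

lemma u_meas[measurable]: "u \<in> borel_measurable borel"
  by (rule borel_measurable_continuous_onI[OF u_cont])

lemma g_meas[measurable]: "g \<in> borel_measurable borel"
  by (rule borel_measurable_continuous_onI[OF g_cont])

lemma u_wt_finite: "nconv eu wt X < \<infinity>"
proof -
  have "nconv eu wt X \<le> ennreal (2 powr (2 * M + 1) * growth M X) * (\<integral>\<^sup>+Y. ennreal (u Y) * ennreal (1 / growth M Y) \<partial>lborel)"
    by (rule nconv_weight_le'[OF M0]) measurable
  also have "\<dots> < \<infinity>" using slow by (simp add: ennreal_mult_less_top)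
  finally show ?thesis .
qed

lemma wt_u_finite: "nconv wt eu X < \<infinity>"
  using u_wt_finite[of X] by (subst nconv_commute) auto

lemma conv_u_finite:
  assumes [measurable]: "K \<in> borel_measurable borel" and "\<And>Y. K Y \<le> ennreal C * wt Y"
  shows "nconv K eu X < \<infinity>"
proof -
  have "nconv K eu X \<le> nconv (\<lambda>Y. ennreal C * wt Y) eu X" by (intro nconv_mono assms) auto
  also have "\<dots> = ennreal C * nconv wt eu X" by (rule nconv_cmult_left) measurable
  also have "\<dots> < \<infinity>" using wt_u_finite by (simp add: ennreal_mult_less_top)
  finally show ?thesis .
qed

definition ut :: "real \<Rightarrow> 'a \<times> real \<Rightarrow> real" where "ut k X = enn2real (nconv (bm k) eu X)"
definition gt :: "real \<Rightarrow> 'a \<times> real \<Rightarrow> real" where "gt k X = enn2real (nconv (bm k) eg X)"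

lemma bump_nonzero: "1 \<le> k \<Longrightarrow> bump k Y \<noteq> 0 \<Longrightarrow> norm Y < 1"
  using bump_eq_0[of k Y] mult_mono[of 1 k 1 "norm Y"] by fastforce

lemma bump_integral_finite:
  assumes "1 \<le> k"
  shows "(\<integral>\<^sup>+Y. bm k Y \<partial>lborel) < \<infinity>"
proof -
  have "(\<integral>\<^sup>+Y. bm k Y \<partial>lborel) \<le> (\<integral>\<^sup>+Y. bm k Y * ennreal (growth M Y) \<partial>lborel)"
  proof (rule nn_integral_mono)
    fix Y :: "'a \<times> real"
    have "bm k Y * ennreal 1 \<le> bm k Y * ennreal (growth M Y)"
      by (intro mult_left_mono ennreal_leI growth_ge_1) simp
    then show "bm k Y \<le> bm k Y * ennreal (growth M Y)" by simp
  qed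
  also have "\<dots> < \<infinity>" by (rule bump_growth_finite[OF M0 assms])
  finally show ?thesis .
qed

lemma bump_conv_finite:
  fixes F :: "'a \<times> real \<Rightarrow> real"
  assumes k: "1 \<le> k" and F: "continuous_on UNIV F"
  obtains B where "\<And>X Y. norm X \<le> R \<Longrightarrow> bump k Y \<noteq> 0 \<Longrightarrow> \<bar>F (X - Y)\<bar> \<le> B" "0 \<le> B"
proof -
  have "bounded (F ` cball 0 (R + 1))"
    using F by (intro compact_imp_bounded compact_continuous_image) (auto intro: continuous_on_subset)
  then obtain B where B: "\<forall>Z\<in>cball 0 (R + 1). norm (F Z) \<le> B" by (auto simp: bounded_iff)
  show ?thesis
  proof (rule that[of "max 0 B"])
    fix X Y :: "'a \<times> real" assume X: "norm X \<le> R" and "bump k Y \<noteq> 0"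
    then have "norm (X - Y) \<le> R + 1"
      using bump_nonzero[OF k] norm_triangle_ineq4[of X Y] by fastforce
    with B show "\<bar>F (X - Y)\<bar> \<le> max 0 B" by (auto simp: max.coboundedI2)
  qed simp
qed

text \<open>Along a convergent sequence of base points the arguments \<open>X - Y\<close> with
  \<open>bump k Y \<noteq> 0\<close> stay in one ball, on which \<open>F\<close> is bounded; the
  bound times the bump is the majorant.\<close>

lemma bump_conv_continuous:
  fixes F :: "'a \<times> real \<Rightarrow> real"
  assumes k: "1 \<le> k" and F: "continuous_on UNIV F" and F0: "\<And>Y. 0 \<le> F Y"
  shows "isCont (\<lambda>X. enn2real (nconv (bm k) (\<lambda>Y. ennreal (F Y)) X)) X"
    and "nconv (bm k) (\<lambda>Y. ennreal (F Y)) X < \<infinity>"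
proof -
  have [measurable]: "F \<in> borel_measurable borel" by (rule borel_measurable_continuous_onI[OF F])
  have contF: "isCont F Z" for Z
    using continuous_on_eq_continuous_at[OF open_UNIV, of F] F by blast
  have w: "integrable lborel (\<lambda>Y. B * bump k (Y :: 'a \<times> real))" for B
    using bump_integral_finite[OF k] by (intro integrable_mult_right integrableI_nonneg) auto
  have eq: "enn2real (nconv (bm k) (\<lambda>Y. ennreal (F Y)) X) = (\<integral>Y. bump k Y * F (X - Y) \<partial>lborel)" for X
    unfolding nconv_def by (subst integral_eq_nn_integral) (auto simp: F0 ennreal_mult)
  show "nconv (bm k) (\<lambda>Y. ennreal (F Y)) X < \<infinity>"
  proof -
    obtain B where B: "\<And>X' Y. norm X' \<le> norm X \<Longrightarrow> bump k Y \<noteq> 0 \<Longrightarrow> \<bar>F (X' - Y)\<bar> \<le> B" "0 \<le> B"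
      using bump_conv_finite[OF k F] by metis
    have "nconv (bm k) (\<lambda>Y. ennreal (F Y)) X \<le> (\<integral>\<^sup>+Y. ennreal B * bm k Y \<partial>lborel)"
      unfolding nconv_def
    proof (rule nn_integral_mono)
      fix Y
      show "bm k Y * ennreal (F (X - Y)) \<le> ennreal B * bm k Y"
      proof (cases "bump k Y = 0")
        case False
        then have "ennreal (F (X - Y)) \<le> ennreal B" using B(1)[of X Y] F0 by (intro ennreal_leI) simp
        then show ?thesis by (metis mult.commute mult_right_mono zero_le)
      qed simp
    qed
    also have "\<dots> < \<infinity>" using bump_integral_finite[OF k] by (simp add: nn_integral_cmult ennreal_mult_less_top)
    finally show ?thesis .
  qed
  show "isCont (\<lambda>X. enn2real (nconv (bm k) (\<lambda>Y. ennreal (F Y)) X)) X"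
    unfolding eq continuous_at_sequentially
  proof (intro allI impI)
    fix Z :: "nat \<Rightarrow> 'a \<times> real" assume Z: "Z \<longlonglongrightarrow> X"
    obtain R where R: "\<And>i. norm (Z i) \<le> R" using Z by (meson Bseq_def convergentI convergent_imp_Bseq)
    obtain B where B: "\<And>X' Y. norm X' \<le> R \<Longrightarrow> bump k Y \<noteq> 0 \<Longrightarrow> \<bar>F (X' - Y)\<bar> \<le> B" "0 \<le> B"
      using bump_conv_finite[OF k F] by metis
    show "((\<lambda>X. \<integral>Y. bump k Y * F (X - Y) \<partial>lborel) \<circ> Z) \<longlonglongrightarrow> (\<integral>Y. bump k Y * F (X - Y) \<partial>lborel)"
      unfolding comp_def
    proof (rule integral_dominated_convergence[OF _ _ w[of B]])
      show "AE Y in lborel. (\<lambda>i. bump k Y * F (Z i - Y)) \<longlonglongrightarrow> bump k Y * F (X - Y)"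
        by (intro AE_I2 tendsto_intros isCont_tendsto_compose[of _ F] Z contF)
      show "AE Y in lborel. norm (bump k Y * F (Z i - Y)) \<le> B * bump k Y" for i
      proof (rule AE_I2)
        fix Y
        show "norm (bump k Y * F (Z i - Y)) \<le> B * bump k Y"
          using mult_left_mono[OF B(1)[OF R[of i], of Y], of "bump k Y"]
          by (cases "bump k Y = 0") (auto simp: abs_mult mult.commute)
      qed
    qed measurable
  qed
qed

lemma ut_eq: "1 \<le> k \<Longrightarrow> (\<lambda>X. ennreal (ut k X)) = nconv (bm k) eu"
  using bump_conv_continuous(2)[OF _ u_cont u0] by (simp add: ut_def fun_eq_iff)

lemma gt_eq: "1 \<le> k \<Longrightarrow> (\<lambda>X. ennreal (gt k X)) = nconv (bm k) eg"
  using bump_conv_continuous(2)[OF _ g_cont g0] by (simp add: gt_def fun_eq_iff)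

lemma ut_meas[measurable]: "ut k \<in> borel_measurable borel"
  unfolding ut_def[abs_def] by measurable

lemma gt_meas[measurable]: "gt k \<in> borel_measurable borel"
  unfolding gt_def[abs_def] by measurable

lemma ut_nonneg: "0 \<le> ut k X" and gt_nonneg: "0 \<le> gt k X"
  by (simp_all add: ut_def gt_def)

text \<open>The kernel can be made to act on \<open>u\<close>, which serves for pointwise limits, or
  on the bump, which serves for global bounds.\<close>

lemma conv_ut:
  assumes "1 \<le> k" and [measurable]: "K \<in> borel_measurable borel"
  shows "nconv K (\<lambda>X. ennreal (ut k X)) = nconv (bm k) (nconv K eu)"
    and "nconv K (\<lambda>X. ennreal (ut k X)) = nconv (nconv K (bm k)) eu"
proof -
  show 2: "nconv K (\<lambda>X. ennreal (ut k X)) = nconv (nconv K (bm k)) eu"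
    unfolding ut_eq[OF assms(1)] by (rule nconv_assoc) measurable
  have "nconv (nconv K (bm k)) eu = nconv (nconv (bm k) K) eu"
    by (subst nconv_commute[of K "bm k"]) auto
  also have "\<dots> = nconv (bm k) (nconv K eu)"
    by (rule nconv_assoc[symmetric]) measurable
  finally show "nconv K (\<lambda>X. ennreal (ut k X)) = nconv (bm k) (nconv K eu)" using 2 by simp
qed

text \<open>The bump confines the convolution to a unit ball about \<open>X\<close>, where
  \<open>gap\<close> bounds the truncation error of \<open>u\<close>; so local regularity is enough
  to pass the equation to the mollified functions.\<close>

lemma mollified_limit:
  assumes k: "1 \<le> k"
  shows "(\<lambda>j. enn2real (ennreal (dl j powr (- s) / s) * ennreal (ut k X)) - enn2real (nconv (jk j) (\<lambda>Y. ennreal (ut k Y)) X)) \<longlonglongrightarrow> \<kappa> * gt k X"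
proof -
  obtain C where C: "\<And>Z. norm Z \<le> norm X + 1 \<Longrightarrow> frac_gap s u Z \<le> ennreal C"
    using gap[of "norm X + 1"] by blast
  have gapC: "frac_gap s u (X - Y) \<le> ennreal C" if "bump k Y \<noteq> 0" for Y :: "'a \<times> real"
    using bump_nonzero[OF k that] norm_triangle_ineq4[of X Y] by (intro C) linarith
  have coef: "0 \<le> dl j powr (- s) / s" for j using s by simp
  have e1: "ennreal (dl j powr (- s) / s * u Z) = ennreal (dl j powr (- s) / s) * ennreal (u Z)" for j Z
    by (rule ennreal_mult'[OF coef])
  have "(\<lambda>j. enn2real (nconv (bm k) (\<lambda>Z. ennreal (dl j powr (- s) / s * u Z)) X) - enn2real (nconv (bm k) (nconv (jk j) eu) X))
     \<longlonglongrightarrow> enn2real (nconv (bm k) (\<lambda>Z. ennreal (\<kappa> * g Z)) X)"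
  proof (rule nconv_dominated_diff[where D = "\<lambda>_. ennreal C", THEN conjunct1])
    show "0 \<le> \<kappa> * g Y" for Y using kappa_pos g0 by simp
    fix j and Y :: "'a \<times> real" assume nz: "bump k Y \<noteq> 0"
    have "ennreal (dl j powr (- s) / s * u (X - Y)) \<le> nconv (jk j) eu (X - Y) + frac_gap s u (X - Y)"
      by (rule truncation_le(1)[OF s(1) dl_pos M u_meas u0 wt_u_finite])
    also have "\<dots> \<le> nconv (jk j) eu (X - Y) + ennreal C" by (intro add_left_mono gapC nz)
    finally show "ennreal (dl j powr (- s) / s * u (X - Y)) \<le> nconv (jk j) eu (X - Y) + ennreal C" .
    have "nconv (jk j) eu (X - Y) \<le> ennreal (dl j powr (- s) / s * u (X - Y)) + frac_gap s u (X - Y)"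
      by (rule truncation_le(2)[OF s(1) dl_pos M u_meas u0 wt_u_finite])
    also have "\<dots> \<le> ennreal (dl j powr (- s) / s * u (X - Y)) + ennreal C" by (intro add_left_mono gapC nz)
    finally show "nconv (jk j) eu (X - Y) \<le> ennreal (dl j powr (- s) / s * u (X - Y)) + ennreal C" .
  next
    fix Y :: "'a \<times> real" assume "bump k Y \<noteq> 0"
    show "(\<lambda>j. enn2real (ennreal (dl j powr (- s) / s * u (X - Y))) - enn2real (nconv (jk j) eu (X - Y))) \<longlonglongrightarrow> \<kappa> * g (X - Y)"
      using lim[of "X - Y"] u0 s by simp
  next
    show "nconv (bm k) (\<lambda>_. ennreal C) X < \<infinity>"
      using bump_integral_finite[OF k] by (simp add: nconv_def nn_integral_multc ennreal_mult_less_top)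
    show "nconv (bm k) (\<lambda>Z. ennreal (dl j powr (- s) / s * u Z)) X < \<infinity>" for j
      unfolding e1 using bump_conv_continuous(2)[OF k u_cont u0, of X] by (simp add: nconv_cmult_right ennreal_mult_less_top)
  qed (measurable, auto)
  moreover have "nconv (bm k) (\<lambda>Z. ennreal (dl j powr (- s) / s * u Z)) X = ennreal (dl j powr (- s) / s) * ennreal (ut k X)" for j
    unfolding e1 by (subst nconv_cmult_right) (auto simp: fun_cong[OF ut_eq[OF k]])
  moreover have "nconv (bm k) (nconv (jk j) eu) = nconv (jk j) (\<lambda>Y. ennreal (ut k Y))" for j
    by (rule conv_ut(1)[OF k, symmetric]) measurable
  moreover have "enn2real (nconv (bm k) (\<lambda>Z. ennreal (\<kappa> * g Z)) X) = \<kappa> * gt k X"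
  proof -
    have "nconv (bm k) (\<lambda>Z. ennreal (\<kappa> * g Z)) X = ennreal \<kappa> * nconv (bm k) eg X"
      using kappa_pos by (subst nconv_cmult_right[symmetric]) (auto simp: ennreal_mult')
    then show ?thesis using kappa_pos by (simp add: enn2real_mult gt_def)
  qed
  ultimately show ?thesis by simp
qed

text \<open>The truncation is applied to the bump instead of \<open>u\<close>. Its error decays like
  the weight, so convolving with \<open>u\<close> gives the majorant \<open>nconv eu wt\<close>,
  finite everywhere and independent of \<open>j\<close>. For \<open>u\<close> itself
  \<open>gap\<close> provides bounds on balls only.\<close>

lemma mollified_dominated:
  assumes k: "1 \<le> k"
  obtains C where "\<And>j X. ennreal (dl j powr (- s) / s) * ennreal (ut k X) \<le> nconv (jk j) (\<lambda>Y. ennreal (ut k Y)) X + ennreal C * nconv eu wt X"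
    "\<And>j X. nconv (jk j) (\<lambda>Y. ennreal (ut k Y)) X \<le> ennreal (dl j powr (- s) / s) * ennreal (ut k X) + ennreal C * nconv eu wt X"
    "\<And>Y. bm k Y \<le> ennreal C * wt Y" "0 \<le> C"
proof -
  obtain C where C: "0 \<le> C" "\<And>Y. frac_gap s (bump k) Y \<le> ennreal C * wt Y" "\<And>Y. bm k Y \<le> ennreal C * wt Y"
    using bump_frac_gap_le[OF s M k] by blast
  have wtb: "nconv wt (bm k) Y < \<infinity>" for Y
  proof -
    have "nconv wt (bm k) Y = nconv (bm k) wt Y" by (subst nconv_commute) auto
    also have "\<dots> \<le> ennreal (2 powr (2 * M + 1) / growth M Y) * (\<integral>\<^sup>+Z. bm k Z * ennreal (growth M Z) \<partial>lborel)"
      by (rule nconv_weight_le[OF M0]) measurable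
    also have "\<dots> < \<infinity>" using bump_growth_finite[OF M0 k, where 'a='a] by (simp add: ennreal_mult_less_top)
    finally show ?thesis .
  qed
  have coef: "0 \<le> dl j powr (- s) / s" for j using s by simp
  have e1: "ennreal (dl j powr (- s) / s * bump k Z) = ennreal (dl j powr (- s) / s) * bm k Z" for j and Z :: "'a \<times> real"
    by (rule ennreal_mult'[OF coef])
  have ub: "ennreal (ut k X) = nconv eu (bm k) X" for X
    unfolding fun_cong[OF ut_eq[OF k], of X] by (subst nconv_commute) auto
  have uj: "nconv (jk j) (\<lambda>Y. ennreal (ut k Y)) X = nconv eu (nconv (jk j) (bm k)) X" for j X
    unfolding conv_ut(2)[OF k stker_measurable[OF fjump_measurable]] by (subst nconv_commute) auto
  show ?thesis
  proof (rule that[OF _ _ C(3) C(1)])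
    fix j X
    have "ennreal (dl j powr (- s) / s) * ennreal (ut k X) = nconv eu (\<lambda>Y. ennreal (dl j powr (- s) / s) * bm k Y) X"
      unfolding ub by (rule nconv_cmult_right[symmetric]) measurable
    also have "\<dots> \<le> nconv eu (\<lambda>Y. nconv (jk j) (bm k) Y + ennreal C * wt Y) X"
    proof (rule nconv_mono[OF order_refl])
      fix Y
      have "ennreal (dl j powr (- s) / s) * bm k Y \<le> nconv (jk j) (bm k) Y + frac_gap s (bump k) Y"
        unfolding e1[symmetric] by (rule truncation_le(1)[OF s(1) dl_pos M bump_measurable bump_nonneg wtb])
      also have "\<dots> \<le> nconv (jk j) (bm k) Y + ennreal C * wt Y" by (intro add_left_mono C)
      finally show "ennreal (dl j powr (- s) / s) * bm k Y \<le> nconv (jk j) (bm k) Y + ennreal C * wt Y" .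
    qed
    also have "\<dots> = nconv (jk j) (\<lambda>Y. ennreal (ut k Y)) X + ennreal C * nconv eu wt X"
      unfolding uj by (simp add: nconv_add_right nconv_cmult_right)
    finally show "ennreal (dl j powr (- s) / s) * ennreal (ut k X) \<le> nconv (jk j) (\<lambda>Y. ennreal (ut k Y)) X + ennreal C * nconv eu wt X" .
    have "nconv eu (nconv (jk j) (bm k)) X \<le> nconv eu (\<lambda>Y. ennreal (dl j powr (- s) / s) * bm k Y + ennreal C * wt Y) X"
    proof (rule nconv_mono[OF order_refl])
      fix Y
      have "nconv (jk j) (bm k) Y \<le> ennreal (dl j powr (- s) / s) * bm k Y + frac_gap s (bump k) Y"
        unfolding e1[symmetric] by (rule truncation_le(2)[OF s(1) dl_pos M bump_measurable bump_nonneg wtb])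
      also have "\<dots> \<le> ennreal (dl j powr (- s) / s) * bm k Y + ennreal C * wt Y" by (intro add_left_mono C)
      finally show "nconv (jk j) (bm k) Y \<le> ennreal (dl j powr (- s) / s) * bm k Y + ennreal C * wt Y" .
    qed
    also have "\<dots> = ennreal (dl j powr (- s) / s) * ennreal (ut k X) + ennreal C * nconv eu wt X"
      unfolding ub by (simp add: nconv_add_right nconv_cmult_right)
    finally show "nconv (jk j) (\<lambda>Y. ennreal (ut k Y)) X \<le> ennreal (dl j powr (- s) / s) * ennreal (ut k X) + ennreal C * nconv eu wt X"
      unfolding uj .
  qed
qed

lemma fpot_finite: "stker (fpot s lam) Y < \<infinity>"
  by (simp add: stker_def fpot_def ennreal_mult_less_top)

text \<open>\<open>nconv_fpot_identity\<close> for the mollified solution reads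
  \<open>a j + m j = e j + b j\<close>. Both \<open>a j\<close> and \<open>b j\<close> may diverge,
  but their difference converges to \<open>\<kappa>\<close> times the damped potential of the
  mollified \<open>g\<close>; \<open>e j\<close> tends to \<open>\<kappa> * ut k X\<close> as an
  approximate identity, and \<open>m j\<close> increases to the convolution with
  \<open>mrem s lam 0\<close>.\<close>

lemma mollified_identity:
  assumes k: "1 \<le> k" and lam: "0 < lam"
  shows "ennreal \<kappa> * nconv (stker (fpot s lam)) (nconv (bm k) eg) X + nconv (stker (mrem s lam 0)) (nconv (bm k) eu) X
    = ennreal \<kappa> * nconv (bm k) eu X"
proof -
  let ?N = "stker (fpot s lam) :: 'a \<times> real \<Rightarrow> ennreal"
  let ?ut = "\<lambda>Y. ennreal (ut k Y)"
  obtain C where dom: "\<And>j X. ennreal (dl j powr (- s) / s) * ?ut X \<le> nconv (jk j) ?ut X + ennreal C * nconv eu wt X"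
    "\<And>j X. nconv (jk j) ?ut X \<le> ennreal (dl j powr (- s) / s) * ?ut X + ennreal C * nconv eu wt X"
    and bC: "\<And>Y. bm k Y \<le> ennreal C * wt Y" "0 \<le> C"
    using mollified_dominated[OF k] by metis
  obtain C2 where C2: "\<And>Y. nconv ?N wt Y \<le> ennreal C2 * wt Y" "0 \<le> C2"
    using fpot_weight_le[OF s(1) lam M] by metis
  have Nwt: "nconv ?N (nconv eu wt) X < \<infinity>"
  proof -
    have "nconv ?N (nconv eu wt) = nconv ?N (nconv wt eu)"
      by (subst nconv_commute[of eu wt]) auto
    also have "\<dots> = nconv (nconv ?N wt) eu" by (rule nconv_assoc) measurable
    finally show ?thesis using conv_u_finite[of "nconv ?N wt" C2 X] C2 by simp
  qed
  have Nut: "nconv ?N ?ut X < \<infinity>"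
  proof -
    have "nconv ?N ?ut X \<le> nconv ?N (\<lambda>Y. ennreal C * nconv eu wt Y) X"
    proof (rule nconv_mono[OF order_refl])
      fix Y
      have "?ut Y \<le> nconv (\<lambda>Y. ennreal C * wt Y) eu Y"
        unfolding fun_cong[OF ut_eq[OF k]] by (intro nconv_mono bC) auto
      also have "\<dots> = ennreal C * nconv wt eu Y" by (rule nconv_cmult_left) measurable
      also have "nconv wt eu Y = nconv eu wt Y" by (subst nconv_commute) auto
      finally show "?ut Y \<le> ennreal C * nconv eu wt Y" .
    qed
    also have "\<dots> = ennreal C * nconv ?N (nconv eu wt) X" by (rule nconv_cmult_right) measurable
    also have "\<dots> < \<infinity>" using Nwt by (simp add: ennreal_mult_less_top)
    finally show ?thesis .
  qed
  define n where "n Y = enn2real (?N Y)" for Y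
  have n: "(\<lambda>Y. ennreal (n Y)) = ?N"
    unfolding n_def by (intro ext ennreal_enn2real) (use fpot_finite in simp)
  have [measurable]: "n \<in> borel_measurable borel" unfolding n_def[abs_def] by measurable
  have coef: "0 \<le> dl j powr (- s) / s" for j using s by simp
  have l12: "(\<lambda>j. enn2real (nconv (\<lambda>Y. ennreal (n Y)) (\<lambda>Y. ennreal (dl j powr (- s) / s) * ?ut Y) X) - enn2real (nconv (\<lambda>Y. ennreal (n Y)) (nconv (jk j) ?ut) X))
      \<longlonglongrightarrow> enn2real (nconv (\<lambda>Y. ennreal (n Y)) (\<lambda>Y. ennreal (\<kappa> * gt k Y)) X)
    \<and> nconv (\<lambda>Y. ennreal (n Y)) (\<lambda>Y. ennreal (\<kappa> * gt k Y)) X < \<infinity>"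
  proof (rule nconv_dominated_diff[where D = "\<lambda>Y. ennreal C * nconv eu wt Y"])
    show "nconv (\<lambda>Y. ennreal (n Y)) (\<lambda>Y. ennreal C * nconv eu wt Y) X < \<infinity>"
      unfolding n using Nwt by (subst nconv_cmult_right) (auto simp: ennreal_mult_less_top)
    show "nconv (\<lambda>Y. ennreal (n Y)) (\<lambda>Y. ennreal (dl j powr (- s) / s) * ?ut Y) X < \<infinity>" for j
      unfolding n using Nut by (subst nconv_cmult_right) (auto simp: ennreal_mult_less_top)
    show "(\<lambda>j. enn2real (ennreal (dl j powr (- s) / s) * ?ut (X - Y)) - enn2real (nconv (jk j) ?ut (X - Y))) \<longlonglongrightarrow> \<kappa> * gt k (X - Y)" for Y
      by (rule mollified_limit[OF k])
  next
    show "0 \<le> \<kappa> * gt k Y" for Y using kappa_pos gt_nonneg by simp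
    show "0 \<le> n Y" for Y by (simp add: n_def)
  next
    fix j and Y :: "'a \<times> real"
    show "ennreal (dl j powr (- s) / s) * ?ut (X - Y) \<le> nconv (jk j) ?ut (X - Y) + ennreal C * nconv eu wt (X - Y)"
      by (rule dom)
    show "nconv (jk j) ?ut (X - Y) \<le> ennreal (dl j powr (- s) / s) * ?ut (X - Y) + ennreal C * nconv eu wt (X - Y)"
      by (rule dom)
  next
    show "n \<in> borel_measurable borel" by measurable
    show "(\<lambda>Y. ennreal (dl j powr (- s) / s) * ?ut Y) \<in> borel_measurable borel" for j by measurable
    show "nconv (jk j) ?ut \<in> borel_measurable borel" for j by measurable
    show "(\<lambda>Y. ennreal C * nconv eu wt Y) \<in> borel_measurable borel" by measurable
    show "(\<lambda>Y. \<kappa> * gt k Y) \<in> borel_measurable borel" by measurable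
  qed
  note l1 = l12[THEN conjunct1] and l2 = l12[THEN conjunct2]
  define a where "a j = ennreal (dl j powr (- s) / s) * nconv ?N ?ut X" for j
  define b where "b j = nconv ?N (nconv (jk j) ?ut) X" for j
  define e where "e j = nconv (stker (\<lambda>r. ennreal (exp (- lam * r)) * mar s (dl j) r)) ?ut X" for j
  define m where "m j = nconv (stker (mrem s lam (dl j))) ?ut X" for j
  define G where "G = enn2real (nconv ?N (nconv (bm k) eg) X)"
  have Nut': "nconv (\<lambda>Y. ennreal (n Y)) (\<lambda>Y. ennreal (dl j powr (- s) / s) * ?ut Y) X = a j" for j
    unfolding n a_def by (rule nconv_cmult_right) measurable
  have kg: "nconv (\<lambda>Y. ennreal (n Y)) (\<lambda>Y. ennreal (\<kappa> * gt k Y)) X = ennreal \<kappa> * nconv ?N (nconv (bm k) eg) X"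
  proof -
    have "(\<lambda>Y. ennreal (\<kappa> * gt k Y)) = (\<lambda>Y. ennreal \<kappa> * nconv (bm k) eg Y)"
      using kappa_pos by (simp add: ennreal_mult' fun_cong[OF gt_eq[OF k]])
    then show ?thesis unfolding n by (simp add: nconv_cmult_right)
  qed
  have ab: "(\<lambda>j. enn2real (a j) - enn2real (b j)) \<longlonglongrightarrow> \<kappa> * G"
    using l1[unfolded Nut' kg, unfolded n] kappa_pos by (simp add: b_def G_def enn2real_mult)
  have Gfin: "nconv ?N (nconv (bm k) eg) X < \<infinity>"
    using l2 kappa_pos unfolding kg by (auto simp: ennreal_mult_less_top)
  have afin: "a j < \<infinity>" for j using Nut by (simp add: a_def ennreal_mult_less_top)
  have bfin: "b j < \<infinity>" for j
  proof -
    have "b j \<le> nconv ?N (\<lambda>Y. ennreal (dl j powr (- s) / s) * ?ut Y + ennreal C * nconv eu wt Y) X"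
      unfolding b_def by (intro nconv_mono order_refl dom)
    also have "\<dots> = ennreal (dl j powr (- s) / s) * nconv ?N ?ut X + ennreal C * nconv ?N (nconv eu wt) X"
      by (simp add: nconv_add_right nconv_cmult_right)
    also have "\<dots> < \<infinity>" using Nut Nwt by (simp add: ennreal_mult_less_top)
    finally show ?thesis .
  qed
  have id: "a j + m j = e j + b j" for j
    unfolding a_def b_def e_def m_def using lam
    by (intro nconv_fpot_identity[OF s dl_pos]) auto
  have elim: "e \<longlonglongrightarrow> ennreal (\<kappa> * ut k X)"
    unfolding e_def[abs_def] \<kappa>
  proof (rule approx_mar[OF s])
    show "isCont (ut k) X" unfolding ut_def[abs_def] by (rule bump_conv_continuous(1)[OF k u_cont u0])
    show "nconv hshift ?ut X < \<infinity>"
    proof -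
      obtain J where J: "(\<integral>\<^sup>+Y. bm k Y * ennreal (growth M Y) \<partial>lborel) = ennreal J" "0 \<le> J"
        using bump_growth_finite[OF M0 k, where 'a='a] by (cases "\<integral>\<^sup>+Y. bm k Y * ennreal (growth M Y) \<partial>lborel") auto
      let ?c = "2 powr (1 + s) * (2 * (1 + (8 * M) powr M))"
      have "nconv hshift (bm k) Y \<le> ennreal (?c * (2 powr (2 * M + 1) * J)) * wt Y" for Y
      proof -
        have "nconv hshift (bm k) Y \<le> nconv (\<lambda>Y. ennreal ?c * wt Y) (bm k) Y"
          by (intro nconv_mono hshift_weight_le s M order_refl)
        also have "\<dots> = ennreal ?c * nconv (bm k) wt Y"
          by (subst nconv_cmult_left, measurable, subst nconv_commute, auto)
        also have "\<dots> \<le> ennreal ?c * (ennreal (2 powr (2 * M + 1) / growth M Y) * ennreal J)"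
          unfolding J(1)[symmetric] by (intro mult_left_mono nconv_weight_le M0) auto
        also have "\<dots> = ennreal (?c * (2 powr (2 * M + 1) * J)) * wt Y"
          using J(2) by (simp add: ennreal_mult'[symmetric] ennreal_mult''[symmetric] mult_ac)
        finally show ?thesis .
      qed
      then have "nconv (nconv hshift (bm k)) eu X < \<infinity>"
        by (rule conv_u_finite[rotated]) measurable
      then show ?thesis by (simp add: conv_ut(2)[OF k])
    qed
  qed (use lam Nut ut_nonneg in auto)
  have mlim: "m \<longlonglongrightarrow> nconv (stker (mrem s lam 0)) ?ut X"
    unfolding m_def[abs_def] nconv_def
  proof (rule nn_integral_LIMSEQ)
    have mono: "mrem s lam (dl j) r \<le> mrem s lam (dl (Suc j)) r" for j r
      using incseq_SucD[OF mrem_incseq[OF s(1)], of lam j] lam by (simp add: le_fun_def)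
    show "incseq (\<lambda>j Y. stker (mrem s lam (dl j)) Y * ?ut (X - Y))"
    proof (intro incseq_SucI le_funI mult_right_mono)
      show "stker (mrem s lam (dl j)) Y \<le> stker (mrem s lam (dl (Suc j))) Y" for j and Y :: "'a \<times> real"
        unfolding stker_def by (intro mult_right_mono mono) simp
    qed simp
    show "(\<lambda>j. stker (mrem s lam (dl j)) Y * ?ut (X - Y)) \<longlonglongrightarrow> stker (mrem s lam 0) Y * ?ut (X - Y)" for Y
    proof -
      have "(\<lambda>j. mrem s lam (dl j) (snd Y)) \<longlonglongrightarrow> mrem s lam 0 (snd Y)"
        using lam by (intro mrem_LIMSEQ s) auto
      then have "(\<lambda>j. (ennreal (heat_kernel (snd Y) (fst Y)) * ?ut (X - Y)) * mrem s lam (dl j) (snd Y))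
         \<longlonglongrightarrow> (ennreal (heat_kernel (snd Y) (fst Y)) * ?ut (X - Y)) * mrem s lam 0 (snd Y)"
        by (intro ennreal_tendsto_cmult) (auto simp: ennreal_mult_less_top)
      then show ?thesis by (simp add: stker_def mult_ac)
    qed
  qed measurable
  have "\<forall>\<^sub>F j in sequentially. e j < \<infinity>"
    by (rule order_tendstoD(2)[OF elim]) simp
  then have ev: "\<forall>\<^sub>F j in sequentially. enn2real (e j) - (enn2real (a j) - enn2real (b j)) = enn2real (m j) \<and> ennreal (enn2real (m j)) = m j"
  proof (rule eventually_mono)
    fix j assume e: "e j < \<infinity>"
    then have "e j + b j < \<infinity>" using bfin[of j] by simp
    then have mfin: "m j < \<infinity>" unfolding id[symmetric] by simp
    obtain a' b' e' m' where *: "a j = ennreal a'" "0 \<le> a'" "b j = ennreal b'" "0 \<le> b'" "e j = ennreal e'" "0 \<le> e'" "m j = ennreal m'" "0 \<le> m'"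
      using afin[of j] bfin[of j] e mfin by (cases "a j"; cases "b j"; cases "e j"; cases "m j") auto
    have "ennreal (a' + m') = ennreal (e' + b')" using id[of j] * by (simp add: ennreal_plus)
    then have "a' + m' = e' + b'" using * by (simp del: ennreal_plus)
    then show "enn2real (e j) - (enn2real (a j) - enn2real (b j)) = enn2real (m j) \<and> ennreal (enn2real (m j)) = m j"
      using * by simp
  qed
  have "(\<lambda>j. enn2real (e j) - (enn2real (a j) - enn2real (b j))) \<longlonglongrightarrow> \<kappa> * ut k X - \<kappa> * G"
    using kappa_pos ut_nonneg by (intro tendsto_diff ab tendsto_enn2real[OF elim, THEN tendsto_eq_rhs]) auto
  then have mr: "(\<lambda>j. enn2real (m j)) \<longlonglongrightarrow> \<kappa> * ut k X - \<kappa> * G"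
    by (rule Lim_transform_eventually) (use ev in \<open>auto elim: eventually_mono\<close>)
  then have nn: "0 \<le> \<kappa> * ut k X - \<kappa> * G"
    by (rule LIMSEQ_le_const) auto
  have "m \<longlonglongrightarrow> ennreal (\<kappa> * ut k X - \<kappa> * G)"
    by (rule Lim_transform_eventually[OF tendsto_ennrealI[OF mr]]) (use ev in \<open>auto elim: eventually_mono\<close>)
  then have meq: "nconv (stker (mrem s lam 0)) ?ut X = ennreal (\<kappa> * ut k X - \<kappa> * G)"
    using mlim by (rule LIMSEQ_unique[symmetric])
  have "ennreal \<kappa> * nconv ?N (nconv (bm k) eg) X = ennreal (\<kappa> * G)"
    using Gfin kappa_pos by (simp add: G_def ennreal_mult')
  moreover have "ennreal (\<kappa> * G) + ennreal (\<kappa> * ut k X - \<kappa> * G) = ennreal (\<kappa> * ut k X)"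
    using nn kappa_pos by (subst ennreal_plus[symmetric]) (auto simp: G_def)
  moreover have "ennreal (\<kappa> * ut k X) = ennreal \<kappa> * nconv (bm k) eu X"
    using kappa_pos by (simp add: ennreal_mult' fun_cong[OF ut_eq[OF k]])
  ultimately show ?thesis
    using meq unfolding ut_eq[OF k] by simp
qed

end

section \<open>Asymptotic constancy of the remainder\<close>

text \<open>The sequence is asymptotically affine along the lines of direction \<open>E\<close>, and a nonnegative affine
  function on a line is constant.\<close>

lemma second_difference_vanishing:
  fixes M :: "nat \<Rightarrow> 'v::real_vector \<Rightarrow> real"
  assumes nn: "\<And>i X. 0 \<le> M i X" and bd: "\<And>i X. M i X \<le> B X"
    and sd: "\<And>X. (\<lambda>i. M i (X + E) + M i (X - E) - 2 * M i X) \<longlonglongrightarrow> 0"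
  shows "(\<lambda>i. M i (X + E) - M i X) \<longlonglongrightarrow> 0"
proof -
  have low: "\<forall>\<^sub>F i in sequentially. - \<epsilon> < M i (X + E) - M i X"
    if "0 < \<epsilon>" and sd: "\<And>X. (\<lambda>i. M i (X + E) + M i (X - E) - 2 * M i X) \<longlonglongrightarrow> 0" for X E \<epsilon>
  proof -
    \<comment> \<open>The deviation from the affine extrapolation in direction \<open>E\<close>. It
      satisfies a two-step recursion in \<open>k\<close> driven by the second differences, so it
      tends to 0 for each fixed \<open>k\<close>.\<close>
    define d where "d k i = M i (X + real k *\<^sub>R E) - M i X - real k * (M i (X + E) - M i X)" for k i
    have d: "d k \<longlonglongrightarrow> 0 \<and> d (Suc k) \<longlonglongrightarrow> 0" for k
    proof (induction k)
      case 0
      show ?case by (simp add: d_def)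
    next
      case (Suc k)
      have "d (Suc (Suc k)) = (\<lambda>i. 2 * d (Suc k) i - d k i
         + (M i (X + real (Suc k) *\<^sub>R E + E) + M i (X + real (Suc k) *\<^sub>R E - E) - 2 * M i (X + real (Suc k) *\<^sub>R E)))"
      proof (rule ext)
        fix i
        have v: "X + real (Suc k) *\<^sub>R E + E = X + real (Suc (Suc k)) *\<^sub>R E" "X + real (Suc k) *\<^sub>R E - E = X + real k *\<^sub>R E"
          by (simp_all only: of_nat_Suc scaleR_add_left scaleR_one) simp_all
        show "d (Suc (Suc k)) i = 2 * d (Suc k) i - d k i
         + (M i (X + real (Suc k) *\<^sub>R E + E) + M i (X + real (Suc k) *\<^sub>R E - E) - 2 * M i (X + real (Suc k) *\<^sub>R E))"
          unfolding v d_def by (simp only: of_nat_Suc) (simp add: distrib_right)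
      qed
      also have "\<dots> \<longlonglongrightarrow> 2 * 0 - 0 + 0"
        by (rule tendsto_add[OF tendsto_diff[OF tendsto_mult[OF tendsto_const Suc.IH[THEN conjunct2]] Suc.IH[THEN conjunct1]] sd])
      finally show ?case using Suc.IH by simp
    qed
    \<comment> \<open>A slope of at most \<open>- \<epsilon>\<close> would make the value at
      \<open>X + k E\<close> negative once \<open>k * \<epsilon>\<close> exceeds
      \<open>\<bar>B X\<bar> + 1\<close>; the summand 1 absorbs the deviation
      \<open>d\<close>.\<close>
    obtain k :: nat where k: "2 * (\<bar>B X\<bar> + 1) / \<epsilon> < real k"
      using reals_Archimedean2 by blast
    have k0: "0 < real k" using k \<open>0 < \<epsilon>\<close> by (rule_tac le_less_trans[OF _ k]) simp
    have "\<forall>\<^sub>F i in sequentially. \<bar>d k i\<bar> < 1"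
      using order_tendstoD(2)[OF tendsto_rabs_zero[OF d[THEN conjunct1]], of 1] by simp
    then show ?thesis
    proof (rule eventually_mono)
      fix i assume di: "\<bar>d k i\<bar> < 1"
      have "0 \<le> M i (X + real k *\<^sub>R E)" by (rule nn)
      then have "- (\<bar>B X\<bar> + 1) < real k * (M i (X + E) - M i X)"
        using di bd[of i X] unfolding d_def by linarith
      moreover have "\<bar>B X\<bar> + 1 < real k * \<epsilon>"
      proof -
        have "2 * (\<bar>B X\<bar> + 1) < real k * \<epsilon>" using k \<open>0 < \<epsilon>\<close> by (simp add: divide_less_eq)
        then show ?thesis by simp
      qed
      ultimately have "real k * (- \<epsilon>) < real k * (M i (X + E) - M i X)" by simp
      then show "- \<epsilon> < M i (X + E) - M i X" using k0 by (simp only: mult_less_cancel_left_pos)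
    qed
  qed
  show ?thesis
  proof (rule LIMSEQ_I)
    fix \<epsilon> :: real assume "0 < \<epsilon>"
    have sd': "(\<lambda>i. M i (X + (- E)) + M i (X - (- E)) - 2 * M i X) \<longlonglongrightarrow> 0" for X
      using sd[of X] by (simp add: add.commute)
    have "\<forall>\<^sub>F i in sequentially. norm (M i (X + E) - M i X - 0) < \<epsilon>"
      using low[OF \<open>0 < \<epsilon>\<close> sd, of X] low[OF \<open>0 < \<epsilon>\<close> sd', of "X + E"]
      by eventually_elim (auto simp: abs_less_iff)
    then show "\<exists>no. \<forall>i\<ge>no. norm (M i (X + E) - M i X - 0) < \<epsilon>"
      by (simp add: eventually_sequentially)
  qed
qed

section \<open>Differences of the heat kernel in space and time\<close>

lemma cosh_minus_one_le:
  fixes y :: real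
  shows "0 \<le> cosh y - 1" and "cosh y - 1 \<le> y\<^sup>2 * exp \<bar>y\<bar>"
proof -
  show "0 \<le> cosh y - 1" using cosh_real_ge_1[of y] by simp
  have *: "cosh y - 1 \<le> y\<^sup>2 * exp \<bar>y\<bar>" if "0 \<le> y" for y :: real
  proof -
    have e: "cosh y - 1 = (exp y - 1)\<^sup>2 / (2 * exp y)"
    proof -
      have "cosh y - 1 = (exp y + 1 / exp y) / 2 - 1"
        by (simp add: cosh_def exp_minus inverse_eq_divide)
      then show ?thesis by (simp add: power2_eq_square field_simps)
    qed
    have "exp y - 1 \<le> y * exp y"
    proof -
      have "exp y * (1 - y) \<le> exp y * exp (- y)"
        using exp_ge_add_one_self[of "- y"] by (intro mult_left_mono) auto
      then show ?thesis by (simp add: exp_minus algebra_simps)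
    qed
    then have "(exp y - 1)\<^sup>2 \<le> (y * exp y)\<^sup>2" using that by (intro power_mono) auto
    then have "cosh y - 1 \<le> (y * exp y)\<^sup>2 / (2 * exp y)"
      unfolding e by (intro divide_right_mono) auto
    also have "\<dots> = y\<^sup>2 * exp y / 2" by (simp add: power2_eq_square field_simps)
    also have "\<dots> \<le> y\<^sup>2 * exp y" by simp
    finally show ?thesis using that by simp
  qed
  show "cosh y - 1 \<le> y\<^sup>2 * exp \<bar>y\<bar>"
    using *[of y] *[of "- y"] by (cases "0 \<le> y") auto
qed

lemma heat_kernel_double: "0 < r \<Longrightarrow> heat_kernel r (z :: 'a::euclidean_space) * exp ((norm z)\<^sup>2 / (8 * r)) = 2 powr (DIM('a) / 2) * heat_kernel (2 * r) z"
proof -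
  assume r: "0 < r"
  have "(4 * pi * (2 * r)) powr (DIM('a) / 2) = 2 powr (DIM('a) / 2) * (4 * pi * r) powr (DIM('a) / 2)"
    using r by (subst powr_mult[symmetric]) (auto simp: ac_simps)
  moreover have "exp (- (norm z)\<^sup>2 / (4 * r)) * exp ((norm z)\<^sup>2 / (8 * r)) = exp (- (norm z)\<^sup>2 / (4 * (2 * r)))"
    using r by (simp add: exp_add[symmetric] field_simps)
  ultimately show ?thesis by (simp add: heat_kernel_def)
qed

text \<open>Expanding the exponents turns the second difference into
  \<open>heat_kernel r z * (2 * (exp (- \<epsilon>) * cosh y - 1))\<close>: the terms linear in
  \<open>e\<close> cancel. The contributions of \<open>\<epsilon>\<close> and of
  \<open>cosh y - 1\<close> both carry a factor \<open>1 / r\<close>, and the growth in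
  \<open>z\<close> is absorbed by passing to the Gaussian at time \<open>2 * r\<close>.\<close>

lemma heat_kernel_second_difference:
  fixes z e :: "'a::euclidean_space"
  assumes r: "1 \<le> r"
  shows "\<bar>heat_kernel r (z + e) + heat_kernel r (z - e) - 2 * heat_kernel r z\<bar>
    \<le> 2 * (norm e)\<^sup>2 * (4 * exp ((norm e)\<^sup>2) + 1) * 2 powr (DIM('a) / 2) / r * heat_kernel (2 * r) z"
proof -
  define w where "w = (norm z)\<^sup>2 / (4 * r)"
  define \<epsilon> where "\<epsilon> = (norm e)\<^sup>2 / (4 * r)"
  define y where "y = (z \<bullet> e) / (2 * r)"
  have w: "0 \<le> w" and eps: "0 \<le> \<epsilon>" using r by (auto simp: w_def \<epsilon>_def)
  have k: "heat_kernel r (z + e) = heat_kernel r z * (exp (- \<epsilon>) * exp (- y))"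
    "heat_kernel r (z - e) = heat_kernel r z * (exp (- \<epsilon>) * exp y)"
    using r by (simp_all add: heat_kernel_def \<epsilon>_def y_def exp_add[symmetric] power2_norm_eq_inner inner_add_left
        inner_add_right inner_diff_left inner_diff_right inner_commute add_divide_distrib diff_divide_distrib)
  have "heat_kernel r (z + e) + heat_kernel r (z - e) - 2 * heat_kernel r z
     = heat_kernel r z * (2 * (exp (- \<epsilon>) * cosh y - 1))"
    unfolding k by (simp add: cosh_def algebra_simps)
  then have 1: "\<bar>heat_kernel r (z + e) + heat_kernel r (z - e) - 2 * heat_kernel r z\<bar>
     = heat_kernel r z * (2 * \<bar>exp (- \<epsilon>) * cosh y - 1\<bar>)"
    by (simp only: abs_mult abs_of_nonneg[OF heat_kernel_nonneg] abs_numeral)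
  have c: "\<bar>exp (- \<epsilon>) * cosh y - 1\<bar> \<le> (cosh y - 1) + \<epsilon>"
  proof -
    have a: "exp (- \<epsilon>) \<le> 1" "1 - exp (- \<epsilon>) \<le> \<epsilon>" using eps exp_ge_add_one_self[of "- \<epsilon>"] by auto
    have b: "exp (- \<epsilon>) * cosh y - 1 = exp (- \<epsilon>) * (cosh y - 1) - (1 - exp (- \<epsilon>))" by (simp add: algebra_simps)
    have "exp (- \<epsilon>) * (cosh y - 1) \<le> 1 * (cosh y - 1)" "0 \<le> exp (- \<epsilon>) * (cosh y - 1)"
      using mult_right_mono[OF a(1) cosh_minus_one_le(1)[of y]] mult_nonneg_nonneg[OF _ cosh_minus_one_le(1)[of y], of "exp (- \<epsilon>)"]
      by simp_all
    moreover have "\<bar>p - q\<bar> \<le> v + e" if "p \<le> v" "0 \<le> p" "q \<le> e" "0 \<le> q" for p q v e :: real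
      using that by linarith
    ultimately show ?thesis unfolding b using a by simp
  qed
  have y2: "y\<^sup>2 \<le> (norm e)\<^sup>2 / r * w"
  proof -
    have "(z \<bullet> e)\<^sup>2 \<le> (norm z * norm e)\<^sup>2"
      using Cauchy_Schwarz_ineq2[of z e] by (subst power2_abs[symmetric], intro power_mono) auto
    then have "(z \<bullet> e)\<^sup>2 / (2 * r)\<^sup>2 \<le> (norm z * norm e)\<^sup>2 / (2 * r)\<^sup>2"
      by (intro divide_right_mono) auto
    also have "\<dots> = (norm e)\<^sup>2 / r * w" by (simp add: w_def power_mult_distrib power2_eq_square mult_ac)
    finally show ?thesis by (simp add: y_def power_divide)
  qed
  \<comment> \<open>From \<open>y^2 \<le> (norm e)^2 * w\<close> and the inequality between
    arithmetic and geometric mean. The share \<open>w / 4\<close> leaves room for the factor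
    \<open>w\<close> within the exponent \<open>w / 2\<close>.\<close>
  have ya: "\<bar>y\<bar> \<le> w / 4 + (norm e)\<^sup>2"
  proof -
    have "y\<^sup>2 \<le> (norm e)\<^sup>2 * w"
    proof -
      have "(norm e)\<^sup>2 / r * w \<le> (norm e)\<^sup>2 * w"
        using r w divide_left_mono[of 1 r "(norm e)\<^sup>2"] by (intro mult_right_mono) auto
      with y2 show ?thesis by linarith
    qed
    also have "\<dots> \<le> (w / 4 + (norm e)\<^sup>2)\<^sup>2"
    proof -
      have "0 \<le> (w / 4 - (norm e)\<^sup>2)\<^sup>2" by simp
      then show ?thesis by (simp add: power2_eq_square algebra_simps)
    qed
    finally show ?thesis using w by (intro power2_le_imp_le[of "\<bar>y\<bar>"]) auto
  qed
  have we: "w * exp (w / 4) \<le> 4 * exp (w / 2)"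
  proof -
    have "w / 4 \<le> exp (w / 4)" using exp_ge_add_one_self[of "w / 4"] by linarith
    then have "w / 4 * exp (w / 4) \<le> exp (w / 4) * exp (w / 4)" by (intro mult_right_mono) auto
    also have "\<dots> = exp (w / 2)" by (simp add: exp_add[symmetric])
    finally show ?thesis by simp
  qed
  have "cosh y - 1 \<le> y\<^sup>2 * exp \<bar>y\<bar>" by (rule cosh_minus_one_le)
  also have "\<dots> \<le> ((norm e)\<^sup>2 / r * w) * exp (w / 4 + (norm e)\<^sup>2)"
    using y2 ya r w by (intro mult_mono) auto
  also have "\<dots> = (norm e)\<^sup>2 / r * exp ((norm e)\<^sup>2) * (w * exp (w / 4))"
    by (simp add: exp_add)
  also have "\<dots> \<le> (norm e)\<^sup>2 / r * exp ((norm e)\<^sup>2) * (4 * exp (w / 2))"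
    using r by (intro mult_left_mono we) auto
  finally have d: "cosh y - 1 \<le> (norm e)\<^sup>2 / r * exp ((norm e)\<^sup>2) * (4 * exp (w / 2))" .
  have "\<epsilon> \<le> (norm e)\<^sup>2 / r * 1" using r by (simp add: \<epsilon>_def field_simps)
  also have "\<dots> \<le> (norm e)\<^sup>2 / r * exp (w / 2)" using r w by (intro mult_left_mono) auto
  finally have "\<epsilon> \<le> (norm e)\<^sup>2 / r * exp (w / 2)" .
  have "\<bar>exp (- \<epsilon>) * cosh y - 1\<bar> \<le> (norm e)\<^sup>2 / r * (4 * exp ((norm e)\<^sup>2) + 1) * exp (w / 2)"
  proof -
    have "(norm e)\<^sup>2 / r * (4 * exp ((norm e)\<^sup>2) + 1) * exp (w / 2)
      = (norm e)\<^sup>2 / r * exp ((norm e)\<^sup>2) * (4 * exp (w / 2)) + (norm e)\<^sup>2 / r * exp (w / 2)"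
      by (simp only: distrib_left distrib_right mult_1_right) simp
    with c d \<open>\<epsilon> \<le> (norm e)\<^sup>2 / r * exp (w / 2)\<close> show ?thesis by linarith
  qed
  then have "heat_kernel r z * (2 * \<bar>exp (- \<epsilon>) * cosh y - 1\<bar>) \<le> heat_kernel r z * (2 * ((norm e)\<^sup>2 / r * (4 * exp ((norm e)\<^sup>2) + 1) * exp (w / 2)))"
    by (intro mult_left_mono) auto
  also have "\<dots> = 2 * (norm e)\<^sup>2 * (4 * exp ((norm e)\<^sup>2) + 1) / r * (heat_kernel r z * exp ((norm z)\<^sup>2 / (8 * r)))"
    by (simp add: w_def)
  also have "\<dots> = 2 * (norm e)\<^sup>2 * (4 * exp ((norm e)\<^sup>2) + 1) * 2 powr (DIM('a) / 2) / r * heat_kernel (2 * r) z"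
    using r by (simp add: heat_kernel_double)
  finally show ?thesis unfolding 1 .
qed

text \<open>The time derivative is \<open>p q * (c / q - n / 2) / q\<close>: it gains
  \<open>1 / q\<close>, and the polynomial factor is paid by half of the Gaussian exponent.\<close>

lemma heat_kernel_time_difference:
  fixes z :: "'a::euclidean_space"
  assumes r: "1 \<le> r" and h: "0 < h"
  shows "\<bar>heat_kernel (r + h) z - heat_kernel r z\<bar>
    \<le> h * (2 + DIM('a) / 2) * (2 * (1 + h)) powr (DIM('a) / 2) / r * heat_kernel (2 * (r + h)) z"
proof -
  let ?n = "DIM('a) / 2"
  define c where "c = (norm z)\<^sup>2 / 4"
  have c: "0 \<le> c" by (simp add: c_def)
  define p where "p q = exp (- c / q) * (4 * pi * q) powr (- ?n)" for q
  have p: "heat_kernel q z = p q" if "0 < q" for q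
    by (simp add: heat_kernel_def p_def c_def powr_minus_divide)
  have d: "(p has_real_derivative (p q * (c / q - ?n) / q)) (at q)" if "r \<le> q" for q
  proof -
    have q: "0 < q" using that r by simp
    have "((\<lambda>q. exp (- c / q)) has_real_derivative exp (- c / q) * (c / q\<^sup>2)) (at q)"
    proof -
      have "((\<lambda>q. - c / q) has_real_derivative c / q\<^sup>2) (at q)"
        using q by (auto intro!: derivative_eq_intros simp: power2_eq_square)
      then show ?thesis by (rule DERIV_fun_exp)
    qed
    moreover have "((\<lambda>q. (4 * pi * q) powr (- ?n)) has_real_derivative (- ?n) * (4 * pi * q) powr (- ?n - of_nat 1) * (4 * pi)) (at q)"
      using q by (intro DERIV_fun_powr) (auto intro!: derivative_eq_intros)
    ultimately have "(p has_real_derivative (exp (- c / q) * (c / q\<^sup>2)) * (4 * pi * q) powr (- ?n)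
        + ((- ?n) * (4 * pi * q) powr (- ?n - of_nat 1) * (4 * pi)) * exp (- c / q)) (at q)"
      unfolding p_def[abs_def] by (rule DERIV_mult)
    also have "(exp (- c / q) * (c / q\<^sup>2)) * (4 * pi * q) powr (- ?n) + ((- ?n) * (4 * pi * q) powr (- ?n - of_nat 1) * (4 * pi)) * exp (- c / q)
       = p q * (c / q - ?n) / q"
    proof -
      have "(4 * pi * q) powr (- ?n - of_nat 1) = (4 * pi * q) powr (- ?n) / (4 * pi * q)"
        using q by (simp add: powr_diff)
      then show ?thesis
        unfolding p_def using q by (simp only:) (simp add: divide_simps power2_eq_square, simp add: algebra_simps)
    qed
    finally show ?thesis .
  qed
  have "\<exists>q. r < q \<and> q < r + h \<and> p (r + h) - p r = (r + h - r) * (p q * (c / q - ?n) / q)"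
    by (rule MVT2) (use h d in auto)
  then obtain q where q: "r < q" "q < r + h" "p (r + h) - p r = h * (p q * (c / q - ?n) / q)"
    by auto
  have q0: "0 < q" using q r by simp
  have "\<bar>c / q - ?n\<bar> \<le> (2 + ?n) * exp (c / q / 2)"
  proof -
    have "\<bar>c / q - ?n\<bar> \<le> c / q + ?n" using c q0 by (simp add: abs_le_iff)
    also have "c / q \<le> 2 * exp (c / q / 2)"
    proof -
      have "x \<le> 2 * exp (x / 2)" for x :: real
        using exp_ge_add_one_self[of "x / 2"] by linarith
      then show ?thesis .
    qed
    also have "?n \<le> ?n * exp (c / q / 2)" using c q0 mult_left_mono[of 1 "exp (c / q / 2)" ?n] by simp
    finally show ?thesis by (simp add: distrib_right)
  qed
  then have "p q * \<bar>c / q - ?n\<bar> \<le> p q * ((2 + ?n) * exp (c / q / 2))"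
    by (intro mult_left_mono) (auto simp: p_def)
  also have "\<dots> = (2 + ?n) * (exp (- (c / q / 2)) * (4 * pi * q) powr (- ?n))"
    by (simp add: p_def exp_add[symmetric])
  \<comment> \<open>The unknown intermediate time \<open>q\<close> is removed from each factor in
    its monotone direction: the exponential grows with time and is taken at \<open>r + h\<close>,
    the normalisation decreases and is taken at \<open>r\<close>.\<close>
  also have "exp (- (c / q / 2)) * (4 * pi * q) powr (- ?n) \<le> exp (- (c / (r + h) / 2)) * (4 * pi * r) powr (- ?n)"
  proof (intro mult_mono)
    have "c / (r + h) \<le> c / q" using q q0 c by (intro divide_left_mono) auto
    then have "c / (r + h) / 2 \<le> c / q / 2" by (rule divide_right_mono) simp
    then show "exp (- (c / q / 2)) \<le> exp (- (c / (r + h) / 2))" by (simp only: exp_le_cancel_iff neg_le_iff_le)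
    show "(4 * pi * q) powr (- ?n) \<le> (4 * pi * r) powr (- ?n)" using q r by (intro powr_mono2') auto
  qed auto
  also have "(4 * pi * r) powr (- ?n) \<le> (2 * (1 + h)) powr ?n * (4 * pi * (2 * (r + h))) powr (- ?n)"
  proof -
    have "(4 * pi * (2 * (r + h))) powr ?n \<le> (2 * (1 + h) * (4 * pi * r)) powr ?n"
    proof (rule powr_mono2)
      have "r + h \<le> r * (1 + h)" using r h by (simp add: algebra_simps)
      then have "4 * pi * 2 * (r + h) \<le> 4 * pi * 2 * (r * (1 + h))" by (intro mult_left_mono) auto
      then show "4 * pi * (2 * (r + h)) \<le> 2 * (1 + h) * (4 * pi * r)" by (simp add: mult_ac)
    qed (use r h in auto)
    also have "\<dots> = (2 * (1 + h)) powr ?n * (4 * pi * r) powr ?n" using r h by (simp add: powr_mult)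
    finally have "(4 * pi * (2 * (r + h))) powr ?n \<le> (2 * (1 + h)) powr ?n * (4 * pi * r) powr ?n" .
    moreover have "inverse b \<le> k * inverse a" if "a \<le> k * b" "0 < a" "0 < b" for a b k :: real
      using that by (simp add: field_simps)
    ultimately show ?thesis unfolding powr_minus using r h by simp
  qed
  finally have e: "p q * \<bar>c / q - ?n\<bar> \<le> (2 + ?n) * (exp (- (c / (r + h) / 2)) * ((2 * (1 + h)) powr ?n * (4 * pi * (2 * (r + h))) powr (- ?n)))"
    by (simp add: mult_left_mono)
  have "heat_kernel (2 * (r + h)) z = exp (- (c / (r + h) / 2)) * (4 * pi * (2 * (r + h))) powr (- ?n)"
    using r h by (subst p) (auto simp: p_def field_simps)
  with e have e': "p q * \<bar>c / q - ?n\<bar> \<le> (2 + ?n) * (2 * (1 + h)) powr ?n * heat_kernel (2 * (r + h)) z"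
    by (simp add: mult_ac)
  have "\<bar>heat_kernel (r + h) z - heat_kernel r z\<bar> = h * (p q * \<bar>c / q - ?n\<bar>) / q"
    using q r h q0 by (simp add: p abs_mult) (simp add: p_def)
  also have "\<dots> \<le> h * ((2 + ?n) * (2 * (1 + h)) powr ?n * heat_kernel (2 * (r + h)) z) / r"
    using q r h e' by (intro frac_le mult_left_mono) auto
  finally show ?thesis by (simp add: mult_ac)
qed

text \<open>The Gaussians left over by the difference estimates live at later times such as
  \<open>2 * r\<close> or \<open>2 * (r + h)\<close>. These are comparable with \<open>r\<close>, so
  the weight bound at time \<open>q\<close> transfers.\<close>

lemma heat_kernel_later_weight_le:
  fixes z :: "'a::euclidean_space"
  assumes s: "0 < s" and M: "M = DIM('a) / 2 + 1 + s" and r: "1 \<le> r" "r \<le> q" "q \<le> a * r"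
  shows "r powr (- 1 - s) * heat_kernel q z \<le> a powr (1 + s) * (2 * (1 + (8 * M) powr M)) / growth M (z, r)"
proof -
  have M0: "0 \<le> M" using M s by simp
  have q: "0 < q" "1 \<le> q" using r by auto
  have a: "0 < a" using r q by (smt (verit) zero_less_mult_pos2 mult_nonpos_nonneg)
  have "q powr (1 + s) \<le> (a * r) powr (1 + s)" using r q s by (intro powr_mono2) auto
  also have "\<dots> = a powr (1 + s) * r powr (1 + s)" using a r by (simp add: powr_mult)
  finally have "r powr (- (1 + s)) \<le> a powr (1 + s) * q powr (- (1 + s))"
    using q r unfolding powr_minus by (simp add: field_simps)
  then have "r powr (- 1 - s) * heat_kernel q z \<le> a powr (1 + s) * q powr (- 1 - s) * heat_kernel q z"
    by (intro mult_right_mono) auto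
  also have "\<dots> \<le> a powr (1 + s) * (2 * (1 + (8 * M) powr M) / growth M (z, q))"
    using heat_kernel_weight_le[OF s q(1) _ M, of z] q(2) by (simp only: mult.assoc) (intro mult_left_mono, auto)
  also have "\<dots> \<le> a powr (1 + s) * (2 * (1 + (8 * M) powr M) / growth M (z, r))"
    using growth_mono[OF M0, of r q z] r
    by (intro mult_left_mono divide_left_mono) (auto intro!: add_nonneg_nonneg)
  finally show ?thesis by simp
qed

section \<open>Shifts and lower semicontinuity of convolutions\<close>

lemma nconv_shift:
  fixes N F :: "'b::euclidean_space \<Rightarrow> ennreal"
  assumes [measurable]: "N \<in> borel_measurable borel" "F \<in> borel_measurable borel"
  shows "(\<integral>\<^sup>+Y. N (Y + E) * F (X - Y) \<partial>lborel) = nconv N F (X + E)"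
  unfolding nconv_def
  by (subst nn_integral_lborel_shift[of "\<lambda>Y. N Y * F (X + E - Y)" E, symmetric])
    (auto simp: algebra_simps)

lemma nconv_swap:
  fixes A B F :: "'b::euclidean_space \<Rightarrow> ennreal"
  assumes [measurable]: "A \<in> borel_measurable borel" "B \<in> borel_measurable borel" "F \<in> borel_measurable borel"
  shows "nconv A (nconv B F) = nconv B (nconv A F)"
proof -
  have "nconv A (nconv B F) = nconv (nconv A B) F" by (rule nconv_assoc) measurable
  also have "nconv A B = nconv B A" by (rule nconv_commute) measurable
  also have "nconv (nconv B A) F = nconv B (nconv A F)" by (rule nconv_assoc[symmetric]) measurable
  finally show ?thesis .
qed

text \<open>Fatou: convolutions of nonnegative kernels with continuous functions are lower
  semicontinuous, even where they may be infinite.\<close>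

lemma nconv_liminf:
  fixes K1 K2 :: "'b::euclidean_space \<Rightarrow> ennreal" and f1 f2 :: "'b \<Rightarrow> real"
  assumes K[measurable]: "K1 \<in> borel_measurable borel" "K2 \<in> borel_measurable borel"
    and fin: "\<And>Y. K1 Y < \<infinity>" "\<And>Y. K2 Y < \<infinity>"
    and f: "continuous_on UNIV f1" "continuous_on UNIV f2" and Z: "Z \<longlonglongrightarrow> X"
  shows "nconv K1 (\<lambda>Y. ennreal (f1 Y)) X + nconv K2 (\<lambda>Y. ennreal (f2 Y)) X
    \<le> liminf (\<lambda>i. nconv K1 (\<lambda>Y. ennreal (f1 Y)) (Z i) + nconv K2 (\<lambda>Y. ennreal (f2 Y)) (Z i))"
proof -
  have [measurable]: "f1 \<in> borel_measurable borel" "f2 \<in> borel_measurable borel"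
    using f by (auto intro: borel_measurable_continuous_onI)
  have cont: "isCont f1 W" "isCont f2 W" for W
    using f continuous_on_eq_continuous_at[OF open_UNIV] by blast+
  define H where "H W Y = K1 Y * ennreal (f1 (W - Y)) + K2 Y * ennreal (f2 (W - Y))" for W Y
  have [measurable]: "H W \<in> borel_measurable borel" for W unfolding H_def[abs_def] by measurable
  have eq: "nconv K1 (\<lambda>Y. ennreal (f1 Y)) W + nconv K2 (\<lambda>Y. ennreal (f2 Y)) W = (\<integral>\<^sup>+Y. H W Y \<partial>lborel)" for W
    unfolding H_def nconv_def by (rule nn_integral_add[symmetric]) measurable
  have "(\<lambda>i. H (Z i) Y) \<longlonglongrightarrow> H X Y" for Y
    unfolding H_def using fin
    by (intro tendsto_add ennreal_tendsto_cmult tendsto_ennrealI isCont_tendsto_compose[OF cont(1)]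
        isCont_tendsto_compose[OF cont(2)] tendsto_diff Z tendsto_const) auto
  then have "H X Y = liminf (\<lambda>i. H (Z i) Y)" for Y
    by (intro lim_imp_Liminf[symmetric]) auto
  then have "(\<integral>\<^sup>+Y. H X Y \<partial>lborel) = (\<integral>\<^sup>+Y. liminf (\<lambda>i. H (Z i) Y) \<partial>lborel)" by simp
  also have "\<dots> \<le> liminf (\<lambda>i. \<integral>\<^sup>+Y. H (Z i) Y \<partial>lborel)"
    by (rule nn_integral_liminf) measurable
  finally show ?thesis unfolding eq .
qed

lemma abs_enn2real_diff_le:
  assumes "S1 < \<infinity>" "S2 < \<infinity>" "0 \<le> R" "S1 \<le> S2 + ennreal R" "S2 \<le> S1 + ennreal R"
  shows "\<bar>enn2real S1 - enn2real S2\<bar> \<le> R"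
proof -
  obtain a b where ab: "S1 = ennreal a" "0 \<le> a" "S2 = ennreal b" "0 \<le> b"
    using assms(1,2) by (cases S1; cases S2) auto
  have "ennreal a \<le> ennreal (b + R)" "ennreal b \<le> ennreal (a + R)"
    using assms(3-5) ab by (simp_all add: ennreal_plus)
  then show ?thesis using ab assms(3) by (simp add: abs_le_iff del: ennreal_plus)
qed

context frac_solution
begin

abbreviation mk :: "real \<Rightarrow> 'a \<times> real \<Rightarrow> ennreal" where "mk lam \<equiv> stker (mrem s lam 0)"
abbreviation qk :: "real \<Rightarrow> 'a \<times> real \<Rightarrow> ennreal" where "qk a \<equiv> stker (\<lambda>r. indicator {0<..<a} r)"

lemma mrem_finite: "0 < lam \<Longrightarrow> mrem s lam 0 r < \<infinity>"
  using mrem_le_const[OF s, of lam r] by (rule order_le_less_trans) simp_all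

lemma mk_finite: "0 < lam \<Longrightarrow> mk lam Y < \<infinity>"
  using mrem_finite by (simp add: stker_def ennreal_mult_less_top)

text \<open>By \<open>mollified_identity\<close> the left side \<open>\<Phi>\<close> and
  \<open>u\<close> have the same convolution with every bump. \<open>\<Phi>\<close> is lower
  semicontinuous and \<open>u\<close> continuous, so \<open>\<Phi> > u\<close> at a point would
  persist on a ball and contradict a bump supported there. Hence \<open>u - \<Phi>\<close> is
  nonnegative with vanishing convolutions, and is zero almost everywhere.\<close>

lemma representation:
  assumes lam: "0 < lam"
  shows "nconv (stker (fpot s lam)) eg X + nconv (\<lambda>Y. ennreal (1 / \<kappa>) * mk lam Y) eu X \<le> eu X"
    and "AE X in lborel. nconv (stker (fpot s lam)) eg X + nconv (\<lambda>Y. ennreal (1 / \<kappa>) * mk lam Y) eu X = eu X"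
proof -
  let ?N = "stker (fpot s lam) :: 'a \<times> real \<Rightarrow> ennreal"
  let ?K = "\<lambda>Y. ennreal (1 / \<kappa>) * mk lam Y"
  define \<Phi> where "\<Phi> X = nconv ?N eg X + nconv ?K eu X" for X
  have [measurable]: "\<Phi> \<in> borel_measurable borel" unfolding \<Phi>_def[abs_def] by measurable
  have bm: "nconv (bm k) \<Phi> X = nconv (bm k) eu X" if k: "1 \<le> k" for k X
  proof -
    have "nconv (bm k) \<Phi> X = nconv (bm k) (nconv ?N eg) X + nconv (bm k) (nconv ?K eu) X"
      unfolding \<Phi>_def[abs_def] by (rule nconv_add_right) measurable
    also have "nconv (bm k) (nconv ?N eg) = nconv ?N (nconv (bm k) eg)" by (rule nconv_swap) measurable
    also have "nconv (bm k) (nconv ?K eu) = nconv ?K (nconv (bm k) eu)" by (rule nconv_swap) measurable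
    also have "nconv ?K (nconv (bm k) eu) X = ennreal (1 / \<kappa>) * nconv (mk lam) (nconv (bm k) eu) X"
      by (rule nconv_cmult_left) measurable
    also have "nconv ?N (nconv (bm k) eg) X = ennreal (1 / \<kappa>) * (ennreal \<kappa> * nconv ?N (nconv (bm k) eg) X)"
      using kappa_pos by (simp add: mult.assoc[symmetric] ennreal_mult'[symmetric])
    also have "\<dots> + ennreal (1 / \<kappa>) * nconv (mk lam) (nconv (bm k) eu) X = ennreal (1 / \<kappa>) * (ennreal \<kappa> * nconv (bm k) eu X)"
      unfolding distrib_left[symmetric] mollified_identity[OF k lam] ..
    also have "\<dots> = nconv (bm k) eu X"
      using kappa_pos by (simp add: mult.assoc[symmetric] ennreal_mult'[symmetric])
    finally show ?thesis .
  qed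
  have le: "\<Phi> X \<le> eu X" for X
  proof (rule ccontr)
    assume "\<not> \<Phi> X \<le> eu X"
    then obtain c' where c': "eu X < c'" "c' < \<Phi> X" by (metis dense not_le)
    then obtain c where c: "c' = ennreal c" "0 \<le> c" by (cases c') auto
    have uc: "u X < c" using c' c u0 by (simp add: ennreal_less_iff)
    define c1 where "c1 = (u X + c) / 2"
    have c1: "u X < c1" "c1 < c" "0 \<le> c1" using uc u0[of X] by (auto simp: c1_def)
    \<comment> \<open>Lower semicontinuity in neighbourhood form: otherwise a sequence with
      \<open>\<Phi>\<close> below \<open>c\<close> would converge to \<open>X\<close>.\<close>
    have "\<exists>d>0. \<forall>Z. norm (Z - X) < d \<longrightarrow> ennreal c \<le> \<Phi> Z"
    proof (rule ccontr)
      assume "\<not> ?thesis"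
      then have "\<forall>n. \<exists>Z. norm (Z - X) < dl n \<and> \<Phi> Z < ennreal c"
        by (metis not_le dl_pos)
      then obtain Z where Z: "\<And>n. norm (Z n - X) < dl n" "\<And>n. \<Phi> (Z n) < ennreal c" by metis
      have "(\<lambda>n. norm (Z n - X)) \<longlonglongrightarrow> 0"
        by (rule tendsto_sandwich[OF _ _ tendsto_const LIMSEQ_inverse_real_of_nat])
          (auto intro!: always_eventually less_imp_le[OF Z(1)] simp del: of_nat_Suc)
      then have "Z \<longlonglongrightarrow> X" by (simp add: LIM_zero_iff tendsto_norm_zero_iff)
      then have "\<Phi> X \<le> liminf (\<lambda>i. \<Phi> (Z i))"
        unfolding \<Phi>_def using fpot_finite mk_finite[OF lam]
        by (intro nconv_liminf g_cont u_cont) (auto simp: ennreal_mult_less_top)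
      then have "ennreal c < liminf (\<lambda>i. \<Phi> (Z i))" using c' c by (auto intro: order_less_le_trans)
      then have "\<forall>\<^sub>F i in sequentially. ennreal c < \<Phi> (Z i)"
        by (rule less_LiminfD)
      then show False using Z(2) by (auto simp: eventually_sequentially dest: less_asym)
    qed
    then obtain d1 where d1: "0 < d1" "\<And>Z. norm (Z - X) < d1 \<Longrightarrow> ennreal c \<le> \<Phi> Z" by blast
    have "isCont u X" using u_cont continuous_on_eq_continuous_at[OF open_UNIV] by blast
    from order_tendstoD(2)[OF this[unfolded isCont_def] c1(1)]
    obtain d2 where d2: "0 < d2" "\<And>Z. Z \<noteq> X \<Longrightarrow> dist Z X < d2 \<Longrightarrow> u Z < c1"
      by (auto simp: eventually_at)
    have d2': "u Z \<le> c1" if "norm (Z - X) < d2" for Z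
      using d2(2)[of Z] that c1(1) by (cases "Z = X") (auto simp: dist_norm)
    define d where "d = min d1 d2"
    have d: "0 < d" using d1 d2 by (simp add: d_def)
    \<comment> \<open>The support, of radius \<open>1 / k\<close>, then lies within distance
      \<open>d\<close>, where \<open>u \<le> c1 < c \<le> \<Phi>\<close>.\<close>
    define k where "k = max 1 (1 / d)"
    have k: "1 \<le> k" by (simp add: k_def)
    have near: "norm (X - Y - X) < d" if "bump k Y \<noteq> 0" for Y
    proof -
      have "k * norm Y < 1" using that bump_eq_0[of k Y] k by fastforce
      moreover have "1 / d * norm Y \<le> k * norm Y" by (intro mult_right_mono) (auto simp: k_def)
      ultimately have "1 / d * norm Y < 1" by linarith
      then show ?thesis using d by (simp add: field_simps)
    qed
    define I where "I = (\<integral>\<^sup>+Y. bm k Y \<partial>lborel)"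
    have "ennreal c * I \<le> nconv (bm k) \<Phi> X"
      unfolding I_def nconv_def
    proof (subst nn_integral_cmult[symmetric], measurable, rule nn_integral_mono)
      fix Y
      show "ennreal c * bm k Y \<le> bm k Y * \<Phi> (X - Y)"
        using mult_left_mono[OF d1(2)[of "X - Y"], of "bm k Y"] near[of Y]
        by (cases "bump k Y = 0") (auto simp: d_def mult.commute)
    qed
    also have "\<dots> = nconv (bm k) eu X" by (rule bm[OF k])
    also have "\<dots> \<le> ennreal c1 * I"
      unfolding I_def nconv_def
    proof (subst nn_integral_cmult[symmetric], measurable, rule nn_integral_mono)
      fix Y
      show "bm k Y * eu (X - Y) \<le> ennreal c1 * bm k Y"
        using mult_left_mono[OF ennreal_leI[OF d2'[of "X - Y"]], of "bm k Y"] near[of Y]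
        by (cases "bump k Y = 0") (auto simp: d_def mult.commute)
    qed
    finally have cI: "ennreal c * I \<le> ennreal c1 * I" .
    obtain i where i: "I = ennreal i" "0 \<le> i" using bump_integral_finite[OF k] by (cases I) (auto simp: I_def)
    have "c * i \<le> c1 * i" using cI c c1 i by (simp add: ennreal_mult[symmetric] ennreal_le_iff)
    \<comment> \<open>Since \<open>c1 < c\<close>, the bump would have mass 0, although it is
      positive on an open ball.\<close>
    then have "i = 0" using c1 i by (simp add: mult_le_cancel_right)
    then have "AE Y in lborel. bm k (Y :: 'a \<times> real) = 0"
      using i unfolding I_def by (subst nn_integral_0_iff_AE[symmetric]) auto
    then have ae: "AE Y in lborel. Y \<notin> ball (0 :: 'a \<times> real) (1 / k)"
    proof (rule AE_mp, intro AE_I2 impI)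
      fix Y :: "'a \<times> real" assume "bm k Y = 0"
      then have "\<not> k * norm Y < 1" using bump_pos[of k Y] k by auto
      then show "Y \<notin> ball 0 (1 / k)" using k by (simp add: field_simps)
    qed
    then have "ball (0 :: 'a \<times> real) (1 / k) \<in> null_sets lborel"
      using AE_iff_null_sets[of "ball (0 :: 'a \<times> real) (1 / k)" lborel] by simp
    then have "negligible (ball (0 :: 'a \<times> real) (1 / k))"
      by (simp add: negligible_iff_null_sets null_sets_completionI)
    then show False using open_not_negligible[of "ball (0 :: 'a \<times> real) (1 / k)"] k by simp
  qed
  then show "nconv ?N eg X + nconv ?K eu X \<le> eu X" by (simp add: \<Phi>_def)
  \<comment> \<open>Now the bump with \<open>k = 1\<close> suffices: at each point one of its
    translates to a countable dense set is positive, so only countably many null sets are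
    discarded.\<close>
  define w where "w X = eu X - \<Phi> X" for X
  have [measurable]: "w \<in> borel_measurable borel" unfolding w_def[abs_def] by measurable
  have "AE Z in lborel. w Z * bm 1 (X - Z) = 0" for X
  proof -
    have "nconv (bm 1) eu X = nconv (bm 1) (\<lambda>Y. \<Phi> Y + w Y) X"
      using le by (simp add: w_def diff_add_self_ennreal add_diff_inverse_ennreal)
    also have "\<dots> = nconv (bm 1) \<Phi> X + nconv (bm 1) w X" by (rule nconv_add_right) measurable
    finally have "nconv (bm 1) eu X = nconv (bm 1) eu X + nconv (bm 1) w X" by (simp add: bm)
    moreover have "nconv (bm 1) eu X < \<infinity>" by (rule bump_conv_continuous(2)[OF _ u_cont u0]) simp
    ultimately have "nconv (bm 1) w X = 0" by (cases "nconv (bm 1) eu X"; cases "nconv (bm 1) w X") (auto simp: ennreal_plus[symmetric] simp del: ennreal_plus)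
    then have "nconv w (bm 1) X = 0" by (subst nconv_commute) auto
    then show ?thesis unfolding nconv_def by (subst (asm) nn_integral_0_iff_AE) auto
  qed
  moreover obtain D :: "('a \<times> real) set" where D: "countable D" "\<And>S. open S \<Longrightarrow> S \<noteq> {} \<Longrightarrow> \<exists>d\<in>D. d \<in> S"
    using countable_dense_setE by metis
  ultimately have "AE Z in lborel. \<forall>X\<in>D. w Z * bm 1 (X - Z) = 0"
    by (intro AE_ball_countable'[OF _ D(1)]) auto
  then show "AE X in lborel. nconv ?N eg X + nconv ?K eu X = eu X"
  proof (rule AE_mp, intro AE_I2 impI)
    fix Z assume Z: "\<forall>X\<in>D. w Z * bm 1 (X - Z) = 0"
    obtain X where X: "X \<in> D" "X \<in> ball Z 1" using D(2)[of "ball Z 1"] by auto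
    then have "0 < bump 1 (X - Z)" by (intro bump_pos) (auto simp: dist_norm norm_minus_commute)
    then have "w Z = 0" using Z X by auto
    then have "\<Phi> Z = eu Z" using le[of Z] by (simp add: w_def diff_eq_0_iff_ennreal antisym)
    then show "nconv ?N eg Z + nconv ?K eu Z = eu Z" by (simp add: \<Phi>_def)
  qed
qed

text \<open>For \<open>norm z < 1\<close> the argument of \<open>u\<close> stays in a compact set.
  For \<open>norm z \<ge> 1\<close> and \<open>0 < r < a\<close> the factor
  \<open>r powr (- 1 - s)\<close> is bounded below, so the kernel is dominated by the
  weight.\<close>

lemma qk_conv_finite:
  assumes a: "0 < a"
  shows "nconv (qk a) eu X < \<infinity>"
proof -
  have "bounded (u ` cball 0 (norm X + 1 + a))"
    using u_cont by (intro compact_imp_bounded compact_continuous_image) (auto intro: continuous_on_subset)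
  then obtain B where B0: "\<forall>Z\<in>cball 0 (norm X + 1 + a). norm (u Z) \<le> B" unfolding bounded_iff by auto
  have B: "u Z \<le> B" if "norm Z \<le> norm X + 1 + a" for Z
    using that bspec[OF B0, of Z] by simp
  define C where "C = a powr (1 + s) * (2 * (1 + (8 * M) powr M))"
  have "nconv (qk a) eu X \<le> (\<integral>\<^sup>+Y. ennreal C * (wt Y * eu (X - Y)) + ennreal B * qk a Y \<partial>lborel)"
    unfolding nconv_def
  proof (rule nn_integral_mono)
    fix Y :: "'a \<times> real"
    obtain z r where Y: "Y = (z, r)" by (cases Y)
    show "qk a Y * eu (X - Y) \<le> ennreal C * (wt Y * eu (X - Y)) + ennreal B * qk a Y"
    proof (cases "0 < r \<and> r < a")
      case r: True
      show ?thesis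
      proof (cases "norm z < 1")
        case True
        have "norm (X - Y) \<le> norm X + norm Y" by (rule norm_triangle_ineq4)
        also have "norm Y \<le> norm z + norm r" unfolding Y by (rule norm_Pair_le)
        finally have "norm (X - Y) \<le> norm X + 1 + a" using True r by simp
        then have "qk a Y * eu (X - Y) \<le> qk a Y * ennreal B" by (intro mult_left_mono ennreal_leI B) auto
        then show ?thesis by (simp add: mult.commute add_increasing)
      next
        case False
        have "1 \<le> a powr (1 + s) * r powr (- 1 - s)"
        proof -
          have "r powr (1 + s) \<le> a powr (1 + s)" using r s by (intro powr_mono2) auto
          moreover have "r powr (- 1 - s) = 1 / r powr (1 + s)" by (simp add: powr_minus_divide[symmetric])
          ultimately show ?thesis using r by simp
        qed
        then have "1 * heat_kernel r z \<le> a powr (1 + s) * r powr (- 1 - s) * heat_kernel r z" by (intro mult_right_mono) auto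
        also have "\<dots> \<le> a powr (1 + s) * (2 * (1 + (8 * M) powr M) / growth M (z, r))"
          using heat_kernel_weight_le[OF s(1) _ _ M, of r z] r False by (simp only: mult.assoc) (intro mult_left_mono, auto)
        finally have "heat_kernel r z \<le> C * (1 / growth M Y)" by (simp add: C_def Y)
        then have "ennreal (heat_kernel r z) \<le> ennreal C * wt Y"
          by (subst ennreal_mult''[symmetric]) (auto intro: ennreal_leI)
        then have "qk a Y * eu (X - Y) \<le> ennreal C * wt Y * eu (X - Y)"
          using r by (intro mult_right_mono) (auto simp: stker_def Y)
        then show ?thesis by (simp add: mult.assoc add_increasing2)
      qed
    qed (auto simp: stker_def Y)
  qed
  also have "\<dots> = ennreal C * nconv wt eu X + ennreal B * (\<integral>\<^sup>+Y. qk a Y \<partial>lborel)"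
    unfolding nconv_def by (rule nn_integral_lincomb) measurable
  also have "(\<integral>\<^sup>+Y. qk a Y \<partial>lborel) = (\<integral>\<^sup>+r. indicator {0<..<a} r \<partial>lborel)"
    by (rule nn_integral_stker) auto
  also have "ennreal C * nconv wt eu X + ennreal B * (\<integral>\<^sup>+r. indicator {0<..<a} r \<partial>lborel) < \<infinity>"
    using wt_u_finite[of X] a by (simp add: ennreal_mult_less_top)
  finally show ?thesis .
qed

text \<open>At bounded times \<open>mk\<close> is small as a whole when \<open>lam\<close> is small,
  so its values can be estimated one by one, without cancellation.\<close>

lemma mk_le_qk:
  assumes "0 < lam" "snd Y < a"
  shows "mk lam Y \<le> ennreal (lam / (s * Gamma s * (1 - s))) * qk a Y"
proof (cases "0 < snd Y")
  case True
  have "mk lam Y \<le> ennreal (lam / (s * Gamma s * (1 - s))) * ennreal (heat_kernel (snd Y) (fst Y))"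
    unfolding stker_def by (intro mult_right_mono mrem_le_const s assms) simp
  then show ?thesis using True assms by (simp add: stker_def)
qed (simp add: stker_def mrem_nonpos)

lemma mk_real:
  assumes "0 < lam"
  shows "mk lam (z, r) = ennreal (enn2real (mrem s lam 0 r) * heat_kernel r z)"
  using mrem_finite[OF assms, of r] by (simp add: stker_def ennreal_mult'')

lemma mrem_real_le:
  assumes "0 < lam" "0 < r"
  shows "enn2real (mrem s lam 0 r) \<le> (2 * s) powr s / (s * Gamma s * (1 - s)) * lam powr (1 - s) * r powr (- s)"
proof -
  have "0 < Gamma s" using s by (simp add: Gamma_real_pos)
  then show ?thesis
    using enn2real_mono[OF mrem_le_powr[OF s assms]] s by simp
qed

text \<open>For \<open>r \<ge> 1\<close> the bound \<open>r powr (- s)\<close> for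
  \<open>mrem\<close> and the gain \<open>1 / r\<close> of the second difference together give
  \<open>r powr (- 1 - s)\<close> times a Gaussian, which the weight dominates; the coefficient is
  \<open>lam powr (1 - s)\<close>. For \<open>r < 1\<close> each term is bounded separately by
  \<open>mk_le_qk\<close>. The error kernels have finite convolutions with \<open>u\<close>.\<close>

lemma mk_space_difference:
  obtains C where "0 \<le> C" "\<And>lam Y. 0 < lam \<Longrightarrow> mk lam (Y + (e, 0)) + mk lam (Y - (e, 0)) \<le> 2 * mk lam Y
      + (ennreal (C * lam powr (1 - s)) * wt Y + ennreal (C * lam) * (qk 1 (Y + (e, 0)) + qk 1 (Y - (e, 0)) + 2 * qk 1 Y))"
    "\<And>lam Y. 0 < lam \<Longrightarrow> 2 * mk lam Y \<le> mk lam (Y + (e, 0)) + mk lam (Y - (e, 0))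
      + (ennreal (C * lam powr (1 - s)) * wt Y + ennreal (C * lam) * (qk 1 (Y + (e, 0)) + qk 1 (Y - (e, 0)) + 2 * qk 1 Y))"
proof -
  define c where "c = 1 / (s * Gamma s * (1 - s))"
  define c1 where "c1 = (2 * s) powr s / (s * Gamma s * (1 - s))"
  define c2 where "c2 = 2 * (norm e)\<^sup>2 * (4 * exp ((norm e)\<^sup>2) + 1) * 2 powr (DIM('a) / 2)"
  define c3 where "c3 = 2 powr (1 + s) * (2 * (1 + (8 * M) powr M))"
  define C where "C = c + c1 * c2 * c3"
  have G: "0 < Gamma s" using s by (simp add: Gamma_real_pos)
  have cs: "0 \<le> c" "0 \<le> c1" "0 \<le> c2" "0 \<le> c3" using G s by (auto simp: c_def c1_def c2_def c3_def add_nonneg_nonneg)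
  then have C: "0 \<le> C" "c \<le> C" "c1 * c2 * c3 \<le> C" by (auto simp: C_def)
  define Er where "Er lam Y = ennreal (C * lam powr (1 - s)) * wt Y + ennreal (C * lam) * (qk 1 (Y + (e, 0)) + qk 1 (Y - (e, 0)) + 2 * qk 1 Y)" for lam Y
  have main: "mk lam (Y + (e, 0)) + mk lam (Y - (e, 0)) \<le> 2 * mk lam Y + Er lam Y
     \<and> 2 * mk lam Y \<le> mk lam (Y + (e, 0)) + mk lam (Y - (e, 0)) + Er lam Y" if lam: "0 < lam" for lam Y
  proof -
    obtain z r where Y: "Y = (z, r)" by (cases Y)
    show ?thesis
    proof (cases "r < 1")
      case True
      have small: "mk lam (z', r) \<le> ennreal (C * lam) * qk 1 (z', r)" for z'
      proof -
        have "mk lam (z', r) \<le> ennreal (lam / (s * Gamma s * (1 - s))) * qk 1 (z', r)"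
          using lam True by (intro mk_le_qk) auto
        also have "\<dots> \<le> ennreal (C * lam) * qk 1 (z', r)"
          using C(2) lam mult_right_mono[OF C(2), of lam] by (intro mult_right_mono ennreal_leI) (auto simp: c_def)
        finally show ?thesis .
      qed
      have "mk lam (Y + (e, 0)) + mk lam (Y - (e, 0)) \<le> ennreal (C * lam) * (qk 1 (Y + (e, 0)) + qk 1 (Y - (e, 0)))"
        using small[of "z + e"] small[of "z - e"] by (simp add: Y distrib_left add_mono)
      also have "\<dots> \<le> Er lam Y"
        unfolding Er_def by (rule add_increasing, simp, rule mult_left_mono, rule add_increasing2) simp_all
      finally have 1: "mk lam (Y + (e, 0)) + mk lam (Y - (e, 0)) \<le> Er lam Y" .
      have "2 * mk lam Y \<le> ennreal (C * lam) * (2 * qk 1 Y)"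
        using mult_left_mono[OF small[of z], of 2] by (simp add: Y mult.left_commute)
      also have "\<dots> \<le> Er lam Y"
        unfolding Er_def by (rule add_increasing, simp, rule mult_left_mono, rule add_increasing) simp_all
      finally have 2: "2 * mk lam Y \<le> Er lam Y" .
      show ?thesis using 1 2 by (simp add: add_increasing)
    next
      case False
      then have r: "1 \<le> r" "0 < r" by auto
      define m where "m = enn2real (mrem s lam 0 r)"
      have m: "0 \<le> m" "m \<le> c1 * lam powr (1 - s) * r powr (- s)"
        using mrem_real_le[OF lam r(2)] by (auto simp: m_def c1_def)
      define p where "p = heat_kernel r (z + e) + heat_kernel r (z - e)"
      have "\<bar>p - 2 * heat_kernel r z\<bar> \<le> c2 / r * heat_kernel (2 * r) z"
        using heat_kernel_second_difference[OF r(1), of z e] by (simp add: p_def c2_def)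
      then have "m * \<bar>p - 2 * heat_kernel r z\<bar> \<le> (c1 * lam powr (1 - s) * r powr (- s)) * (c2 / r * heat_kernel (2 * r) z)"
        using m cs r by (intro mult_mono) auto
      also have "\<dots> = c1 * c2 * lam powr (1 - s) * (r powr (- 1 - s) * heat_kernel (2 * r) z)"
      proof -
        have "r powr (- 1 - s) = r powr (- s) / r" using r by (simp add: powr_diff[symmetric, of r "- s" 1, simplified] algebra_simps) (metis powr_diff powr_one r(2) less_imp_le minus_diff_commute uminus_add_conv_diff add.commute diff_conv_add_uminus)
        then show ?thesis by simp
      qed
      also have "\<dots> \<le> c1 * c2 * lam powr (1 - s) * (c3 / growth M (z, r))"
        unfolding c3_def using cs r by (intro mult_left_mono heat_kernel_later_weight_le s M) auto
      also have "\<dots> = c1 * c2 * c3 * (lam powr (1 - s) * (1 / growth M (z, r)))" by simp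
      also have "\<dots> \<le> C * (lam powr (1 - s) * (1 / growth M (z, r)))"
        by (intro mult_right_mono C) auto
      finally have d: "m * \<bar>p - 2 * heat_kernel r z\<bar> \<le> C * lam powr (1 - s) * (1 / growth M Y)" by (simp add: Y)
      have d12: "m * p \<le> 2 * (m * heat_kernel r z) + C * lam powr (1 - s) * (1 / growth M Y)"
        "2 * (m * heat_kernel r z) \<le> m * p + C * lam powr (1 - s) * (1 / growth M Y)"
      proof -
        have "m * (p - 2 * heat_kernel r z) \<le> m * \<bar>p - 2 * heat_kernel r z\<bar>" "- (m * (p - 2 * heat_kernel r z)) \<le> m * \<bar>p - 2 * heat_kernel r z\<bar>"
          using m(1) by (auto simp: mult_left_mono minus_mult_right intro!: mult_left_mono)
        then show "m * p \<le> 2 * (m * heat_kernel r z) + C * lam powr (1 - s) * (1 / growth M Y)"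
          "2 * (m * heat_kernel r z) \<le> m * p + C * lam powr (1 - s) * (1 / growth M Y)"
          using d by (auto simp: algebra_simps)
      qed
      have p0: "0 \<le> p" by (simp add: p_def)
      have S: "mk lam (Y + (e, 0)) + mk lam (Y - (e, 0)) = ennreal (m * p)"
        using m(1) by (simp add: Y mk_real[OF lam] m_def[symmetric] p_def distrib_left ennreal_plus)
      have S2: "2 * mk lam Y = ennreal (2 * (m * heat_kernel r z))"
        by (simp add: Y mk_real[OF lam] m_def[symmetric] ennreal_mult')
      have W: "ennreal (C * lam powr (1 - s)) * wt Y = ennreal (C * lam powr (1 - s) * (1 / growth M Y))"
        using C by (intro ennreal_mult'[symmetric]) auto
      have le: "ennreal (C * lam powr (1 - s) * (1 / growth M Y)) \<le> Er lam Y"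
        unfolding Er_def W by simp
      have nn: "0 \<le> C * lam powr (1 - s) * (1 / growth M Y)" using C by simp
      have "ennreal (m * p) \<le> ennreal (2 * (m * heat_kernel r z)) + ennreal (C * lam powr (1 - s) * (1 / growth M Y))"
        using d12(1) m nn by (subst ennreal_plus[symmetric]) (auto intro: ennreal_leI simp del: ennreal_plus)
      moreover have "ennreal (2 * (m * heat_kernel r z)) \<le> ennreal (m * p) + ennreal (C * lam powr (1 - s) * (1 / growth M Y))"
        using d12(2) m nn p0 by (subst ennreal_plus[symmetric]) (auto intro: ennreal_leI simp del: ennreal_plus)
      ultimately show ?thesis unfolding S S2 using le by (meson add_left_mono order_trans)
    qed
  qed
  show ?thesis
    by (rule that[OF C(1)]) (use main in \<open>auto simp: Er_def\<close>)
qed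

end

context frac_solution
begin

text \<open>Product rule for \<open>mrem\<close> times the heat kernel: \<open>mrem_diff_le\<close>
  and \<open>heat_kernel_time_difference\<close> each gain \<open>1 / r\<close>, so a first
  difference is enough in time. The cut-off \<open>1 + h\<close> in \<open>qk\<close> covers the
  shifted point whenever \<open>r < 1\<close>.\<close>

lemma mk_time_difference:
  assumes h: "0 < h"
  obtains C where "0 \<le> C" "\<And>lam Y. 0 < lam \<Longrightarrow> mk lam (Y + (0, h)) \<le> mk lam Y
      + (ennreal (C * lam powr (1 - s)) * wt Y + ennreal (C * lam) * (qk (1 + h) (Y + (0, h)) + qk (1 + h) Y))"
    "\<And>lam Y. 0 < lam \<Longrightarrow> mk lam Y \<le> mk lam (Y + (0, h))
      + (ennreal (C * lam powr (1 - s)) * wt Y + ennreal (C * lam) * (qk (1 + h) (Y + (0, h)) + qk (1 + h) Y))"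
proof -
  define c where "c = 1 / (s * Gamma s * (1 - s))"
  define c1 where "c1 = (2 * s) powr s / (s * Gamma s * (1 - s))"
  define c2 where "c2 = h * (2 + DIM('a) / 2) * (2 * (1 + h)) powr (DIM('a) / 2)"
  define c3 where "c3 = (2 * (1 + h)) powr (1 + s) * (2 * (1 + (8 * M) powr M))"
  define c4 where "c4 = (2 * (1 + s)) powr (1 + s) * h / (s * Gamma s * (1 - s))"
  define c5 where "c5 = (1 + h) powr (1 + s) * (2 * (1 + (8 * M) powr M))"
  define C where "C = c + (c1 * c2 * c3 + c4 * c5)"
  have G: "0 < Gamma s" using s by (simp add: Gamma_real_pos)
  have cs: "0 \<le> c" "0 \<le> c1" "0 \<le> c2" "0 \<le> c3" "0 \<le> c4" "0 \<le> c5"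
    using G s h by (auto simp: c_def c1_def c2_def c3_def c4_def c5_def add_nonneg_nonneg)
  then have C: "0 \<le> C" "c \<le> C" "c1 * c2 * c3 + c4 * c5 \<le> C" by (auto simp: C_def)
  define Er where "Er lam Y = ennreal (C * lam powr (1 - s)) * wt Y + ennreal (C * lam) * (qk (1 + h) (Y + (0, h)) + qk (1 + h) Y)" for lam Y
  have main: "mk lam (Y + (0, h)) \<le> mk lam Y + Er lam Y \<and> mk lam Y \<le> mk lam (Y + (0, h)) + Er lam Y" if lam: "0 < lam" for lam Y
  proof -
    obtain z r where Y: "Y = (z, r)" by (cases Y)
    show ?thesis
    proof (cases "r < 1")
      case True
      have small: "mk lam Z \<le> ennreal (C * lam) * qk (1 + h) Z" if "snd Z < 1 + h" for Z
      proof -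
        have "mk lam Z \<le> ennreal (lam / (s * Gamma s * (1 - s))) * qk (1 + h) Z"
          using lam that by (intro mk_le_qk) auto
        also have "\<dots> \<le> ennreal (C * lam) * qk (1 + h) Z"
          using C(2) lam mult_right_mono[OF C(2), of lam] by (intro mult_right_mono ennreal_leI) (auto simp: c_def)
        finally show ?thesis .
      qed
      have "mk lam (Y + (0, h)) \<le> ennreal (C * lam) * qk (1 + h) (Y + (0, h))"
        using True by (intro small) (simp add: Y)
      also have "\<dots> \<le> Er lam Y"
        unfolding Er_def by (rule add_increasing, simp, rule mult_left_mono, rule add_increasing2) simp_all
      finally have 1: "mk lam (Y + (0, h)) \<le> Er lam Y" .
      have "mk lam Y \<le> ennreal (C * lam) * qk (1 + h) Y"
        using True h by (intro small) (simp add: Y)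
      also have "\<dots> \<le> Er lam Y"
        unfolding Er_def by (rule add_increasing, simp, rule mult_left_mono, rule add_increasing) simp_all
      finally have 2: "mk lam Y \<le> Er lam Y" .
      show ?thesis using 1 2 by (simp add: add_increasing)
    next
      case False
      then have r: "1 \<le> r" "0 < r" by auto
      define m where "m = enn2real (mrem s lam 0 r)"
      define m' where "m' = enn2real (mrem s lam 0 (r + h))"
      define p where "p = heat_kernel r z"
      define p' where "p' = heat_kernel (r + h) z"
      let ?L = "lam powr (1 - s)"
      have m: "0 \<le> m" "m \<le> c1 * ?L * r powr (- s)"
        using mrem_real_le[OF lam r(2)] by (auto simp: m_def c1_def)
      have pp: "0 \<le> p" "0 \<le> p'" by (auto simp: p_def p'_def)
      have fin: "mrem s lam 0 q = ennreal (enn2real (mrem s lam 0 q))" for q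
        using mrem_finite[OF lam, of q] by simp
      have md: "\<bar>m' - m\<bar> \<le> c4 * ?L * r powr (- 1 - s)"
      proof (rule abs_leI)
        have "m' \<le> m" unfolding m'_def m_def
          using mrem_antimono[OF s(1) lam r(2), of "r + h"] h mrem_finite[OF lam] by (intro enn2real_mono) auto
        moreover have "0 \<le> c4 * ?L * r powr (- 1 - s)" using cs by simp
        ultimately show "m' - m \<le> c4 * ?L * r powr (- 1 - s)" by linarith
        have "ennreal m \<le> ennreal m' + ennreal (c4 * ?L * r powr (- 1 - s))"
          using mrem_diff_le[OF s lam r(2), of h] h unfolding m_def m'_def fin[symmetric] by (simp add: c4_def mult_ac)
        also have "\<dots> = ennreal (m' + c4 * ?L * r powr (- 1 - s))"
          using cs by (simp add: ennreal_plus m'_def)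
        finally have "m \<le> m' + c4 * ?L * r powr (- 1 - s)"
          using cs by (subst (asm) ennreal_le_iff) (auto simp: m'_def)
        then show "- (m' - m) \<le> c4 * ?L * r powr (- 1 - s)" by simp
      qed
      have w1: "r powr (- 1 - s) * p' \<le> c5 / growth M (z, r)"
        unfolding c5_def p'_def using r h by (intro heat_kernel_later_weight_le s M) (auto simp: algebra_simps)
      have w2: "r powr (- 1 - s) * heat_kernel (2 * (r + h)) z \<le> c3 / growth M (z, r)"
        unfolding c3_def using r h by (intro heat_kernel_later_weight_le s M) (auto simp: algebra_simps)
      have "\<bar>m' * p' - m * p\<bar> \<le> \<bar>m' - m\<bar> * p' + m * \<bar>p' - p\<bar>"
      proof -
        have "m' * p' - m * p = (m' - m) * p' + m * (p' - p)" by (simp add: algebra_simps)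
        also have "\<bar>\<dots>\<bar> \<le> \<bar>(m' - m) * p'\<bar> + \<bar>m * (p' - p)\<bar>" by (rule abs_triangle_ineq)
        finally show ?thesis using pp m(1) by (simp add: abs_mult)
      qed
      also have "\<dots> \<le> (c4 * ?L * r powr (- 1 - s)) * p' + (c1 * ?L * r powr (- s)) * (c2 / r * heat_kernel (2 * (r + h)) z)"
      proof (intro add_mono mult_mono md m order_refl)
        show "\<bar>p' - p\<bar> \<le> c2 / r * heat_kernel (2 * (r + h)) z"
          using heat_kernel_time_difference[OF r(1) h, of z] by (simp add: p_def p'_def c2_def)
      qed (use pp cs in auto)
      also have "\<dots> = c4 * ?L * (r powr (- 1 - s) * p') + c1 * c2 * ?L * (r powr (- 1 - s) * heat_kernel (2 * (r + h)) z)"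
      proof -
        have "r powr (- 1 - s) = r powr (- s) / r" using powr_diff[of r "- s" 1] r by (simp add: minus_diff_commute)
        then show ?thesis by (simp only:) (simp add: mult_ac)
      qed
      also have "\<dots> \<le> c4 * ?L * (c5 / growth M (z, r)) + c1 * c2 * ?L * (c3 / growth M (z, r))"
        using cs by (intro add_mono mult_left_mono w1 w2) auto
      also have "\<dots> = (c1 * c2 * c3 + c4 * c5) * (?L * (1 / growth M (z, r)))" by (simp add: algebra_simps add_divide_distrib)
      also have "\<dots> \<le> C * (?L * (1 / growth M (z, r)))"
        by (intro mult_right_mono C) auto
      finally have d: "\<bar>m' * p' - m * p\<bar> \<le> C * ?L * (1 / growth M Y)" by (simp add: Y)
      have S: "mk lam (Y + (0, h)) = ennreal (m' * p')" "mk lam Y = ennreal (m * p)"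
        by (simp_all add: Y mk_real[OF lam] m_def m'_def p_def p'_def)
      have W: "ennreal (C * ?L) * wt Y = ennreal (C * ?L * (1 / growth M Y))"
        using C by (intro ennreal_mult'[symmetric]) auto
      have le: "ennreal (C * ?L * (1 / growth M Y)) \<le> Er lam Y"
        unfolding Er_def W by simp
      have nn: "0 \<le> C * ?L * (1 / growth M Y)" "0 \<le> m' * p'" "0 \<le> m * p" using C m pp by (auto simp: m'_def)
      have "ennreal (m' * p') \<le> ennreal (m * p) + ennreal (C * ?L * (1 / growth M Y))"
        using d nn by (subst ennreal_plus[symmetric]) (auto intro!: ennreal_leI simp del: ennreal_plus)
      moreover have "ennreal (m * p) \<le> ennreal (m' * p') + ennreal (C * ?L * (1 / growth M Y))"
        using d nn by (subst ennreal_plus[symmetric]) (auto intro!: ennreal_leI simp del: ennreal_plus)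
      ultimately show ?thesis unfolding S using le by (meson add_left_mono order_trans)
    qed
  qed
  show ?thesis
    by (rule that[OF C(1)]) (use main in \<open>auto simp: Er_def\<close>)
qed

text \<open>Here \<open>dl i\<close> is the damping parameter, not a truncation length.\<close>

definition Mi :: "nat \<Rightarrow> 'a \<times> real \<Rightarrow> real" where
  "Mi i X = enn2real (nconv (mk (dl i)) eu X)"

lemma mk_conv_le:
  assumes lam: "0 < lam"
  shows "nconv (mk lam) eu X \<le> ennreal (\<kappa> * u X)"
proof -
  have "nconv (mk lam) eu X = ennreal \<kappa> * nconv (\<lambda>Y. ennreal (1 / \<kappa>) * mk lam Y) eu X"
    using kappa_pos by (subst nconv_cmult_left) (auto simp: mult.assoc[symmetric] ennreal_mult'[symmetric])
  also have "\<dots> \<le> ennreal \<kappa> * eu X"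
    using representation(1)[OF lam, of X] by (intro mult_left_mono) (auto intro: order_trans[rotated] add_increasing)
  finally show ?thesis using kappa_pos by (simp add: ennreal_mult')
qed

lemma mk_conv_finite: "0 < lam \<Longrightarrow> nconv (mk lam) eu X < \<infinity>"
  using mk_conv_le[of lam X] by (rule order_le_less_trans) simp_all

lemma Mi_bounds: "0 \<le> Mi i X" "Mi i X \<le> \<kappa> * u X"
  using enn2real_mono[OF mk_conv_le[OF dl_pos, of i X]] kappa_pos u0[of X] by (simp_all add: Mi_def)

lemma error_tendsto_0: "(\<lambda>i. C * dl i powr (1 - s) * a + C * dl i * b) \<longlonglongrightarrow> 0"
proof -
  have "(\<lambda>i. C * dl i powr (1 - s) * a + C * dl i * b) \<longlonglongrightarrow> C * 0 * a + C * 0 * b"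
    using s by (intro tendsto_add tendsto_mult tendsto_const inverse_Suc_powr_tendsto_0 LIMSEQ_inverse_real_of_nat) auto
  then show ?thesis by simp
qed

text \<open>Integrating the bounds of \<open>mk_space_difference\<close> against \<open>u\<close>
  makes the second differences vanish in the limit. Nonnegativity and the pointwise bound
  \<open>\<kappa> * u X\<close>, which may be unbounded in \<open>X\<close>, then lead to first
  differences.\<close>

lemma Mi_space: "(\<lambda>i. Mi i (X + (e, 0)) - Mi i X) \<longlonglongrightarrow> 0"
proof (rule second_difference_vanishing[where B = "\<lambda>X. \<kappa> * u X"])
  fix X :: "'a \<times> real"
  obtain C where C: "0 \<le> C" and C1: "\<And>lam Y. 0 < lam \<Longrightarrow> mk lam (Y + (e, 0)) + mk lam (Y - (e, 0)) \<le> 2 * mk lam Y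
      + (ennreal (C * lam powr (1 - s)) * wt Y + ennreal (C * lam) * (qk 1 (Y + (e, 0)) + qk 1 (Y - (e, 0)) + 2 * qk 1 Y))"
    and C2: "\<And>lam Y. 0 < lam \<Longrightarrow> 2 * mk lam Y \<le> mk lam (Y + (e, 0)) + mk lam (Y - (e, 0))
      + (ennreal (C * lam powr (1 - s)) * wt Y + ennreal (C * lam) * (qk 1 (Y + (e, 0)) + qk 1 (Y - (e, 0)) + 2 * qk 1 Y))"
    using mk_space_difference[of e] by blast
  let ?E = "(e, 0) :: 'a \<times> real"
  define W where "W = enn2real (nconv wt eu X)"
  define Q where "Q = enn2real (nconv (qk 1) eu (X + ?E)) + enn2real (nconv (qk 1) eu (X - ?E)) + 2 * enn2real (nconv (qk 1) eu X)"
  have shift: "(\<integral>\<^sup>+Y. N (Y - ?E) * eu (X - Y) \<partial>lborel) = nconv N eu (X - ?E)" if [measurable]: "N \<in> borel_measurable borel" for N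
    using nconv_shift[of N eu "- ?E" X] unfolding add_uminus_conv_diff by simp
  have err: "(\<integral>\<^sup>+Y. (ennreal a * wt Y + ennreal b * (qk 1 (Y + ?E) + qk 1 (Y - ?E) + 2 * qk 1 Y)) * eu (X - Y) \<partial>lborel) = ennreal (a * W + b * Q)"
    if ab: "0 \<le> a" "0 \<le> b" for a b
  proof -
    have "(\<integral>\<^sup>+Y. (ennreal a * wt Y + ennreal b * (qk 1 (Y + ?E) + qk 1 (Y - ?E) + 2 * qk 1 Y)) * eu (X - Y) \<partial>lborel)
      = (\<integral>\<^sup>+Y. ennreal a * (wt Y * eu (X - Y)) + ennreal b * (qk 1 (Y + ?E) * eu (X - Y) + (qk 1 (Y - ?E) * eu (X - Y) + 2 * (qk 1 Y * eu (X - Y)))) \<partial>lborel)"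
      by (intro nn_integral_cong) (simp add: distrib_left distrib_right mult.assoc add.assoc)
    also have "\<dots> = ennreal a * nconv wt eu X + ennreal b * (nconv (qk 1) eu (X + ?E) + (nconv (qk 1) eu (X - ?E) + 2 * nconv (qk 1) eu X))"
      using nconv_shift[of "qk 1" eu ?E X] shift[of "qk 1"] by (simp add: nn_integral_add nn_integral_cmult nconv_def)
    also have "\<dots> = ennreal (a * W + b * Q)"
      using wt_u_finite[of X] qk_conv_finite[of 1 "X + ?E"] qk_conv_finite[of 1 "X - ?E"] qk_conv_finite[of 1 X] ab
      by (cases "nconv wt eu X"; cases "nconv (qk 1) eu (X + ?E)"; cases "nconv (qk 1) eu (X - ?E)"; cases "nconv (qk 1) eu X")
        (auto simp: W_def Q_def ennreal_mult ennreal_plus add.assoc simp del: ennreal_numeral simp flip: ennreal_numeral)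
    finally show ?thesis .
  qed
  have bound: "\<bar>Mi i (X + ?E) + Mi i (X - ?E) - 2 * Mi i X\<bar> \<le> C * dl i powr (1 - s) * W + C * dl i * Q" for i
  proof -
    let ?m = "mk (dl i)"
    define S where "S = nconv ?m eu (X + ?E) + nconv ?m eu (X - ?E)"
    define S0 where "S0 = 2 * nconv ?m eu X"
    have S: "S = (\<integral>\<^sup>+Y. (?m (Y + ?E) + ?m (Y - ?E)) * eu (X - Y) \<partial>lborel)"
      using nconv_shift[of ?m eu ?E X] by (simp add: S_def distrib_right nn_integral_add shift)
    have S0: "S0 = (\<integral>\<^sup>+Y. (2 * ?m Y) * eu (X - Y) \<partial>lborel)"
      by (simp add: S0_def mult.assoc nn_integral_cmult nconv_def)
    have fin: "nconv ?m eu Z < \<infinity>" for Z by (rule mk_conv_finite[OF dl_pos])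
    have nn: "0 \<le> C * dl i powr (1 - s)" "0 \<le> C * dl i" using C by auto
    have "S \<le> (\<integral>\<^sup>+Y. (2 * ?m Y + (ennreal (C * dl i powr (1 - s)) * wt Y + ennreal (C * dl i) * (qk 1 (Y + ?E) + qk 1 (Y - ?E) + 2 * qk 1 Y))) * eu (X - Y) \<partial>lborel)"
      unfolding S by (intro nn_integral_mono mult_right_mono C1 dl_pos) simp
    also have "\<dots> = S0 + ennreal (C * dl i powr (1 - s) * W + C * dl i * Q)"
      unfolding S0 err[OF nn, symmetric] distrib_right[of "2 * ?m _"] by (rule nn_integral_add) measurable
    finally have 1: "S \<le> S0 + ennreal (C * dl i powr (1 - s) * W + C * dl i * Q)" .
    have "S0 \<le> (\<integral>\<^sup>+Y. (?m (Y + ?E) + ?m (Y - ?E) + (ennreal (C * dl i powr (1 - s)) * wt Y + ennreal (C * dl i) * (qk 1 (Y + ?E) + qk 1 (Y - ?E) + 2 * qk 1 Y))) * eu (X - Y) \<partial>lborel)"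
      unfolding S0 by (intro nn_integral_mono mult_right_mono C2 dl_pos) simp
    also have "\<dots> = S + ennreal (C * dl i powr (1 - s) * W + C * dl i * Q)"
      unfolding S err[OF nn, symmetric] distrib_right[of "?m _ + ?m _"] by (rule nn_integral_add) measurable
    finally have 2: "S0 \<le> S + ennreal (C * dl i powr (1 - s) * W + C * dl i * Q)" .
    have "\<bar>enn2real S - enn2real S0\<bar> \<le> C * dl i powr (1 - s) * W + C * dl i * Q"
      using fin nn by (intro abs_enn2real_diff_le 1 2) (auto simp: S_def S0_def ennreal_mult_less_top W_def Q_def)
    moreover have "enn2real S = Mi i (X + ?E) + Mi i (X - ?E)"
      using fin by (simp add: S_def Mi_def enn2real_plus)
    moreover have "enn2real S0 = 2 * Mi i X" by (simp add: S0_def Mi_def enn2real_mult)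
    ultimately show ?thesis by simp
  qed
  show "(\<lambda>i. Mi i (X + ?E) + Mi i (X - ?E) - 2 * Mi i X) \<longlonglongrightarrow> 0"
    by (rule Lim_null_comparison[OF _ error_tendsto_0[of C W Q]]) (intro always_eventually allI, simp only: real_norm_def bound)
qed (rule Mi_bounds)+

lemma Mi_time:
  assumes h: "0 < h"
  shows "(\<lambda>i. Mi i (X + (0, h)) - Mi i X) \<longlonglongrightarrow> 0"
proof -
  let ?H = "(0, h) :: 'a \<times> real"
  obtain C where C: "0 \<le> C" and C1: "\<And>lam Y. 0 < lam \<Longrightarrow> mk lam (Y + ?H) \<le> mk lam Y
      + (ennreal (C * lam powr (1 - s)) * wt Y + ennreal (C * lam) * (qk (1 + h) (Y + ?H) + qk (1 + h) Y))"
    and C2: "\<And>lam Y. 0 < lam \<Longrightarrow> mk lam Y \<le> mk lam (Y + ?H)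
      + (ennreal (C * lam powr (1 - s)) * wt Y + ennreal (C * lam) * (qk (1 + h) (Y + ?H) + qk (1 + h) Y))"
    using mk_time_difference[OF h] by blast
  define W where "W = enn2real (nconv wt eu X)"
  define Q where "Q = enn2real (nconv (qk (1 + h)) eu (X + ?H)) + enn2real (nconv (qk (1 + h)) eu X)"
  have err: "(\<integral>\<^sup>+Y. (ennreal a * wt Y + ennreal b * (qk (1 + h) (Y + ?H) + qk (1 + h) Y)) * eu (X - Y) \<partial>lborel) = ennreal (a * W + b * Q)"
    if ab: "0 \<le> a" "0 \<le> b" for a b
  proof -
    have "(\<integral>\<^sup>+Y. (ennreal a * wt Y + ennreal b * (qk (1 + h) (Y + ?H) + qk (1 + h) Y)) * eu (X - Y) \<partial>lborel)
      = (\<integral>\<^sup>+Y. ennreal a * (wt Y * eu (X - Y)) + ennreal b * (qk (1 + h) (Y + ?H) * eu (X - Y) + qk (1 + h) Y * eu (X - Y)) \<partial>lborel)"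
      by (intro nn_integral_cong) (simp add: distrib_left distrib_right mult.assoc)
    also have "\<dots> = ennreal a * nconv wt eu X + ennreal b * (nconv (qk (1 + h)) eu (X + ?H) + nconv (qk (1 + h)) eu X)"
      using nconv_shift[of "qk (1 + h)" eu ?H X] by (simp add: nn_integral_add nn_integral_cmult nconv_def)
    also have "\<dots> = ennreal (a * W + b * Q)"
      using wt_u_finite[of X] qk_conv_finite[of "1 + h" "X + ?H"] qk_conv_finite[of "1 + h" X] ab h
      by (cases "nconv wt eu X"; cases "nconv (qk (1 + h)) eu (X + ?H)"; cases "nconv (qk (1 + h)) eu X")
        (auto simp: W_def Q_def ennreal_mult ennreal_plus)
    finally show ?thesis .
  qed
  have bound: "\<bar>Mi i (X + ?H) - Mi i X\<bar> \<le> C * dl i powr (1 - s) * W + C * dl i * Q" for i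
  proof -
    let ?m = "mk (dl i)"
    have fin: "nconv ?m eu Z < \<infinity>" for Z by (rule mk_conv_finite[OF dl_pos])
    have nn: "0 \<le> C * dl i powr (1 - s)" "0 \<le> C * dl i" using C by auto
    have S: "nconv ?m eu (X + ?H) = (\<integral>\<^sup>+Y. ?m (Y + ?H) * eu (X - Y) \<partial>lborel)"
      using nconv_shift[of ?m eu ?H X] by simp
    have S0: "nconv ?m eu X = (\<integral>\<^sup>+Y. ?m Y * eu (X - Y) \<partial>lborel)" by (simp add: nconv_def)
    have "nconv ?m eu (X + ?H) \<le> (\<integral>\<^sup>+Y. (?m Y + (ennreal (C * dl i powr (1 - s)) * wt Y + ennreal (C * dl i) * (qk (1 + h) (Y + ?H) + qk (1 + h) Y))) * eu (X - Y) \<partial>lborel)"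
      unfolding S by (intro nn_integral_mono mult_right_mono C1 dl_pos) simp
    also have "\<dots> = nconv ?m eu X + ennreal (C * dl i powr (1 - s) * W + C * dl i * Q)"
      unfolding S0 err[OF nn, symmetric] distrib_right[of "?m _"] by (rule nn_integral_add) measurable
    finally have 1: "nconv ?m eu (X + ?H) \<le> nconv ?m eu X + ennreal (C * dl i powr (1 - s) * W + C * dl i * Q)" .
    have "nconv ?m eu X \<le> (\<integral>\<^sup>+Y. (?m (Y + ?H) + (ennreal (C * dl i powr (1 - s)) * wt Y + ennreal (C * dl i) * (qk (1 + h) (Y + ?H) + qk (1 + h) Y))) * eu (X - Y) \<partial>lborel)"
      unfolding S0 by (intro nn_integral_mono mult_right_mono C2 dl_pos) simp
    also have "\<dots> = nconv ?m eu (X + ?H) + ennreal (C * dl i powr (1 - s) * W + C * dl i * Q)"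
      unfolding S err[OF nn, symmetric] distrib_right[of "?m _"] by (rule nn_integral_add) measurable
    finally have 2: "nconv ?m eu X \<le> nconv ?m eu (X + ?H) + ennreal (C * dl i powr (1 - s) * W + C * dl i * Q)" .
    show ?thesis
      unfolding Mi_def using fin nn by (intro abs_enn2real_diff_le 1 2) (auto simp: W_def Q_def)
  qed
  show ?thesis
    by (rule Lim_null_comparison[OF _ error_tendsto_0[of C W Q]]) (intro always_eventually allI, simp only: real_norm_def bound)
qed

lemma Mi_const: "(\<lambda>i. Mi i X - Mi i X') \<longlonglongrightarrow> 0"
proof -
  have time: "(\<lambda>i. Mi i (x, t) - Mi i (x, t')) \<longlonglongrightarrow> 0" for x t t'
  proof -
    consider "t = t'" | "t' < t" | "t < t'" by linarith
    then show ?thesis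
    proof cases
      case 2
      then show ?thesis using Mi_time[of "t - t'" "(x, t')"] by simp
    next
      case 3
      then show ?thesis using tendsto_minus[OF Mi_time[of "t' - t" "(x, t)"]] by simp
    qed simp
  qed
  have "(\<lambda>i. Mi i X - Mi i (fst X', snd X)) \<longlonglongrightarrow> 0"
    using Mi_space[of "(fst X', snd X)" "fst X - fst X'"] by simp
  from tendsto_add[OF this time[of "fst X'" "snd X" "snd X'"]] show ?thesis by simp
qed

end

section \<open>Solutions are potentials\<close>

lemma fpot_le:
  assumes "0 < s" "lam' \<le> lam"
  shows "fpot s lam r \<le> fpot s lam' r"
  using assms Gamma_real_pos[of s]
  by (auto simp: fpot_def intro!: ennreal_leI divide_right_mono mult_right_mono)

lemma potential_truncation_limit_real:
  fixes g :: "'a::euclidean_space \<times> real \<Rightarrow> real"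
  assumes s: "0 < s" "s < 1" and g: "g \<in> borel_measurable borel"
    and g0: "\<And>Y. 0 \<le> g Y" and cont: "isCont g X"
  defines "U \<equiv> nconv (stker (fpot s 0)) (\<lambda>Y. ennreal (g Y))"
  assumes fin: "U X < \<infinity>" "U (X + (0, 1)) < \<infinity>"
  shows "(\<lambda>j. inverse (real (Suc j)) powr (- s) / s * enn2real (U X) - enn2real (nconv (stker (fjump s (inverse (real (Suc j))))) U X))
    \<longlonglongrightarrow> Gamma (1 - s) / s * g X"
proof -
  obtain p where p: "U X = ennreal p" "0 \<le> p" using fin(1) by (cases "U X") auto
  define J where "J j = nconv (stker (fjump s (inverse (real (Suc j))))) U X" for j
  define D where "D j = inverse (real (Suc j)) powr (- s) / s" for j
  have D: "0 < D j" for j using s by (simp add: D_def)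
  have P: "(\<lambda>j. ennreal (D j) * ennreal p - J j) \<longlonglongrightarrow> ennreal (Gamma (1 - s) / s * g X)" "J j \<le> ennreal (D j) * ennreal p" for j
    using potential_truncation_limit[OF s g g0 cont fin[unfolded U_def]]
    unfolding U_def[symmetric] by (simp_all only: p(1) D_def J_def)
  have Dp: "ennreal (D j) * ennreal p = ennreal (D j * p)" for j
    using p(2) by (rule ennreal_mult''[symmetric])
  have fin': "J j < \<infinity>" for j
    by (rule order_le_less_trans[OF P(2)[of j]]) (simp add: Dp)
  have nn: "0 \<le> D j * p - enn2real (J j)" for j
    using enn2real_mono[OF P(2)[of j, unfolded Dp]] D[of j] p(2) by simp
  have eq: "ennreal (D j) * ennreal p - J j = ennreal (D j * p - enn2real (J j))" for j
    using fin'[of j] unfolding Dp by (cases "J j") (auto simp: ennreal_minus)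
  have "(\<lambda>j. enn2real (ennreal (D j * p - enn2real (J j)))) \<longlonglongrightarrow> enn2real (ennreal (Gamma (1 - s) / s * g X))"
    using P(1) unfolding eq by (intro tendsto_enn2real) auto
  moreover have "0 \<le> Gamma (1 - s) / s * g X" using s g0[of X] Gamma_real_pos[of "1 - s"] by simp
  ultimately show ?thesis using nn p by (simp add: D_def J_def)
qed

context frac_solution
begin

abbreviation Ig :: "'a \<times> real \<Rightarrow> ennreal" where "Ig \<equiv> nconv (stker (fpot s 0)) eg"

text \<open>Monotone convergence: the damped kernels increase as the damping decreases, so this
  holds before \<open>Ig\<close> is known to be finite.\<close>

lemma conv_fpot_LIMSEQ: "(\<lambda>i. nconv (stker (fpot s (dl i))) eg X) \<longlonglongrightarrow> Ig X"
  unfolding nconv_def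
proof (rule nn_integral_LIMSEQ)
  show "incseq (\<lambda>i Y. stker (fpot s (dl i)) Y * eg (X - Y))"
  proof (intro incseq_SucI le_funI mult_right_mono)
    have "dl (Suc i) \<le> dl i" for i by (simp add: field_simps)
    then show "stker (fpot s (dl i)) Y \<le> stker (fpot s (dl (Suc i))) Y" for i and Y :: "'a \<times> real"
      unfolding stker_def by (intro mult_right_mono fpot_le s) simp_all
  qed simp
  show "(\<lambda>i. stker (fpot s (dl i)) Y * eg (X - Y)) \<longlonglongrightarrow> stker (fpot s 0) Y * eg (X - Y)" for Y
  proof -
    have "(\<lambda>i. fpot s (dl i) (snd Y)) \<longlonglongrightarrow> fpot s 0 (snd Y)"
    proof (cases "0 < snd Y")
      case True
      have "(\<lambda>i. exp (- dl i * snd Y) * snd Y powr (s - 1) / Gamma s) \<longlonglongrightarrow> exp (- 0 * snd Y) * snd Y powr (s - 1) / Gamma s"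
        using less_imp_neq[OF Gamma_real_pos[OF s(1)]] by (intro tendsto_intros LIMSEQ_inverse_real_of_nat) auto
      then show ?thesis using True unfolding fpot_def by (simp only: if_True tendsto_ennrealI)
    qed (simp add: fpot_def)
    then have "(\<lambda>i. (ennreal (heat_kernel (snd Y) (fst Y)) * eg (X - Y)) * fpot s (dl i) (snd Y))
       \<longlonglongrightarrow> (ennreal (heat_kernel (snd Y) (fst Y)) * eg (X - Y)) * fpot s 0 (snd Y)"
      by (intro ennreal_tendsto_cmult) (auto simp: ennreal_mult_less_top)
    then show ?thesis by (simp add: stker_def mult_ac)
  qed
qed measurable

lemma Ig_le: "Ig X \<le> eu X"
proof (rule LIMSEQ_le_const2[OF conv_fpot_LIMSEQ])
  show "\<exists>N. \<forall>i\<ge>N. nconv (stker (fpot s (dl i))) eg X \<le> eu X"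
    using representation(1)[OF dl_pos, of _ X] by (meson add_increasing2 order_trans zero_le le_iff_add)
qed

lemma Ig_finite: "Ig X < \<infinity>"
  using Ig_le[of X] by (rule order_le_less_trans) simp

text \<open>The damped time factors have mass \<open>lam powr (- s)\<close>, unbounded as
  \<open>lam\<close> tends to 0, so the undamped kernel has infinite mass; but \<open>q\<close>
  times this mass would be at most the finite value \<open>Ig 0\<close>.\<close>

lemma potential_of_bounded_below:
  assumes q: "0 < q" "\<And>X. q \<le> g X"
  shows False
proof -
  define I where "I = (\<integral>\<^sup>+Y. stker (fpot s 0) (Y :: 'a \<times> real) \<partial>lborel)"
  have "I * ennreal q \<le> Ig 0"
    unfolding I_def nconv_def
    by (subst nn_integral_multc[symmetric]) (auto intro!: nn_integral_mono mult_left_mono ennreal_leI q)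
  then have "I * ennreal q < \<infinity>" using Ig_finite by (rule order_le_less_trans)
  then have fin: "I < \<infinity>" using q(1) by (auto simp: ennreal_mult_less_top)
  have le: "ennreal (dl i powr (- s)) \<le> I" for i
  proof -
    have "ennreal (dl i powr (- s)) = (\<integral>\<^sup>+r. fpot s (dl i) r \<partial>lborel)"
    proof -
      have "(\<integral>\<^sup>+r. fpot s (dl i) r \<partial>lborel)
        = (\<integral>\<^sup>+r. ennreal (1 / Gamma s) * (indicator {0<..} r * ennreal (r powr (s - 1) * exp (- dl i * r))) \<partial>lborel)"
        using s Gamma_real_pos[of s]
        by (intro nn_integral_cong) (auto simp: fpot_def ennreal_mult'[symmetric] mult_ac)
      also have "\<dots> = ennreal (1 / Gamma s) * ennreal (Gamma s * dl i powr (- s))"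
        using nn_integral_Gamma_scaled[OF s(1) dl_pos[of i]] by (simp add: nn_integral_cmult)
      also have "\<dots> = ennreal (dl i powr (- s))"
        using Gamma_real_pos[OF s(1)] by (simp add: ennreal_mult'[symmetric])
      finally show ?thesis by simp
    qed
    also have "\<dots> \<le> (\<integral>\<^sup>+r. fpot s 0 r \<partial>lborel)"
      by (intro nn_integral_mono fpot_le s) simp
    also have "\<dots> = I" unfolding I_def by (rule nn_integral_stker[symmetric]) (auto simp: fpot_nonpos)
    finally show ?thesis .
  qed
  obtain i0 where i0: "I = ennreal i0" "0 \<le> i0" using fin by (cases I) auto
  \<comment> \<open>\<open>dl i powr (- s)\<close> is \<open>(i + 1) powr s\<close>, which exceeds
    the supposed mass \<open>i0\<close> for this \<open>i\<close>.\<close>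
  obtain i where i: "(i0 + 1) powr (1 / s) < real i" using reals_Archimedean2 by blast
  have "i0 + 1 = ((i0 + 1) powr (1 / s)) powr s" using s i0 by (simp add: powr_powr)
  also have "\<dots> \<le> real (Suc i) powr s" using i s by (intro powr_mono2) auto
  also have "\<dots> = dl i powr (- s)" by (simp add: powr_minus inverse_powr)
  also have "\<dots> \<le> i0" using le[of i] i0 by simp
  finally show False by simp
qed

text \<open>A single point with \<open>Ig X < u X\<close> at which the representation holds for all
  \<open>dl i\<close> leads to a contradiction: there \<open>Mi i X\<close> tends to a positive
  constant \<open>c\<close>, and \<open>Mi_const\<close> carries this limit to every other point,
  exceptional ones included. As \<open>Mi i\<close> is at most \<open>\<kappa> * u\<close>, this
  bounds \<open>u\<close> from below by \<open>c / \<kappa>\<close>.\<close>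

lemma Ig_eq_AE:
  assumes low: "\<And>c. 0 < c \<Longrightarrow> (\<And>X. c \<le> u X) \<Longrightarrow> \<exists>q>0. \<forall>X. q \<le> g X"
  shows "AE X in lborel. Ig X = eu X"
proof -
  have "AE X in lborel. \<forall>i. nconv (stker (fpot s (dl i))) eg X + nconv (\<lambda>Y. ennreal (1 / \<kappa>) * mk (dl i) Y) eu X = eu X"
    using representation(2)[OF dl_pos] by (simp add: AE_all_countable)
  then show ?thesis
  proof eventually_elim
    case (elim X)
    show "Ig X = eu X"
    proof (rule ccontr)
      assume ne: "Ig X \<noteq> eu X"
      obtain p where p: "Ig X = ennreal p" "0 \<le> p" using Ig_finite[of X] by (cases "Ig X") auto
      have "p \<le> u X" using Ig_le[of X] p u0[of X] by simp
      then have pu: "p < u X" using ne p by (auto simp: le_less)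
      have Mi: "Mi i X = \<kappa> * (u X - enn2real (nconv (stker (fpot s (dl i))) eg X))" for i
      proof -
        have e: "nconv (stker (fpot s (dl i))) eg X + ennreal (1 / \<kappa>) * nconv (mk (dl i)) eu X = eu X"
          using elim[rule_format, of i] by (simp add: nconv_cmult_left)
        then have "nconv (stker (fpot s (dl i))) eg X < \<infinity>"
          by (metis ennreal_less_top infinity_ennreal_def le_iff_add order_le_less_trans)
        then obtain a b where ab: "nconv (stker (fpot s (dl i))) eg X = ennreal a" "0 \<le> a"
          "nconv (mk (dl i)) eu X = ennreal b" "0 \<le> b"
          using mk_conv_finite[OF dl_pos, of i X]
          by (cases "nconv (stker (fpot s (dl i))) eg X"; cases "nconv (mk (dl i)) eu X") auto
        have "ennreal (a + 1 / \<kappa> * b) = ennreal (u X)"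
          using e ab kappa_pos by (simp add: ennreal_plus ennreal_mult'[symmetric])
        then have "a + 1 / \<kappa> * b = u X" using ab kappa_pos u0[of X] by (subst (asm) ennreal_inj) auto
        then have "u X - a = 1 / \<kappa> * b" by simp
        then have "b = \<kappa> * (u X - a)" using kappa_pos by simp
        then show ?thesis using ab by (simp add: Mi_def)
      qed
      define c where "c = \<kappa> * (u X - p)"
      have c: "0 < c" using pu kappa_pos by (simp add: c_def)
      have "(\<lambda>i. enn2real (nconv (stker (fpot s (dl i))) eg X)) \<longlonglongrightarrow> enn2real (Ig X)"
        using conv_fpot_LIMSEQ[of X] p by (intro tendsto_enn2real) auto
      then have "(\<lambda>i. Mi i X) \<longlonglongrightarrow> c"
        unfolding Mi c_def using p by (intro tendsto_mult tendsto_diff tendsto_const) simp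
      then have "(\<lambda>i. Mi i X' ) \<longlonglongrightarrow> c" for X'
        using tendsto_add[OF Mi_const[of X' X]] by fastforce
      then have "c \<le> \<kappa> * u X'" for X'
        by (rule LIMSEQ_le_const2) (auto intro: Mi_bounds)
      then have "c / \<kappa> \<le> u X'" for X'
        using kappa_pos by (simp add: divide_le_eq mult.commute)
      moreover have "0 < c / \<kappa>" using c kappa_pos by simp
      ultimately obtain q where "0 < q" "\<And>X. q \<le> g X" using low by meson
      then show False by (rule potential_of_bounded_below)
    qed
  qed
qed

text \<open>The truncated operator contains the point value with the coefficient \<open>D j\<close>
  and everything else under an integral. Replacing \<open>u\<close> by \<open>Ig\<close> leaves the
  integral unchanged, and both truncations have the limit \<open>\<kappa> * g X\<close>; so
  \<open>D j * (u X - Ig X)\<close> tends to 0.\<close>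

lemma solution_eq_potential:
  assumes low: "\<And>c. 0 < c \<Longrightarrow> (\<And>X. c \<le> u X) \<Longrightarrow> \<exists>q>0. \<forall>X. q \<le> g X"
  shows "Ig X = eu X"
proof -
  have cont: "isCont g X" using continuous_on_eq_continuous_at[OF open_UNIV, of g] g_cont by blast
  have ae: "nconv N Ig X = nconv N eu X" if [measurable]: "N \<in> borel_measurable borel" for N
  proof -
    have "nconv Ig N X = nconv eu N X"
      unfolding nconv_def[of Ig] nconv_def[of eu]
    proof (rule nn_integral_cong_AE)
      have "AE Y in lborel. Ig Y = eu Y" by (rule Ig_eq_AE) (rule low)
      then show "AE Y in lborel. Ig Y * N (X - Y) = eu Y * N (X - Y)" by eventually_elim simp
    qed
    then show ?thesis using nconv_commute[of N Ig] nconv_commute[of N eu] by simp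
  qed
  obtain p where p: "Ig X = ennreal p" "0 \<le> p" using Ig_finite[of X] by (cases "Ig X") auto
  define D where "D j = dl j powr (- s) / s" for j
  have "(\<lambda>j. D j * p - enn2real (nconv (jk j) eu X)) \<longlonglongrightarrow> \<kappa> * g X"
    using potential_truncation_limit_real[OF s g_meas g0 cont Ig_finite Ig_finite] p
    by (simp add: ae D_def \<kappa>)
  from tendsto_diff[OF lim[of X, folded D_def] this]
  have lim0: "(\<lambda>j. D j * (u X - p)) \<longlonglongrightarrow> 0" by (simp add: algebra_simps)
  \<comment> \<open>With coefficients of at least 1 the nonnegative difference
    \<open>u X - p\<close> is at most \<open>D j\<close> times itself, which tends to 0.\<close>
  have D1: "1 \<le> D j" for j
  proof -
    have "1 powr (- s) \<le> dl j powr (- s)" using s by (intro powr_mono2') (auto simp: field_simps)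
    moreover have "dl j powr (- s) \<le> dl j powr (- s) / s" using s by (simp add: le_divide_eq mult_left_le)
    ultimately show ?thesis by (simp add: D_def)
  qed
  have "p \<le> u X" using Ig_le[of X] p u0[of X] by simp
  then have "u X - p \<le> D j * (u X - p)" for j using mult_right_mono[OF D1[of j], of "u X - p"] by simp
  then have "u X - p \<le> 0" using LIMSEQ_le_const[OF lim0] by blast
  with \<open>p \<le> u X\<close> show ?thesis using p by simp
qed

end

section \<open>The operator and the potential in coordinates\<close>

text \<open>The functional equation of \<open>Gamma\<close> at \<open>- s\<close>, which lies
  strictly between the poles -1 and 0. It identifies the normalising constant of the operator with
  the mass found in \<open>nn_integral_mar\<close>.\<close>

lemma abs_Gamma_minus:
  fixes s :: real
  assumes "0 < s" "s < 1"
  shows "\<bar>Gamma (- s)\<bar> = Gamma (1 - s) / s"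
proof -
  have "- s \<notin> \<int>\<^sub>\<le>\<^sub>0"
  proof
    assume "- s \<in> \<int>\<^sub>\<le>\<^sub>0"
    then obtain n where "- s = of_int n" by (elim nonpos_Ints_cases)
    then have "real_of_int n < 0" "real_of_int (- 1) < real_of_int n" using assms by simp_all
    then show False by (simp only: of_int_less_iff of_int_less_0_iff)
  qed
  then have "Gamma (- s + 1) = - s * Gamma (- s)" by (rule Gamma_plus1)
  then have "Gamma (- s) = - (Gamma (1 - s) / s)" using assms by (simp add: field_simps)
  moreover have "0 < Gamma (1 - s) / s" using assms Gamma_real_pos[of "1 - s"] by simp
  ultimately show ?thesis by linarith
qed

lemma slowly_increasing_weighted_integral:
  fixes u :: "real ^ 'n \<Rightarrow> real \<Rightarrow> real"
  assumes "slowly_increasing s u" and M: "M = CARD('n) / 2 + 1 + s"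
    and [measurable]: "(\<lambda>X. u (fst X) (snd X)) \<in> borel_measurable borel" and u0: "\<And>x t. 0 \<le> u x t"
  shows "(\<integral>\<^sup>+Y. ennreal (u (fst Y) (snd Y)) * ennreal (1 / growth M Y) \<partial>lborel) < \<infinity>"
proof -
  let ?f = "\<lambda>Y. u (fst Y) (snd Y) * (1 / growth M Y)"
  have "(\<lambda>(x, t). \<bar>u x t\<bar> / (1 + norm x powr (real CARD('n) + 2 + 2 * s) + \<bar>t\<bar> powr (real CARD('n) / 2 + 1 + s))) = ?f"
    using u0 by (auto simp: fun_eq_iff growth_def M algebra_simps)
  then have "integrable lebesgue ?f" using assms(1) by (simp add: slowly_increasing_def)
  then have "integrable lborel ?f" by (subst (asm) integrable_completion) auto
  then have "(\<integral>\<^sup>+Y. ennreal (norm (?f Y)) \<partial>lborel) < \<infinity>" by (simp add: integrable_iff_bounded)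
  also have "(\<integral>\<^sup>+Y. ennreal (norm (?f Y)) \<partial>lborel) = (\<integral>\<^sup>+Y. ennreal (u (fst Y) (snd Y)) * ennreal (1 / growth M Y) \<partial>lborel)"
    using u0 by (intro nn_integral_cong) (simp add: ennreal_mult'[symmetric])
  finally show ?thesis .
qed

lemma parabolic_holder_frac_gap_bounded:
  fixes u :: "real ^ 'n \<Rightarrow> real \<Rightarrow> real"
  assumes s: "0 < s" "s < 1" and a: "s < a" "parabolic_holder_loc a u" and u0: "\<And>x t. 0 \<le> u x t"
    and M: "M = CARD('n) / 2 + 1 + s"
    and W: "(\<integral>\<^sup>+Y. ennreal (u (fst Y) (snd Y)) * ennreal (1 / growth M Y) \<partial>lborel) < \<infinity>"
  shows "\<exists>C. \<forall>X. norm X \<le> R \<longrightarrow> frac_gap s (\<lambda>X. u (fst X) (snd X)) X \<le> ennreal C"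
proof -
  let ?U = "\<lambda>X. u (fst X) (snd X)"
  have cont: "continuous_on UNIV ?U" using a s by (intro parabolic_holder_loc_continuous[OF a(2)]) auto
  have [measurable]: "?U \<in> borel_measurable borel" by (rule borel_measurable_continuous_onI[OF cont])
  define b where "b = min a 1"
  have b: "s < b" "b \<le> 1" using a s by (auto simp: b_def)
  have M': "M = DIM(real ^ 'n) / 2 + 1 + s" using M by simp
  have M0: "0 \<le> M" using M s by simp
  obtain C where C: "0 \<le> C"
    and est: "\<And>(F :: (real ^ 'n) \<times> real \<Rightarrow> real) X c. F \<in> borel_measurable borel \<Longrightarrow> (\<And>Y. 0 \<le> F Y) \<Longrightarrow> 0 \<le> c
      \<Longrightarrow> (\<And>r. 0 < r \<Longrightarrow> r < 1 \<Longrightarrow> \<bar>F X - F (fst X, snd X - r)\<bar> \<le> c * r powr b)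
      \<Longrightarrow> (\<And>r z. 0 < r \<Longrightarrow> r < 1 \<Longrightarrow> norm z < 1 \<Longrightarrow>
            \<bar>F (fst X + z, snd X - r) + F (fst X - z, snd X - r) - 2 * F (fst X, snd X - r)\<bar> \<le> c * norm z powr (2 * b))
      \<Longrightarrow> frac_gap s F X \<le> ennreal (C * (c + F X)) + ennreal C * nconv (\<lambda>Y. ennreal (1 / growth M Y)) (\<lambda>Y. ennreal (F Y)) X"
    using frac_gap_le[OF s(1) b M'] by blast
  \<comment> \<open>The differences involve points within distance 1 of the ball, in space as in
    time.\<close>
  define R' where "R' = \<bar>R\<bar> + 1"
  obtain c where c: "0 \<le> c"
    and c1: "\<And>x t \<tau>. norm x \<le> R' \<Longrightarrow> \<bar>t\<bar> \<le> R' \<Longrightarrow> \<bar>\<tau>\<bar> \<le> R' \<Longrightarrow> \<bar>u x t - u x \<tau>\<bar> \<le> c * \<bar>t - \<tau>\<bar> powr b"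
    and c2: "\<And>x z t. norm (x + z) \<le> R' \<Longrightarrow> norm (x - z) \<le> R' \<Longrightarrow> \<bar>t\<bar> \<le> R' \<Longrightarrow>
          \<bar>u (x + z) t + u (x - z) t - 2 * u x t\<bar> \<le> c * norm z powr (2 * b)"
    using parabolic_holder_loc_estimates[OF a(2), of R'] unfolding b_def R'_def by fastforce
  have "bounded (?U ` cball 0 R)"
    using cont by (intro compact_imp_bounded compact_continuous_image) (auto intro: continuous_on_subset)
  then obtain B where "\<forall>v\<in>?U ` cball 0 R. norm v \<le> B" unfolding bounded_iff by blast
  then have B: "?U Z \<le> B" if "norm Z \<le> R" for Z using that by (auto simp: abs_le_iff)
  obtain W0 where W0: "(\<integral>\<^sup>+Y. ennreal (?U Y) * ennreal (1 / growth M Y) \<partial>lborel) = ennreal W0" "0 \<le> W0"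
    using W by (cases "\<integral>\<^sup>+Y. ennreal (?U Y) * ennreal (1 / growth M Y) \<partial>lborel") auto
  define G where "G = 1 + \<bar>R\<bar> powr (2 * M) + \<bar>R\<bar> powr M"
  define C' where "C' = C * (c + B) + C * (2 powr (2 * M + 1) * G * W0)"
  show ?thesis
  proof (intro exI[of _ C'] allI impI)
    fix X :: "(real ^ 'n) \<times> real" assume X: "norm X \<le> R"
    have f: "norm (fst X) \<le> \<bar>R\<bar>" and sn: "\<bar>snd X\<bar> \<le> \<bar>R\<bar>"
      using X norm_fst_le[of "fst X" "snd X"] norm_snd_le[of "snd X" "fst X"] unfolding prod.collapse real_norm_def by linarith+
    have UB: "?U X \<le> B" "0 \<le> B" using B[OF X] u0[of "fst X" "snd X"] by linarith+
    have "frac_gap s ?U X \<le> ennreal (C * (c + ?U X)) + ennreal C * nconv (\<lambda>Y. ennreal (1 / growth M Y)) (\<lambda>Y. ennreal (?U Y)) X"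
    proof (rule est)
      fix r :: real assume r: "0 < r" "r < 1"
      then show "\<bar>?U X - ?U (fst X, snd X - r)\<bar> \<le> c * r powr b"
        using c1[of "fst X" "snd X" "snd X - r"] f sn by (simp add: R'_def)
      fix z :: "real ^ 'n" assume z: "norm z < 1"
      show "\<bar>?U (fst X + z, snd X - r) + ?U (fst X - z, snd X - r) - 2 * ?U (fst X, snd X - r)\<bar> \<le> c * norm z powr (2 * b)"
        using c2[of "fst X" z "snd X - r"] norm_triangle_ineq[of "fst X" z] norm_triangle_ineq4[of "fst X" z] f sn z r
        by (simp add: R'_def)
    qed (use c u0 in auto)
    also have "\<dots> \<le> ennreal (C * (c + B)) + ennreal C * ennreal (2 powr (2 * M + 1) * G * W0)"
    proof (intro add_mono mult_left_mono ennreal_leI UB C order_refl)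
      have "nconv (\<lambda>Y. ennreal (1 / growth M Y)) (\<lambda>Y. ennreal (?U Y)) X = nconv (\<lambda>Y. ennreal (?U Y)) (\<lambda>Y. ennreal (1 / growth M Y)) X"
        by (subst nconv_commute) auto
      also have "\<dots> \<le> ennreal (2 powr (2 * M + 1) * growth M X) * ennreal W0"
        unfolding W0(1)[symmetric] by (rule nconv_weight_le'[OF M0]) measurable
      also have "\<dots> = ennreal (2 powr (2 * M + 1) * growth M X * W0)"
        using W0(2) by (rule ennreal_mult''[symmetric])
      also have "\<dots> \<le> ennreal (2 powr (2 * M + 1) * G * W0)"
      proof (intro ennreal_leI mult_right_mono mult_left_mono W0(2))
        show "growth M X \<le> G" unfolding growth_def G_def
          using f sn M0 by (intro add_mono powr_mono2) auto
      qed simp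
      finally show "nconv (\<lambda>Y. ennreal (1 / growth M Y)) (\<lambda>Y. ennreal (?U Y)) X \<le> ennreal (2 powr (2 * M + 1) * G * W0)" .
    qed simp_all
    also have "\<dots> = ennreal C'"
    proof -
      have "0 \<le> 2 powr (2 * M + 1) * G * W0" using W0 by (simp add: G_def)
      then show ?thesis using C c UB(2) by (simp add: C'_def ennreal_plus ennreal_mult)
    qed
    finally show "frac_gap s ?U X \<le> ennreal C'" .
  qed
qed

text \<open>Dominated convergence with \<open>\<epsilon> = 1 / k\<close>; the excised balls shrink
  to the null set of the centre.\<close>

lemma has_pv_integral_of_integrable:
  assumes "integrable lebesgue g"
  shows "has_pv_integral g x (LINT y|lebesgue. g y)"
  unfolding has_pv_integral_def
proof (intro conjI allI impI)
  have [measurable]: "g \<in> borel_measurable lebesgue" using assms by simp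
  show "g absolutely_integrable_on - ball x \<epsilon>" for \<epsilon>
    unfolding set_integrable_def by (intro integrable_mult_indicator assms) auto
  have m: "(\<lambda>y. indicat_real (- ball x \<epsilon>) y *\<^sub>R g y) \<in> borel_measurable lebesgue" for \<epsilon>
    by (intro borel_measurable_scaleR borel_measurable_indicator) auto
  have "((\<lambda>k. LINT y|lebesgue. indicat_real (- ball x (inverse k)) y *\<^sub>R g y) \<longlongrightarrow> (LINT y|lebesgue. g y)) at_top"
  proof (rule integral_dominated_convergence_at_top[where w = "\<lambda>y. norm (g y)"])
    have "AE y in lebesgue. y \<noteq> x" by (intro AE_completion AE_lborel_singleton)
    then show "AE y in lebesgue. ((\<lambda>k. indicat_real (- ball x (inverse k)) y *\<^sub>R g y) \<longlongrightarrow> g y) at_top"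
    proof eventually_elim
      case (elim y)
      show ?case
      proof (rule tendsto_eventually, rule eventually_mono[OF eventually_ge_at_top[of "inverse (dist x y)"]])
        fix k assume k: "inverse (dist x y) \<le> k"
        have "inverse k \<le> dist x y" using le_imp_inverse_le[OF k] elim by simp
        then show "indicat_real (- ball x (inverse k)) y *\<^sub>R g y = g y" by (simp add: indicator_def)
      qed
    qed
    show "\<forall>\<^sub>F k in at_top. AE y in lebesgue. norm (indicat_real (- ball x (inverse k)) y *\<^sub>R g y) \<le> norm (g y)"
      by (auto simp: indicator_def)
  qed (use assms m in auto)
  then show "((\<lambda>\<epsilon>. LINT y : - ball x \<epsilon>|lebesgue. g y) \<longlongrightarrow> (LINT y|lebesgue. g y)) (at_right 0)"
    unfolding set_lebesgue_integral_def filterlim_at_right_to_top .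
qed

lemma has_pv_integral_unique:
  "has_pv_integral g x I \<Longrightarrow> has_pv_integral g x J \<Longrightarrow> I = J"
  by (auto simp: has_pv_integral_def intro: tendsto_unique[OF trivial_limit_at_right_real])

text \<open>At a fixed \<open>\<tau> < t\<close> the kernel has no singularity in \<open>y\<close>,
  so the principal value is an ordinary integral. It splits into \<open>u x t\<close> times the mass
  1 of the heat kernel and the heat average; \<open>(4 * pi) powr (n / 2)\<close> is the
  normalisation of the heat kernel.\<close>

lemma has_pv_integral_heat_difference:
  fixes u :: "real ^ 'n \<Rightarrow> real \<Rightarrow> real"
  assumes [measurable]: "(\<lambda>X. u (fst X) (snd X)) \<in> borel_measurable borel" and u0: "\<And>x t. 0 \<le> u x t"
    and \<tau>: "\<tau> < t" and fin: "heat_avg (t - \<tau>) (\<lambda>X. ennreal (u (fst X) (snd X))) (x, t) < \<infinity>"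
  shows "has_pv_integral (\<lambda>y. (u x t - u y \<tau>) / (t - \<tau>) powr (real CARD('n) / 2 + 1 + s)
      * exp (- (norm (x - y))\<^sup>2 / (4 * (t - \<tau>)))) x
    ((4 * pi) powr (real CARD('n) / 2) * ((t - \<tau>) powr (- 1 - s)
      * (u x t - enn2real (heat_avg (t - \<tau>) (\<lambda>X. ennreal (u (fst X) (snd X))) (x, t)))))"
proof -
  define r where "r = t - \<tau>"
  have r: "0 < r" using \<tau> by (simp add: r_def)
  let ?H = "\<lambda>y. heat_kernel r (x - y)"
  have "(\<lambda>X. u (fst X) (snd X)) \<in> borel_measurable (borel \<Otimes>\<^sub>M borel)"
    using assms(1) by (simp add: borel_prod)
  from measurable_compose[OF _ this, of "\<lambda>y. (y, \<tau>)" borel]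
  have [measurable]: "(\<lambda>y. u y \<tau>) \<in> borel_measurable borel" by simp
  have 1: "(\<integral>\<^sup>+y. ennreal (?H y) \<partial>lborel) = 1"
    using nn_integral_lborel_diff[of "\<lambda>z. ennreal (heat_kernel r z)" x] nn_integral_heat_kernel[OF r, where 'a = "real ^ 'n"] by simp
  have 2: "(\<integral>\<^sup>+y. ennreal (?H y * u y \<tau>) \<partial>lborel) = heat_avg r (\<lambda>X. ennreal (u (fst X) (snd X))) (x, t)"
    using nn_integral_lborel_diff[of "\<lambda>y. ennreal (?H y * u y \<tau>)" x]
    by (simp add: heat_avg_def ennreal_mult' r_def)
  have i1: "integrable lborel ?H" by (rule integrableI_nonneg) (auto simp: 1)
  have i2: "integrable lborel (\<lambda>y. ?H y * u y \<tau>)"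
    by (rule integrableI_nonneg) (use u0 fin 2 in \<open>auto simp: r_def\<close>)
  have e1: "(LINT y|lborel. ?H y) = 1" by (subst integral_eq_nn_integral) (auto simp: 1)
  have e2: "(LINT y|lborel. ?H y * u y \<tau>) = enn2real (heat_avg r (\<lambda>X. ennreal (u (fst X) (snd X))) (x, t))"
    by (subst integral_eq_nn_integral) (use u0 in \<open>auto simp: 2\<close>)
  let ?c = "(4 * pi) powr (real CARD('n) / 2) * r powr (- 1 - s)"
  have eq: "(u x t - u y \<tau>) / r powr (real CARD('n) / 2 + 1 + s) * exp (- (norm (x - y))\<^sup>2 / (4 * r))
      = ?c * (u x t * ?H y - ?H y * u y \<tau>)" for y
  proof -
    let ?A = "(4 * pi) powr (real CARD('n) / 2)" and ?B = "r powr (real CARD('n) / 2)" and ?C = "r powr (real CARD('n) / 2 + 1 + s)"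
    have H: "heat_kernel r (x - y) = exp (- (norm (x - y))\<^sup>2 / (4 * r)) / (?A * ?B)"
      by (simp add: heat_kernel_def powr_mult[of "4 * pi" r])
    have "?C * r powr (- 1 - s) = ?B" by (simp add: powr_add[symmetric])
    then have R: "r powr (- 1 - s) = ?B / ?C" using r by (simp add: field_simps)
    have alg: "(a - b) / C * E = A * (B / C) * (a * (E / (A * B)) - E / (A * B) * b)"
      if "A \<noteq> 0" "B \<noteq> 0" "C \<noteq> 0" for a b A B C E :: real
      using that by (simp add: field_simps)
    show ?thesis unfolding H R by (rule alg) (use r in simp_all)
  qed
  let ?f = "\<lambda>y. ?c * (u x t * ?H y - ?H y * u y \<tau>)"
  have int: "integrable lborel ?f" using i1 i2 by simp
  then have "integrable lebesgue ?f" by (subst integrable_completion) auto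
  then have "has_pv_integral ?f x (LINT y|lebesgue. ?f y)" by (rule has_pv_integral_of_integrable)
  also have "(LINT y|lebesgue. ?f y) = (LINT y|lborel. ?f y)" by (rule integral_completion) measurable
  also have "\<dots> = ?c * (u x t - enn2real (heat_avg r (\<lambda>X. ennreal (u (fst X) (snd X))) (x, t)))"
    using i1 i2 by (simp add: e1 e2)
  finally show ?thesis unfolding r_def[symmetric] eq by (simp only: mult.assoc)
qed

text \<open>Principal values are unique, so every admissible \<open>h\<close> agrees almost
  everywhere on \<open>\<tau> < t\<close> with the explicit one; the value of the operator becomes
  an integral over \<open>r = t - \<tau>\<close>, and the factors
  \<open>(4 * pi) powr (n / 2)\<close> cancel.\<close>

lemma has_frac_heat_iff:
  fixes u :: "real ^ 'n \<Rightarrow> real \<Rightarrow> real"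
  assumes s: "0 < s" "s < 1" and M: "M = CARD('n) / 2 + 1 + s"
    and um[measurable]: "(\<lambda>X. u (fst X) (snd X)) \<in> borel_measurable borel" and u0: "\<And>x t. 0 \<le> u x t"
    and W: "nconv (\<lambda>Y. ennreal (1 / growth M Y)) (\<lambda>Y. ennreal (u (fst Y) (snd Y))) (x, t) < \<infinity>"
    and gap: "frac_gap s (\<lambda>X. u (fst X) (snd X)) (x, t) < \<infinity>"
  shows "has_frac_heat s u x t w \<longleftrightarrow> Gamma (1 - s) / s * w = (LINT r:{0<..}|lborel. r powr (- 1 - s) * (u x t - enn2real (heat_avg r (\<lambda>X. ennreal (u (fst X) (snd X))) (x, t))))"
    (is "_ \<longleftrightarrow> _ = ?I")
proof -
  let ?T = "\<lambda>r. heat_avg r (\<lambda>X. ennreal (u (fst X) (snd X))) (x, t)"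
  define P where "P = (4 * pi) powr (real CARD('n) / 2)"
  have P: "0 < P" by (simp add: P_def)
  define h where "h r = r powr (- 1 - s) * (u x t - enn2real (?T r))" for r
  have M': "M = DIM(real ^ 'n) / 2 + 1 + s" using M by simp
  have [measurable]: "h \<in> borel_measurable borel" unfolding h_def[abs_def] by measurable
  have I: "?I = (LINT r|lborel. indicator {0<..} r * h r)"
    by (simp add: set_lebesgue_integral_def h_def)
  have inth: "integrable lborel (\<lambda>r. indicator {0<..} r * h r)"
    using truncation_limit(1)[OF s(1) M' um _ W] u0 gap by (simp add: set_integrable_def h_def)
  let ?k = "\<lambda>\<tau>. indicator {..<t} \<tau> * (P * h (t - \<tau>))"
  have keq: "?k \<tau> = P * (indicator {0<..} (t + (- 1) * \<tau>) * h (t + (- 1) * \<tau>))" for \<tau>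
    by (simp add: indicator_def)
  have kint: "integrable lborel ?k"
    unfolding keq by (intro integrable_mult_right lborel_integrable_real_affine inth) simp
  have kval: "(LINT \<tau>|lborel. ?k \<tau>) = P * ?I"
    unfolding I keq using lborel_integral_real_affine[of "- 1" "\<lambda>r. indicator {0<..} r * h r" t] by simp
  have kint': "integrable lebesgue ?k" using kint by (subst integrable_completion) auto
  have kval': "(LINT \<tau>|lebesgue. ?k \<tau>) = P * ?I" unfolding kval[symmetric] by (rule integral_completion) measurable
  have "AE r in lborel. 0 < r \<longrightarrow> ?T r < \<infinity>"
    using AE_heat_avg_finite[OF s(1) M' _ W] by simp
  then have "AE \<tau> in lborel. 0 < t + (- 1) * \<tau> \<longrightarrow> ?T (t + (- 1) * \<tau>) < \<infinity>"
    by (intro AE_borel_affine) auto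
  then have "AE \<tau> in lebesgue. 0 < t + (- 1) * \<tau> \<longrightarrow> ?T (t + (- 1) * \<tau>) < \<infinity>" by (rule AE_completion)
  then have pv: "AE \<tau> in lebesgue. \<tau> < t \<longrightarrow> has_pv_integral
       (\<lambda>y. (u x t - u y \<tau>) / (t - \<tau>) powr (real CARD('n) / 2 + 1 + s)
            * exp (- (norm (x - y))\<^sup>2 / (4 * (t - \<tau>)))) x (P * h (t - \<tau>))"
  proof eventually_elim
    case (elim \<tau>)
    then show ?case unfolding P_def h_def
      by (intro impI has_pv_integral_heat_difference um u0) simp_all
  qed
  have val: "(w = 1 / (P * \<bar>Gamma (- s)\<bar>) * (P * ?I)) \<longleftrightarrow> Gamma (1 - s) / s * w = ?I"
  proof -
    define k where "k = Gamma (1 - s) / s"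
    have "0 < k" using s Gamma_real_pos[of "1 - s"] by (simp add: k_def)
    then show ?thesis unfolding abs_Gamma_minus[OF s] k_def[symmetric] using P by (auto simp: field_simps)
  qed
  show ?thesis
  proof
    assume "has_frac_heat s u x t w"
    then obtain h' where pv': "AE \<tau> in lebesgue. \<tau> < t \<longrightarrow> has_pv_integral
       (\<lambda>y. (u x t - u y \<tau>) / (t - \<tau>) powr (real CARD('n) / 2 + 1 + s)
            * exp (- (norm (x - y))\<^sup>2 / (4 * (t - \<tau>)))) x (h' \<tau>)"
      and int': "h' absolutely_integrable_on {..<t}"
      and w: "w = 1 / (P * \<bar>Gamma (- s)\<bar>) * (LINT \<tau> : {..<t} | lebesgue. h' \<tau>)"
      unfolding has_frac_heat_def P_def by blast
    have "(LINT \<tau> : {..<t} | lebesgue. h' \<tau>) = (LINT \<tau>|lebesgue. ?k \<tau>)"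
      unfolding set_lebesgue_integral_def
    proof (rule integral_cong_AE)
      show "AE \<tau> in lebesgue. indicator {..<t} \<tau> *\<^sub>R h' \<tau> = ?k \<tau>"
        using pv pv' by eventually_elim (auto simp: indicator_def intro: has_pv_integral_unique)
    qed (use int' kint' in \<open>auto simp: set_integrable_def dest: borel_measurable_integrable\<close>)
    then show "Gamma (1 - s) / s * w = ?I" using w kval' val by simp
  next
    assume "Gamma (1 - s) / s * w = ?I"
    then have "w = 1 / (P * \<bar>Gamma (- s)\<bar>) * (P * ?I)" using val by simp
    moreover have "(LINT \<tau> : {..<t} | lebesgue. P * h (t - \<tau>)) = P * ?I"
      using kval' unfolding set_lebesgue_integral_def real_scaleR_def .
    moreover have "(\<lambda>\<tau>. P * h (t - \<tau>)) absolutely_integrable_on {..<t}"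
      using kint' by (simp add: set_integrable_def)
    ultimately show "has_frac_heat s u x t w"
      unfolding has_frac_heat_def P_def[symmetric] by (intro exI[of _ "\<lambda>\<tau>. P * h (t - \<tau>)"] conjI pv) (simp_all only:)
  qed
qed

lemma heat_G_eq:
  fixes z :: "real ^ 'n"
  assumes "0 < s"
  shows "ennreal (heat_G s z r) = fpot s 0 r * ennreal (heat_kernel r z)"
proof (cases "0 < r")
  case True
  have "(4 * pi * r) powr (real CARD('n) / 2) = (4 * pi) powr (real CARD('n) / 2) * r powr (real CARD('n) / 2)"
    by (rule powr_mult)
  moreover have "r powr (s - 1) * r powr (real CARD('n) / 2 + 1 - s) = r powr (real CARD('n) / 2)"
    by (simp add: powr_add[symmetric])
  then have "r powr (s - 1) = r powr (real CARD('n) / 2) / r powr (real CARD('n) / 2 + 1 - s)"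
    using True by (simp add: field_simps)
  ultimately have "heat_G s z r = r powr (s - 1) / Gamma s * heat_kernel r z"
    using True by (simp add: heat_G_def heat_kernel_def)
  then show ?thesis using True by (simp add: fpot_def ennreal_mult''[symmetric])
qed (simp add: heat_G_def fpot_def)

lemma heat_G_potential:
  fixes g :: "(real ^ 'n) \<times> real \<Rightarrow> real"
  assumes s: "0 < s" and [measurable]: "g \<in> borel_measurable borel" and g0: "\<And>Y. 0 \<le> g Y"
  shows "(\<integral>\<^sup>+ \<tau>. (\<integral>\<^sup>+ y. ennreal (heat_G s (x - y) (t - \<tau>) * g (y, \<tau>)) \<partial>lebesgue) \<partial>lebesgue)
    = nconv (stker (fpot s 0)) (\<lambda>Y. ennreal (g Y)) (x, t)"
proof -
  have [measurable]: "g \<in> borel_measurable (borel \<Otimes>\<^sub>M borel)" by (simp add: borel_prod)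
  let ?F = "\<lambda>\<tau> y. fpot s 0 (t - \<tau>) * (ennreal (heat_kernel (t - \<tau>) (x - y)) * ennreal (g (y, \<tau>)))"
  have [measurable]: "(\<lambda>\<tau>. \<integral>\<^sup>+ y. ?F \<tau> y \<partial>lborel) \<in> borel_measurable borel" by measurable
  have "(\<integral>\<^sup>+ \<tau>. (\<integral>\<^sup>+ y. ennreal (heat_G s (x - y) (t - \<tau>) * g (y, \<tau>)) \<partial>lebesgue) \<partial>lebesgue)
    = (\<integral>\<^sup>+ \<tau>. (\<integral>\<^sup>+ y. ?F \<tau> y \<partial>lebesgue) \<partial>lebesgue)"
    using g0 by (intro nn_integral_cong) (simp add: ennreal_mult'' heat_G_eq[OF s] mult.assoc)
  also have "\<dots> = (\<integral>\<^sup>+ \<tau>. (\<integral>\<^sup>+ y. ?F \<tau> y \<partial>lborel) \<partial>lborel)"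
    by (simp add: nn_integral_completion)
  also have "\<dots> = (\<integral>\<^sup>+ \<tau>. fpot s 0 (t - \<tau>) * (\<integral>\<^sup>+ y. ennreal (heat_kernel (t - \<tau>) (x - y)) * ennreal (g (y, \<tau>)) \<partial>lborel) \<partial>lborel)"
    by (simp add: nn_integral_cmult)
  also have "\<dots> = (\<integral>\<^sup>+ \<tau>. fpot s 0 (t - \<tau>) * (\<integral>\<^sup>+ z. ennreal (heat_kernel (t - \<tau>) z) * ennreal (g (x - z, \<tau>)) \<partial>lborel) \<partial>lborel)"
  proof (rule nn_integral_cong)
    fix \<tau> :: real
    have "(\<integral>\<^sup>+ y. ennreal (heat_kernel (t - \<tau>) (x - y)) * ennreal (g (y, \<tau>)) \<partial>lborel)
      = (\<integral>\<^sup>+ z. ennreal (heat_kernel (t - \<tau>) z) * ennreal (g (x - z, \<tau>)) \<partial>lborel)"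
      using nn_integral_lborel_diff[of "\<lambda>y. ennreal (heat_kernel (t - \<tau>) (x - y)) * ennreal (g (y, \<tau>))" x] by simp
    then show "fpot s 0 (t - \<tau>) * (\<integral>\<^sup>+ y. ennreal (heat_kernel (t - \<tau>) (x - y)) * ennreal (g (y, \<tau>)) \<partial>lborel)
      = fpot s 0 (t - \<tau>) * (\<integral>\<^sup>+ z. ennreal (heat_kernel (t - \<tau>) z) * ennreal (g (x - z, \<tau>)) \<partial>lborel)"
      by simp
  qed
  also have "\<dots> = (\<integral>\<^sup>+ r. fpot s 0 r * (\<integral>\<^sup>+ z. ennreal (heat_kernel r z) * ennreal (g (x - z, t - r)) \<partial>lborel) \<partial>lborel)"
    using nn_integral_lborel_diff[of "\<lambda>r. fpot s 0 r * (\<integral>\<^sup>+ z. ennreal (heat_kernel r z) * ennreal (g (x - z, t - r)) \<partial>lborel)" t] by simp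
  also have "\<dots> = nconv (stker (fpot s 0)) (\<lambda>Y. ennreal (g Y)) (x, t)"
    by (subst nconv_stker) auto
  finally show ?thesis .
qed

theorem theorem1p3:
  fixes s :: real
    and u :: "real ^ 'n \<Rightarrow> real \<Rightarrow> real"
    and f :: "real ^ 'n \<Rightarrow> real \<Rightarrow> real \<Rightarrow> real"
  assumes "0 < s" and "s < 1"
    and "\<And>x t. u x t > 0"
    and "\<exists>\<alpha>>s. parabolic_holder_loc \<alpha> u"
    and "slowly_increasing s u"
    and "\<And>x t \<zeta>. \<zeta> > 0 \<Longrightarrow> f x t \<zeta> \<ge> 0"
    and "continuous_on (UNIV \<times> UNIV \<times> {0<..}) (\<lambda>(x, t, \<zeta>). f x t \<zeta>)"
    and "\<forall>C1>0. \<exists>C2>0. \<forall>x t. \<forall>\<zeta>\<ge>C1. f x t \<zeta> \<ge> C2"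
  shows "(\<forall>x t. has_frac_heat s u x t (f x t (u x t))) \<longleftrightarrow>
         (\<forall>x t. ennreal (u x t) =
            (\<integral>\<^sup>+ \<tau>. (\<integral>\<^sup>+ y. ennreal (heat_G s (x - y) (t - \<tau>) * f y \<tau> (u y \<tau>)) \<partial>lebesgue)
              \<partial>lebesgue))"
proof -
  note s = assms(1,2)
  obtain \<alpha> where \<alpha>: "s < \<alpha>" "parabolic_holder_loc \<alpha> u" using assms(4) by blast
  define U where "U X = u (fst X) (snd X)" for X
  define g where "g X = f (fst X) (snd X) (U X)" for X
  define M where "M = CARD('n) / 2 + 1 + s"
  define \<kappa> where "\<kappa> = Gamma (1 - s) / s"
  have M: "M = CARD('n) / 2 + 1 + s" "M = DIM(real ^ 'n) / 2 + 1 + s" by (simp_all add: M_def)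
  have M0: "0 \<le> M" using s by (simp add: M_def)
  have u0: "0 \<le> u x t" for x t using assms(3)[of x t] by simp
  have U0: "0 \<le> U X" for X using u0 by (simp add: U_def)
  have g0: "0 \<le> g X" for X using assms(3,6) by (simp add: g_def U_def)
  have U_cont: "continuous_on UNIV U"
    unfolding U_def[abs_def] using s \<alpha> by (intro parabolic_holder_loc_continuous[OF \<alpha>(2)]) auto
  have g_cont: "continuous_on UNIV g"
  proof -
    have "continuous_on UNIV (\<lambda>X. (\<lambda>(x, t, \<zeta>). f x t \<zeta>) (fst X, snd X, U X))"
      using assms(3) U_cont by (intro continuous_on_compose2[OF assms(7)] continuous_intros) (auto simp: U_def)
    then show ?thesis by (simp add: g_def[abs_def])
  qed
  have U_meas[measurable]: "U \<in> borel_measurable borel" by (rule borel_measurable_continuous_onI[OF U_cont])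
  have g_meas[measurable]: "g \<in> borel_measurable borel" by (rule borel_measurable_continuous_onI[OF g_cont])
  have W: "(\<integral>\<^sup>+Y. ennreal (U Y) * ennreal (1 / growth M Y) \<partial>lborel) < \<infinity>"
    using slowly_increasing_weighted_integral[OF assms(5) M(1) _ u0] U_meas by (simp add: U_def[abs_def])
  have wW: "nconv (\<lambda>Y. ennreal (1 / growth M Y)) (\<lambda>Y. ennreal (U Y)) X < \<infinity>" for X
  proof -
    have "nconv (\<lambda>Y. ennreal (1 / growth M Y)) (\<lambda>Y. ennreal (U Y)) X = nconv (\<lambda>Y. ennreal (U Y)) (\<lambda>Y. ennreal (1 / growth M Y)) X"
      by (subst nconv_commute) auto
    also have "\<dots> \<le> ennreal (2 powr (2 * M + 1) * growth M X) * (\<integral>\<^sup>+Y. ennreal (U Y) * ennreal (1 / growth M Y) \<partial>lborel)"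
      by (rule nconv_weight_le'[OF M0]) measurable
    also have "\<dots> < \<infinity>" using W by (simp add: ennreal_mult_less_top)
    finally show ?thesis .
  qed
  have gap: "\<exists>C. \<forall>X. norm X \<le> R \<longrightarrow> frac_gap s U X \<le> ennreal C" for R
    using parabolic_holder_frac_gap_bounded[OF s \<alpha> u0 M(1)] W by (simp add: U_def[abs_def])
  have gap': "frac_gap s U X < \<infinity>" for X
  proof -
    obtain C where "frac_gap s U X \<le> ennreal C" using gap[of "norm X"] by blast
    then show ?thesis by (rule order_le_less_trans) simp
  qed
  let ?J = "\<lambda>j X. inverse (real (Suc j)) powr (- s) / s * U X
    - enn2real (nconv (stker (fjump s (inverse (real (Suc j))))) (\<lambda>Y. ennreal (U Y)) X)"
  let ?I = "\<lambda>X. LINT r:{0<..}|lborel. r powr (- 1 - s) * (U X - enn2real (heat_avg r (\<lambda>Y. ennreal (U Y)) X))"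
  have trunc: "(\<lambda>j. ?J j X) \<longlonglongrightarrow> ?I X" for X
    by (rule truncation_limit(2)[OF s(1) M(2) U_meas U0 wW gap'])
  have heat: "has_frac_heat s u x t (f x t (u x t)) \<longleftrightarrow> \<kappa> * g (x, t) = ?I (x, t)" for x t
    using has_frac_heat_iff[where x = x and t = t, OF s M(1) _ u0] wW[of "(x, t)"] gap'[of "(x, t)"] U_meas
    by (simp add: U_def[abs_def] g_def \<kappa>_def)
  have pot: "(\<integral>\<^sup>+ \<tau>. (\<integral>\<^sup>+ y. ennreal (heat_G s (x - y) (t - \<tau>) * f y \<tau> (u y \<tau>)) \<partial>lebesgue) \<partial>lebesgue)
    = nconv (stker (fpot s 0)) (\<lambda>Y. ennreal (g Y)) (x, t)" for x t
    using heat_G_potential[where x = x and t = t, OF s(1) g_meas g0] by (simp add: g_def U_def)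
  show ?thesis
  proof
    assume "\<forall>x t. has_frac_heat s u x t (f x t (u x t))"
    then have "\<kappa> * g X = ?I X" for X by (cases X) (simp only: heat)
    then have lim: "(\<lambda>j. ?J j X) \<longlonglongrightarrow> \<kappa> * g X" for X using trunc by simp
    interpret frac_solution s M \<kappa> U g
      by unfold_locales (use s M(2) \<kappa>_def U_cont U0 g_cont g0 W gap lim in auto)
    have "nconv (stker (fpot s 0)) (\<lambda>Y. ennreal (g Y)) X = ennreal (U X)" for X
    \<comment> \<open>The lower bound assumed for \<open>f\<close> turns a positive lower bound of
      \<open>U\<close> into one of \<open>g\<close>.\<close>
    proof (rule solution_eq_potential)
      fix c assume "0 < c" and c: "\<And>X. c \<le> U X"
      then obtain q where q: "0 < q" "\<And>x t \<zeta>. c \<le> \<zeta> \<Longrightarrow> q \<le> f x t \<zeta>" using assms(8) by blast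
      show "\<exists>q>0. \<forall>X. q \<le> g X" using q c by (auto simp: g_def)
    qed
    then show "\<forall>x t. ennreal (u x t) = (\<integral>\<^sup>+ \<tau>. (\<integral>\<^sup>+ y. ennreal (heat_G s (x - y) (t - \<tau>) * f y \<tau> (u y \<tau>)) \<partial>lebesgue) \<partial>lebesgue)"
      by (simp add: pot U_def)
  next
    assume R: "\<forall>x t. ennreal (u x t) = (\<integral>\<^sup>+ \<tau>. (\<integral>\<^sup>+ y. ennreal (heat_G s (x - y) (t - \<tau>) * f y \<tau> (u y \<tau>)) \<partial>lebesgue) \<partial>lebesgue)"
    have p: "nconv (stker (fpot s 0)) (\<lambda>Y. ennreal (g Y)) = (\<lambda>Y. ennreal (U Y))"
      using R by (auto simp: pot U_def)
    \<comment> \<open>\<open>U\<close> is now its own potential, so the same truncations converge to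
      \<open>\<kappa> * g X\<close> as truncations of a potential and to \<open>?I X\<close> as
      truncations of the operator.\<close>
    have "\<kappa> * g X = ?I X" for X
    proof (rule LIMSEQ_unique)
      have "isCont g X" using continuous_on_eq_continuous_at[OF open_UNIV, of g] g_cont by blast
      from potential_truncation_limit_real[OF s g_meas g0 this] show "(\<lambda>j. ?J j X) \<longlonglongrightarrow> \<kappa> * g X"
        unfolding p using U0 by (simp add: \<kappa>_def)
    qed (rule trunc)
    then show "\<forall>x t. has_frac_heat s u x t (f x t (u x t))"
      by (intro allI) (simp only: heat)
  qed
qed

end
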